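(* Let $\Omega\Subset\mathbb{R}^3$ be a bounded Lipschitz domain with $0\in\partial\Omega$, let $M>0$, $0<\alpha<1$, and let $h>0$ be sufficiently small such that $$(B_h\times(-M,M))\cap\Omega=S_h\times(-M,M).$$ Fix $x_3^c\in(-M,M)$ and let $L>0$ be sufficiently small such that $(x_3^c-L,x_3^c+L)\subset(-M,M)$. Let $V\in L^\infty(\Omega)$, $q:=1+V$, $k\in\mathbb{R}_+$, and let $v,w\in H^1(\Omega)$ be interior transmission eigenfunctions, i.e. nontrivial solutions of $$\Delta w+k^2(1+V)w=0\text{ in }\Omega,\qquad \Delta v+k^2v=0\text{ in }\Omega,\qquad w=v,\ \ \partial_\nu v=\partial_\nu w\ \text{ on }\partial\Omega.$$ Assume that $qw\in C^\alpha(\overline{S_h}\times[-M,M])$ and $v-w\in H^2(S_h\times(-M,M))$, and that the following conditions are fulfilled: (a) $v$ can be approximated in $H^1(S_h\times(-M,M))$ by Herglotz functions $v_j$, $j=1,2,\ldots$, with kernels $g_j$ satisfying $$\|v-v_j\|_{H^1(S_h\times(-M,M))}\le j^{-2-\Upsilon},\qquad \|g_j\|_{L^2(\mathbb{S}^2)}\le Cj^{\varrho}$$ for some constants $C>0$, $\Upsilon>0$ and $0<\varrho<\alpha$; (b) $-\pi<\theta_m<\theta_M<\pi$ and $\theta_M-\theta_m\neq\pi$. Then $$\lim_{\rho\to+0}\frac{1}{m(B(0,\rho)\cap P(\Omega))}\int_{B(0,\rho)\cap P(\Omega)}\mathcal{R}(Vw)(x')\,\mathrm{d}x'=0,$$ where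 $B(0,\rho)\subset\mathbb{R}^2$ is the open disc of radius $\rho$ centered at $0$, $m$ is the area, and $P(\Omega)$ is the projection onto the $x'$-plane $\mathbb{R}^2$ of $(B_h\times(-M,M))\cap\Omega$ (that is, $P(\Omega)=S_h$).
   Context: $\nu$ is the exterior unit normal to $\partial\Omega$; $B_h\subset\mathbb{R}^2$ is the open disc of radius $h$ centered at $0$. Points of $\mathbb{R}^3$ are written $x=(x',x_3)$, $x'\in\mathbb{R}^2$. The sector is $W=\{x'\in\mathbb{R}^2: x'\neq0,\ \theta_m<\arg(x_1+ix_2)<\theta_M\}$ with $-\pi<\theta_m<\theta_M<\pi$, and $S_h=W\cap B_h$. The dimension reduction operator: fix a nonnegative function $\psi\in C_0^\infty((x_3^c-L,x_3^c+L))$, $\psi\not\equiv0$; for a function $g$ on $S_h\times(-M,M)$ put $\mathcal{R}(g)(x')=\int_{x_3^c-L}^{x_3^c+L}\psi(x_3)g(x',x_3)\,\mathrm{d}x_3$, $x'\in S_h$. The Herglotz wave function with kernel $g_j\in L^2(\mathbb{S}^2)$ is $v_j(x)=\int_{\mathbb{S}^2}e^{ikd\cdot x}g_j(d)\,\mathrm{d}\sigma(d)$, $x\in\mathbb{R}^3$. *)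

theory Defs
  imports "HOL-Analysis.Analysis"
begin

section \<open>Smooth functions and test functions\<close>

definition pd :: "'a::euclidean_space \<Rightarrow> ('a \<Rightarrow> 'b::real_normed_vector) \<Rightarrow> 'a \<Rightarrow> 'b" where
  "pd b f x = frechet_derivative f (at x) b"

definition iterated_pd :: "'a::euclidean_space list \<Rightarrow> ('a \<Rightarrow> 'b::real_normed_vector) \<Rightarrow> 'a \<Rightarrow> 'b" where
  "iterated_pd bs f = foldr pd bs f"

definition smooth :: "('a::euclidean_space \<Rightarrow> 'b::real_normed_vector) \<Rightarrow> bool" where
  "smooth f \<longleftrightarrow> (\<forall>bs. set bs \<subseteq> Basis \<longrightarrow> (\<forall>x. iterated_pd bs f differentiable (at x)))"

definition laplacian :: "('a::euclidean_space \<Rightarrow> 'b::real_normed_vector) \<Rightarrow> 'a \<Rightarrow> 'b" where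
  "laplacian f x = (\<Sum>b\<in>Basis. pd b (pd b f) x)"

definition test_function :: "'a::euclidean_space set \<Rightarrow> ('a \<Rightarrow> 'b::real_normed_vector) \<Rightarrow> bool" where
  "test_function U \<phi> \<longleftrightarrow>
     smooth \<phi> \<and> compact (closure {x. \<phi> x \<noteq> 0}) \<and> closure {x. \<phi> x \<noteq> 0} \<subseteq> U"

section \<open>Lebesgue and Sobolev spaces\<close>

text \<open>Elements of these spaces are represented by total functions. Only their values on \<open>U\<close>,
  up to a Lebesgue null set, matter.\<close>

definition Linf :: "'a::euclidean_space set \<Rightarrow> ('a \<Rightarrow> complex) \<Rightarrow> bool" where
  "Linf U f \<longleftrightarrow> f \<in> borel_measurable (lebesgue_on U) \<and>
     (\<exists>C. AE x in lebesgue_on U. norm (f x) \<le> C)"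

definition L2 :: "'a measure \<Rightarrow> ('a \<Rightarrow> complex) \<Rightarrow> bool" where
  "L2 M f \<longleftrightarrow> f \<in> borel_measurable M \<and> integrable M (\<lambda>x. (norm (f x))\<^sup>2)"

definition L2_norm :: "'a measure \<Rightarrow> ('a \<Rightarrow> complex) \<Rightarrow> real" where
  "L2_norm M f = sqrt (LINT x|M. (norm (f x))\<^sup>2)"

definition locally_integrable :: "'a::euclidean_space set \<Rightarrow> ('a \<Rightarrow> complex) \<Rightarrow> bool" where
  "locally_integrable U f \<longleftrightarrow> (\<forall>K. compact K \<longrightarrow> K \<subseteq> U \<longrightarrow> set_integrable lebesgue K f)"

definition has_weak_pd ::
    "'a::euclidean_space set \<Rightarrow> 'a \<Rightarrow> ('a \<Rightarrow> complex) \<Rightarrow> ('a \<Rightarrow> complex) \<Rightarrow> bool" where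
  "has_weak_pd U b f g \<longleftrightarrow> locally_integrable U f \<and> locally_integrable U g \<and>
     (\<forall>\<phi> :: 'a \<Rightarrow> real. test_function U \<phi> \<longrightarrow>
        (LINT x:U|lebesgue. pd b \<phi> x *\<^sub>R f x) = - (LINT x:U|lebesgue. \<phi> x *\<^sub>R g x))"

definition has_weak_laplacian ::
    "'a::euclidean_space set \<Rightarrow> ('a \<Rightarrow> complex) \<Rightarrow> ('a \<Rightarrow> complex) \<Rightarrow> bool" where
  "has_weak_laplacian U f g \<longleftrightarrow> locally_integrable U f \<and> locally_integrable U g \<and>
     (\<forall>\<phi> :: 'a \<Rightarrow> real. test_function U \<phi> \<longrightarrow>
        (LINT x:U|lebesgue. laplacian \<phi> x *\<^sub>R f x) = (LINT x:U|lebesgue. \<phi> x *\<^sub>R g x))"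

text \<open>Weak derivatives are unique up to null sets, so the choices below do not affect any
  integral; they are only meaningful when a weak derivative exists.\<close>

definition weak_pd :: "'a::euclidean_space set \<Rightarrow> 'a \<Rightarrow> ('a \<Rightarrow> complex) \<Rightarrow> 'a \<Rightarrow> complex" where
  "weak_pd U b f = (SOME g. has_weak_pd U b f g)"

definition weak_laplacian :: "'a::euclidean_space set \<Rightarrow> ('a \<Rightarrow> complex) \<Rightarrow> 'a \<Rightarrow> complex" where
  "weak_laplacian U f = (SOME g. has_weak_laplacian U f g)"

primrec sobolev :: "nat \<Rightarrow> 'a::euclidean_space set \<Rightarrow> ('a \<Rightarrow> complex) \<Rightarrow> bool" where
  "sobolev 0 U f \<longleftrightarrow> L2 (lebesgue_on U) f"
| "sobolev (Suc m) U f \<longleftrightarrow> L2 (lebesgue_on U) f \<and>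
     (\<forall>b\<in>Basis. \<exists>g. has_weak_pd U b f g \<and> sobolev m U g)"

abbreviation H1 :: "'a::euclidean_space set \<Rightarrow> ('a \<Rightarrow> complex) \<Rightarrow> bool" where
  "H1 \<equiv> sobolev 1"

abbreviation H2 :: "'a::euclidean_space set \<Rightarrow> ('a \<Rightarrow> complex) \<Rightarrow> bool" where
  "H2 \<equiv> sobolev 2"

definition H1_norm :: "'a::euclidean_space set \<Rightarrow> ('a \<Rightarrow> complex) \<Rightarrow> real" where
  "H1_norm U f = sqrt ((L2_norm (lebesgue_on U) f)\<^sup>2 +
     (\<Sum>b\<in>Basis. (L2_norm (lebesgue_on U) (weak_pd U b f))\<^sup>2))"

definition H1_0 :: "'a::euclidean_space set \<Rightarrow> ('a \<Rightarrow> complex) \<Rightarrow> bool" where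
  "H1_0 U f \<longleftrightarrow> H1 U f \<and>
     (\<exists>\<phi> :: nat \<Rightarrow> 'a \<Rightarrow> complex. (\<forall>n. test_function U (\<phi> n)) \<and>
        (\<lambda>n. H1_norm U (\<lambda>x. f x - \<phi> n x)) \<longlonglongrightarrow> 0)"

text \<open>Boundary values of \<open>H\<^sup>1\<close> functions on a bounded Lipschitz domain. The trace space
  \<open>H\<^sup>1\<^sup>/\<^sup>2\<close> of the boundary is the quotient of \<open>H\<^sup>1\<close> by \<open>H\<^sup>1\<^sub>0\<close>, so two functions have the same
  trace iff their difference is in \<open>H\<^sup>1\<^sub>0\<close>. For \<open>u\<close> in \<open>H\<^sup>1\<close> whose distributional Laplacian is
  in \<open>L\<^sup>2\<close>, the exterior normal derivative is the element of the dual of the trace space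
  given by Green's formula: its (bilinear) pairing with the trace of \<open>\<phi>\<close> in \<open>H\<^sup>1\<close> is the integral
  of \<open>\<nabla>u \<sqdot> \<nabla>\<phi> + (\<Delta>u) \<phi>\<close> over \<open>U\<close>.\<close>

definition same_trace ::
    "'a::euclidean_space set \<Rightarrow> ('a \<Rightarrow> complex) \<Rightarrow> ('a \<Rightarrow> complex) \<Rightarrow> bool" where
  "same_trace U f g \<longleftrightarrow> H1_0 U (\<lambda>x. f x - g x)"

definition normal_derivative_pairing ::
    "'a::euclidean_space set \<Rightarrow> ('a \<Rightarrow> complex) \<Rightarrow> ('a \<Rightarrow> complex) \<Rightarrow> complex" where
  "normal_derivative_pairing U u \<phi> =
     (LINT x:U|lebesgue.
        (\<Sum>b\<in>Basis. weak_pd U b u x * weak_pd U b \<phi> x) + weak_laplacian U u x * \<phi> x)"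

definition same_normal_derivative ::
    "'a::euclidean_space set \<Rightarrow> ('a \<Rightarrow> complex) \<Rightarrow> ('a \<Rightarrow> complex) \<Rightarrow> bool" where
  "same_normal_derivative U f g \<longleftrightarrow>
     (\<forall>\<phi>. H1 U \<phi> \<longrightarrow> normal_derivative_pairing U f \<phi> = normal_derivative_pairing U g \<phi>)"

definition holder_on ::
    "real \<Rightarrow> 'a::metric_space set \<Rightarrow> ('a \<Rightarrow> 'b::metric_space) \<Rightarrow> bool" where
  "holder_on \<alpha> K f \<longleftrightarrow> (\<exists>C. \<forall>x\<in>K. \<forall>y\<in>K. dist (f x) (f y) \<le> C * dist x y powr \<alpha>)"

section \<open>Geometry\<close>

text \<open>The splitting \<open>x = (x', x\<^sub>3)\<close> of points of three-space.\<close>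

definition proj2 :: "real^3 \<Rightarrow> real^2" where
  "proj2 x = vector [x $ 1, x $ 2]"

definition join3 :: "real^2 \<Rightarrow> real \<Rightarrow> real^3" where
  "join3 x' t = vector [x' $ 1, x' $ 2, t]"

definition cyl :: "(real^2) set \<Rightarrow> real set \<Rightarrow> (real^3) set" where
  "cyl A I = {x. proj2 x \<in> A \<and> x $ 3 \<in> I}"

definition sector :: "real \<Rightarrow> real \<Rightarrow> (real^2) set" where
  "sector \<theta>\<^sub>m \<theta>\<^sub>M =
     {x'. x' \<noteq> 0 \<and> \<theta>\<^sub>m < Arg (Complex (x' $ 1) (x' $ 2)) \<and> Arg (Complex (x' $ 1) (x' $ 2)) < \<theta>\<^sub>M}"

definition truncated_sector :: "real \<Rightarrow> real \<Rightarrow> real \<Rightarrow> (real^2) set" where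
  "truncated_sector \<theta>\<^sub>m \<theta>\<^sub>M h = sector \<theta>\<^sub>m \<theta>\<^sub>M \<inter> ball 0 h"

definition bounded_lipschitz_domain :: "(real^3) set \<Rightarrow> bool" where
  "bounded_lipschitz_domain \<Omega> \<longleftrightarrow> open \<Omega> \<and> connected \<Omega> \<and> \<Omega> \<noteq> {} \<and> bounded \<Omega> \<and>
     (\<forall>p\<in>frontier \<Omega>. \<exists>T r C \<gamma>. orthogonal_transformation T \<and> r > 0 \<and> C-lipschitz_on UNIV \<gamma> \<and>
        \<Omega> \<inter> ball p r = {x \<in> ball p r. \<gamma> (proj2 (T (x - p))) < T (x - p) $ 3})"

section \<open>Transmission eigenfunctions, Herglotz waves, dimension reduction\<close>

definition transmission_eigenfunctions ::
    "(real^3) set \<Rightarrow> (real^3 \<Rightarrow> complex) \<Rightarrow> real \<Rightarrow> (real^3 \<Rightarrow> complex) \<Rightarrow> (real^3 \<Rightarrow> complex) \<Rightarrow> bool"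
  where
  "transmission_eigenfunctions \<Omega> V k v w \<longleftrightarrow>
     H1 \<Omega> v \<and> H1 \<Omega> w \<and> \<not> (AE x in lebesgue_on \<Omega>. v x = 0 \<and> w x = 0) \<and>
     has_weak_laplacian \<Omega> w (\<lambda>x. - ((of_real k)\<^sup>2 * (1 + V x) * w x)) \<and>
     has_weak_laplacian \<Omega> v (\<lambda>x. - ((of_real k)\<^sup>2 * v x)) \<and>
     same_trace \<Omega> w v \<and> same_normal_derivative \<Omega> v w"

text \<open>Surface measure of the unit sphere from polar coordinates: the area of a Borel subset \<open>A\<close>
  is the dimension times the volume of the cone \<open>{t d | 0 < t < 1, d \<in> A}\<close>.\<close>

definition sphere_measure :: "'a::euclidean_space measure" where
  "sphere_measure =
     distr (scale_measure (of_nat DIM('a)) (restrict_space lborel (ball 0 1 - {0})))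
       (restrict_space borel (sphere 0 1)) sgn"

definition herglotz :: "real \<Rightarrow> (real^3 \<Rightarrow> complex) \<Rightarrow> real^3 \<Rightarrow> complex" where
  "herglotz k g x = (LINT d|sphere_measure. exp (\<i> * of_real (k * (d \<bullet> x))) * g d)"

text \<open>Lebesgue measure rather than \<open>lborel\<close>, since almost every slice of a Lebesgue measurable
  function is only Lebesgue measurable.\<close>

definition dim_reduction ::
    "(real \<Rightarrow> real) \<Rightarrow> real \<Rightarrow> real \<Rightarrow> (real^3 \<Rightarrow> complex) \<Rightarrow> real^2 \<Rightarrow> complex" where
  "dim_reduction \<psi> c L g x' = (LINT t:{c - L<..<c + L}|lebesgue. \<psi> t *\<^sub>R g (join3 x' t))"

end

theory Submission
  imports Defs
begin

text \<open>Write \<open>z = x\<^sub>1 + \<i> x\<^sub>2\<close> and let \<open>p\<close> be the unit complex number opposite to the bisector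
  of the sector. Since \<open>v - w\<close> has vanishing Cauchy data, it may be integrated against the Laplacian
  of functions that do not vanish on the boundary. We take
  \<open>\<phi>\<^sub>\<epsilon>(x) = \<psi>(x\<^sub>3) \<chi>(x') (z/\<epsilon> - p)\<^sup>-\<^sup>5\<close> with a radial cut-off \<open>\<chi>\<close>; because the last factor is
  holomorphic in \<open>z\<close>, its Laplacian loses no negative power of \<open>\<epsilon>\<close>. Extended by
  zero, \<open>v - w\<close> vanishes on a part of every small horizontal circle, and a Poincare inequality
  along these circles makes its weighted averages at scale \<open>\<epsilon>\<close> tend to \<open>0\<close>. Hence
  \<open>\<epsilon>\<^sup>-\<^sup>2 \<integral> ((1 + V) w - v) \<phi>\<^sub>\<epsilon> \<rightarrow> 0\<close>. Here \<open>(1 + V) w\<close> may be replaced by its value on the edge,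
  and \<open>v\<close> by the edge value of \<open>v\<^sub>j\<close> with \<open>j \<approx> \<epsilon>\<^sup>-\<^sup>1\<^sup>/\<^sup>2\<close>: the approximation error is controlled by
  \<open>j\<^sup>-\<^sup>2 \<le> \<epsilon>\<close>, the oscillation of \<open>v\<^sub>j\<close> by \<open>j \<epsilon> \<rightarrow> 0\<close>. The remaining factor converges to the integral of
  \<open>(z - p)\<^sup>-\<^sup>5\<close> over the sector, which is a nonzero multiple of the difference of \<open>exp (- 2 \<i> \<theta>)\<close> at the
  two sides and so vanishes only for the opening angle \<open>\<pi>\<close>. Therefore the difference of the two
  edge values tends to \<open>0\<close>, and averaging over discs instead of against \<open>\<phi>\<^sub>\<epsilon>\<close> gives the claim.\<close>

section \<open>Bump functions and the fundamental lemma\<close>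

text \<open>Critical scaling shapes the argument. The Laplacian of \<phi>_\<epsilon> obeys the same
  bound as \<phi>_\<epsilon>, a constant times a weight of mass of order \<epsilon>^2, so after
  division by \<epsilon>^2 the tested identity gains nothing by itself. All smallness must come from
  v - w: the radius in the circle inequality gives one factor \<epsilon>, Cauchy-Schwarz against the
  weight the other, and what remains is the gradient energy of v - w near the edge, which tends to 0
  without a rate. Hence the limits are qualitative and run along sequences of scales. A rational
  kernel only needs its pole off the closed sector, so convex and reentrant edges are treated alike;
  an exponential exp(a z) would decay in a half-plane only. The edge value of v need not exist. The
  edge values of the v_j replace it, at an index tied to the scale, and only their difference with
  the fixed edge value of (1 + V) w is shown to vanish. The bumps serve solely to identify weak
  derivatives almost everywhere; the corner functions themselves are not smooth.\<close>

definition flat :: "nat \<Rightarrow> real \<Rightarrow> real" where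
  "flat n t = (if t \<le> 0 then 0 else exp (- 1 / t) / t ^ n)"

lemma flat_tendsto_0: "(flat n \<longlongrightarrow> 0) (at 0)"
proof -
  have "((\<lambda>t. inverse t ^ n / exp (inverse t)) \<longlongrightarrow> 0) (at_right (0::real))"
    by (rule filterlim_compose[OF tendsto_power_div_exp_0 filterlim_inverse_at_top_right])
  then have "(flat n \<longlongrightarrow> 0) (at_right 0)"
    by (rule Lim_transform_eventually)
      (auto simp: eventually_at_filter flat_def exp_minus field_simps)
  moreover have "(flat n \<longlongrightarrow> 0) (at_left 0)"
    by (rule Lim_transform_eventually[OF tendsto_const])
      (auto simp: eventually_at_filter flat_def)
  ultimately show ?thesis
    by (simp add: filterlim_split_at)
qed

text \<open>The powers of t in the denominator make the family closed under differentiation: each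
  derivative is a combination of members with larger index. At 0 the difference quotient of
  \<open>flat n\<close> is \<open>flat (n + 1)\<close>, so differentiability there is the decay of
  the next member.\<close>

lemma flat_has_derivative:
  "(flat n has_real_derivative flat (n + 2) t - of_nat n * flat (n + 1) t) (at t)"
proof -
  consider "t < 0" | "t = 0" | "t > 0" by linarith
  then show ?thesis
  proof cases
    case 1
    have "((\<lambda>_. 0) has_real_derivative 0) (at t)" by simp
    then have "(flat n has_real_derivative 0) (at t)"
      by (rule has_field_derivative_transform_within_open[of _ _ _ "{..<0}"]) (use 1 in \<open>auto simp: flat_def\<close>)
    with 1 show ?thesis by (simp add: flat_def)
  next
    case 2
    have "(\<lambda>h. (flat n (0 + h) - flat n 0) / h) = flat (n + 1)"
      by (auto simp: flat_def fun_eq_iff)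
    then have "(flat n has_real_derivative 0) (at 0)"
      unfolding DERIV_def using flat_tendsto_0[of "n + 1"] by simp
    with 2 show ?thesis by (simp add: flat_def)
  next
    case 3
    have "((\<lambda>t. exp (- 1 / t) / t ^ n) has_real_derivative
        flat (n + 2) t - of_nat n * flat (n + 1) t) (at t)"
      using 3
      by (auto intro!: derivative_eq_intros simp: flat_def field_simps power2_eq_square)
        (cases n; cases "n - 1"; auto)?
    then show ?thesis
      by (rule has_field_derivative_transform_within_open[of _ _ _ "{0<..}"]) (use 3 in \<open>auto simp: flat_def\<close>)
  qed
qed

text \<open>A class of functions closed under partial derivatives, whose members are therefore smooth.\<close>

inductive_set flat_alg :: "('a::euclidean_space \<Rightarrow> real) set" where
  const: "(\<lambda>x. c) \<in> flat_alg"
| atom: "(\<lambda>x. flat n (w \<bullet> x + d)) \<in> flat_alg"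
| add: "f \<in> flat_alg \<Longrightarrow> g \<in> flat_alg \<Longrightarrow> (\<lambda>x. f x + g x) \<in> flat_alg"
| mult: "f \<in> flat_alg \<Longrightarrow> g \<in> flat_alg \<Longrightarrow> (\<lambda>x. f x * g x) \<in> flat_alg"

lemma flat_alg_derivative:
  assumes "f \<in> flat_alg"
  shows "\<exists>f'. (\<forall>x. (f has_derivative f' x) (at x)) \<and> (\<forall>b. (\<lambda>x. f' x b) \<in> flat_alg)"
  using assms
proof induction
  case (const c)
  show ?case by (rule exI[of _ "\<lambda>_ _. 0"]) (auto intro: flat_alg.const)
next
  case (atom n w d)
  let ?g = "\<lambda>t. flat (n + 2) t - of_nat n * flat (n + 1) t"
  let ?f' = "\<lambda>x b. (w \<bullet> b) * ?g (w \<bullet> x + d)"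
  have "((\<lambda>x. flat n (w \<bullet> x + d)) has_derivative ?f' x) (at x)" for x
  proof -
    have "((\<lambda>x. w \<bullet> x + d) has_derivative (\<lambda>b. w \<bullet> b)) (at x)"
      by (auto intro!: derivative_eq_intros)
    from has_derivative_compose[OF this flat_has_derivative[of n "w \<bullet> x + d", unfolded has_field_derivative_def]]
    show ?thesis by (simp add: mult.commute)
  qed
  moreover have "(\<lambda>x. ?f' x b) \<in> flat_alg" for b
  proof -
    have "(\<lambda>x. (w \<bullet> b) * (flat (n + 2) (w \<bullet> x + d) + (- of_nat n) * flat (n + 1) (w \<bullet> x + d))) \<in> flat_alg"
      by (intro flat_alg.intros)
    then show ?thesis by simp
  qed
  ultimately show ?case by (intro exI[of _ ?f']) simp
next
  case (add f g)
  then obtain f' g' where f': "\<And>x. (f has_derivative f' x) (at x)" "\<And>b. (\<lambda>x. f' x b) \<in> flat_alg"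
    and g': "\<And>x. (g has_derivative g' x) (at x)" "\<And>b. (\<lambda>x. g' x b) \<in> flat_alg" by blast
  show ?case
    by (rule exI[of _ "\<lambda>x b. f' x b + g' x b"]) (auto intro: flat_alg.add f' g' has_derivative_add)
next
  case (mult f g)
  then obtain f' g' where f': "\<And>x. (f has_derivative f' x) (at x)" "\<And>b. (\<lambda>x. f' x b) \<in> flat_alg"
    and g': "\<And>x. (g has_derivative g' x) (at x)" "\<And>b. (\<lambda>x. g' x b) \<in> flat_alg" by blast
  show ?case
    by (rule exI[of _ "\<lambda>x b. f x * g' x b + f' x b * g x"])
      (auto intro!: flat_alg.add flat_alg.mult f' g' has_derivative_mult mult(1,2))
qed

lemma smooth_flat_alg:
  assumes "f \<in> flat_alg"
  shows "smooth f"
proof -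
  have pd: "pd b f \<in> flat_alg" if f: "f \<in> flat_alg" for b and f :: "'a \<Rightarrow> real"
  proof -
    obtain f' where f': "\<And>x. (f has_derivative f' x) (at x)" "\<And>b. (\<lambda>x. f' x b) \<in> flat_alg"
      using flat_alg_derivative[OF f] by blast
    have "pd b f = (\<lambda>x. f' x b)"
      using frechet_derivative_at[OF f'(1)] by (auto simp: pd_def fun_eq_iff)
    with f'(2) show ?thesis by simp
  qed
  have "iterated_pd bs f \<in> flat_alg" for bs
    by (induction bs) (auto simp: iterated_pd_def assms pd)
  then show ?thesis
    unfolding smooth_def differentiable_def using flat_alg_derivative by blast
qed

section \<open>Bumps supported in boxes\<close>

lemma flat_alg_prod:
  assumes "finite I" "\<And>i. i \<in> I \<Longrightarrow> f i \<in> flat_alg"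
  shows "(\<lambda>x. \<Prod>i\<in>I. f i x) \<in> flat_alg"
  using assms by (induction I rule: finite_induct) (auto intro: flat_alg.intros)

text \<open>As \<open>n\<close> grows, every factor exp(-1/(n t)) tends to 1 for t > 0, while it
  stays 0 for t \<le> 0. The bumps thus lie in [0, 1] and converge pointwise to the indicator of the
  open box, so that dominated convergence replaces mollification.\<close>

definition box_bump :: "'a::euclidean_space \<Rightarrow> 'a \<Rightarrow> nat \<Rightarrow> 'a \<Rightarrow> real" where
  "box_bump l u n x =
     (\<Prod>b\<in>Basis. flat 0 (real n * (x \<bullet> b - l \<bullet> b)) * flat 0 (real n * (u \<bullet> b - x \<bullet> b)))"

lemma smooth_box_bump: "smooth (box_bump l u n)"
proof -
  have "(\<lambda>x. \<Prod>b\<in>Basis. flat 0 ((real n *\<^sub>R b) \<bullet> x + (- real n * (l \<bullet> b))) *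
      flat 0 ((- real n *\<^sub>R b) \<bullet> x + (real n * (u \<bullet> b)))) \<in> flat_alg"
    by (intro flat_alg_prod flat_alg.intros) auto
  also have "(\<lambda>x. \<Prod>b\<in>Basis. flat 0 ((real n *\<^sub>R b) \<bullet> x + (- real n * (l \<bullet> b))) *
      flat 0 ((- real n *\<^sub>R b) \<bullet> x + (real n * (u \<bullet> b)))) = box_bump l u n"
    by (auto simp: fun_eq_iff box_bump_def inner_commute algebra_simps intro!: prod.cong)
  finally show ?thesis by (rule smooth_flat_alg)
qed

lemma box_bump_eq_0: "x \<notin> box l u \<Longrightarrow> box_bump l u n x = 0"
  by (force simp: box_bump_def box_def flat_def mult_le_0_iff not_less intro!: prod_zero)

lemma box_bump_bounds: "0 \<le> box_bump l u n x" "box_bump l u n x \<le> 1"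
  by (auto simp: box_bump_def flat_def intro!: prod_nonneg prod_le_1 mult_le_one)

lemma box_bump_tendsto: "(\<lambda>n. box_bump l u n x) \<longlonglongrightarrow> indicator (box l u) x"
proof (cases "x \<in> box l u")
  case False
  then show ?thesis by (simp add: box_bump_eq_0)
next
  case True
  have flat: "(\<lambda>n. flat 0 (real n * t)) \<longlonglongrightarrow> 1" if "t > 0" for t
  proof -
    have "(\<lambda>n. exp (- 1 / t * (1 / real n))) \<longlonglongrightarrow> exp (- 1 / t * 0)"
      by (intro tendsto_intros lim_1_over_n)
    then have "(\<lambda>n. exp (- 1 / (real n * t))) \<longlonglongrightarrow> 1" by (simp add: field_simps)
    then show ?thesis
      by (rule Lim_transform_eventually)
        (use that in \<open>auto simp: flat_def mult_le_0_iff intro!: eventually_mono[OF eventually_gt_at_top[of 0]]\<close>)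
  qed
  have "(\<lambda>n. box_bump l u n x) \<longlonglongrightarrow> (\<Prod>b\<in>(Basis::'a set). 1 * 1)"
    unfolding box_bump_def using True by (intro tendsto_intros flat) (auto simp: box_def)
  with True show ?thesis by simp
qed

lemma test_function_box_bump:
  assumes "cbox l u \<subseteq> U"
  shows "test_function U (box_bump l u n)"
proof -
  have "closure {x. box_bump l u n x \<noteq> 0} \<subseteq> cbox l u"
    by (intro closure_minimal closed_cbox) (use box_bump_eq_0[of _ l u n] box_subset_cbox[of l u] in auto)
  moreover from this have "compact (closure {x. box_bump l u n x \<noteq> 0})"
    by (meson bounded_cbox bounded_subset closed_closure compact_eq_bounded_closed)
  ultimately show ?thesis
    using assms smooth_box_bump by (auto simp: test_function_def)
qed

text \<open>Open boxes are an intersection-stable generator of the Borel sets. For a Borel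
  representative G' the measures with densities G' and -G', each truncated at 0, are finite and
  equal on boxes, hence equal.\<close>

lemma AE_eq_0_if_box_integrals_eq_0:
  fixes G :: "'a::euclidean_space \<Rightarrow> real"
  assumes G: "integrable lebesgue G"
    and box: "\<And>l u. (LINT x:box l u|lebesgue. G x) = 0"
  shows "AE x in lebesgue. G x = 0"
proof -
  obtain G' where G'[measurable]: "G' \<in> borel_measurable lborel" and eq: "AE x in lborel. G x = G' x"
    using completion_ex_borel_measurable_real[of G lborel] G by blast
  have eq': "AE x in lebesgue. G x = G' x"
    by (rule AE_completion[OF eq])
  have int: "integrable lborel G'"
    using G integrable_cong_AE[OF _ _ eq'] integrable_completion[of G' lborel] by (auto simp: measurable_completion)
  let ?p = "density lborel (\<lambda>x. ennreal (G' x))" and ?m = "density lborel (\<lambda>x. ennreal (- G' x))"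
  have box0: "emeasure ?p (box l u) = emeasure ?m (box l u)" "emeasure ?p (box l u) \<noteq> \<infinity>" for l u
  proof -
    have i: "integrable lborel (\<lambda>x. indicator (box l u) x * G' x)"
      using integrable_mult_indicator[OF _ int, of "box l u"] by simp
    have "(LINT x|lborel. indicator (box l u) x * G' x) = (LINT x|lebesgue. indicator (box l u) x * G' x)"
      by (subst integral_completion) auto
    also have "\<dots> = (LINT x|lebesgue. indicator (box l u) x * G x)"
      using eq' borel_measurable_integrable[OF G] measurable_completion[OF G']
      by (intro integral_cong_AE borel_measurable_times borel_measurable_indicator
        fmeasurableD[OF lmeasurable_box]) auto
    also have "\<dots> = 0" using box[of l u] by (simp add: set_lebesgue_integral_def)
    finally have z: "(LINT x|lborel. indicator (box l u) x * G' x) = 0" .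
    have e: "emeasure ?p (box l u) = (\<integral>\<^sup>+x. ennreal (indicator (box l u) x * G' x) \<partial>lborel)"
      "emeasure ?m (box l u) = (\<integral>\<^sup>+x. ennreal (- (indicator (box l u) x * G' x)) \<partial>lborel)"
      by (auto simp: emeasure_density indicator_def intro!: nn_integral_cong)
    have f1: "(\<integral>\<^sup>+x. ennreal (indicator (box l u) x * G' x) \<partial>lborel) \<noteq> \<infinity>"
      "(\<integral>\<^sup>+x. ennreal (- (indicator (box l u) x * G' x)) \<partial>lborel) \<noteq> \<infinity>"
      using i by (auto simp: real_integrable_def)
    show "emeasure ?p (box l u) \<noteq> \<infinity>" using e f1 by simp
    have "enn2real (emeasure ?p (box l u)) = enn2real (emeasure ?m (box l u))"
      using z real_lebesgue_integral_def[OF i] e by simp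
    then show "emeasure ?p (box l u) = emeasure ?m (box l u)"
      using f1 e by (metis ennreal_enn2real infinity_ennreal_def top.not_eq_extremum)
  qed
  have "?p = ?m"
  proof (rule measure_eqI_generator_eq)
    let ?E = "range (\<lambda>(a, b). box a b::'a set)"
    show "Int_stable ?E"
      by (auto simp: Int_stable_def box_Int_box)
    show "?E \<subseteq> Pow UNIV" "sets ?p = sigma_sets UNIV ?E" "sets ?m = sigma_sets UNIV ?E"
      by (simp_all add: borel_eq_box)
    let ?A = "\<lambda>n::nat. box (- (real n *\<^sub>R One)) (real n *\<^sub>R One) :: 'a set"
    show "range ?A \<subseteq> ?E" "(\<Union>i. ?A i) = UNIV"
      unfolding UN_box_eq_UNIV by auto
    show "emeasure ?p (?A i) \<noteq> \<infinity>" for i by (rule box0)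
    show "emeasure ?p X = emeasure ?m X" if "X \<in> ?E" for X
      using that box0 by auto
  qed
  \<comment> \<open>\<open>ennreal\<close> sends negative numbers to 0, so the two densities can
    agree at a point only if both are 0 there.\<close>
  then have "AE x in lborel. ennreal (G' x) = ennreal (- G' x)"
    by (intro sigma_finite_measure.density_unique) (auto intro: sigma_finite_lborel)
  then have "AE x in lborel. G' x = 0"
    by eventually_elim (metis ennreal_eq_0_iff ennreal_neg linear neg_le_0_iff_le order_antisym)
  then have "AE x in lebesgue. G' x = 0" by (rule AE_completion)
  with eq' show ?thesis by eventually_elim simp
qed

text \<open>Box bumps turn the hypothesis into vanishing box integrals. The previous criterion is
  then applied on closed boxes inside U, separately to real and imaginary part, and countably many
  such boxes cover U.\<close>

lemma AE_eq_0_if_test_integrals_eq_0: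
  fixes g :: "'a::euclidean_space \<Rightarrow> complex"
  assumes U: "open U" and g: "locally_integrable U g"
    and test: "\<And>\<phi> :: 'a \<Rightarrow> real. test_function U \<phi> \<Longrightarrow> (LINT x:U|lebesgue. \<phi> x *\<^sub>R g x) = 0"
  shows "AE x in lebesgue. x \<in> U \<longrightarrow> g x = 0"
proof -
  have box0: "(LINT x:box l u|lebesgue. g x) = 0" if lu: "cbox l u \<subseteq> U" for l u
  proof -
    have gi: "integrable lebesgue (\<lambda>x. indicator (cbox l u) x *\<^sub>R g x)"
      using g lu by (auto simp: locally_integrable_def set_integrable_def)
    have "(\<lambda>n. LINT x|lebesgue. box_bump l u n x *\<^sub>R (indicator (cbox l u) x *\<^sub>R g x))
        \<longlonglongrightarrow> (LINT x|lebesgue. indicator (box l u) x *\<^sub>R (indicator (cbox l u) x *\<^sub>R g x))"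
    proof (rule integral_dominated_convergence[where w="\<lambda>x. norm (indicator (cbox l u) x *\<^sub>R g x)"])
      have [measurable]: "box_bump l u n \<in> borel_measurable borel" for n
        unfolding box_bump_def flat_def by measurable
      show "(\<lambda>x. box_bump l u n x *\<^sub>R indicator (cbox l u) x *\<^sub>R g x) \<in> borel_measurable lebesgue" for n
        by (intro borel_measurable_scaleR borel_measurable_integrable[OF gi] measurable_completion) auto
      show "(\<lambda>x. indicator (box l u) x *\<^sub>R indicator (cbox l u) x *\<^sub>R g x) \<in> borel_measurable lebesgue"
        by (intro borel_measurable_scaleR[OF _ borel_measurable_integrable[OF gi]]
          borel_measurable_indicator fmeasurableD[OF lmeasurable_box])
      show "integrable lebesgue (\<lambda>x. norm (indicator (cbox l u) x *\<^sub>R g x))" by (rule integrable_norm[OF gi])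
      show "AE x in lebesgue. (\<lambda>n. box_bump l u n x *\<^sub>R indicator (cbox l u) x *\<^sub>R g x)
          \<longlonglongrightarrow> indicator (box l u) x *\<^sub>R indicator (cbox l u) x *\<^sub>R g x"
        by (intro AE_I2 tendsto_intros box_bump_tendsto)
      show "AE x in lebesgue. norm (box_bump l u n x *\<^sub>R indicator (cbox l u) x *\<^sub>R g x)
          \<le> norm (indicator (cbox l u) x *\<^sub>R g x)" for n
        using box_bump_bounds[of l u n] by (intro AE_I2) (simp add: mult.assoc mult_left_le_one_le)
    qed
    moreover have "(LINT x|lebesgue. box_bump l u n x *\<^sub>R (indicator (cbox l u) x *\<^sub>R g x)) = 0" for n
    proof -
      have "(LINT x|lebesgue. box_bump l u n x *\<^sub>R (indicator (cbox l u) x *\<^sub>R g x))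
          = (LINT x:U|lebesgue. box_bump l u n x *\<^sub>R g x)"
        unfolding set_lebesgue_integral_def using lu box_subset_cbox[of l u]
        by (intro Bochner_Integration.integral_cong) (auto simp: indicator_def box_bump_eq_0 subset_eq)
      also have "\<dots> = 0" by (intro test test_function_box_bump lu)
      finally show ?thesis .
    qed
    ultimately have "(LINT x|lebesgue. indicator (box l u) x *\<^sub>R (indicator (cbox l u) x *\<^sub>R g x)) = 0"
      by (simp add: LIMSEQ_const_iff)
    also have "(\<lambda>x. indicator (box l u) x *\<^sub>R (indicator (cbox l u) x *\<^sub>R g x)) = (\<lambda>x. indicator (box l u) x *\<^sub>R g x)"
      using box_subset_cbox[of l u] by (auto simp: fun_eq_iff subset_eq split: split_indicator)
    finally show ?thesis by (simp add: set_lebesgue_integral_def)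
  qed
  have cbox0: "AE x in lebesgue. x \<in> cbox a b \<longrightarrow> g x = 0" if ab: "cbox a b \<subseteq> U" for a b
  proof -
    have gi: "integrable lebesgue (\<lambda>x. indicator (box a b) x *\<^sub>R g x)"
    proof -
      have "set_integrable lebesgue (cbox a b) g"
        using g ab by (auto simp: locally_integrable_def)
      then have "set_integrable lebesgue (box a b) g"
        by (rule set_integrable_subset) (auto simp: box_subset_cbox)
      then show ?thesis by (simp add: set_integrable_def)
    qed
    \<comment> \<open>The criterion asks for every box of the space, including those that leave U.
      Only the intersection with \<open>box a b\<close> matters; it is again a box, and if it is
      nonempty its closure stays inside \<open>cbox a b\<close>.\<close>
    have z: "(LINT x|lebesgue. indicator (box l u) x *\<^sub>R indicator (box a b) x *\<^sub>R g x) = 0" for l u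
    proof -
      obtain l' u' where lu: "box l u \<inter> box a b = box l' u'" using box_Int_box[of l u a b] by (rule that)
      have *: "(LINT x:box l' u'|lebesgue. g x) = 0"
      proof (cases "box l' u' = {}")
        case True then show ?thesis by (simp add: set_lebesgue_integral_def)
      next
        case False
        moreover from this have "box a b \<noteq> {}" using lu by auto
        moreover have "closure (box l' u') \<subseteq> closure (box a b)"
          unfolding lu[symmetric] by (rule closure_mono) auto
        ultimately have "cbox l' u' \<subseteq> cbox a b" by (simp add: closure_box)
        then show ?thesis using ab by (intro box0) auto
      qed
      have "(\<lambda>x. indicator (box l u) x *\<^sub>R indicator (box a b) x *\<^sub>R g x) = (\<lambda>x. indicator (box l' u') x *\<^sub>R g x)"
        unfolding lu[symmetric] by (auto simp: fun_eq_iff split: split_indicator)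
      with * show ?thesis by (simp add: set_lebesgue_integral_def)
    qed
    have zi: "integrable lebesgue (\<lambda>x. indicator (box l u) x *\<^sub>R indicator (box a b) x *\<^sub>R g x)" for l u
      using integrable_mult_indicator[OF _ gi, of "box l u"] by simp
    have "AE x in lebesgue. Re (indicator (box a b) x *\<^sub>R g x) = 0"
    proof (rule AE_eq_0_if_box_integrals_eq_0)
      show "integrable lebesgue (\<lambda>x. Re (indicator (box a b) x *\<^sub>R g x))" using gi by (rule integrable_Re)
      show "(LINT x:box l u|lebesgue. Re (indicator (box a b) x *\<^sub>R g x)) = 0" for l u
        using z[of l u] integral_Re[OF zi, of l u] by (simp add: set_lebesgue_integral_def mult.assoc)
    qed
    moreover have "AE x in lebesgue. Im (indicator (box a b) x *\<^sub>R g x) = 0"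
    proof (rule AE_eq_0_if_box_integrals_eq_0)
      show "integrable lebesgue (\<lambda>x. Im (indicator (box a b) x *\<^sub>R g x))" using gi by (rule integrable_Im)
      show "(LINT x:box l u|lebesgue. Im (indicator (box a b) x *\<^sub>R g x)) = 0" for l u
        using z[of l u] integral_Im[OF zi, of l u] by (simp add: set_lebesgue_integral_def mult.assoc)
    qed
    \<comment> \<open>The faces of the box, which the open boxes leave undecided, form a null
      set.\<close>
    moreover have "AE x in lebesgue. x \<notin> cbox a b - box a b"
      by (intro AE_not_in negligible_frontier_interval[of a b, unfolded negligible_iff_null_sets])
    ultimately show ?thesis
      by eventually_elim (auto simp: complex_eq_iff)
  qed
  obtain \<D> where D: "countable \<D>" "\<D> \<subseteq> Pow U" "\<And>X. X \<in> \<D> \<Longrightarrow> \<exists>a b. X = cbox a b" "\<Union>\<D> = U"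
    by (rule open_countable_Union_open_cbox[OF U]) blast
  have "AE x in lebesgue. \<forall>X\<in>\<D>. x \<in> X \<longrightarrow> g x = 0"
    unfolding AE_ball_countable[OF D(1)]
  proof
    fix X assume X: "X \<in> \<D>"
    then obtain a b where "X = cbox a b" using D(3) by blast
    with X D(2) cbox0[of a b] show "AE x in lebesgue. x \<in> X \<longrightarrow> g x = 0" by auto
  qed
  then show ?thesis
    by eventually_elim (use D(4) in auto)
qed

section \<open>Integration by parts\<close>

text \<open>The test functions below are only twice differentiable, and only on \<open>\<Omega>\<close>; derivatives along
  the coordinate directions are all that integration by parts needs.\<close>

definition has_dir_deriv :: "('a::euclidean_space \<Rightarrow> complex) \<Rightarrow> 'a \<Rightarrow> complex \<Rightarrow> 'a \<Rightarrow> bool" where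
  "has_dir_deriv f b D x \<longleftrightarrow> ((\<lambda>t. f (x + t *\<^sub>R b)) has_vector_derivative D) (at 0)"

lemma has_dir_deriv_shift:
  assumes "has_dir_deriv f b D (x + s *\<^sub>R b)"
  shows "((\<lambda>t. f (x + t *\<^sub>R b)) has_vector_derivative D) (at s)"
proof -
  have "((\<lambda>t. f (x + s *\<^sub>R b + t *\<^sub>R b)) \<circ> (\<lambda>t. t - s) has_vector_derivative 1 *\<^sub>R D) (at s)"
    using assms unfolding has_dir_deriv_def
    by (intro vector_diff_chain_at) (auto intro!: derivative_eq_intros)
  then show ?thesis by (simp add: o_def algebra_simps)
qed

lemma has_dir_deriv_unique: "has_dir_deriv f b D x \<Longrightarrow> has_dir_deriv f b D' x \<Longrightarrow> D = D'"
  unfolding has_dir_deriv_def by (rule vector_derivative_unique_at)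

lemma has_dir_deriv_transform:
  assumes "has_dir_deriv f b D x" "open U" "x \<in> U" "\<And>y. y \<in> U \<Longrightarrow> f y = g y"
  shows "has_dir_deriv g b D x"
proof -
  let ?T = "(\<lambda>t. x + t *\<^sub>R b) -` U"
  have "open ?T" by (intro open_vimage continuous_intros assms(2))
  show ?thesis
    unfolding has_dir_deriv_def
    by (rule has_vector_derivative_transform_within_open[OF assms(1)[unfolded has_dir_deriv_def] \<open>open ?T\<close>])
      (use assms(3,4) in auto)
qed

lemma has_dir_deriv_0_outside:
  assumes "compact K" "\<And>x. x \<notin> K \<Longrightarrow> f x = 0" "x \<notin> K" "has_dir_deriv f b D x"
  shows "D = 0"
proof -
  have "has_dir_deriv (\<lambda>_. 0) b 0 x" by (simp add: has_dir_deriv_def)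
  then have "has_dir_deriv f b 0 x"
    by (rule has_dir_deriv_transform[where U="- K"]) (use assms in \<open>auto simp: compact_imp_closed open_Compl\<close>)
  with assms(4) show ?thesis by (rule has_dir_deriv_unique)
qed

lemma has_dir_deriv_mult:
  assumes "has_dir_deriv f b D x" "has_dir_deriv g b E x"
  shows "has_dir_deriv (\<lambda>x. f x * g x) b (f x * E + D * g x) x"
  using has_vector_derivative_mult[OF assms[unfolded has_dir_deriv_def]] by (simp add: has_dir_deriv_def)

lemma continuous_on_compact_support_bounded:
  fixes F :: "'a::euclidean_space \<Rightarrow> complex"
  assumes "continuous_on UNIV F" "compact K" "\<And>x. x \<notin> K \<Longrightarrow> F x = 0"
  obtains B where "B \<ge> 0" "\<And>x. norm (F x) \<le> B"
proof -
  have "compact (F ` K)" using assms by (intro compact_continuous_image continuous_on_subset[OF assms(1)]) auto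
  then obtain B where B: "\<And>x. x \<in> K \<Longrightarrow> norm (F x) \<le> B"
    using compact_imp_bounded[of "F ` K"] by (auto simp: bounded_iff)
  show ?thesis
  proof (rule that[of "max 0 B"])
    show "norm (F x) \<le> max 0 B" for x
      using B[of x] assms(3)[of x] by (cases "x \<in> K") auto
  qed simp
qed

lemma integrable_continuous_compact_support:
  fixes F :: "'a::euclidean_space \<Rightarrow> complex"
  assumes "continuous_on UNIV F" "compact K" "\<And>x. x \<notin> K \<Longrightarrow> F x = 0"
  shows "integrable lborel F"
proof -
  have "integrable lborel (\<lambda>x. indicator K x *\<^sub>R F x)"
    by (intro borel_integrable_compact assms continuous_on_subset[OF assms(1)]) auto
  also have "(\<lambda>x. indicator K x *\<^sub>R F x) = F" using assms(3) by (auto simp: indicator_def)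
  finally show ?thesis .
qed

lemma lborel_integral_translation:
  fixes F :: "'a::euclidean_space \<Rightarrow> complex"
  assumes "F \<in> borel_measurable borel"
  shows "(LINT x|lborel. F (x + c)) = (LINT x|lborel. F x)"
proof -
  have "(LINT x|lborel. F x) = (LINT x|distr lborel borel ((+) c). F x)" by (simp add: lborel_distr_plus)
  also have "\<dots> = (LINT x|lborel. F (c + x))" using assms by (intro integral_distr) auto
  finally show ?thesis by (simp add: add.commute)
qed

text \<open>The fundamental theorem without slicing: the integral of a difference quotient vanishes
  by translation invariance, the mean value inequality bounds the quotients uniformly, and dominated
  convergence passes to F'.\<close>

lemma integral_dir_deriv_eq_0:
  assumes der: "\<And>x. has_dir_deriv F b (F' x) x"
    and cont: "continuous_on UNIV F" "continuous_on UNIV F'"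
    and K: "compact K" "\<And>x. x \<notin> K \<Longrightarrow> F x = 0"
  shows "(LINT x|lborel. F' x) = 0"
proof -
  have K': "F' x = 0" if "x \<notin> K" for x
    by (rule has_dir_deriv_0_outside[OF K that der])
  obtain B where B: "B \<ge> 0" "\<And>x. norm (F' x) \<le> B"
    using continuous_on_compact_support_bounded[OF cont(2) K(1) K'] by metis
  obtain R where R: "\<And>x. x \<in> K \<Longrightarrow> norm x \<le> R"
    using compact_imp_bounded[OF K(1)] by (auto simp: bounded_iff)
  define Q where "Q n x = real (Suc n) *\<^sub>R (F (x + (1 / real (Suc n)) *\<^sub>R b) - F x)" for n x
  have [measurable]: "F \<in> borel_measurable borel" "F' \<in> borel_measurable borel"
    using cont by (auto intro: borel_measurable_continuous_onI)
  have intF: "integrable lborel F" by (rule integrable_continuous_compact_support[OF cont(1) K])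
  have Qb: "norm (Q n x) \<le> B" for n x
  proof -
    have "norm (F (x + (1 / real (Suc n)) *\<^sub>R b) - F (x + 0 *\<^sub>R b)) \<le> B * norm (1 / real (Suc n) - 0)"
    proof (rule differentiable_bound[where S=UNIV and f'="\<lambda>t h. h *\<^sub>R F' (x + t *\<^sub>R b)"])
      show "((\<lambda>t. F (x + t *\<^sub>R b)) has_derivative (\<lambda>h. h *\<^sub>R F' (x + t *\<^sub>R b))) (at t within UNIV)" for t
        using has_dir_deriv_shift[OF der] by (simp add: has_vector_derivative_def)
      show "onorm (\<lambda>h. h *\<^sub>R F' (x + t *\<^sub>R b)) \<le> B" for t
        using B by (intro onorm_bound) (auto simp: mult.commute[of B] intro: mult_left_mono)
    qed auto
    then have "norm (F (x + (1 / real (Suc n)) *\<^sub>R b) - F x) * real (Suc n) \<le> B"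
      by (simp add: pos_le_divide_eq[symmetric] del: of_nat_Suc)
    then show ?thesis unfolding Q_def norm_scaleR by (simp add: mult.commute del: of_nat_Suc)
  qed
  have Qlim: "(\<lambda>n. Q n x) \<longlonglongrightarrow> F' x" for x
  proof -
    let ?q = "\<lambda>t. norm (F (x + t *\<^sub>R b) - F x - t *\<^sub>R F' x) / norm t"
    have "(?q \<longlongrightarrow> 0) (at 0)"
      using der[of x] unfolding has_dir_deriv_def has_vector_derivative_def has_derivative_iff_norm by simp
    then have "(\<lambda>n. ?q (1 / real (Suc n))) \<longlonglongrightarrow> 0"
      by (rule filterlim_compose[where g="?q"])
        (use LIMSEQ_inverse_real_of_nat in \<open>auto simp: filterlim_at inverse_eq_divide\<close>)
    moreover have "?q (1 / real (Suc n)) = norm (Q n x - F' x)" for n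
    proof -
      have "Q n x - F' x = real (Suc n) *\<^sub>R (F (x + (1 / real (Suc n)) *\<^sub>R b) - F x - (1 / real (Suc n)) *\<^sub>R F' x)"
        by (simp add: Q_def scaleR_diff_right)
      then show ?thesis by (simp only: norm_scaleR) simp
    qed
    ultimately have "(\<lambda>n. norm (Q n x - F' x)) \<longlonglongrightarrow> 0" by simp
    then show ?thesis by (rule LIM_zero_cancel[OF tendsto_norm_zero_cancel])
  qed
  \<comment> \<open>Step sizes are at most 1, so every quotient is supported within distance
    \<open>norm b\<close> of K; this gives one dominating function for all n.\<close>
  have "(\<lambda>n. LINT x|lborel. Q n x) \<longlonglongrightarrow> (LINT x|lborel. F' x)"
  proof (rule integral_dominated_convergence[where w="\<lambda>x. indicator (cball 0 (R + norm b)) x *\<^sub>R B"])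
    show "AE x in lborel. norm (Q n x) \<le> indicator (cball 0 (R + norm b)) x *\<^sub>R B" for n
    proof (intro AE_I2)
      fix x show "norm (Q n x) \<le> indicator (cball 0 (R + norm b)) x *\<^sub>R B"
      proof (cases "x \<in> cball 0 (R + norm b)")
        case True with Qb show ?thesis by simp
      next
        case False
        have 1: "norm ((1 / real (Suc n)) *\<^sub>R b) \<le> norm b" by (simp add: field_simps mult_left_le_one_le)
        have "x \<notin> K" using False R[of x] norm_ge_zero[of b] by (fastforce simp: dist_norm)
        moreover have "x + (1 / real (Suc n)) *\<^sub>R b \<notin> K"
          using False R[of "x + (1 / real (Suc n)) *\<^sub>R b"] 1
            norm_triangle_ineq4[of "x + (1 / real (Suc n)) *\<^sub>R b" "(1 / real (Suc n)) *\<^sub>R b"]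
          by (fastforce simp: dist_norm)
        ultimately show ?thesis using False by (simp add: Q_def K)
      qed
    qed
    show "integrable lborel (\<lambda>x. indicator (cball 0 (R + norm b)) x *\<^sub>R B)"
      by (intro borel_integrable_compact) auto
  qed (use Qlim in \<open>auto simp: Q_def\<close>)
  moreover have "(LINT x|lborel. Q n x) = 0" for n
  proof -
    have "integrable lborel (\<lambda>x. F (x + c))" for c
    proof (rule integrable_continuous_compact_support[of _ "(\<lambda>x. x - c) ` K"])
      show "compact ((\<lambda>x. x - c) ` K)" by (intro compact_continuous_image continuous_intros K)
      show "continuous_on UNIV (\<lambda>x. F (x + c))"
        by (rule continuous_on_compose2[OF cont(1)]) (auto intro!: continuous_intros)
      show "F (x + c) = 0" if "x \<notin> (\<lambda>x. x - c) ` K" for x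
        using that K(2)[of "x + c"] by (metis add_diff_cancel_right' image_eqI)
    qed
    then show ?thesis
      unfolding Q_def using intF by (simp add: lborel_integral_translation)
  qed
  ultimately show ?thesis by (simp add: LIMSEQ_const_iff)
qed

text \<open>U and the complement of K are open and cover the space, and the extension is continuous
  on each of them.\<close>

lemma continuous_extension_by_0:
  fixes f :: "'a::euclidean_space \<Rightarrow> complex"
  assumes "open U" "continuous_on U f" "compact K" "K \<subseteq> U" "\<And>x. x \<notin> K \<Longrightarrow> f x = 0"
  shows "continuous_on UNIV (\<lambda>x. if x \<in> U then f x else 0)"
proof -
  have "continuous_on (U \<union> - K) (\<lambda>x. if x \<in> U then f x else 0)"
  proof (rule continuous_on_open_Un)
    show "continuous_on U (\<lambda>x. if x \<in> U then f x else 0)"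
      using assms(2) by (rule continuous_on_eq) simp
    show "continuous_on (- K) (\<lambda>x. if x \<in> U then f x else 0)"
      by (rule continuous_on_eq[of _ "\<lambda>_. 0"]) (use assms(5) in auto)
  qed (use assms in \<open>auto simp: compact_imp_closed\<close>)
  also have "U \<union> - K = UNIV" using assms by auto
  finally show ?thesis .
qed

lemma set_integral_lborel:
  fixes f :: "'a::euclidean_space \<Rightarrow> complex"
  assumes "integrable lborel (\<lambda>x. if x \<in> U then f x else 0)"
  shows "set_integrable lebesgue U f"
    and "(LINT x:U|lebesgue. f x) = (LINT x|lborel. (if x \<in> U then f x else 0))"
proof -
  have eq: "(\<lambda>x. indicator U x *\<^sub>R f x) = (\<lambda>x. if x \<in> U then f x else 0)" by auto
  show "set_integrable lebesgue U f"
    using assms unfolding set_integrable_def eq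
    by (subst integrable_completion[OF borel_measurable_integrable[OF assms]])
  show "(LINT x:U|lebesgue. f x) = (LINT x|lborel. (if x \<in> U then f x else 0))"
    unfolding set_lebesgue_integral_def eq
    by (rule integral_completion[OF borel_measurable_integrable[OF assms]])
qed

text \<open>Nothing is assumed of \<phi> at or beyond the boundary of U. Since \<zeta> has compact
  support in U, the product extended by zero has a continuous derivative along b everywhere, and the
  integral of that derivative vanishes.\<close>

lemma integration_by_parts_compact_support:
  assumes U: "open U" and K: "compact K" "K \<subseteq> U" "\<And>x. x \<notin> K \<Longrightarrow> \<zeta> x = 0"
    and \<zeta>: "\<And>x. has_dir_deriv \<zeta> b (\<zeta>' x) x" "continuous_on UNIV \<zeta>" "continuous_on UNIV \<zeta>'"
    and \<phi>: "\<And>x. x \<in> U \<Longrightarrow> has_dir_deriv \<phi> b (\<phi>' x) x" "continuous_on U \<phi>" "continuous_on U \<phi>'"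
  shows "set_integrable lebesgue U (\<lambda>x. \<zeta>' x * \<phi> x)" "set_integrable lebesgue U (\<lambda>x. \<zeta> x * \<phi>' x)"
    and "(LINT x:U|lebesgue. \<zeta>' x * \<phi> x) = - (LINT x:U|lebesgue. \<zeta> x * \<phi>' x)"
proof -
  have K': "\<zeta>' x = 0" if "x \<notin> K" for x
    by (rule has_dir_deriv_0_outside[OF K(1,3) that \<zeta>(1)])
  let ?e = "\<lambda>f x. if x \<in> U then f x else (0::complex)"
  have c: "continuous_on UNIV (?e (\<lambda>x. \<zeta> x * \<phi> x))" "continuous_on UNIV (?e (\<lambda>x. \<zeta>' x * \<phi> x))"
    "continuous_on UNIV (?e (\<lambda>x. \<zeta> x * \<phi>' x))"
    by (rule continuous_extension_by_0[OF U _ K(1,2)];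
        force intro!: continuous_intros \<phi> continuous_on_subset[OF \<zeta>(2)] continuous_on_subset[OF \<zeta>(3)] simp: K(3) K')+
  have i: "integrable lborel (?e (\<lambda>x. \<zeta>' x * \<phi> x))" "integrable lborel (?e (\<lambda>x. \<zeta> x * \<phi>' x))"
    by (rule integrable_continuous_compact_support[OF c(2) K(1)], simp add: K',
        rule integrable_continuous_compact_support[OF c(3) K(1)], simp add: K)
  show si: "set_integrable lebesgue U (\<lambda>x. \<zeta>' x * \<phi> x)" "set_integrable lebesgue U (\<lambda>x. \<zeta> x * \<phi>' x)"
    by (intro set_integral_lborel i)+
  have "(LINT x|lborel. ?e (\<lambda>x. \<zeta> x * \<phi>' x) x + ?e (\<lambda>x. \<zeta>' x * \<phi> x) x) = 0"
  proof (rule integral_dir_deriv_eq_0[where b=b])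
    show "has_dir_deriv (?e (\<lambda>x. \<zeta> x * \<phi> x)) b (?e (\<lambda>x. \<zeta> x * \<phi>' x) x + ?e (\<lambda>x. \<zeta>' x * \<phi> x) x) x" for x
    proof (cases "x \<in> U")
      case True
      have "has_dir_deriv (?e (\<lambda>x. \<zeta> x * \<phi> x)) b (\<zeta> x * \<phi>' x + \<zeta>' x * \<phi> x) x"
        by (rule has_dir_deriv_transform[OF has_dir_deriv_mult[OF \<zeta>(1) \<phi>(1)] U True]) (use True in auto)
      with True show ?thesis by simp
    next
      case False
      have "has_dir_deriv (\<lambda>_. 0) b 0 x" by (simp add: has_dir_deriv_def)
      then have "has_dir_deriv (?e (\<lambda>x. \<zeta> x * \<phi> x)) b 0 x"
        by (rule has_dir_deriv_transform[where U="- K"])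
          (use K False in \<open>auto simp: compact_imp_closed open_Compl\<close>)
      with False show ?thesis by simp
    qed
    show "continuous_on UNIV (\<lambda>x. ?e (\<lambda>x. \<zeta> x * \<phi>' x) x + ?e (\<lambda>x. \<zeta>' x * \<phi> x) x)"
      by (intro continuous_intros c)
    show "compact K" by fact
    show "\<And>x. x \<notin> K \<Longrightarrow> ?e (\<lambda>x. \<zeta> x * \<phi> x) x = 0" by (simp add: K)
  qed (rule c)
  then have "(LINT x|lborel. ?e (\<lambda>x. \<zeta> x * \<phi>' x) x) + (LINT x|lborel. ?e (\<lambda>x. \<zeta>' x * \<phi> x) x) = 0"
    using i by simp
  then show "(LINT x:U|lebesgue. \<zeta>' x * \<phi> x) = - (LINT x:U|lebesgue. \<zeta> x * \<phi>' x)"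
    by (simp add: set_integral_lborel i eq_neg_iff_add_eq_0 add.commute)
qed

section \<open>Smooth functions, test functions and classical weak derivatives\<close>

lemma smooth_imp_has_derivative:
  fixes f :: "'a::euclidean_space \<Rightarrow> 'b::real_normed_vector"
  assumes "smooth f"
  shows "(f has_derivative frechet_derivative f (at x)) (at x)" "continuous_on UNIV f"
proof -
  have "\<forall>x. f differentiable (at x)"
    using assms unfolding smooth_def by (elim allE[of _ "[]"]) (simp add: iterated_pd_def)
  then show "(f has_derivative frechet_derivative f (at x)) (at x)" "continuous_on UNIV f"
    by (auto simp: frechet_derivative_works differentiable_imp_continuous_within continuous_on_eq_continuous_within)
qed

lemma smooth_imp_continuous_pd:
  fixes f :: "'a::euclidean_space \<Rightarrow> 'b::real_normed_vector"
  assumes "smooth f" "b \<in> Basis"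
  shows "continuous_on UNIV (pd b f)"
proof -
  have "\<forall>x. iterated_pd [b] f differentiable (at x)"
    using assms unfolding smooth_def by simp
  then show ?thesis
    by (auto simp: iterated_pd_def differentiable_imp_continuous_within continuous_on_eq_continuous_within)
qed

lemma smooth_has_vector_derivative_line:
  fixes f :: "'a::euclidean_space \<Rightarrow> 'b::real_normed_vector"
  assumes "smooth f"
  shows "((\<lambda>t. f (x + t *\<^sub>R b)) has_vector_derivative pd b f x) (at 0)"
proof -
  note d = smooth_imp_has_derivative(1)[OF assms, of x]
  have "((\<lambda>t. x + t *\<^sub>R b) has_derivative (\<lambda>t. t *\<^sub>R b)) (at 0)"
    by (auto intro!: derivative_eq_intros)
  moreover have "(f has_derivative frechet_derivative f (at x)) (at (x + 0 *\<^sub>R b))"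
    using d by simp
  ultimately have "((\<lambda>t. f (x + t *\<^sub>R b)) has_derivative (\<lambda>t. frechet_derivative f (at x) (t *\<^sub>R b))) (at 0)"
    by (rule has_derivative_compose)
  then show ?thesis
    unfolding has_vector_derivative_def pd_def linear_cmul[OF has_derivative_linear[OF d]] .
qed

lemma smooth_has_dir_deriv: "smooth f \<Longrightarrow> has_dir_deriv f b (pd b f x) x"
  unfolding has_dir_deriv_def by (rule smooth_has_vector_derivative_line)

lemma smooth_has_dir_deriv_of_real:
  fixes f :: "'a::euclidean_space \<Rightarrow> real"
  assumes "smooth f"
  shows "has_dir_deriv (\<lambda>x. complex_of_real (f x)) b (complex_of_real (pd b f x)) x"
proof -
  have "((\<lambda>t. f (x + t *\<^sub>R b)) has_vector_derivative pd b f x) (at 0)"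
    by (rule smooth_has_vector_derivative_line[OF assms])
  from bounded_linear.has_vector_derivative[OF bounded_linear_of_real this]
  show ?thesis unfolding has_dir_deriv_def .
qed

lemma test_function_eq_0: "test_function U \<zeta> \<Longrightarrow> x \<notin> closure {x. \<zeta> x \<noteq> 0} \<Longrightarrow> \<zeta> x = 0"
  using closure_subset[of "{x. \<zeta> x \<noteq> 0}"] by blast

lemma locally_integrable_continuous:
  assumes "continuous_on U f"
  shows "locally_integrable U f"
proof -
  have "set_integrable lebesgue K f" if "compact K" "K \<subseteq> U" for K
  proof -
    have i: "integrable lborel (\<lambda>x. indicator K x *\<^sub>R f x)"
      using that by (intro borel_integrable_compact continuous_on_subset[OF assms]) auto
    then show ?thesis
      unfolding set_integrable_def
      by (subst integrable_completion[OF borel_measurable_integrable[OF i]])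
  qed
  then show ?thesis
    unfolding locally_integrable_def by blast
qed

text \<open>This admits functions of limited regularity into the Sobolev framework: continuous
  coordinate derivatives on U are weak derivatives, whatever happens at the boundary.\<close>

lemma has_weak_pd_classical:
  assumes "open U" "b \<in> Basis"
    and \<phi>: "\<And>x. x \<in> U \<Longrightarrow> has_dir_deriv \<phi> b (\<phi>' x) x" "continuous_on U \<phi>" "continuous_on U \<phi>'"
  shows "has_weak_pd U b \<phi> \<phi>'"
  unfolding has_weak_pd_def
proof (intro conjI allI impI)
  fix \<zeta> :: "'a \<Rightarrow> real" assume t: "test_function U \<zeta>"
  then have s: "smooth \<zeta>" by (simp add: test_function_def)
  have "(LINT x:U|lebesgue. complex_of_real (pd b \<zeta> x) * \<phi> x) = - (LINT x:U|lebesgue. complex_of_real (\<zeta> x) * \<phi>' x)"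
  proof (rule integration_by_parts_compact_support(3)[OF \<open>open U\<close> _ _ _ smooth_has_dir_deriv_of_real[OF s] _ _ \<phi>])
    show "compact (closure {x. \<zeta> x \<noteq> 0})" "closure {x. \<zeta> x \<noteq> 0} \<subseteq> U"
      using t by (auto simp: test_function_def)
    show "complex_of_real (\<zeta> x) = 0" if "x \<notin> closure {x. \<zeta> x \<noteq> 0}" for x
      by (simp only: test_function_eq_0[OF t that] of_real_0)
    show "continuous_on UNIV (\<lambda>x. complex_of_real (\<zeta> x))" "continuous_on UNIV (\<lambda>x. complex_of_real (pd b \<zeta> x))"
      using smooth_imp_has_derivative(2)[OF s] smooth_imp_continuous_pd[OF s assms(2)]
      by (auto intro!: continuous_on_of_real)
  qed
  then show "(LINT x:U|lebesgue. pd b \<zeta> x *\<^sub>R \<phi> x) = - (LINT x:U|lebesgue. \<zeta> x *\<^sub>R \<phi>' x)"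
    by (simp add: scaleR_conv_of_real)
qed (rule locally_integrable_continuous[OF \<phi>(2)] locally_integrable_continuous[OF \<phi>(3)])+

lemma locally_integrable_diff:
  "locally_integrable U f \<Longrightarrow> locally_integrable U g \<Longrightarrow> locally_integrable U (\<lambda>x. f x - g x)"
  unfolding locally_integrable_def by (intro allI impI set_integral_diff(1)) simp_all

lemma set_integrable_test_function:
  fixes \<phi> :: "'a::euclidean_space \<Rightarrow> real"
  assumes "locally_integrable U f" "continuous_on UNIV \<phi>" "compact K" "K \<subseteq> U" "\<And>x. x \<notin> K \<Longrightarrow> \<phi> x = 0"
  shows "set_integrable lebesgue U (\<lambda>x. \<phi> x *\<^sub>R f x)"
proof -
  have f: "integrable lebesgue (\<lambda>x. indicator K x *\<^sub>R f x)"
    using assms by (auto simp: locally_integrable_def set_integrable_def)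
  have "continuous_on UNIV (\<lambda>x. complex_of_real (\<phi> x))" using assms(2) by (intro continuous_on_of_real)
  then obtain B where B: "\<And>x. norm (complex_of_real (\<phi> x)) \<le> B"
    using continuous_on_compact_support_bounded[of _ K] assms(3,5) by (metis of_real_0)
  have "integrable lebesgue (\<lambda>x. \<phi> x *\<^sub>R (indicator K x *\<^sub>R f x))"
  proof (rule Bochner_Integration.integrable_bound[where f="\<lambda>x. B *\<^sub>R (indicator K x *\<^sub>R f x)"])
    show "integrable lebesgue (\<lambda>x. B *\<^sub>R (indicator K x *\<^sub>R f x))" using f by (intro integrable_scaleR_right) auto
    show "(\<lambda>x. \<phi> x *\<^sub>R indicat_real K x *\<^sub>R f x) \<in> borel_measurable lebesgue"
      by (intro borel_measurable_scaleR borel_measurable_integrable[OF f] measurable_completion)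
        (use assms(2) in \<open>auto intro: borel_measurable_continuous_onI\<close>)
    show "AE x in lebesgue. norm (\<phi> x *\<^sub>R indicat_real K x *\<^sub>R f x) \<le> norm (B *\<^sub>R indicat_real K x *\<^sub>R f x)"
      using B by (intro AE_I2) (auto simp: abs_mult intro!: mult_right_mono intro: order_trans[OF _ abs_ge_self])
  qed
  also have "(\<lambda>x. \<phi> x *\<^sub>R (indicator K x *\<^sub>R f x)) = (\<lambda>x. indicator U x *\<^sub>R (\<phi> x *\<^sub>R f x))"
    using assms(4,5) by (auto simp: fun_eq_iff subset_eq split: split_indicator)
  finally show ?thesis by (simp add: set_integrable_def)
qed

lemma test_function_facts:
  fixes \<phi> :: "'a::euclidean_space \<Rightarrow> real"
  assumes "test_function U \<phi>"
  obtains K where "compact K" "K \<subseteq> U" "\<And>x. x \<notin> K \<Longrightarrow> \<phi> x = 0"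
    "\<And>x b. x \<notin> K \<Longrightarrow> pd b \<phi> x = 0" "continuous_on UNIV \<phi>" "\<And>b. b \<in> Basis \<Longrightarrow> continuous_on UNIV (pd b \<phi>)"
proof -
  let ?K = "closure {x. \<phi> x \<noteq> 0}"
  have s: "smooth \<phi>" and K: "compact ?K" "?K \<subseteq> U" using assms by (auto simp: test_function_def)
  have z: "\<And>x. x \<notin> ?K \<Longrightarrow> \<phi> x = 0" by (rule test_function_eq_0[OF assms])
  have z': "pd b \<phi> x = 0" if "x \<notin> ?K" for x b
  proof -
    have "complex_of_real (pd b \<phi> x) = 0"
      by (rule has_dir_deriv_0_outside[OF K(1) _ that smooth_has_dir_deriv_of_real[OF s]]) (subst z, assumption, simp)
    then show ?thesis by simp
  qed
  show ?thesis
    by (rule that[OF K z z' smooth_imp_has_derivative(2)[OF s] smooth_imp_continuous_pd[OF s]])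
qed

section \<open>Linearity and uniqueness of weak derivatives\<close>

lemma has_weak_pd_diff:
  assumes "has_weak_pd U b f f'" "has_weak_pd U b g g'" "b \<in> Basis"
  shows "has_weak_pd U b (\<lambda>x. f x - g x) (\<lambda>x. f' x - g' x)"
  unfolding has_weak_pd_def
proof (intro conjI allI impI)
  fix \<phi> :: "'a \<Rightarrow> real" assume t: "test_function U \<phi>"
  obtain K where K: "compact K" "K \<subseteq> U" "\<And>x. x \<notin> K \<Longrightarrow> \<phi> x = 0"
    "\<And>x b. x \<notin> K \<Longrightarrow> pd b \<phi> x = 0" "continuous_on UNIV \<phi>" "\<And>b. b \<in> Basis \<Longrightarrow> continuous_on UNIV (pd b \<phi>)"
    by (rule test_function_facts[OF t]) blast
  have i: "set_integrable lebesgue U (\<lambda>x. \<phi> x *\<^sub>R h x)" "set_integrable lebesgue U (\<lambda>x. pd b \<phi> x *\<^sub>R h x)"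
    if "locally_integrable U h" for h
    using that K assms(3) by (auto intro!: set_integrable_test_function)
  show "(LINT x:U|lebesgue. pd b \<phi> x *\<^sub>R (f x - g x)) = - (LINT x:U|lebesgue. \<phi> x *\<^sub>R (f' x - g' x))"
    using assms t unfolding has_weak_pd_def
    by (simp add: scaleR_diff_right set_integral_diff i)
qed (use assms in \<open>simp_all add: has_weak_pd_def locally_integrable_diff\<close>)

text \<open>Partial derivatives and the Laplacian share this uniqueness argument, since both are
  defined by pairing the candidate with real test functions.\<close>

lemma AE_eq_if_test_integrals_eq:
  fixes g g' :: "'a::euclidean_space \<Rightarrow> complex"
  assumes "open U" "locally_integrable U g" "locally_integrable U g'"
    and eq: "\<And>\<phi> :: 'a \<Rightarrow> real. test_function U \<phi> \<Longrightarrow>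
      (LINT x:U|lebesgue. \<phi> x *\<^sub>R g x) = (LINT x:U|lebesgue. \<phi> x *\<^sub>R g' x)"
  shows "AE x in lebesgue. x \<in> U \<longrightarrow> g x = g' x"
proof -
  have "AE x in lebesgue. x \<in> U \<longrightarrow> g x - g' x = 0"
  proof (rule AE_eq_0_if_test_integrals_eq_0)
    fix \<phi> :: "'a \<Rightarrow> real" assume t: "test_function U \<phi>"
    obtain K where K: "compact K" "K \<subseteq> U" "\<And>x. x \<notin> K \<Longrightarrow> \<phi> x = 0" "continuous_on UNIV \<phi>"
      by (rule test_function_facts[OF t]) blast
    show "(LINT x:U|lebesgue. \<phi> x *\<^sub>R (g x - g' x)) = 0"
      using eq[OF t] set_integrable_test_function[OF _ K(4,1,2,3)] assms(2,3)
      by (simp add: scaleR_diff_right set_integral_diff)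
  qed (use assms in \<open>simp_all add: locally_integrable_diff\<close>)
  then show ?thesis by simp
qed

lemma has_weak_pd_unique:
  assumes "open U" "has_weak_pd U b f g" "has_weak_pd U b f g'"
  shows "AE x in lebesgue. x \<in> U \<longrightarrow> g x = g' x"
  using assms by (intro AE_eq_if_test_integrals_eq) (auto simp: has_weak_pd_def)

lemma has_weak_laplacian_unique:
  assumes "open U" "has_weak_laplacian U f g" "has_weak_laplacian U f g'"
  shows "AE x in lebesgue. x \<in> U \<longrightarrow> g x = g' x"
  using assms by (intro AE_eq_if_test_integrals_eq) (auto simp: has_weak_laplacian_def)

text \<open>The chosen representatives inside \<open>H1_norm\<close> and inside the normal
  derivative pairing can thus be exchanged, under an integral, for any explicit weak
  derivative.\<close>

lemma weak_pd_AE_eq: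
  assumes "open U" "has_weak_pd U b f g"
  shows "AE x in lebesgue. x \<in> U \<longrightarrow> weak_pd U b f x = g x"
  using has_weak_pd_unique[OF assms(1) someI[of "has_weak_pd U b f", OF assms(2)] assms(2)]
  by (simp add: weak_pd_def)

lemma weak_laplacian_AE_eq:
  assumes "open U" "has_weak_laplacian U f g"
  shows "AE x in lebesgue. x \<in> U \<longrightarrow> weak_laplacian U f x = g x"
  using has_weak_laplacian_unique[OF assms(1) someI[of "has_weak_laplacian U f", OF assms(2)] assms(2)]
  by (simp add: weak_laplacian_def)

section \<open>Horizontal and vertical variables\<close>

lemma prod_Basis_cart: "(\<Prod>b\<in>(Basis::(real^'n) set). f b) = (\<Prod>i\<in>UNIV. f (axis i 1))"
proof -
  have "inj (\<lambda>i::'n. axis i (1::real))" by (auto simp: inj_on_def axis_eq_axis)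
  moreover have B: "(Basis::(real^'n) set) = range (\<lambda>i. axis i 1)" by (auto simp: Basis_vec_def)
  ultimately show ?thesis unfolding B by (simp only: prod.reindex o_def)
qed

lemma sum_Basis_cart: "(\<Sum>b\<in>(Basis::(real^'n) set). f b) = (\<Sum>i\<in>UNIV. f (axis i 1))"
proof -
  have "inj (\<lambda>i::'n. axis i (1::real))" by (auto simp: inj_on_def axis_eq_axis)
  moreover have B: "(Basis::(real^'n) set) = range (\<lambda>i. axis i 1)" by (auto simp: Basis_vec_def)
  ultimately show ?thesis unfolding B by (simp only: sum.reindex o_def)
qed

lemma prod_UNIV_2: "prod f (UNIV::2 set) = f 1 * f 2"
  unfolding UNIV_2 by simp

lemma prod_UNIV_3: "prod f (UNIV::3 set) = f 1 * f 2 * f 3"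
  unfolding UNIV_3 by (simp add: mult.assoc)

lemma vector2_conv_axis: "(vector [a, b] :: real^2) = a *\<^sub>R axis 1 1 + b *\<^sub>R axis 2 1"
  by (simp add: vec_eq_iff forall_2 axis_def)

lemma vector3_conv_axis: "(vector [a, b, c] :: real^3) = a *\<^sub>R axis 1 1 + b *\<^sub>R axis 2 1 + c *\<^sub>R axis 3 1"
  by (simp add: vec_eq_iff forall_3 axis_def)

lemma continuous_on_vector2 [continuous_intros]:
  "continuous_on A f \<Longrightarrow> continuous_on A g \<Longrightarrow> continuous_on A (\<lambda>x. vector [f x, g x] :: real^2)"
  unfolding vector2_conv_axis by (intro continuous_intros)

lemma continuous_on_vector3 [continuous_intros]:
  "continuous_on A f \<Longrightarrow> continuous_on A g \<Longrightarrow> continuous_on A h \<Longrightarrow>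
    continuous_on A (\<lambda>x. vector [f x, g x, h x] :: real^3)"
  unfolding vector3_conv_axis by (intro continuous_intros)

lemma join3_nth [simp]: "join3 y t $ 1 = y $ 1" "join3 y t $ 2 = y $ 2" "join3 y t $ 3 = t"
  by (simp_all add: join3_def)

lemma proj2_nth [simp]: "proj2 x $ 1 = x $ 1" "proj2 x $ 2 = x $ 2"
  by (simp_all add: proj2_def)

lemma proj2_join3 [simp]: "proj2 (join3 y t) = y"
  by (simp add: vec_eq_iff forall_2)

lemma join3_in_cyl [simp]: "join3 y t \<in> cyl A I \<longleftrightarrow> y \<in> A \<and> t \<in> I"
  by (simp add: cyl_def)

lemma continuous_on_proj2: "continuous_on A proj2"
  unfolding proj2_def by (intro continuous_intros)

lemma continuous_on_join3: "continuous_on A f \<Longrightarrow> continuous_on A g \<Longrightarrow> continuous_on A (\<lambda>x. join3 (f x) (g x))"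
  unfolding join3_def by (intro continuous_intros)

lemma borel_measurable_proj2 [measurable]: "proj2 \<in> borel_measurable borel"
  by (intro borel_measurable_continuous_onI continuous_on_proj2)

lemma norm_vec2: "norm (x::real^2) = sqrt ((x $ 1)\<^sup>2 + (x $ 2)\<^sup>2)"
  by (simp add: norm_vec_def L2_set_def sum_2)

lemma norm_vec3: "norm (x::real^3) = sqrt ((x $ 1)\<^sup>2 + (x $ 2)\<^sup>2 + (x $ 3)\<^sup>2)"
  by (simp add: norm_vec_def L2_set_def sum_3)

text \<open>Lebesgue measure is determined by the volumes of boxes. P and Q pick the two parts of a
  corner of a box, so one criterion covers both the plane as a product of lines and space as a
  product of a plane and a line.\<close>

lemma distr_pair_eq_lborel:
  fixes T :: "'a::euclidean_space \<times> 'b::euclidean_space \<Rightarrow> 'c::euclidean_space"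
  assumes cont: "continuous_on UNIV T"
    and box: "\<And>l u. T -` box l u = box (P l) (P u) \<times> box (Q l) (Q u)"
    and le: "\<And>l u. (\<forall>b\<in>Basis. l \<bullet> b \<le> u \<bullet> b) \<Longrightarrow> (\<forall>b\<in>Basis. P l \<bullet> b \<le> P u \<bullet> b) \<and> (\<forall>b\<in>Basis. Q l \<bullet> b \<le> Q u \<bullet> b)"
    and prod: "\<And>l u. (\<Prod>b\<in>Basis. (P u - P l) \<bullet> b) * (\<Prod>b\<in>Basis. (Q u - Q l) \<bullet> b) = (\<Prod>b\<in>Basis. (u - l) \<bullet> b)"
  shows "distr (lborel \<Otimes>\<^sub>M lborel) borel T = lborel"
proof (rule lborel_eqI[symmetric])
  have T: "T \<in> (lborel \<Otimes>\<^sub>M lborel) \<rightarrow>\<^sub>M borel"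
    unfolding lborel_prod using cont by (simp add: borel_measurable_continuous_onI)
  fix l u :: 'c assume lu: "\<And>b. b \<in> Basis \<Longrightarrow> l \<bullet> b \<le> u \<bullet> b"
  have "emeasure (distr (lborel \<Otimes>\<^sub>M lborel) borel T) (box l u) = emeasure (lborel \<Otimes>\<^sub>M lborel) (box (P l) (P u) \<times> box (Q l) (Q u))"
    using T by (subst emeasure_distr) (auto simp: box space_pair_measure)
  also have "\<dots> = emeasure lborel (box (P l) (P u)) * emeasure lborel (box (Q l) (Q u))"
    by (rule lborel.emeasure_pair_measure_Times) auto
  also have "\<dots> = ennreal (\<Prod>b\<in>Basis. (P u - P l) \<bullet> b) * ennreal (\<Prod>b\<in>Basis. (Q u - Q l) \<bullet> b)"
    using le[of l u] lu by (simp add: emeasure_lborel_box_eq)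
  also have "\<dots> = ennreal (\<Prod>b\<in>Basis. (u - l) \<bullet> b)"
    using le[of l u] lu prod[of u l] by (subst ennreal_mult'[symmetric]) (auto intro!: prod_nonneg simp: inner_diff_left)
  finally show "emeasure (distr (lborel \<Otimes>\<^sub>M lborel) borel T) (box l u) = ennreal (\<Prod>b\<in>Basis. (u - l) \<bullet> b)" .
qed simp

lemma lborel_eq_distr_vector2: "distr (lborel \<Otimes>\<^sub>M lborel) borel (\<lambda>p. vector [fst p, snd p] :: real^2) = lborel"
proof (rule distr_pair_eq_lborel[where P="\<lambda>x. x $ 1" and Q="\<lambda>x. x $ 2"])
  show "continuous_on UNIV (\<lambda>p::real \<times> real. vector [fst p, snd p] :: real^2)" by (intro continuous_intros)
  show "(\<Prod>b\<in>Basis. (u $ 1 - l $ 1) \<bullet> b) * (\<Prod>b\<in>Basis. (u $ 2 - l $ 2) \<bullet> b) = (\<Prod>b\<in>Basis. (u - l) \<bullet> b)"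
    for l u :: "real^2"
    by (simp add: prod_Basis_cart prod_UNIV_2 inner_axis)
qed (auto simp: mem_box_cart forall_2 box_real Basis_vec_def inner_axis)

lemma lborel_eq_distr_join3: "distr (lborel \<Otimes>\<^sub>M lborel) borel (\<lambda>p. join3 (fst p) (snd p)) = lborel"
proof (rule distr_pair_eq_lborel[where P="proj2" and Q="\<lambda>x. x $ 3"])
  show "continuous_on UNIV (\<lambda>p. join3 (fst p) (snd p))" by (intro continuous_on_join3 continuous_intros)
  show "(\<Prod>b\<in>Basis. (proj2 u - proj2 l) \<bullet> b) * (\<Prod>b\<in>Basis. (u $ 3 - l $ 3) \<bullet> b) = (\<Prod>b\<in>Basis. (u - l) \<bullet> b)"
    for l u :: "real^3"
    by (simp add: prod_Basis_cart prod_UNIV_2 prod_UNIV_3 inner_axis)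
qed (auto simp: mem_box_cart forall_2 forall_3 box_real Basis_vec_def inner_axis)

section \<open>Fubini along the splitting of coordinates\<close>

lemma nn_integral_join3:
  fixes f :: "real^3 \<Rightarrow> ennreal"
  assumes [measurable]: "f \<in> borel_measurable borel"
  shows "(\<integral>\<^sup>+x. f x \<partial>lborel) = (\<integral>\<^sup>+y. \<integral>\<^sup>+t. f (join3 y t) \<partial>lborel \<partial>lborel)"
proof -
  have [measurable]: "(\<lambda>p. join3 (fst p) (snd p)) \<in> (lborel \<Otimes>\<^sub>M lborel) \<rightarrow>\<^sub>M borel"
    unfolding lborel_prod by (auto intro!: borel_measurable_continuous_onI continuous_on_join3 continuous_intros)
  have "(\<integral>\<^sup>+x. f x \<partial>lborel) = (\<integral>\<^sup>+x. f x \<partial>(distr (lborel \<Otimes>\<^sub>M lborel) borel (\<lambda>p. join3 (fst p) (snd p))))"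
    by (simp add: lborel_eq_distr_join3)
  also have "\<dots> = (\<integral>\<^sup>+p. f (join3 (fst p) (snd p)) \<partial>(lborel \<Otimes>\<^sub>M lborel))"
    by (rule nn_integral_distr) auto
  also have "\<dots> = (\<integral>\<^sup>+y. \<integral>\<^sup>+t. f (join3 y t) \<partial>lborel \<partial>lborel)"
    by (subst lborel.nn_integral_fst[symmetric]) auto
  finally show ?thesis .
qed

lemma nn_integral_vector2:
  fixes f :: "real^2 \<Rightarrow> ennreal"
  assumes [measurable]: "f \<in> borel_measurable borel"
  shows "(\<integral>\<^sup>+x. f x \<partial>lborel) = (\<integral>\<^sup>+a. \<integral>\<^sup>+b. f (vector [a, b]) \<partial>lborel \<partial>lborel)"
proof -
  have [measurable]: "(\<lambda>p::real\<times>real. vector [fst p, snd p] :: real^2) \<in> (lborel \<Otimes>\<^sub>M lborel) \<rightarrow>\<^sub>M borel"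
    unfolding lborel_prod by (auto intro!: borel_measurable_continuous_onI continuous_intros)
  have "(\<integral>\<^sup>+x. f x \<partial>lborel) = (\<integral>\<^sup>+x. f x \<partial>(distr (lborel \<Otimes>\<^sub>M lborel) borel (\<lambda>p. vector [fst p, snd p])))"
    by (simp add: lborel_eq_distr_vector2)
  also have "\<dots> = (\<integral>\<^sup>+p. f (vector [fst p, snd p]) \<partial>(lborel \<Otimes>\<^sub>M lborel))"
    by (rule nn_integral_distr) auto
  also have "\<dots> = (\<integral>\<^sup>+a. \<integral>\<^sup>+b. f (vector [a, b]) \<partial>lborel \<partial>lborel)"
    by (subst lborel.nn_integral_fst[symmetric]) auto
  finally show ?thesis .
qed

lemma integral_vector2:
  fixes f :: "real^2 \<Rightarrow> complex"
  assumes f: "integrable lborel f"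
  shows "integrable (lborel \<Otimes>\<^sub>M lborel) (\<lambda>p. f (vector [fst p, snd p]))"
    and "(LINT x|lborel. f x) = (LINT p|(lborel \<Otimes>\<^sub>M lborel). f (vector [fst p, snd p]))"
proof -
  have T: "(\<lambda>p::real\<times>real. vector [fst p, snd p] :: real^2) \<in> (lborel \<Otimes>\<^sub>M lborel) \<rightarrow>\<^sub>M borel"
    unfolding lborel_prod by (auto intro!: borel_measurable_continuous_onI continuous_intros)
  show "integrable (lborel \<Otimes>\<^sub>M lborel) (\<lambda>p. f (vector [fst p, snd p]))"
    using integrable_distr[OF T, of f] f by (simp add: lborel_eq_distr_vector2)
  show "(LINT x|lborel. f x) = (LINT p|(lborel \<Otimes>\<^sub>M lborel). f (vector [fst p, snd p]))"
    using integral_distr[OF T, of f] borel_measurable_integrable[OF f] by (simp add: lborel_eq_distr_vector2)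
qed

lemma completion_ex_borel_measurable_complex:
  fixes g :: "'a \<Rightarrow> complex"
  assumes g: "g \<in> borel_measurable (completion M)"
  shows "\<exists>g'\<in>borel_measurable M. AE x in M. g x = g' x"
proof -
  note g[measurable]
  have "(\<lambda>x. Re (g x)) \<in> borel_measurable (completion M)" "(\<lambda>x. Im (g x)) \<in> borel_measurable (completion M)"
    by measurable
  then obtain r i where ri[measurable]: "r \<in> borel_measurable M" "i \<in> borel_measurable M"
    and ae: "AE x in M. Re (g x) = r x" "AE x in M. Im (g x) = i x"
    using completion_ex_borel_measurable_real[of "\<lambda>x. Re (g x)" M]
      completion_ex_borel_measurable_real[of "\<lambda>x. Im (g x)" M] by blast
  show ?thesis
  proof (rule bexI)
    show "AE x in M. g x = Complex (r x) (i x)"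
      using ae by eventually_elim (simp add: complex_eq_iff)
    show "(\<lambda>x. Complex (r x) (i x)) \<in> borel_measurable M"
      unfolding Complex_eq by measurable
  qed
qed

text \<open>Slices of a Lebesgue measurable function are only almost everywhere Lebesgue measurable, so
  the function is first replaced by a Borel representative.\<close>

lemma lebesgue_integral_join3:
  fixes f :: "real^3 \<Rightarrow> complex"
  assumes f: "integrable lebesgue f"
  shows "(LINT y|lebesgue. LINT t|lebesgue. f (join3 y t)) = (LINT x|lebesgue. f x)"
proof -
  obtain f' where f'[measurable]: "f' \<in> borel_measurable lborel" and ae: "AE x in lborel. f x = f' x"
    using completion_ex_borel_measurable_complex[OF borel_measurable_integrable[OF f]] by blast
  have ae': "AE x in lebesgue. f x = f' x" by (rule AE_completion[OF ae])
  have "integrable lebesgue f'"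
    by (rule integrable_cong_AE_imp[OF f measurable_completion[OF f']]) (use ae' in eventually_elim, simp)
  then have int: "integrable lborel f'" by (simp add: integrable_completion)
  have T: "(\<lambda>p. join3 (fst p) (snd p)) \<in> (lborel \<Otimes>\<^sub>M lborel) \<rightarrow>\<^sub>M borel"
    unfolding lborel_prod by (auto intro!: borel_measurable_continuous_onI continuous_on_join3 continuous_intros)
  have intp: "integrable (lborel \<Otimes>\<^sub>M lborel) (\<lambda>p. f' (join3 (fst p) (snd p)))"
    using integrable_distr[OF T, of f'] int by (simp add: lborel_eq_distr_join3)
  have "AE p in lborel \<Otimes>\<^sub>M lborel. f (join3 (fst p) (snd p)) = f' (join3 (fst p) (snd p))"
  proof -
    have "AE x in distr (lborel \<Otimes>\<^sub>M lborel) borel (\<lambda>p. join3 (fst p) (snd p)). f x = f' x"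
      by (subst lborel_eq_distr_join3) (rule ae)
    then show ?thesis by (rule AE_distrD[OF T])
  qed
  from lborel_pair.AE_pair[OF this]
  have aey: "AE y in lborel. AE t in lborel. f (join3 y t) = f' (join3 y t)" by simp
  have inner: "AE y in lborel. (LINT t|lebesgue. f (join3 y t)) = (LINT t|lborel. f' (join3 y t))"
    using aey
  proof eventually_elim
    fix y assume a: "AE t in lborel. f (join3 y t) = f' (join3 y t)"
    have m: "(\<lambda>t. f' (join3 y t)) \<in> borel_measurable lborel"
      by (rule measurable_compose[OF _ f'])
        (auto intro!: borel_measurable_continuous_onI continuous_on_join3 continuous_intros)
    have m': "(\<lambda>t. f' (join3 y t)) \<in> borel_measurable lebesgue" by (rule measurable_completion[OF m])
    have "(\<lambda>t. f (join3 y t)) \<in> borel_measurable lebesgue"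
      by (rule borel_measurable_AE[OF m' AE_completion]) (use a in eventually_elim, simp)
    then have "(LINT t|lebesgue. f (join3 y t)) = (LINT t|lebesgue. f' (join3 y t))"
      using m' AE_completion[OF a] by (intro integral_cong_AE) auto
    then show "(LINT t|lebesgue. f (join3 y t)) = (LINT t|lborel. f' (join3 y t))"
      by (simp add: integral_completion[OF m])
  qed
  have mi: "(\<lambda>y. LINT t|lborel. f' (join3 y t)) \<in> borel_measurable lborel"
    using lborel_pair.integrable_fst'[OF intp] by (auto dest: borel_measurable_integrable)
  have "(LINT y|lebesgue. LINT t|lebesgue. f (join3 y t)) = (LINT y|lebesgue. LINT t|lborel. f' (join3 y t))"
  proof (rule integral_cong_AE)
    show "(\<lambda>y. LINT t|lborel. f' (join3 y t)) \<in> borel_measurable lebesgue" by (rule measurable_completion[OF mi])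
    then show "(\<lambda>y. LINT t|lebesgue. f (join3 y t)) \<in> borel_measurable lebesgue"
      by (rule borel_measurable_AE[OF _ AE_completion]) (use inner in eventually_elim, simp)
    show "AE y in lebesgue. (LINT t|lebesgue. f (join3 y t)) = (LINT t|lborel. f' (join3 y t))"
      by (rule AE_completion[OF inner])
  qed
  also have "\<dots> = (LINT y|lborel. LINT t|lborel. f' (join3 y t))" by (rule integral_completion[OF mi])
  also have "\<dots> = (LINT p|(lborel \<Otimes>\<^sub>M lborel). f' (join3 (fst p) (snd p)))"
    using lborel_pair.integral_fst'[OF intp] by simp
  also have "\<dots> = (LINT x|lborel. f' x)"
    using integral_distr[OF T, of f'] by (simp add: lborel_eq_distr_join3)
  also have "\<dots> = (LINT x|lebesgue. f' x)" by (simp add: integral_completion)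
  also have "\<dots> = (LINT x|lebesgue. f x)"
    by (rule integral_cong_AE) (use ae' borel_measurable_integrable[OF f] measurable_completion[OF f'] in \<open>auto simp: eq_commute\<close>)
  finally show ?thesis .
qed

section \<open>Rotations about the edge\<close>

definition rot :: "real \<Rightarrow> real^3 \<Rightarrow> real^3" where
  "rot t x = vector [cos t * x $ 1 - sin t * x $ 2, sin t * x $ 1 + cos t * x $ 2, x $ 3]"

lemma rot_nth [simp]:
  "rot t x $ 1 = cos t * x $ 1 - sin t * x $ 2" "rot t x $ 2 = sin t * x $ 1 + cos t * x $ 2" "rot t x $ 3 = x $ 3"
  by (simp_all add: rot_def)

lemma rot_0 [simp]: "rot 0 x = x"
  by (simp add: vec_eq_iff forall_3)

lemma rot_rot: "rot s (rot t x) = rot (s + t) x"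
  by (simp add: vec_eq_iff forall_3 cos_add sin_add algebra_simps)

lemma norm_proj2_rot [simp]: "norm (proj2 (rot t x)) = norm (proj2 x)"
proof -
  have "(cos t * x $ 1 - sin t * x $ 2)\<^sup>2 + (sin t * x $ 1 + cos t * x $ 2)\<^sup>2
      = ((cos t)\<^sup>2 + (sin t)\<^sup>2) * ((x $ 1)\<^sup>2 + (x $ 2)\<^sup>2)"
    by algebra
  then show ?thesis by (simp add: norm_vec2)
qed

lemma orthogonal_transformation_rot: "orthogonal_transformation (rot t)"
  unfolding orthogonal_transformation
proof (intro conjI)
  show "linear (rot t)" by (rule linearI) (simp_all add: vec_eq_iff forall_3 algebra_simps)
  have "norm (rot t x) = norm x" for x
  proof -
    have "(cos t * x $ 1 - sin t * x $ 2)\<^sup>2 + (sin t * x $ 1 + cos t * x $ 2)\<^sup>2 + (x $ 3)\<^sup>2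
        = ((cos t)\<^sup>2 + (sin t)\<^sup>2) * ((x $ 1)\<^sup>2 + (x $ 2)\<^sup>2) + (x $ 3)\<^sup>2"
      by algebra
    then show ?thesis by (simp add: norm_vec3)
  qed
  then show "\<forall>v. norm (rot t v) = norm v" by blast
qed

lemma continuous_on_rot:
  fixes A :: "'a::t2_space set"
  shows "continuous_on A f \<Longrightarrow> continuous_on A g \<Longrightarrow> continuous_on A (\<lambda>x. rot (f x) (g x))"
  unfolding rot_def by (intro continuous_intros)

text \<open>The preimage of a box is its image under the inverse rotation, and orthogonal maps
  preserve Lebesgue measure.\<close>

lemma distr_rot: "distr lborel borel (rot t) = lborel"
proof (rule lborel_eqI[symmetric])
  have m: "rot t \<in> borel \<rightarrow>\<^sub>M borel"
    by (intro borel_measurable_continuous_onI continuous_on_rot continuous_intros)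
  fix l u :: "real^3" assume lu: "\<And>b. b \<in> Basis \<Longrightarrow> l \<bullet> b \<le> u \<bullet> b"
  have img: "rot t -` box l u = rot (- t) ` box l u"
  proof -
    have "x = rot (- t) (rot t x)" "rot t (rot (- t) x) = x" for x by (simp_all add: rot_rot)
    then show ?thesis by (auto simp: image_iff intro!: bexI)
  qed
  have ms: "rot t -` box l u \<in> sets borel" using measurable_sets[OF m, of "box l u"] by simp
  note o = orthogonal_transformation_rot[of "- t"]
  have fm: "rot (- t) ` box l u \<in> lmeasurable" by (rule measurable_orthogonal_image[OF o]) simp
  have "emeasure (distr lborel borel (rot t)) (box l u) = emeasure lborel (rot t -` box l u)"
    using m by (simp add: emeasure_distr)
  also have "\<dots> = emeasure lebesgue (rot t -` box l u)" using ms by simp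
  also have "\<dots> = emeasure lebesgue (rot (- t) ` box l u)" by (simp only: img)
  also have "\<dots> = ennreal (measure lebesgue (box l u))"
    using emeasure_eq_measure2[OF fm] measure_orthogonal_image[OF o, of "box l u"] by simp
  also have "\<dots> = ennreal (\<Prod>b\<in>Basis. (u - l) \<bullet> b)" using lu by (simp add: measure_lborel_box_eq)
  finally show "emeasure (distr lborel borel (rot t)) (box l u) = ennreal (\<Prod>b\<in>Basis. (u - l) \<bullet> b)" .
qed simp

lemma nn_integral_rot:
  fixes f :: "real^3 \<Rightarrow> ennreal"
  assumes "f \<in> borel_measurable borel"
  shows "(\<integral>\<^sup>+x. f (rot t x) \<partial>lborel) = (\<integral>\<^sup>+x. f x \<partial>lborel)"
proof -
  have "(\<integral>\<^sup>+x. f x \<partial>lborel) = (\<integral>\<^sup>+x. f x \<partial>distr lborel borel (rot t))" by (simp add: distr_rot)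
  also have "\<dots> = (\<integral>\<^sup>+x. f (rot t x) \<partial>lborel)"
    using assms by (intro nn_integral_distr)
      (auto intro!: borel_measurable_continuous_onI continuous_on_rot continuous_intros)
  finally show ?thesis ..
qed

text \<open>The kernels of the proof are bounded by \<open>wt y / (1 + norm y)\<close>: the spare factor absorbs an
  at most linear oscillation at the edge and leaves an integrable weight.\<close>

definition wt :: "real^2 \<Rightarrow> real" where
  "wt y = 1 / (1 + norm y) ^ 4"

lemma wt_pos: "wt y > 0"
  unfolding wt_def by (intro divide_pos_pos zero_less_power add_pos_nonneg) auto

lemma one_plus_norm_pos: "1 + norm x > 0"
  by (simp add: add_pos_nonneg)

lemma wt_le_1: "wt y \<le> 1"
  using one_le_power[of "1 + norm y" 4] one_plus_norm_pos[of y] by (simp add: wt_def divide_le_eq_1)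

lemma continuous_on_wt: "continuous_on A f \<Longrightarrow> continuous_on A (\<lambda>x. wt (f x))"
  unfolding wt_def
  by (intro continuous_intros ballI power_not_zero; (assumption | rule less_imp_neq[OF one_plus_norm_pos, symmetric]))

lemma borel_measurable_wt [measurable]: "wt \<in> borel_measurable borel"
  by (intro borel_measurable_continuous_onI continuous_on_wt continuous_intros)

section \<open>The mass of the weight\<close>

lemma nn_integral_inverse_1_plus_square: "(\<integral>\<^sup>+x. ennreal (1 / (1 + x\<^sup>2)) \<partial>lborel) < \<infinity>"
proof -
  let ?f = "\<lambda>x::real. 1 / (1 + x\<^sup>2)"
  have half: "(\<integral>\<^sup>+x. ennreal (?f x) * indicator {0..} x \<partial>lborel) = ennreal (pi / 2 - arctan 0)"
  proof (rule nn_integral_FTC_atLeast)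
    show "(arctan \<longlongrightarrow> pi / 2) at_top" by (rule tendsto_arctan_at_top)
    show "DERIV arctan x :> ?f x" for x by (auto intro!: derivative_eq_intros simp: inverse_eq_divide)
  qed auto
  have "(\<integral>\<^sup>+x. ennreal (?f x) \<partial>lborel)
      \<le> (\<integral>\<^sup>+x. ennreal (?f x) * indicator {0..} x + ennreal (?f x) * indicator {0..} (- x) \<partial>lborel)"
    by (intro nn_integral_mono) (auto simp: indicator_def)
  also have "\<dots> = (\<integral>\<^sup>+x. ennreal (?f x) * indicator {0..} x \<partial>lborel) + (\<integral>\<^sup>+x. ennreal (?f x) * indicator {0..} (- x) \<partial>lborel)"
    by (rule nn_integral_add) auto
  also have "(\<integral>\<^sup>+x. ennreal (?f x) * indicator {0..} (- x) \<partial>lborel) = (\<integral>\<^sup>+x. ennreal (?f x) * indicator {0..} x \<partial>lborel)"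
    using nn_integral_real_affine[of "\<lambda>x. ennreal (?f x) * indicator {0..} x" "-1" 0] by simp
  finally show ?thesis unfolding half
    by (rule le_less_trans) (simp add: ennreal_plus[symmetric] del: ennreal_plus)
qed

text \<open>In coordinates (1 + |y|)^4 dominates (1 + a^2)(1 + b^2), so the weight lies below a
  product of two functions integrable on the line.\<close>

lemma nn_integral_wt: "(\<integral>\<^sup>+y. ennreal (wt y) \<partial>lborel) < \<infinity>"
proof -
  let ?f = "\<lambda>x::real. 1 / (1 + x\<^sup>2)"
  have le: "wt (vector [a, b]) \<le> ?f a * ?f b" for a b :: real
  proof -
    have "(1 + a\<^sup>2) * (1 + b\<^sup>2) \<le> (1 + (a\<^sup>2 + b\<^sup>2))\<^sup>2"
    proof -
      have "(1 + (a\<^sup>2 + b\<^sup>2))\<^sup>2 - (1 + a\<^sup>2) * (1 + b\<^sup>2) = a\<^sup>2 + b\<^sup>2 + a\<^sup>2 * b\<^sup>2 + (a\<^sup>2)\<^sup>2 + (b\<^sup>2)\<^sup>2" by algebra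
      also have "\<dots> \<ge> 0" by (intro add_nonneg_nonneg mult_nonneg_nonneg) auto
      finally show ?thesis by simp
    qed
    also have "(1 + (a\<^sup>2 + b\<^sup>2))\<^sup>2 \<le> ((1 + sqrt (a\<^sup>2 + b\<^sup>2))\<^sup>2)\<^sup>2"
      by (intro power_mono) (auto simp: power2_sum)
    also have "\<dots> = (1 + norm (vector [a, b] :: real^2)) ^ 4" by (simp add: norm_vec2)
    finally have "(1 + a\<^sup>2) * (1 + b\<^sup>2) \<le> (1 + norm (vector [a, b] :: real^2)) ^ 4" .
    then have "1 / (1 + norm (vector [a, b] :: real^2)) ^ 4 \<le> 1 / ((1 + a\<^sup>2) * (1 + b\<^sup>2))"
      by (intro divide_left_mono mult_pos_pos zero_less_power one_plus_norm_pos) (auto simp: add_pos_nonneg)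
    then show ?thesis by (simp add: wt_def)
  qed
  have "(\<integral>\<^sup>+y. ennreal (wt y) \<partial>lborel) = (\<integral>\<^sup>+a. \<integral>\<^sup>+b. ennreal (wt (vector [a, b])) \<partial>lborel \<partial>lborel)"
    by (rule nn_integral_vector2) simp
  also have "\<dots> \<le> (\<integral>\<^sup>+a. \<integral>\<^sup>+b. ennreal (?f a) * ennreal (?f b) \<partial>lborel \<partial>lborel)"
    using le by (intro nn_integral_mono) (simp add: ennreal_mult'[symmetric])
  also have "\<dots> = (\<integral>\<^sup>+a. ennreal (?f a) \<partial>lborel) * (\<integral>\<^sup>+b. ennreal (?f b) \<partial>lborel)"
    by (simp add: nn_integral_cmult nn_integral_multc)
  also have "\<dots> < \<infinity>" using nn_integral_inverse_1_plus_square by (simp add: ennreal_mult_less_top)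
  finally show ?thesis .
qed

lemma nn_integral_scale:
  fixes f :: "real^2 \<Rightarrow> ennreal"
  assumes [measurable]: "f \<in> borel_measurable borel" and e: "e > 0"
  shows "(\<integral>\<^sup>+y. f (y /\<^sub>R e) \<partial>lborel) = ennreal (e\<^sup>2) * (\<integral>\<^sup>+y. f y \<partial>lborel)"
proof -
  have "(\<integral>\<^sup>+y. f (y /\<^sub>R e) \<partial>lborel) = (\<integral>\<^sup>+y. f (y /\<^sub>R e) \<partial>density (distr lborel borel (\<lambda>x. 0 + e *\<^sub>R x)) (\<lambda>_. \<bar>e\<bar>^DIM(real^2)))"
    using e by (subst lborel_affine[of e 0, symmetric]) auto
  also have "\<dots> = ennreal (e\<^sup>2) * (\<integral>\<^sup>+y. f y \<partial>lborel)"
    using e by (simp add: nn_integral_density nn_integral_distr nn_integral_cmult power2_eq_square)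
  finally show ?thesis .
qed

definition wt_mass :: real where "wt_mass = enn2real (\<integral>\<^sup>+y. ennreal (wt y) \<partial>lborel)"

lemma wt_mass_nonneg: "wt_mass \<ge> 0"
  by (simp add: wt_mass_def)

text \<open>The factor \<open>e\<^sup>2\<close> is the Jacobian of the horizontal dilation; all
  averages at scale \<open>e\<close> are normalised by it.\<close>

lemma nn_integral_wt_cyl:
  assumes e: "e > 0" and M: "M > 0"
  shows "(\<integral>\<^sup>+x. ennreal (wt (proj2 x /\<^sub>R e)) * indicator {x. x $ 3 \<in> {-M<..<M}} x \<partial>lborel) = ennreal (2 * M * wt_mass * e\<^sup>2)"
proof -
  have "(\<integral>\<^sup>+x. ennreal (wt (proj2 x /\<^sub>R e)) * indicator {x. x $ 3 \<in> {-M<..<M}} x \<partial>lborel)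
      = (\<integral>\<^sup>+y. \<integral>\<^sup>+t. ennreal (wt (y /\<^sub>R e)) * indicator {-M<..<M} t \<partial>lborel \<partial>lborel)"
    by (subst nn_integral_join3) (auto simp: indicator_def intro!: nn_integral_cong)
  also have "\<dots> = (\<integral>\<^sup>+y. ennreal (wt (y /\<^sub>R e)) * ennreal (2 * M) \<partial>lborel)"
    using M by (simp add: nn_integral_cmult)
  also have "\<dots> = ennreal (e\<^sup>2) * (\<integral>\<^sup>+y. ennreal (wt y) \<partial>lborel) * ennreal (2 * M)"
    using nn_integral_scale[of "\<lambda>y. ennreal (wt y)" e] e by (simp add: nn_integral_multc)
  also have "(\<integral>\<^sup>+y. ennreal (wt y) \<partial>lborel) = ennreal wt_mass"
    using nn_integral_wt by (simp add: wt_mass_def)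
  finally show ?thesis
    using M wt_mass_nonneg by (simp add: ennreal_mult'[symmetric] mult_ac)
qed

section \<open>Testing the transmission problem\<close>

lemma L2_imp_integrable:
  assumes "finite_measure N" "L2 N f"
  shows "integrable N f"
proof -
  interpret finite_measure N by fact
  have "integrable N (\<lambda>x. 1 + (norm (f x))\<^sup>2)"
    using assms(2) by (intro Bochner_Integration.integrable_add integrable_const) (auto simp: L2_def)
  then show ?thesis
  proof (rule Bochner_Integration.integrable_bound)
    show "f \<in> borel_measurable N" using assms(2) by (simp add: L2_def)
    have "t \<le> 1 + t\<^sup>2" for t :: real
      using sum_power2_ge_zero[of "t - 1/2" 0] by (simp add: power2_eq_square algebra_simps)
    then show "AE x in N. norm (f x) \<le> norm (1 + (norm (f x))\<^sup>2)"
      by (intro AE_I2) (metis abs_ge_self order_trans real_norm_def)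
  qed
qed

lemma integrable_mult_bounded:
  fixes f g :: "'a \<Rightarrow> complex"
  assumes f: "integrable N f" and g: "g \<in> borel_measurable N" "AE x in N. norm (g x) \<le> B"
  shows "integrable N (\<lambda>x. f x * g x)"
proof (rule Bochner_Integration.integrable_bound)
  show "integrable N (\<lambda>x. B * norm (f x))" using f by (intro integrable_mult_right integrable_norm)
  show "(\<lambda>x. f x * g x) \<in> borel_measurable N"
    using borel_measurable_integrable[OF f] g(1) by (intro borel_measurable_times)
  show "AE x in N. norm (f x * g x) \<le> norm (B * norm (f x))"
    using g(2)
  proof eventually_elim
    case (elim x)
    have "norm (f x * g x) \<le> norm (f x) * B" unfolding norm_mult using elim by (intro mult_left_mono) auto
    then show ?case using abs_ge_self[of "B * norm (f x)"] by (simp add: mult.commute)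
  qed
qed

lemma integrable_mult_bounded_space:
  fixes f g :: "'a \<Rightarrow> complex"
  assumes "integrable N f" "g \<in> borel_measurable N" "\<And>x. x \<in> space N \<Longrightarrow> norm (g x) \<le> B"
  shows "integrable N (\<lambda>x. f x * g x)"
  using assms by (intro integrable_mult_bounded[of N f g B] AE_I2)

lemma L2_bounded:
  assumes "finite_measure N" "f \<in> borel_measurable N" "\<And>x. x \<in> space N \<Longrightarrow> norm (f x) \<le> B"
  shows "L2 N f"
  unfolding L2_def
proof
  show "f \<in> borel_measurable N" by fact
  interpret finite_measure N by fact
  show "integrable N (\<lambda>x. (norm (f x))\<^sup>2)"
  proof (rule integrable_const_bound[of _ "B\<^sup>2"])
    show "AE x in N. norm ((norm (f x))\<^sup>2) \<le> B\<^sup>2"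
      using assms(3) by (intro AE_I2) (simp add: power_mono)
  qed (use assms(2) in measurable)
qed

lemma L2_diff:
  assumes "L2 N f" "L2 N g"
  shows "L2 N (\<lambda>x. f x - g x)"
  unfolding L2_def
proof
  show m: "(\<lambda>x. f x - g x) \<in> borel_measurable N"
    using assms by (intro borel_measurable_diff) (auto simp: L2_def)
  have "integrable N (\<lambda>x. 2 * (norm (f x))\<^sup>2 + 2 * (norm (g x))\<^sup>2)"
    using assms by (intro Bochner_Integration.integrable_add integrable_mult_right) (auto simp: L2_def)
  then show "integrable N (\<lambda>x. (norm (f x - g x))\<^sup>2)"
  proof (rule Bochner_Integration.integrable_bound)
    show "(\<lambda>x. (norm (f x - g x))\<^sup>2) \<in> borel_measurable N" using m by measurable
    have "(norm (f x - g x))\<^sup>2 \<le> 2 * (norm (f x))\<^sup>2 + 2 * (norm (g x))\<^sup>2" for x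
    proof -
      have "(norm (f x - g x))\<^sup>2 \<le> (norm (f x) + norm (g x))\<^sup>2"
        by (intro power_mono norm_triangle_ineq4) auto
      also have "\<dots> \<le> 2 * (norm (f x))\<^sup>2 + 2 * (norm (g x))\<^sup>2"
        using sum_power2_ge_zero[of "norm (f x) - norm (g x)" 0] by (simp add: power2_eq_square algebra_simps)
      finally show ?thesis .
    qed
    then show "AE x in N. norm ((norm (f x - g x))\<^sup>2) \<le> norm (2 * (norm (f x))\<^sup>2 + 2 * (norm (g x))\<^sup>2)"
      by (intro AE_I2) simp
  qed
qed

text \<open>A substitute for the Cauchy-Schwarz inequality: under an integral, with t close to the
  quotient of the L2 norms of b and a, it yields the product of these norms.\<close>

lemma young_inequality: "a * b \<le> (t * a\<^sup>2 + b\<^sup>2 / t) / 2" if "t > 0" for a b t :: real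
proof -
  have "0 \<le> (t * a - b)\<^sup>2 / t" using that by simp
  also have "\<dots> = t * a\<^sup>2 + b\<^sup>2 / t - 2 * (a * b)" using that by (simp add: power2_eq_square field_simps)
  finally show ?thesis by simp
qed

lemma L1_tendsto_0_if_L2:
  assumes "finite_measure N" and L2: "\<And>n. L2 N (d n)"
    and lim: "(\<lambda>n. L2_norm N (d n)) \<longlonglongrightarrow> 0"
  shows "(\<lambda>n. LINT x|N. norm (d n x)) \<longlonglongrightarrow> 0"
proof -
  interpret finite_measure N by fact
  \<comment> \<open>The ideal Young parameter is the norm itself; the added 1/(n + 1) keeps it
    positive and does not disturb the limit.\<close>
  define t where "t n = L2_norm N (d n) + 1 / real (Suc n)" for n
  have nn: "L2_norm N (d n) \<ge> 0" for n
    unfolding L2_norm_def by (intro real_sqrt_ge_zero integral_nonneg_AE) auto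
  then have t: "t n > 0" for n unfolding t_def by (intro add_nonneg_pos) auto
  have bound: "(LINT x|N. norm (d n x)) \<le> (t n * measure N (space N) + L2_norm N (d n)) / 2" for n
  proof -
    have i: "integrable N (\<lambda>x. (norm (d n x))\<^sup>2)" using L2[of n] by (simp add: L2_def)
    have "(LINT x|N. norm (d n x)) \<le> (LINT x|N. (t n + (norm (d n x))\<^sup>2 / t n) / 2)"
      using young_inequality[where a=1, OF t[of n]] L2_imp_integrable[OF assms(1) L2] i
      by (intro integral_mono) auto
    also have "\<dots> = (t n * measure N (space N) + (L2_norm N (d n))\<^sup>2 / t n) / 2"
      using i by (simp add: L2_norm_def integral_nonneg_AE mult.commute)
    also have "(L2_norm N (d n))\<^sup>2 / t n \<le> L2_norm N (d n)"
    proof -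
      have "(L2_norm N (d n))\<^sup>2 \<le> L2_norm N (d n) * t n"
        unfolding power2_eq_square using nn[of n] by (intro mult_left_mono) (auto simp: t_def)
      with t[of n] show ?thesis by (simp add: pos_divide_le_eq)
    qed
    finally show ?thesis by simp
  qed
  have t0: "t \<longlonglongrightarrow> 0"
    using tendsto_add[OF lim LIMSEQ_inverse_real_of_nat] by (simp add: t_def[abs_def] inverse_eq_divide)
  show ?thesis
  proof (rule tendsto_sandwich[OF _ _ tendsto_const])
    show "(\<lambda>n. (t n * measure N (space N) + L2_norm N (d n)) / 2) \<longlonglongrightarrow> 0"
      using tendsto_divide[OF tendsto_add[OF tendsto_mult_left_zero[OF t0] lim] tendsto_const[of 2]] by simp
    show "\<forall>\<^sub>F n in sequentially. (LINT x|N. norm (d n x)) \<le> (t n * measure N (space N) + L2_norm N (d n)) / 2"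
      using bound by simp
  qed (simp add: integral_nonneg_AE)
qed

lemma tendsto_integral_if_L1:
  fixes f :: "'a \<Rightarrow> complex"
  assumes f: "integrable N f" and fn: "\<And>n. integrable N (g n)"
    and lim: "(\<lambda>n. LINT x|N. norm (f x - g n x)) \<longlonglongrightarrow> 0"
    and \<phi>: "\<phi> \<in> borel_measurable N" "\<And>x. x \<in> space N \<Longrightarrow> norm (\<phi> x) \<le> B"
  shows "(\<lambda>n. LINT x|N. g n x * \<phi> x) \<longlonglongrightarrow> (LINT x|N. f x * \<phi> x)"
proof -
  have i: "integrable N (\<lambda>x. f x * \<phi> x)" "integrable N (\<lambda>x. g n x * \<phi> x)" for n
    using \<phi> by (auto intro!: integrable_mult_bounded_space f fn)
  have "norm ((LINT x|N. g n x * \<phi> x) - (LINT x|N. f x * \<phi> x)) \<le> B * (LINT x|N. norm (f x - g n x))" for n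
  proof -
    have "(LINT x|N. g n x * \<phi> x) - (LINT x|N. f x * \<phi> x) = (LINT x|N. (g n x - f x) * \<phi> x)"
      using i by (simp add: left_diff_distrib)
    also have "norm \<dots> \<le> (LINT x|N. norm ((g n x - f x) * \<phi> x))" by (rule integral_norm_bound)
    also have "\<dots> \<le> (LINT x|N. B * norm (f x - g n x))"
    proof (rule integral_mono)
      show "integrable N (\<lambda>x. norm ((g n x - f x) * \<phi> x))"
        using i by (intro integrable_norm) (simp add: left_diff_distrib)
      show "integrable N (\<lambda>x. B * norm (f x - g n x))" using f fn by (intro integrable_mult_right integrable_norm) auto
      show "norm ((g n x - f x) * \<phi> x) \<le> B * norm (f x - g n x)" if "x \<in> space N" for x
        using mult_left_mono[OF \<phi>(2)[OF that] norm_ge_zero[of "f x - g n x"]]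
        by (simp add: norm_mult norm_minus_commute mult.commute)
    qed
    finally show ?thesis by simp
  qed
  then have "(\<lambda>n. (LINT x|N. g n x * \<phi> x) - (LINT x|N. f x * \<phi> x)) \<longlonglongrightarrow> 0"
    by (intro Lim_null_comparison[OF _ tendsto_mult_right_zero[OF lim, of B]]) simp
  then show ?thesis by (rule LIM_zero_cancel)
qed

section \<open>Functions of zero trace on bounded open sets\<close>

lemma set_integral_lebesgue_on:
  fixes f :: "'a::euclidean_space \<Rightarrow> 'b::{banach, second_countable_topology}"
  assumes "U \<in> sets lebesgue"
  shows "(LINT x:U|lebesgue. f x) = (LINT x|lebesgue_on U. f x)"
    and "set_integrable lebesgue U f \<longleftrightarrow> integrable (lebesgue_on U) f"
  using assms by (simp_all add: set_lebesgue_integral_def set_integrable_def integral_restrict_space integrable_restrict_space)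

lemma borel_measurable_lebesgue_on_AE:
  fixes f g :: "'a::euclidean_space \<Rightarrow> complex"
  assumes U: "U \<in> sets lebesgue" and f: "f \<in> borel_measurable (lebesgue_on U)"
    and ae: "AE x in lebesgue. x \<in> U \<longrightarrow> f x = g x"
  shows "g \<in> borel_measurable (lebesgue_on U)"
proof -
  have "(\<lambda>x. indicator U x *\<^sub>R f x) \<in> borel_measurable lebesgue"
    using f U by (subst (asm) borel_measurable_restrict_space_iff) auto
  then have "(\<lambda>x. indicator U x *\<^sub>R g x) \<in> borel_measurable lebesgue"
    by (rule borel_measurable_AE) (use ae in eventually_elim, auto simp: indicator_def)
  then show ?thesis using U by (subst borel_measurable_restrict_space_iff) auto
qed

lemma AE_lebesgue_on_iff:
  "U \<in> sets lebesgue \<Longrightarrow> (AE x in lebesgue_on U. P x) \<longleftrightarrow> (AE x in lebesgue. x \<in> U \<longrightarrow> P x)"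
  by (simp add: AE_restrict_space_iff)

lemma sets_lebesgue_open: "open U \<Longrightarrow> U \<in> sets lebesgue"
  by (simp add: borel_open)

lemma finite_measure_lebesgue_on_open: "open U \<Longrightarrow> bounded U \<Longrightarrow> finite_measure (lebesgue_on U)"
  by (intro finite_measure_lebesgue_on lmeasurable_open)

lemma continuous_imp_measurable_lebesgue_on_open:
  "open U \<Longrightarrow> continuous_on U f \<Longrightarrow> f \<in> borel_measurable (lebesgue_on U)"
  for f :: "'a::euclidean_space \<Rightarrow> complex"
  by (intro continuous_imp_measurable_on_sets_lebesgue sets_lebesgue_open)

lemma sobolev_1_weak_derivatives:
  assumes "H1 U f"
  obtains G where "L2 (lebesgue_on U) f" "\<And>b. b \<in> Basis \<Longrightarrow> has_weak_pd U b f (G b)" "\<And>b. b \<in> Basis \<Longrightarrow> L2 (lebesgue_on U) (G b)"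
proof -
  have "\<forall>b\<in>Basis. \<exists>g. has_weak_pd U b f g \<and> L2 (lebesgue_on U) g" "L2 (lebesgue_on U) f"
    using assms by simp_all
  then show ?thesis using that by (metis bchoice)
qed

lemma test_function_complex_facts:
  fixes \<zeta> :: "'a::euclidean_space \<Rightarrow> complex"
  assumes t: "test_function U \<zeta>"
  shows "compact (closure {x. \<zeta> x \<noteq> 0})" "closure {x. \<zeta> x \<noteq> 0} \<subseteq> U"
    "x \<notin> closure {x. \<zeta> x \<noteq> 0} \<Longrightarrow> \<zeta> x = 0" "x \<notin> closure {x. \<zeta> x \<noteq> 0} \<Longrightarrow> pd b \<zeta> x = 0"
    "continuous_on UNIV \<zeta>" "b \<in> Basis \<Longrightarrow> continuous_on UNIV (pd b \<zeta>)" "has_dir_deriv \<zeta> b (pd b \<zeta> x) x"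
proof -
  let ?K = "closure {x. \<zeta> x \<noteq> 0}"
  have s: "smooth \<zeta>" using t by (simp add: test_function_def)
  show K: "compact ?K" "?K \<subseteq> U" using t by (auto simp: test_function_def)
  show z: "\<zeta> x = 0" if "x \<notin> ?K" for x by (rule test_function_eq_0[OF t that])
  show "pd b \<zeta> x = 0" if "x \<notin> ?K" for x b
    by (rule has_dir_deriv_0_outside[OF K(1) z that smooth_has_dir_deriv[OF s]])
  show "continuous_on UNIV \<zeta>" by (rule smooth_imp_has_derivative(2)[OF s])
  show "b \<in> Basis \<Longrightarrow> continuous_on UNIV (pd b \<zeta>)" by (rule smooth_imp_continuous_pd[OF s])
  show "has_dir_deriv \<zeta> b (pd b \<zeta> x) x" by (rule smooth_has_dir_deriv[OF s])
qed

lemma L2_test_function: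
  fixes \<zeta> :: "'a::euclidean_space \<Rightarrow> complex"
  assumes U: "open U" "bounded U" and t: "test_function U \<zeta>"
  shows "L2 (lebesgue_on U) \<zeta>" "b \<in> Basis \<Longrightarrow> L2 (lebesgue_on U) (pd b \<zeta>)"
proof -
  note fin = finite_measure_lebesgue_on_open[OF U]
  note K = test_function_complex_facts[OF t]
  let ?K = "closure {x. \<zeta> x \<noteq> 0}"
  have *: "L2 (lebesgue_on U) f" if f: "continuous_on UNIV f" "\<And>x. x \<notin> ?K \<Longrightarrow> f x = 0" for f :: "'a \<Rightarrow> complex"
  proof -
    obtain B where B: "\<And>x. norm (f x) \<le> B"
      using continuous_on_compact_support_bounded[OF f(1) K(1) f(2)] by blast
    show ?thesis
      by (rule L2_bounded[OF fin _ B])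
        (rule continuous_imp_measurable_lebesgue_on_open[OF U(1) continuous_on_subset[OF f(1)]], simp)
  qed
  show "L2 (lebesgue_on U) \<zeta>" by (rule *[OF K(5,3)])
  show "L2 (lebesgue_on U) (pd b \<zeta>)" if "b \<in> Basis" by (rule *[OF K(6)[OF that] K(4)])
qed

text \<open>The norm in \<open>H1_0\<close> refers to chosen weak derivatives of the difference;
  uniqueness replaces them by \<open>G b\<close> minus the classical derivative of the approximant.
  As U is bounded, L2 convergence gives L1 convergence, which is what integration against bounded
  functions asks for.\<close>

lemma H1_0_approximation:
  fixes u :: "'a::euclidean_space \<Rightarrow> complex"
  assumes U: "open U" "bounded U" and u: "H1_0 U u"
    and G: "\<And>b. b \<in> Basis \<Longrightarrow> has_weak_pd U b u (G b)" "\<And>b. b \<in> Basis \<Longrightarrow> L2 (lebesgue_on U) (G b)"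
  obtains \<zeta> where "\<And>n. test_function U (\<zeta> n)"
    "(\<lambda>n. LINT x|lebesgue_on U. norm (u x - \<zeta> n x)) \<longlonglongrightarrow> 0"
    "\<And>b. b \<in> Basis \<Longrightarrow> (\<lambda>n. LINT x|lebesgue_on U. norm (G b x - pd b (\<zeta> n) x)) \<longlonglongrightarrow> 0"
proof -
  note fin = finite_measure_lebesgue_on_open[OF U] and Us = sets_lebesgue_open[OF U(1)]
  from u obtain \<zeta> where \<zeta>: "\<And>n. test_function U (\<zeta> n)"
    and lim: "(\<lambda>n. H1_norm U (\<lambda>x. u x - \<zeta> n x)) \<longlonglongrightarrow> 0"
    by (auto simp: H1_0_def)
  have u2: "L2 (lebesgue_on U) u" using u by (simp add: H1_0_def)
  have sq: "0 \<le> (L2_norm N f)\<^sup>2" for N and f :: "'a \<Rightarrow> complex" by simp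
  have wk: "AE x in lebesgue. x \<in> U \<longrightarrow> G b x - pd b (\<zeta> n) x = weak_pd U b (\<lambda>x. u x - \<zeta> n x) x" if b: "b \<in> Basis" for b n
  proof -
    note K = test_function_complex_facts[OF \<zeta>[of n]]
    have "has_weak_pd U b (\<zeta> n) (pd b (\<zeta> n))"
      by (rule has_weak_pd_classical[OF U(1) b K(7) continuous_on_subset[OF K(5)] continuous_on_subset[OF K(6)[OF b]]]) auto
    from weak_pd_AE_eq[OF U(1) has_weak_pd_diff[OF G(1)[OF b] this b]]
    show ?thesis by (simp add: eq_commute)
  qed
  have d2: "L2 (lebesgue_on U) (\<lambda>x. G b x - pd b (\<zeta> n) x)" if "b \<in> Basis" for b n
    by (intro L2_diff G L2_test_function[OF U \<zeta>] that)
  have e: "L2_norm (lebesgue_on U) (weak_pd U b (\<lambda>x. u x - \<zeta> n x)) = L2_norm (lebesgue_on U) (\<lambda>x. G b x - pd b (\<zeta> n) x)"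
    if b: "b \<in> Basis" for b n
  proof -
    have m: "(\<lambda>x. G b x - pd b (\<zeta> n) x) \<in> borel_measurable (lebesgue_on U)" using d2[OF b] by (simp add: L2_def)
    note m' = borel_measurable_lebesgue_on_AE[OF Us m wk[OF b]]
    show ?thesis
      unfolding L2_norm_def
    proof (intro arg_cong[where f=sqrt] integral_cong_AE)
      show "AE x in lebesgue_on U. (norm (weak_pd U b (\<lambda>x. u x - \<zeta> n x) x))\<^sup>2 = (norm (G b x - pd b (\<zeta> n) x))\<^sup>2"
        unfolding AE_lebesgue_on_iff[OF Us] using wk[OF b, of n] by eventually_elim simp
    qed (use m m' in measurable)
  qed
  have le1: "L2_norm (lebesgue_on U) (\<lambda>x. u x - \<zeta> n x) \<le> H1_norm U (\<lambda>x. u x - \<zeta> n x)" for n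
    unfolding H1_norm_def by (intro real_le_rsqrt) (auto intro!: sum_nonneg)
  have le2: "L2_norm (lebesgue_on U) (\<lambda>x. G b x - pd b (\<zeta> n) x) \<le> H1_norm U (\<lambda>x. u x - \<zeta> n x)" if b: "b \<in> Basis" for b n
    unfolding H1_norm_def e[OF b, symmetric]
    using member_le_sum[OF b, of "\<lambda>b. (L2_norm (lebesgue_on U) (weak_pd U b (\<lambda>x. u x - \<zeta> n x)))\<^sup>2"]
    by (intro real_le_rsqrt) (auto intro: add_increasing)
  have nn: "L2_norm N f \<ge> 0" for N and f :: "'a \<Rightarrow> complex"
    unfolding L2_norm_def by (intro real_sqrt_ge_zero integral_nonneg_AE) auto
  show ?thesis
  proof (rule that[OF \<zeta>])
    show "(\<lambda>n. LINT x|lebesgue_on U. norm (u x - \<zeta> n x)) \<longlonglongrightarrow> 0"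
    proof (rule L1_tendsto_0_if_L2[OF fin])
      show "L2 (lebesgue_on U) (\<lambda>x. u x - \<zeta> n x)" for n by (intro L2_diff u2 L2_test_function[OF U \<zeta>])
      show "(\<lambda>n. L2_norm (lebesgue_on U) (\<lambda>x. u x - \<zeta> n x)) \<longlonglongrightarrow> 0"
        by (rule tendsto_sandwich[OF _ _ tendsto_const lim]) (simp_all add: nn le1)
    qed
    show "(\<lambda>n. LINT x|lebesgue_on U. norm (G b x - pd b (\<zeta> n) x)) \<longlonglongrightarrow> 0" if b: "b \<in> Basis" for b
    proof (rule L1_tendsto_0_if_L2[OF fin d2[OF b]])
      show "(\<lambda>n. L2_norm (lebesgue_on U) (\<lambda>x. G b x - pd b (\<zeta> n) x)) \<longlonglongrightarrow> 0"
        by (rule tendsto_sandwich[OF _ _ tendsto_const lim]) (simp_all add: nn le2[OF b])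
    qed
  qed
qed

text \<open>The zero trace sits entirely in u, so \<phi> carries no boundary condition: the formula
  holds for each approximating test function, and bounded \<phi> and \<phi>' let the L1 limits
  pass.\<close>

lemma H1_0_integration_by_parts:
  fixes u :: "'a::euclidean_space \<Rightarrow> complex"
  assumes U: "open U" "bounded U" and u: "H1_0 U u"
    and G: "\<And>b. b \<in> Basis \<Longrightarrow> has_weak_pd U b u (G b)" "\<And>b. b \<in> Basis \<Longrightarrow> L2 (lebesgue_on U) (G b)"
    and b: "b \<in> Basis"
    and \<phi>: "\<And>x. x \<in> U \<Longrightarrow> has_dir_deriv \<phi> b (\<phi>' x) x" "continuous_on U \<phi>" "continuous_on U \<phi>'"
    and B: "\<And>x. x \<in> U \<Longrightarrow> norm (\<phi> x) \<le> B" "\<And>x. x \<in> U \<Longrightarrow> norm (\<phi>' x) \<le> B'"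
  shows "(LINT x|lebesgue_on U. G b x * \<phi> x) = - (LINT x|lebesgue_on U. u x * \<phi>' x)"
proof -
  note fin = finite_measure_lebesgue_on_open[OF U] and Us = sets_lebesgue_open[OF U(1)]
  obtain \<zeta> where \<zeta>: "\<And>n. test_function U (\<zeta> n)"
    "(\<lambda>n. LINT x|lebesgue_on U. norm (u x - \<zeta> n x)) \<longlonglongrightarrow> 0"
    "(\<lambda>n. LINT x|lebesgue_on U. norm (G b x - pd b (\<zeta> n) x)) \<longlonglongrightarrow> 0"
    by (rule H1_0_approximation[OF U u G]) (use b in blast)+
  have u2: "L2 (lebesgue_on U) u" using u by (simp add: H1_0_def)
  have l1: "(\<lambda>n. LINT x|lebesgue_on U. pd b (\<zeta> n) x * \<phi> x) \<longlonglongrightarrow> (LINT x|lebesgue_on U. G b x * \<phi> x)"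
    by (rule tendsto_integral_if_L1[OF L2_imp_integrable[OF fin G(2)[OF b]]
          L2_imp_integrable[OF fin L2_test_function(2)[OF U \<zeta>(1) b]] \<zeta>(3)
          continuous_imp_measurable_lebesgue_on_open[OF U(1) \<phi>(2)] B(1)]) simp
  have l2: "(\<lambda>n. LINT x|lebesgue_on U. \<zeta> n x * \<phi>' x) \<longlonglongrightarrow> (LINT x|lebesgue_on U. u x * \<phi>' x)"
    by (rule tendsto_integral_if_L1[OF L2_imp_integrable[OF fin u2]
          L2_imp_integrable[OF fin L2_test_function(1)[OF U \<zeta>(1)]] \<zeta>(2)
          continuous_imp_measurable_lebesgue_on_open[OF U(1) \<phi>(3)] B(2)]) simp
  have "(LINT x|lebesgue_on U. pd b (\<zeta> n) x * \<phi> x) = - (LINT x|lebesgue_on U. \<zeta> n x * \<phi>' x)" for n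
  proof -
    note K = test_function_complex_facts[OF \<zeta>(1)[of n]]
    have "(LINT x:U|lebesgue. pd b (\<zeta> n) x * \<phi> x) = - (LINT x:U|lebesgue. \<zeta> n x * \<phi>' x)"
      by (rule integration_by_parts_compact_support(3)[OF U(1) K(1,2,3,7,5) K(6)[OF b] \<phi>])
    then show ?thesis
      by (simp only: set_integral_lebesgue_on[OF Us])
  qed
  with l1 have "(\<lambda>n. - (LINT x|lebesgue_on U. \<zeta> n x * \<phi>' x)) \<longlonglongrightarrow> (LINT x|lebesgue_on U. G b x * \<phi> x)" by simp
  from LIMSEQ_unique[OF this tendsto_minus[OF l2]] show ?thesis .
qed

text \<open>The choices hidden in \<open>weak_pd\<close> and \<open>weak_laplacian\<close> are
  replaced by given representatives. Boundedness of \<phi> and of its derivatives makes each term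
  integrable on its own, so the pairing splits.\<close>

lemma normal_derivative_pairing_eq:
  fixes u \<phi> :: "'a::euclidean_space \<Rightarrow> complex"
  assumes U: "open U" "bounded U"
    and G: "\<And>b. b \<in> Basis \<Longrightarrow> has_weak_pd U b u (G b)" "\<And>b. b \<in> Basis \<Longrightarrow> L2 (lebesgue_on U) (G b)"
    and lap: "has_weak_laplacian U u f" "integrable (lebesgue_on U) f"
    and \<phi>: "\<And>b x. b \<in> Basis \<Longrightarrow> x \<in> U \<Longrightarrow> has_dir_deriv \<phi> b (\<phi>' b x) x" "continuous_on U \<phi>"
      "\<And>b. b \<in> Basis \<Longrightarrow> continuous_on U (\<phi>' b)"
    and B: "\<And>x. x \<in> U \<Longrightarrow> norm (\<phi> x) \<le> B" "\<And>b x. b \<in> Basis \<Longrightarrow> x \<in> U \<Longrightarrow> norm (\<phi>' b x) \<le> B"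
  shows "normal_derivative_pairing U u \<phi> =
    (\<Sum>b\<in>Basis. LINT x|lebesgue_on U. G b x * \<phi>' b x) + (LINT x|lebesgue_on U. f x * \<phi> x)"
proof -
  let ?N = "lebesgue_on U"
  note fin = finite_measure_lebesgue_on_open[OF U] and Us = sets_lebesgue_open[OF U(1)]
  note meas = continuous_imp_measurable_lebesgue_on_open[OF U(1)]
  have i1: "integrable ?N (\<lambda>x. G b x * \<phi>' b x)" if b: "b \<in> Basis" for b
    by (rule integrable_mult_bounded_space[OF L2_imp_integrable[OF fin G(2)[OF b]] meas[OF \<phi>(3)[OF b]], of B])
      (simp add: B b)
  have i2: "integrable ?N (\<lambda>x. f x * \<phi> x)"
    by (rule integrable_mult_bounded_space[OF lap(2) meas[OF \<phi>(2)], of B]) (simp add: B)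
  have ae: "AE x in lebesgue. x \<in> U \<longrightarrow> (\<Sum>b\<in>Basis. G b x * \<phi>' b x) + f x * \<phi> x
      = (\<Sum>b\<in>Basis. weak_pd U b u x * weak_pd U b \<phi> x) + weak_laplacian U u x * \<phi> x"
  proof -
    have "AE x in lebesgue. \<forall>b\<in>Basis. x \<in> U \<longrightarrow> weak_pd U b u x = G b x \<and> weak_pd U b \<phi> x = \<phi>' b x"
    proof (rule AE_finite_allI[OF finite_Basis])
      fix b :: 'a assume b: "b \<in> Basis"
      have wk: "has_weak_pd U b \<phi> (\<phi>' b)"
        by (rule has_weak_pd_classical[OF U(1) b \<phi>(1)[OF b] \<phi>(2) \<phi>(3)[OF b]])
      show "AE x in lebesgue. x \<in> U \<longrightarrow> weak_pd U b u x = G b x \<and> weak_pd U b \<phi> x = \<phi>' b x"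
        using weak_pd_AE_eq[OF U(1) G(1)[OF b]] weak_pd_AE_eq[OF U(1) wk]
        by eventually_elim auto
    qed
    with weak_laplacian_AE_eq[OF U(1) lap(1)] show ?thesis
      by eventually_elim auto
  qed
  have m: "(\<lambda>x. (\<Sum>b\<in>Basis. G b x * \<phi>' b x) + f x * \<phi> x) \<in> borel_measurable ?N"
    using i1 i2 by (intro borel_measurable_add borel_measurable_sum) (auto dest: borel_measurable_integrable)
  have "normal_derivative_pairing U u \<phi> = (LINT x|?N. (\<Sum>b\<in>Basis. weak_pd U b u x * weak_pd U b \<phi> x) + weak_laplacian U u x * \<phi> x)"
    unfolding normal_derivative_pairing_def by (rule set_integral_lebesgue_on[OF Us])
  also have "\<dots> = (LINT x|?N. (\<Sum>b\<in>Basis. G b x * \<phi>' b x) + f x * \<phi> x)"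
  proof (rule integral_cong_AE[OF borel_measurable_lebesgue_on_AE[OF Us m ae] m])
    show "AE x in ?N. (\<Sum>b\<in>Basis. weak_pd U b u x * weak_pd U b \<phi> x) + weak_laplacian U u x * \<phi> x
        = (\<Sum>b\<in>Basis. G b x * \<phi>' b x) + f x * \<phi> x"
      unfolding AE_lebesgue_on_iff[OF Us] using ae by eventually_elim simp
  qed
  also have "\<dots> = (\<Sum>b\<in>Basis. LINT x|?N. G b x * \<phi>' b x) + (LINT x|?N. f x * \<phi> x)"
    using i1 i2 by (simp add: Bochner_Integration.integral_add Bochner_Integration.integral_sum)
  finally show ?thesis .
qed

lemma Linf_times_L2_integrable:
  assumes "finite_measure (lebesgue_on U)" "Linf U V" "L2 (lebesgue_on U) w"
  shows "integrable (lebesgue_on U) (\<lambda>x. V x * w x)"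
proof -
  obtain C where "AE x in lebesgue_on U. norm (V x) \<le> C" using assms(2) by (auto simp: Linf_def)
  then have "integrable (lebesgue_on U) (\<lambda>x. w x * V x)"
    using assms by (intro integrable_mult_bounded[where B=C] L2_imp_integrable) (auto simp: Linf_def)
  then show ?thesis by (simp add: mult.commute)
qed

text \<open>Green's second identity for v - w with zero Cauchy data. Equality of the normal
  derivatives compares the two gradient pairings, and the trace condition moves the remaining
  derivative from w - v onto \<phi>' without a boundary term.\<close>

lemma transmission_identity:
  assumes U: "open \<Omega>" "bounded \<Omega>" and V: "Linf \<Omega> V" and te: "transmission_eigenfunctions \<Omega> V k v w"
    and \<phi>: "\<And>b x. b \<in> Basis \<Longrightarrow> x \<in> \<Omega> \<Longrightarrow> has_dir_deriv \<phi> b (\<phi>' b x) x" "continuous_on \<Omega> \<phi>"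
      "\<And>b. b \<in> Basis \<Longrightarrow> continuous_on \<Omega> (\<phi>' b)"
      "\<And>b x. b \<in> Basis \<Longrightarrow> x \<in> \<Omega> \<Longrightarrow> has_dir_deriv (\<phi>' b) b (\<phi>'' b x) x"
      "\<And>b. b \<in> Basis \<Longrightarrow> continuous_on \<Omega> (\<phi>'' b)"
    and B: "\<And>x. x \<in> \<Omega> \<Longrightarrow> norm (\<phi> x) \<le> B" "\<And>b x. b \<in> Basis \<Longrightarrow> x \<in> \<Omega> \<Longrightarrow> norm (\<phi>' b x) \<le> B"
      "\<And>b x. b \<in> Basis \<Longrightarrow> x \<in> \<Omega> \<Longrightarrow> norm (\<phi>'' b x) \<le> B"
  shows "(LINT x|lebesgue_on \<Omega>. (v x - w x) * (\<Sum>b\<in>Basis. \<phi>'' b x))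
    = (of_real k)\<^sup>2 * (LINT x|lebesgue_on \<Omega>. ((1 + V x) * w x - v x) * \<phi> x)"
proof -
  let ?N = "lebesgue_on \<Omega>"
  note fin = finite_measure_lebesgue_on_open[OF U] and Us = sets_lebesgue_open[OF U(1)]
  note meas = continuous_imp_measurable_lebesgue_on_open[OF U(1)]
  have H: "H1 \<Omega> v" "H1 \<Omega> w"
    "has_weak_laplacian \<Omega> w (\<lambda>x. - ((of_real k)\<^sup>2 * (1 + V x) * w x))"
    "has_weak_laplacian \<Omega> v (\<lambda>x. - ((of_real k)\<^sup>2 * v x))"
    and tr: "H1_0 \<Omega> (\<lambda>x. w x - v x)" and nd: "same_normal_derivative \<Omega> v w"
    using te by (auto simp: transmission_eigenfunctions_def same_trace_def)
  obtain Gv where Gv: "L2 ?N v" "\<And>b. b \<in> Basis \<Longrightarrow> has_weak_pd \<Omega> b v (Gv b)" "\<And>b. b \<in> Basis \<Longrightarrow> L2 ?N (Gv b)"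
    using sobolev_1_weak_derivatives[OF H(1)] by blast
  obtain Gw where Gw: "L2 ?N w" "\<And>b. b \<in> Basis \<Longrightarrow> has_weak_pd \<Omega> b w (Gw b)" "\<And>b. b \<in> Basis \<Longrightarrow> L2 ?N (Gw b)"
    using sobolev_1_weak_derivatives[OF H(2)] by blast
  have iv: "integrable ?N v" and iw: "integrable ?N w" using Gv(1) Gw(1) by (simp_all add: L2_imp_integrable[OF fin])
  have iVw: "integrable ?N (\<lambda>x. V x * w x)" by (rule Linf_times_L2_integrable[OF fin V Gw(1)])
  have iqw: "integrable ?N (\<lambda>x. (1 + V x) * w x)" using iw iVw by (simp add: ring_distribs)
  have ilw: "integrable ?N (\<lambda>x. - ((of_real k)\<^sup>2 * (1 + V x) * w x))"
    using integrable_mult_right[OF iqw, of "- (of_real k)\<^sup>2"] by (simp add: mult.assoc)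
  have ilv: "integrable ?N (\<lambda>x. - ((of_real k)\<^sup>2 * v x))"
    using integrable_mult_right[OF iv, of "- (of_real k)\<^sup>2"] by simp
  have phi2: "L2 ?N \<phi>" by (rule L2_bounded[OF fin meas[OF \<phi>(2)], of B]) (simp add: B)
  \<comment> \<open>The condition on the normal derivatives quantifies over H1, so \<phi> has to be
    placed there first.\<close>
  have "H1 \<Omega> \<phi>"
  proof -
    have "has_weak_pd \<Omega> b \<phi> (\<phi>' b) \<and> L2 ?N (\<phi>' b)" if b: "b \<in> Basis" for b
    proof
      show "has_weak_pd \<Omega> b \<phi> (\<phi>' b)"
        by (rule has_weak_pd_classical[OF U(1) b \<phi>(1)[OF b] \<phi>(2) \<phi>(3)[OF b]])
      show "L2 ?N (\<phi>' b)"
        by (rule L2_bounded[OF fin meas[OF \<phi>(3)[OF b]], of B]) (simp add: B(2)[OF b])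
    qed
    with phi2 show ?thesis by auto
  qed
  then have eq: "normal_derivative_pairing \<Omega> v \<phi> = normal_derivative_pairing \<Omega> w \<phi>"
    using nd by (simp add: same_normal_derivative_def)
  let ?Iv = "\<lambda>b. LINT x|?N. Gv b x * \<phi>' b x" and ?Iw = "\<lambda>b. LINT x|?N. Gw b x * \<phi>' b x"
  have bd: "integrable ?N (\<lambda>x. f x * \<phi> x)" if "integrable ?N f" for f
    by (rule integrable_mult_bounded_space[OF that meas[OF \<phi>(2)], of B]) (simp add: B)
  have 1: "(\<Sum>b\<in>Basis. ?Iw b) - (\<Sum>b\<in>Basis. ?Iv b)
      = (of_real k)\<^sup>2 * (LINT x|?N. ((1 + V x) * w x - v x) * \<phi> x)"
  proof -
    have a: "(LINT x|?N. - ((of_real k)\<^sup>2 * (1 + V x) * w x) * \<phi> x) = - (of_real k)\<^sup>2 * (LINT x|?N. ((1 + V x) * w x) * \<phi> x)"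
    proof -
      have "(\<lambda>x. - ((of_real k)\<^sup>2 * (1 + V x) * w x) * \<phi> x) = (\<lambda>x. - (of_real k)\<^sup>2 * (((1 + V x) * w x) * \<phi> x))"
        by (simp add: fun_eq_iff mult.assoc)
      then show ?thesis by (simp only: integral_mult_right_zero)
    qed
    have b: "(LINT x|?N. - ((of_real k)\<^sup>2 * v x) * \<phi> x) = - (of_real k)\<^sup>2 * (LINT x|?N. v x * \<phi> x)"
    proof -
      have "(\<lambda>x. - ((of_real k)\<^sup>2 * v x) * \<phi> x) = (\<lambda>x. - (of_real k)\<^sup>2 * (v x * \<phi> x))"
        by (simp add: fun_eq_iff mult.assoc)
      then show ?thesis by (simp only: integral_mult_right_zero)
    qed
    have c: "(LINT x|?N. ((1 + V x) * w x - v x) * \<phi> x) = (LINT x|?N. ((1 + V x) * w x) * \<phi> x) - (LINT x|?N. v x * \<phi> x)"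
      unfolding left_diff_distrib by (rule Bochner_Integration.integral_diff[OF bd[OF iqw] bd[OF iv]])
    have "(\<Sum>b\<in>Basis. ?Iv b) + (LINT x|?N. - ((of_real k)\<^sup>2 * v x) * \<phi> x)
        = (\<Sum>b\<in>Basis. ?Iw b) + (LINT x|?N. - ((of_real k)\<^sup>2 * (1 + V x) * w x) * \<phi> x)"
      using eq normal_derivative_pairing_eq[OF U Gv(2,3) H(4) ilv \<phi>(1,2,3) B(1,2)]
        normal_derivative_pairing_eq[OF U Gw(2,3) H(3) ilw \<phi>(1,2,3) B(1,2)] by simp
    then show ?thesis unfolding a b c by (simp add: algebra_simps)
  qed
  have 2: "?Iw b - ?Iv b = (LINT x|?N. (v x - w x) * \<phi>'' b x)" if b: "b \<in> Basis" for b
  proof -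
    have "(LINT x|?N. (Gw b x - Gv b x) * \<phi>' b x) = - (LINT x|?N. (w x - v x) * \<phi>'' b x)"
      by (rule H1_0_integration_by_parts[where G="\<lambda>b x. Gw b x - Gv b x", OF U tr])
        (auto intro!: has_weak_pd_diff L2_diff Gv Gw b \<phi> B)
    moreover have "(LINT x|?N. (Gw b x - Gv b x) * \<phi>' b x) = ?Iw b - ?Iv b"
      unfolding left_diff_distrib
      using b by (intro Bochner_Integration.integral_diff integrable_mult_bounded_space[where B=B] L2_imp_integrable[OF fin] Gv Gw meas \<phi>)
        (auto simp: B)
    moreover have "- (LINT x|?N. (w x - v x) * \<phi>'' b x) = (LINT x|?N. (v x - w x) * \<phi>'' b x)"
      by (subst Bochner_Integration.integral_minus[symmetric]) (simp add: algebra_simps)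
    ultimately show ?thesis by simp
  qed
  have i3: "integrable ?N (\<lambda>x. (v x - w x) * \<phi>'' b x)" if b: "b \<in> Basis" for b
    by (rule integrable_mult_bounded_space[OF _ meas[OF \<phi>(5)[OF b]], of _ B]) (use iv iw b in \<open>auto simp: B\<close>)
  have "(LINT x|?N. (v x - w x) * (\<Sum>b\<in>Basis. \<phi>'' b x)) = (\<Sum>b\<in>Basis. LINT x|?N. (v x - w x) * \<phi>'' b x)"
    unfolding sum_distrib_left by (rule Bochner_Integration.integral_sum) (rule i3)
  also have "\<dots> = (\<Sum>b\<in>Basis. ?Iw b) - (\<Sum>b\<in>Basis. ?Iv b)"
    unfolding sum_subtractf[symmetric] by (rule sum.cong) (simp_all add: 2)
  finally show ?thesis using 1 by simp
qed

section \<open>Averages of trace-zero functions near the edge\<close>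

lemma open_cyl: "open A \<Longrightarrow> open I \<Longrightarrow> open (cyl A I)"
  unfolding cyl_def
  by (intro open_Collect_conj open_vimage[of A proj2, unfolded vimage_def] continuous_on_proj2
      open_vimage[of I "\<lambda>x. x $ 3", unfolded vimage_def] continuous_intros)

lemma integral_wt_cyl:
  assumes D: "D \<in> sets borel" "\<And>x. x \<in> D \<Longrightarrow> x $ 3 \<in> {-M<..<M}" and e: "e > 0" and M: "M > 0"
  shows "integrable (lebesgue_on D) (\<lambda>x. wt (proj2 x /\<^sub>R e))"
    and "(LINT x|lebesgue_on D. wt (proj2 x /\<^sub>R e)) \<le> 2 * M * wt_mass * e\<^sup>2"
proof -
  let ?f = "\<lambda>x. indicator D x * wt (proj2 x /\<^sub>R e)"
  have m: "?f \<in> borel_measurable lborel" using D(1) by measurable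
  have "(\<integral>\<^sup>+x. ennreal (?f x) \<partial>lborel) \<le> (\<integral>\<^sup>+x. ennreal (wt (proj2 x /\<^sub>R e)) * indicator {x. x $ 3 \<in> {-M<..<M}} x \<partial>lborel)"
    using D(2) by (intro nn_integral_mono) (auto simp: indicator_def)
  then have le: "(\<integral>\<^sup>+x. ennreal (?f x) \<partial>lborel) \<le> ennreal (2 * M * wt_mass * e\<^sup>2)"
    by (simp only: nn_integral_wt_cyl[OF e M])
  have nn: "0 \<le> ?f x" for x using wt_pos[of "proj2 x /\<^sub>R e"] by (simp add: less_imp_le)
  have i: "integrable lborel ?f"
    using le nn by (intro integrableI_nonneg m) (auto intro: le_less_trans)
  have "integrable lebesgue ?f" by (subst integrable_completion[OF m]) (rule i)
  then show "integrable (lebesgue_on D) (\<lambda>x. wt (proj2 x /\<^sub>R e))"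
    using D(1) by (simp add: integrable_restrict_space)
  have "(LINT x|lebesgue_on D. wt (proj2 x /\<^sub>R e)) = (LINT x|lebesgue. ?f x)"
    using D(1) by (simp add: integral_restrict_space)
  also have "\<dots> = (LINT x|lborel. ?f x)" by (rule integral_completion[OF m])
  also have "\<dots> \<le> 2 * M * wt_mass * e\<^sup>2"
    using le nn_integral_eq_integral[OF i] nn M wt_mass_nonneg by (simp add: ennreal_le_iff)
  finally show "(LINT x|lebesgue_on D. wt (proj2 x /\<^sub>R e)) \<le> 2 * M * wt_mass * e\<^sup>2" .
qed

section \<open>A Poincare inequality along horizontal circles\<close>

lemma rot_has_vector_derivative:
  "((\<lambda>t. rot t x) has_vector_derivative (- (rot t x $ 2)) *\<^sub>R axis 1 1 + (rot t x $ 1) *\<^sub>R axis 2 1) (at t)"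
proof -
  have "((\<lambda>t. (cos t * x $ 1 - sin t * x $ 2) *\<^sub>R (axis 1 1 :: real^3) + (sin t * x $ 1 + cos t * x $ 2) *\<^sub>R axis 2 1 + (x $ 3) *\<^sub>R axis 3 1)
      has_vector_derivative (- (sin t * x $ 1 + cos t * x $ 2)) *\<^sub>R axis 1 1 + (cos t * x $ 1 - sin t * x $ 2) *\<^sub>R axis 2 1) (at t)"
    by (auto intro!: derivative_eq_intros simp: algebra_simps)
  moreover have "(\<lambda>t. (cos t * x $ 1 - sin t * x $ 2) *\<^sub>R (axis 1 1 :: real^3) + (sin t * x $ 1 + cos t * x $ 2) *\<^sub>R axis 2 1 + (x $ 3) *\<^sub>R axis 3 1)
      = (\<lambda>t. rot t x)"
    by (simp only: rot_def vector3_conv_axis)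
  ultimately show ?thesis by (simp only: rot_nth)
qed

lemma smooth_rot_has_vector_derivative:
  fixes \<zeta> :: "real^3 \<Rightarrow> complex"
  assumes "smooth \<zeta>"
  shows "((\<lambda>t. \<zeta> (rot t x)) has_vector_derivative
    (- (rot t x $ 2)) *\<^sub>R pd (axis 1 1) \<zeta> (rot t x) + (rot t x $ 1) *\<^sub>R pd (axis 2 1) \<zeta> (rot t x)) (at t)"
proof -
  note d = smooth_imp_has_derivative(1)[OF assms, of "rot t x"]
  from vector_derivative_diff_chain_within[of "\<lambda>t. rot t x" _ t UNIV, OF _ has_derivative_at_withinI[OF d]]
    rot_has_vector_derivative[of x t]
  have "((\<zeta> \<circ> (\<lambda>t. rot t x)) has_vector_derivative frechet_derivative \<zeta> (at (rot t x))
      ((- (rot t x $ 2)) *\<^sub>R axis 1 1 + (rot t x $ 1) *\<^sub>R axis 2 1)) (at t)"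
    by blast
  moreover have "linear (frechet_derivative \<zeta> (at (rot t x)))" by (rule has_derivative_linear[OF d])
  ultimately show ?thesis by (simp add: o_def pd_def linear_add linear_cmul)
qed

text \<open>Rotation by pi - Arg z carries the point to the negative half-axis, and the range of Arg
  keeps this angle in [0, 2 pi]. The sector stays away from that half-axis, so every circle leaves
  it.\<close>

lemma rot_meets_negative_axis:
  obtains t where "0 \<le> t" "t \<le> 2 * pi" "rot t x $ 2 = 0" "rot t x $ 1 \<le> 0"
proof -
  define z where "z = Complex (x $ 1) (x $ 2)"
  define t where "t = pi - Arg z"
  have t: "0 \<le> t" "t \<le> 2 * pi" using Arg_le_pi[of z] mpi_less_Arg[of z] by (auto simp: t_def)
  have "cis t * z = - of_real (norm z)"
  proof -
    have "cis t * z = cis t * (of_real (norm z) * cis (Arg z))"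
      by (cases "z = 0") (simp_all add: cis_Arg sgn_div_norm scaleR_conv_of_real)
    also have "\<dots> = of_real (norm z) * (cis t * cis (Arg z))" by (simp add: mult_ac)
    also have "\<dots> = - of_real (norm z)" by (simp add: cis_mult t_def)
    finally show ?thesis .
  qed
  then have "Re (cis t * z) = - norm z" "Im (cis t * z) = 0" by simp_all
  moreover have "rot t x $ 1 = Re (cis t * z)" "rot t x $ 2 = Im (cis t * z)" by (simp_all add: z_def)
  ultimately have r: "rot t x $ 1 \<le> 0" "rot t x $ 2 = 0" using norm_ge_zero[of z] by linarith+
  show ?thesis by (rule that[OF t r(2,1)])
qed

lemma abs_nth_le_norm_proj2: "\<bar>x $ 1\<bar> \<le> norm (proj2 x)" "\<bar>x $ 2\<bar> \<le> norm (proj2 x)"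
  using component_le_norm_cart[of "proj2 x"] by (metis proj2_nth(1), metis proj2_nth(2))

text \<open>Along each horizontal circle a function vanishing somewhere is bounded by the integral of its
  tangential derivative; rotation invariance of Lebesgue measure turns this into an integral
  inequality with an arbitrary radial weight.\<close>

lemma rotational_poincare_test_function:
  fixes \<zeta> :: "real^3 \<Rightarrow> complex" and h M e :: real
  defines "A \<equiv> cyl (ball 0 h) {-M<..<M}"
  assumes \<Omega>: "test_function \<Omega> \<zeta>" and D: "A \<inter> \<Omega> = D" "open D"
    and axis: "\<And>x. x \<in> D \<Longrightarrow> \<not> (x $ 2 = 0 \<and> x $ 1 \<le> 0)"
  shows "(LINT x|lebesgue_on D. norm (\<zeta> x) * wt (proj2 x /\<^sub>R e))
    \<le> 2 * pi * (LINT x|lebesgue_on D. norm (proj2 x) * (norm (pd (axis 1 1) \<zeta> x) + norm (pd (axis 2 1) \<zeta> x)) * wt (proj2 x /\<^sub>R e))"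
proof -
  let ?b1 = "axis 1 1 :: real^3" and ?b2 = "axis 2 1 :: real^3"
  have bas: "?b1 \<in> Basis" "?b2 \<in> Basis" by auto
  note K = test_function_complex_facts[OF \<Omega>]
  have s: "smooth \<zeta>" using \<Omega> by (simp add: test_function_def)
  have z: "\<zeta> x = 0" "pd b \<zeta> x = 0" if "x \<notin> \<Omega>" for x b
    using K(2) that by (auto intro: K(3,4))
  have cont[measurable]: "\<zeta> \<in> borel_measurable borel" "pd ?b1 \<zeta> \<in> borel_measurable borel" "pd ?b2 \<zeta> \<in> borel_measurable borel"
    using K(5) K(6)[OF bas(1)] K(6)[OF bas(2)] by (auto intro: borel_measurable_continuous_onI)
  have A[measurable]: "A \<in> sets borel" unfolding A_def by (intro borel_open open_cyl) auto
  have wtnn: "0 \<le> wt y" for y using wt_pos[of y] by simp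
  define H where "H x = indicator A x * (norm (proj2 x) * (norm (pd ?b1 \<zeta> x) + norm (pd ?b2 \<zeta> x)) * wt (proj2 x /\<^sub>R e))" for x
  define F where "F x = indicator A x * (norm (\<zeta> x) * wt (proj2 x /\<^sub>R e))" for x
  have Hm[measurable]: "H \<in> borel_measurable borel" unfolding H_def by measurable
  have Fm[measurable]: "F \<in> borel_measurable borel" unfolding F_def by measurable
  have Hnn: "0 \<le> H x" and Fnn: "0 \<le> F x" for x by (auto simp: H_def F_def wtnn)
  have "proj2 (rot t x) \<in> ball 0 h \<longleftrightarrow> proj2 x \<in> ball 0 h" for t x by simp
  then have Arot: "rot t x \<in> A \<longleftrightarrow> x \<in> A" for t x by (simp add: A_def cyl_def)
  have wrot: "wt (proj2 (rot t x) /\<^sub>R e) = wt (proj2 x /\<^sub>R e)" for t x by (simp add: wt_def)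
  \<comment> \<open>The fundamental theorem is applied on [0, t0], from x to a point where \<zeta>
    vanishes. Enlarging the interval to a full turn removes the dependence on t0, hence on x, and
    prepares the exchange of integrals.\<close>
  have pt: "ennreal (F x) \<le> (\<integral>\<^sup>+t. indicator {0..2*pi} t * ennreal (H (rot t x)) \<partial>lborel)" for x
  proof (cases "x \<in> A")
    case False then show ?thesis by (simp add: F_def)
  next
    case True
    obtain t0 where t0: "0 \<le> t0" "t0 \<le> 2 * pi" "rot t0 x $ 2 = 0" "rot t0 x $ 1 \<le> 0"
      by (rule rot_meets_negative_axis)
    \<comment> \<open>The rotated point remains in A but cannot lie in D, so it has left
      \<Omega>.\<close>
    have "rot t0 x \<notin> \<Omega>" using axis[of "rot t0 x"] t0 D(1) True Arot by blast
    then have z0: "\<zeta> (rot t0 x) = 0" by (rule z)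
    let ?d = "\<lambda>t. (- (rot t x $ 2)) *\<^sub>R pd ?b1 \<zeta> (rot t x) + (rot t x $ 1) *\<^sub>R pd ?b2 \<zeta> (rot t x)"
    have cd: "continuous_on {0..t0} ?d"
      by (intro continuous_intros continuous_on_compose2[OF K(6)[OF bas(1)]] continuous_on_compose2[OF K(6)[OF bas(2)]] continuous_on_rot) auto
    have ftc: "has_bochner_integral lborel (\<lambda>t. indicator {0..t0} t *\<^sub>R ?d t) (\<zeta> (rot t0 x) - \<zeta> (rot 0 x))"
      by (rule has_bochner_integral_FTC_Icc[OF t0(1) _ cd])
        (rule has_vector_derivative_at_within[OF smooth_rot_has_vector_derivative[OF s]])
    have "ennreal (norm (\<zeta> x)) = ennreal (norm (LINT t|lborel. indicator {0..t0} t *\<^sub>R ?d t))"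
      using has_bochner_integral_integral_eq[OF ftc] z0 by simp
    also have "\<dots> \<le> (\<integral>\<^sup>+t. norm (indicator {0..t0} t *\<^sub>R ?d t) \<partial>lborel)"
      using ftc by (intro integral_norm_bound_ennreal) (auto simp: has_bochner_integral_iff)
    finally have "ennreal (norm (\<zeta> x)) \<le> (\<integral>\<^sup>+t. norm (indicator {0..t0} t *\<^sub>R ?d t) \<partial>lborel)" .
    then have "ennreal (norm (\<zeta> x)) * ennreal (wt (proj2 x /\<^sub>R e))
        \<le> (\<integral>\<^sup>+t. norm (indicator {0..t0} t *\<^sub>R ?d t) \<partial>lborel) * ennreal (wt (proj2 x /\<^sub>R e))"
      by (intro mult_right_mono) auto
    also have "\<dots> = (\<integral>\<^sup>+t. norm (indicator {0..t0} t *\<^sub>R ?d t) * ennreal (wt (proj2 x /\<^sub>R e)) \<partial>lborel)"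
      by (rule nn_integral_multc[symmetric, OF measurable_compose[OF borel_measurable_has_bochner_integral[OF ftc]]]) measurable
    also have "\<dots> \<le> (\<integral>\<^sup>+t. indicator {0..2*pi} t * ennreal (H (rot t x)) \<partial>lborel)"
    proof (intro nn_integral_mono)
      fix t
      have "norm (?d t) \<le> \<bar>rot t x $ 2\<bar> * norm (pd ?b1 \<zeta> (rot t x)) + \<bar>rot t x $ 1\<bar> * norm (pd ?b2 \<zeta> (rot t x))"
        by (rule order_trans[OF norm_triangle_ineq]) (simp only: norm_scaleR abs_minus_cancel order_refl)
      also have "\<dots> \<le> norm (proj2 x) * norm (pd ?b1 \<zeta> (rot t x)) + norm (proj2 x) * norm (pd ?b2 \<zeta> (rot t x))"
        using abs_nth_le_norm_proj2[of "rot t x"] by (intro add_mono mult_right_mono) (simp_all only: norm_proj2_rot norm_ge_zero)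
      finally have "norm (?d t) * wt (proj2 x /\<^sub>R e) \<le> (norm (proj2 x) * (norm (pd ?b1 \<zeta> (rot t x)) + norm (pd ?b2 \<zeta> (rot t x)))) * wt (proj2 x /\<^sub>R e)"
        by (intro mult_right_mono) (simp_all add: distrib_left wtnn)
      also have "\<dots> = H (rot t x)" using True by (simp add: H_def Arot wrot)
      finally show "ennreal (norm (indicator {0..t0} t *\<^sub>R ?d t)) * ennreal (wt (proj2 x /\<^sub>R e)) \<le> indicator {0..2*pi} t * ennreal (H (rot t x))"
        using t0 by (auto simp: indicator_def ennreal_mult'[symmetric] intro!: ennreal_leI)
    qed
    finally show ?thesis using True by (simp add: F_def ennreal_mult')
  qed
  have mm: "case_prod (\<lambda>x t. indicator {0..2*pi} t * ennreal (H (rot t x))) \<in> borel_measurable (lborel \<Otimes>\<^sub>M lborel)"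
  proof -
    have [measurable]: "(\<lambda>p::(real^3) \<times> real. rot (snd p) (fst p)) \<in> borel_measurable (lborel \<Otimes>\<^sub>M lborel)"
      unfolding lborel_prod by (auto intro!: borel_measurable_continuous_onI continuous_on_rot continuous_intros)
    show ?thesis unfolding case_prod_beta by measurable
  qed
  have mr: "(\<lambda>x. ennreal (H (rot t x))) \<in> borel_measurable lborel" for t
    by (rule measurable_compose[of "rot t" _ borel])
      (auto intro!: borel_measurable_continuous_onI continuous_on_rot continuous_intros)
  \<comment> \<open>After the exchange, rotation invariance makes the inner integral the same for
    every angle; the angles contribute only the length 2 pi.\<close>
  have "(\<integral>\<^sup>+x. ennreal (F x) \<partial>lborel) \<le> (\<integral>\<^sup>+x. \<integral>\<^sup>+t. indicator {0..2*pi} t * ennreal (H (rot t x)) \<partial>lborel \<partial>lborel)"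
    by (intro nn_integral_mono pt)
  also have "\<dots> = (\<integral>\<^sup>+t. \<integral>\<^sup>+x. indicator {0..2*pi} t * ennreal (H (rot t x)) \<partial>lborel \<partial>lborel)"
    by (rule lborel_pair.Fubini'[OF mm, symmetric])
  also have "\<dots> = (\<integral>\<^sup>+t. indicator {0..2*pi} t * (\<integral>\<^sup>+x. ennreal (H x) \<partial>lborel) \<partial>lborel)"
    using mr by (intro nn_integral_cong) (simp add: nn_integral_cmult nn_integral_rot[of "\<lambda>x. ennreal (H x)"])
  also have "\<dots> = ennreal (2 * pi) * (\<integral>\<^sup>+x. ennreal (H x) \<partial>lborel)"
    by (simp add: nn_integral_multc)
  finally have main: "(\<integral>\<^sup>+x. ennreal (F x) \<partial>lborel) \<le> ennreal (2 * pi) * (\<integral>\<^sup>+x. ennreal (H x) \<partial>lborel)" .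
  have in1: "integrable lborel (\<lambda>x. norm (\<zeta> x))" "integrable lborel (\<lambda>x. norm (pd ?b1 \<zeta> x))" "integrable lborel (\<lambda>x. norm (pd ?b2 \<zeta> x))"
    by (intro integrable_norm integrable_continuous_compact_support[OF _ K(1)] K(3,4,5,6) bas; assumption)+
  have iF: "integrable lborel F"
  proof (rule Bochner_Integration.integrable_bound[OF in1(1)])
    have "norm (F x) \<le> norm (norm (\<zeta> x))" for x
      using wtnn[of "proj2 x /\<^sub>R e"] wt_le_1[of "proj2 x /\<^sub>R e"]
      by (auto simp: F_def indicator_def mult_left_le)
    then show "AE x in lborel. norm (F x) \<le> norm (norm (\<zeta> x))" by simp
  qed simp
  have iH: "integrable lborel H"
  proof (rule Bochner_Integration.integrable_bound)
    show "integrable lborel (\<lambda>x. h * (norm (pd ?b1 \<zeta> x) + norm (pd ?b2 \<zeta> x)))"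
      using in1 by (intro integrable_mult_right Bochner_Integration.integrable_add)
    have "norm (H x) \<le> norm (h * (norm (pd ?b1 \<zeta> x) + norm (pd ?b2 \<zeta> x)))" for x
    proof (cases "x \<in> A")
      case True
      then have n: "norm (proj2 x) \<le> h" by (simp add: A_def cyl_def)
      have "H x \<le> (h * (norm (pd ?b1 \<zeta> x) + norm (pd ?b2 \<zeta> x))) * 1"
      proof -
        have "H x = (norm (proj2 x) * (norm (pd ?b1 \<zeta> x) + norm (pd ?b2 \<zeta> x))) * wt (proj2 x /\<^sub>R e)"
          using True by (simp add: H_def)
        also have "\<dots> \<le> (h * (norm (pd ?b1 \<zeta> x) + norm (pd ?b2 \<zeta> x))) * 1"
          using order_trans[OF norm_ge_zero n] by (intro mult_mono n wt_le_1 wtnn mult_nonneg_nonneg) auto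
        finally show ?thesis .
      qed
      then show ?thesis using Hnn[of x] by simp
    qed (simp add: H_def)
    then show "AE x in lborel. norm (H x) \<le> norm (h * (norm (pd ?b1 \<zeta> x) + norm (pd ?b2 \<zeta> x)))" by simp
  qed simp
  \<comment> \<open>The integrands vanish off \<Omega>, so D may be replaced by the
    rotation-invariant cylinder A.\<close>
  have re: "(LINT x|lebesgue_on D. f x) = (LINT x|lborel. indicator A x * f x)"
    if f: "(\<lambda>x. indicator A x * f x) \<in> borel_measurable borel" "\<And>x. x \<notin> \<Omega> \<Longrightarrow> f x = 0" for f :: "real^3 \<Rightarrow> real"
  proof -
    have "(LINT x|lebesgue_on D. f x) = (LINT x|lebesgue. indicator D x * f x)"
      using D(2) by (simp add: integral_restrict_space)
    also have "(\<lambda>x. indicator D x * f x) = (\<lambda>x. indicator A x * f x)"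
      using D(1) f(2) by (force simp: indicator_def fun_eq_iff)
    also have "(LINT x|lebesgue. indicator A x * f x) = (LINT x|lborel. indicator A x * f x)"
      using f(1) by (intro integral_completion) simp
    finally show ?thesis .
  qed
  have eF: "(LINT x|lebesgue_on D. norm (\<zeta> x) * wt (proj2 x /\<^sub>R e)) = (LINT x|lborel. F x)"
    unfolding F_def by (rule re) (use Fm z in \<open>simp_all add: F_def[abs_def]\<close>)
  have eH: "(LINT x|lebesgue_on D. norm (proj2 x) * (norm (pd ?b1 \<zeta> x) + norm (pd ?b2 \<zeta> x)) * wt (proj2 x /\<^sub>R e)) = (LINT x|lborel. H x)"
    unfolding H_def by (rule re) (use Hm z in \<open>simp_all add: H_def[abs_def]\<close>)
  have "ennreal (LINT x|lborel. F x) \<le> ennreal (2 * pi * (LINT x|lborel. H x))"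
    using main Hnn Fnn by (simp add: nn_integral_eq_integral iF iH ennreal_mult')
  then show ?thesis
    unfolding eF eH using Hnn by (subst (asm) ennreal_le_iff) (auto intro!: mult_nonneg_nonneg integral_nonneg_AE)
qed

lemma lebesgue_on_subset:
  fixes f :: "'a::euclidean_space \<Rightarrow> complex"
  assumes "D \<in> sets lebesgue" "U \<in> sets lebesgue" "D \<subseteq> U" "integrable (lebesgue_on U) f"
  shows "integrable (lebesgue_on D) f" "(LINT x|lebesgue_on D. norm (f x)) \<le> (LINT x|lebesgue_on U. norm (f x))"
proof -
  have i: "integrable lebesgue (\<lambda>x. indicator U x *\<^sub>R f x)" using assms by (simp add: integrable_restrict_space)
  have e: "(\<lambda>x. indicator D x *\<^sub>R (indicator U x *\<^sub>R f x)) = (\<lambda>x. indicator D x *\<^sub>R f x)"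
    using assms(3) by (auto simp: indicator_def fun_eq_iff)
  have i': "integrable lebesgue (\<lambda>x. indicator D x *\<^sub>R f x)"
    using integrable_mult_indicator[OF assms(1) i] by (simp only: e)
  then show "integrable (lebesgue_on D) f" using assms(1) by (simp add: integrable_restrict_space)
  have "(LINT x|lebesgue. norm (indicator D x *\<^sub>R f x)) \<le> (LINT x|lebesgue. norm (indicator U x *\<^sub>R f x))"
    using assms(3) by (intro integral_mono integrable_norm i i') (auto simp: indicator_def)
  then show "(LINT x|lebesgue_on D. norm (f x)) \<le> (LINT x|lebesgue_on U. norm (f x))"
    using assms(1,2) by (simp add: integral_restrict_space)
qed

lemma integrable_norm_times_bounded:
  fixes f :: "'a \<Rightarrow> complex" and m :: "'a \<Rightarrow> real"
  assumes f: "integrable N f" and m: "m \<in> borel_measurable N" "\<And>x. x \<in> space N \<Longrightarrow> \<bar>m x\<bar> \<le> B"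
  shows "integrable N (\<lambda>x. norm (f x) * m x)"
proof (rule Bochner_Integration.integrable_bound)
  show "integrable N (\<lambda>x. B * norm (f x))" using f by (intro integrable_mult_right integrable_norm)
  show "(\<lambda>x. norm (f x) * m x) \<in> borel_measurable N"
    using borel_measurable_integrable[OF f] m(1) by measurable
  show "AE x in N. norm (norm (f x) * m x) \<le> norm (B * norm (f x))"
  proof (rule AE_I2)
    fix x assume x: "x \<in> space N"
    have "norm (norm (f x) * m x) = norm (f x) * \<bar>m x\<bar>" by (simp add: abs_mult)
    also have "\<dots> \<le> norm (f x) * B" by (intro mult_left_mono m x) simp
    finally show "norm (norm (f x) * m x) \<le> norm (B * norm (f x))" using abs_ge_self[of "B * norm (f x)"] by (simp add: mult.commute)
  qed
qed

lemma tendsto_integral_norm_if_L1: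
  fixes f :: "'a \<Rightarrow> complex" and m :: "'a \<Rightarrow> real"
  assumes f: "integrable N f" and fn: "\<And>n. integrable N (g n)"
    and lim: "(\<lambda>n. LINT x|N. norm (f x - g n x)) \<longlonglongrightarrow> 0"
    and m: "m \<in> borel_measurable N" "\<And>x. x \<in> space N \<Longrightarrow> \<bar>m x\<bar> \<le> B"
  shows "(\<lambda>n. LINT x|N. norm (g n x) * m x) \<longlonglongrightarrow> (LINT x|N. norm (f x) * m x)"
proof -
  note i = integrable_norm_times_bounded[OF f m] integrable_norm_times_bounded[OF fn m]
  have "norm ((LINT x|N. norm (g n x) * m x) - (LINT x|N. norm (f x) * m x)) \<le> B * (LINT x|N. norm (f x - g n x))" for n
  proof -
    have "(LINT x|N. norm (g n x) * m x) - (LINT x|N. norm (f x) * m x) = (LINT x|N. norm (g n x) * m x - norm (f x) * m x)"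
      using i by simp
    also have "norm \<dots> \<le> (LINT x|N. norm (norm (g n x) * m x - norm (f x) * m x))" by (rule integral_norm_bound)
    also have "\<dots> \<le> (LINT x|N. B * norm (f x - g n x))"
    proof (rule integral_mono)
      show "integrable N (\<lambda>x. norm (norm (g n x) * m x - norm (f x) * m x))" using i by (intro integrable_norm) simp
      show "integrable N (\<lambda>x. B * norm (f x - g n x))" using f fn by (intro integrable_mult_right integrable_norm) auto
      show "norm (norm (g n x) * m x - norm (f x) * m x) \<le> B * norm (f x - g n x)" if "x \<in> space N" for x
      proof -
        have "norm (norm (g n x) * m x - norm (f x) * m x) = \<bar>norm (g n x) - norm (f x)\<bar> * \<bar>m x\<bar>"
          by (simp add: left_diff_distrib[symmetric] abs_mult)
        also have "\<dots> \<le> norm (g n x - f x) * B" by (intro mult_mono norm_triangle_ineq3 m that) auto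
        finally show ?thesis by (simp add: norm_minus_commute mult.commute)
      qed
    qed
    finally show ?thesis by simp
  qed
  then have "(\<lambda>n. (LINT x|N. norm (g n x) * m x) - (LINT x|N. norm (f x) * m x)) \<longlonglongrightarrow> 0"
    by (intro Lim_null_comparison[OF _ tendsto_mult_right_zero[OF lim, of B]]) simp
  then show ?thesis by (rule LIM_zero_cancel)
qed

text \<open>Both sides are continuous in u and its gradient with respect to L1, because the weights
  are bounded on D; hence the inequality passes from test functions to their limits.\<close>

lemma rotational_poincare:
  fixes u :: "real^3 \<Rightarrow> complex" and h M e :: real
  assumes \<Omega>: "open \<Omega>" "bounded \<Omega>" and D: "cyl (ball 0 h) {-M<..<M} \<inter> \<Omega> = D" "open D"
    and axis: "\<And>x. x \<in> D \<Longrightarrow> \<not> (x $ 2 = 0 \<and> x $ 1 \<le> 0)"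
    and u: "H1_0 \<Omega> u"
    and G: "\<And>b. b \<in> Basis \<Longrightarrow> has_weak_pd \<Omega> b u (G b)" "\<And>b. b \<in> Basis \<Longrightarrow> L2 (lebesgue_on \<Omega>) (G b)"
  shows "(LINT x|lebesgue_on D. norm (u x) * wt (proj2 x /\<^sub>R e))
    \<le> 2 * pi * (LINT x|lebesgue_on D. norm (proj2 x) * (norm (G (axis 1 1) x) + norm (G (axis 2 1) x)) * wt (proj2 x /\<^sub>R e))"
proof -
  let ?b1 = "axis 1 1 :: real^3" and ?b2 = "axis 2 1 :: real^3" and ?N = "lebesgue_on D"
  have bas: "?b1 \<in> Basis" "?b2 \<in> Basis" by auto
  note fin = finite_measure_lebesgue_on_open[OF \<Omega>]
  have Ds: "D \<in> sets lebesgue" "\<Omega> \<in> sets lebesgue" "D \<subseteq> \<Omega>" using D \<Omega> by (auto intro: sets_lebesgue_open)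
  note sub = lebesgue_on_subset[OF Ds]
  obtain \<zeta> where \<zeta>: "\<And>n. test_function \<Omega> (\<zeta> n)"
    "(\<lambda>n. LINT x|lebesgue_on \<Omega>. norm (u x - \<zeta> n x)) \<longlonglongrightarrow> 0"
    "\<And>b. b \<in> Basis \<Longrightarrow> (\<lambda>n. LINT x|lebesgue_on \<Omega>. norm (G b x - pd b (\<zeta> n) x)) \<longlonglongrightarrow> 0"
    by (rule H1_0_approximation[OF \<Omega> u G]) (assumption, assumption, erule that, simp_all)
  have u2: "L2 (lebesgue_on \<Omega>) u" using u by (simp add: H1_0_def)
  have iu: "integrable (lebesgue_on \<Omega>) u" by (rule L2_imp_integrable[OF fin u2])
  have i\<zeta>: "integrable (lebesgue_on \<Omega>) (\<zeta> n)" for n by (rule L2_imp_integrable[OF fin L2_test_function(1)[OF \<Omega> \<zeta>(1)]])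
  have iG: "integrable (lebesgue_on \<Omega>) (G b)" "integrable (lebesgue_on \<Omega>) (pd b (\<zeta> n))" if "b \<in> Basis" for b n
    using L2_imp_integrable[OF fin G(2)[OF that]] L2_imp_integrable[OF fin L2_test_function(2)[OF \<Omega> \<zeta>(1) that]] .
  have restr: "(\<lambda>n. LINT x|?N. norm (f x - g n x)) \<longlonglongrightarrow> 0"
    if "(\<lambda>n. LINT x|lebesgue_on \<Omega>. norm (f x - g n x)) \<longlonglongrightarrow> 0" "integrable (lebesgue_on \<Omega>) f" "\<And>n. integrable (lebesgue_on \<Omega>) (g n)"
    for f and g :: "nat \<Rightarrow> real^3 \<Rightarrow> complex"
    by (rule tendsto_sandwich[OF _ _ tendsto_const that(1)]) (use that(2,3) in \<open>auto intro!: always_eventually sub(2) Bochner_Integration.integrable_diff\<close>)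
  have mw: "(\<lambda>x. wt (proj2 x /\<^sub>R e)) \<in> borel_measurable ?N"
    by (rule measurable_restrict_space1, rule measurable_completion) measurable
  have mr: "(\<lambda>x. norm (proj2 x) * wt (proj2 x /\<^sub>R e)) \<in> borel_measurable ?N"
    by (rule measurable_restrict_space1, rule measurable_completion) measurable
  have bw: "\<bar>wt y\<bar> \<le> 1" for y using wt_pos[of y] wt_le_1[of y] by simp
  have br: "\<bar>norm (proj2 x) * wt (proj2 x /\<^sub>R e)\<bar> \<le> h" if "x \<in> space ?N" for x
  proof -
    have "norm (proj2 x) \<le> h" using that D(1) by (auto simp: cyl_def)
    then have "norm (proj2 x) * \<bar>wt (proj2 x /\<^sub>R e)\<bar> \<le> h * 1"
      using order_trans[OF norm_ge_zero \<open>norm (proj2 x) \<le> h\<close>] by (intro mult_mono bw) auto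
    then show ?thesis by (simp add: abs_mult)
  qed
  have l1: "(\<lambda>n. LINT x|?N. norm (\<zeta> n x) * wt (proj2 x /\<^sub>R e)) \<longlonglongrightarrow> (LINT x|?N. norm (u x) * wt (proj2 x /\<^sub>R e))"
    by (rule tendsto_integral_norm_if_L1[OF sub(1)[OF iu] sub(1)[OF i\<zeta>] restr[OF \<zeta>(2) iu i\<zeta>] mw bw])
  have l2: "(\<lambda>n. LINT x|?N. norm (pd b (\<zeta> n) x) * (norm (proj2 x) * wt (proj2 x /\<^sub>R e))) \<longlonglongrightarrow> (LINT x|?N. norm (G b x) * (norm (proj2 x) * wt (proj2 x /\<^sub>R e)))"
    if b: "b \<in> Basis" for b
    by (rule tendsto_integral_norm_if_L1[OF sub(1)[OF iG(1)[OF b]] sub(1)[OF iG(2)[OF b]] restr[OF \<zeta>(3)[OF b] iG(1)[OF b] iG(2)[OF b]] mr br])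
  have split: "(LINT x|?N. norm (proj2 x) * (norm (p x) + norm (q x)) * wt (proj2 x /\<^sub>R e))
      = (LINT x|?N. norm (p x) * (norm (proj2 x) * wt (proj2 x /\<^sub>R e))) + (LINT x|?N. norm (q x) * (norm (proj2 x) * wt (proj2 x /\<^sub>R e)))"
    if "integrable (lebesgue_on \<Omega>) p" "integrable (lebesgue_on \<Omega>) q" for p q :: "real^3 \<Rightarrow> complex"
  proof -
    note i = integrable_norm_times_bounded[OF sub(1)[OF that(1)] mr br] integrable_norm_times_bounded[OF sub(1)[OF that(2)] mr br]
    have "(\<lambda>x. norm (proj2 x) * (norm (p x) + norm (q x)) * wt (proj2 x /\<^sub>R e))
        = (\<lambda>x. norm (p x) * (norm (proj2 x) * wt (proj2 x /\<^sub>R e)) + norm (q x) * (norm (proj2 x) * wt (proj2 x /\<^sub>R e)))"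
      by (simp add: fun_eq_iff algebra_simps)
    then show ?thesis by (simp only: Bochner_Integration.integral_add[OF i])
  qed
  have l3: "(\<lambda>n. 2 * pi * (LINT x|?N. norm (proj2 x) * (norm (pd ?b1 (\<zeta> n) x) + norm (pd ?b2 (\<zeta> n) x)) * wt (proj2 x /\<^sub>R e)))
      \<longlonglongrightarrow> 2 * pi * (LINT x|?N. norm (proj2 x) * (norm (G ?b1 x) + norm (G ?b2 x)) * wt (proj2 x /\<^sub>R e))"
    unfolding split[OF iG(2)[OF bas(1)] iG(2)[OF bas(2)]] split[OF iG(1)[OF bas(1)] iG(1)[OF bas(2)]]
    by (intro tendsto_intros l2 bas)
  show ?thesis
    by (rule LIMSEQ_le[OF l1 l3]) (use rotational_poincare_test_function[OF \<zeta>(1) D axis] in blast)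
qed

text \<open>Put s = 1 + |x'|/e. Then |x'| times the weight is at most e s^-3, and splitting s^-3
  into s^-2 and s^-1 in Cauchy-Schwarz gives, up to constants, e times e times the root of the
  integral of |grad u|^2 / s^2. The last factor tends to 0 because s tends to infinity off the
  axis.\<close>

lemma rotational_poincare_asymptotics:
  fixes u :: "real^3 \<Rightarrow> complex" and h M :: real and e :: "nat \<Rightarrow> real"
  assumes \<Omega>: "open \<Omega>" "bounded \<Omega>" and D: "cyl (ball 0 h) {-M<..<M} \<inter> \<Omega> = D" "open D"
    and axis: "\<And>x. x \<in> D \<Longrightarrow> \<not> (x $ 2 = 0 \<and> x $ 1 \<le> 0)"
    and u: "H1_0 \<Omega> u" and M: "M > 0"
    and e: "\<And>n. e n > 0" "e \<longlonglongrightarrow> 0"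
  shows "(\<lambda>n. (LINT x|lebesgue_on D. norm (u x) * wt (proj2 x /\<^sub>R e n)) / (e n)\<^sup>2) \<longlonglongrightarrow> 0"
proof -
  let ?b1 = "axis 1 1 :: real^3" and ?b2 = "axis 2 1 :: real^3" and ?N = "lebesgue_on D"
  have bas: "?b1 \<in> Basis" "?b2 \<in> Basis" by auto
  have Ds: "D \<in> sets lebesgue" "\<Omega> \<in> sets lebesgue" "D \<subseteq> \<Omega>" using D \<Omega> by (auto intro: sets_lebesgue_open)
  have Db: "D \<in> sets borel" using D(2) by (rule borel_open)
  have D3: "x $ 3 \<in> {-M<..<M}" if "x \<in> D" for x using that D(1) by (auto simp: cyl_def)
  have "H1 \<Omega> u" using u by (simp add: H1_0_def)
  then obtain G where G: "\<And>b. b \<in> Basis \<Longrightarrow> has_weak_pd \<Omega> b u (G b)" "\<And>b. b \<in> Basis \<Longrightarrow> L2 (lebesgue_on \<Omega>) (G b)"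
    by (rule sobolev_1_weak_derivatives) blast
  define g where "g x = norm (G ?b1 x) + norm (G ?b2 x)" for x
  have g2: "integrable ?N (\<lambda>x. (g x)\<^sup>2)" and gm: "g \<in> borel_measurable ?N"
  proof -
    have L: "L2 ?N (G b)" if "b \<in> Basis" for b
    proof -
      have "integrable (lebesgue_on \<Omega>) (\<lambda>x. complex_of_real ((norm (G b x))\<^sup>2))"
        using G(2)[OF that] unfolding L2_def by (intro integrable_of_real) simp
      from lebesgue_on_subset(1)[OF Ds this]
      have "integrable ?N (\<lambda>x. (norm (G b x))\<^sup>2)" by (simp only: complex_of_real_integrable_eq)
      moreover have "G b \<in> borel_measurable ?N"
        using G(2)[OF that] Ds(3) by (auto simp: L2_def intro: measurable_restrict_mono)
      ultimately show ?thesis by (simp add: L2_def)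
    qed
    show gm: "g \<in> borel_measurable ?N"
      unfolding g_def using L[OF bas(1)] L[OF bas(2)] by (intro borel_measurable_add borel_measurable_norm) (auto simp: L2_def)
    show "integrable ?N (\<lambda>x. (g x)\<^sup>2)"
    proof (rule Bochner_Integration.integrable_bound)
      show "integrable ?N (\<lambda>x. 2 * (norm (G ?b1 x))\<^sup>2 + 2 * (norm (G ?b2 x))\<^sup>2)"
        using L[OF bas(1)] L[OF bas(2)] by (intro Bochner_Integration.integrable_add integrable_mult_right) (auto simp: L2_def)
      show "(\<lambda>x. (g x)\<^sup>2) \<in> borel_measurable ?N" using gm by measurable
      have "(g x)\<^sup>2 \<le> 2 * (norm (G ?b1 x))\<^sup>2 + 2 * (norm (G ?b2 x))\<^sup>2" for x
        unfolding g_def using sum_power2_ge_zero[of "norm (G ?b1 x) - norm (G ?b2 x)" 0] by (simp add: power2_eq_square algebra_simps)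
      then show "AE x in ?N. norm ((g x)\<^sup>2) \<le> norm (2 * (norm (G ?b1 x))\<^sup>2 + 2 * (norm (G ?b2 x))\<^sup>2)"
        by (intro AE_I2) simp
    qed
  qed
  define s where "s n x = 1 + norm (proj2 x) / e n" for n x
  have s: "s n x \<ge> 1" for n x using e(1)[of n] by (simp add: s_def)
  have wts: "wt (proj2 x /\<^sub>R e n) = 1 / (s n x) ^ 4" for n x
    using e(1)[of n] by (simp add: wt_def s_def divide_inverse mult.commute)
  have sm[measurable]: "s n \<in> borel_measurable ?N" for n
    unfolding s_def by (rule measurable_restrict_space1, rule measurable_completion) measurable
  \<comment> \<open>The gradient energy seen at scale \<open>e n\<close>. The full energy dominates
    it, and the integrand tends to 0 at every point of D, since D does not meet the axis.\<close>
  define J where "J n = (LINT x|?N. (g x)\<^sup>2 / (s n x)\<^sup>2)" for n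
  have iJ: "integrable ?N (\<lambda>x. (g x)\<^sup>2 / (s n x)\<^sup>2)" for n
  proof (rule Bochner_Integration.integrable_bound[OF g2])
    show "(\<lambda>x. (g x)\<^sup>2 / (s n x)\<^sup>2) \<in> borel_measurable ?N" using gm by measurable
    have "(g x)\<^sup>2 / (s n x)\<^sup>2 \<le> (g x)\<^sup>2" for x
      using s[of n x] by (intro divide_le_eq[THEN iffD2]) (auto simp: one_le_power mult_left_le_imp_le intro!: mult_left_le_one_le mult_le_cancel_left1[THEN iffD2])
    then show "AE x in ?N. norm ((g x)\<^sup>2 / (s n x)\<^sup>2) \<le> norm ((g x)\<^sup>2)" by (intro AE_I2) simp
  qed
  have Jnn: "J n \<ge> 0" for n unfolding J_def by (intro integral_nonneg_AE AE_I2) simp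
  have J0: "J \<longlonglongrightarrow> 0"
  proof -
    have "(\<lambda>n. LINT x|?N. (g x)\<^sup>2 / (s n x)\<^sup>2) \<longlonglongrightarrow> (LINT x|?N. 0)"
    proof (rule integral_dominated_convergence[OF _ _ g2])
      show "AE x in ?N. (\<lambda>n. (g x)\<^sup>2 / (s n x)\<^sup>2) \<longlonglongrightarrow> 0"
      proof (rule AE_I2)
        fix x assume "x \<in> space ?N"
        then have "proj2 x \<noteq> 0" using axis[of x] by (metis (no_types) IntD1 order_refl proj2_nth(1) proj2_nth(2) space_restrict_space zero_index)
        then have p: "norm (proj2 x) > 0" by simp
        have "filterlim e (at_right 0) sequentially"
          using e by (intro tendsto_imp_filterlim_at_right) simp_all
        then have "filterlim (\<lambda>n. norm (proj2 x) * inverse (e n)) at_top sequentially"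
          by (intro filterlim_tendsto_pos_mult_at_top[OF tendsto_const p] filterlim_compose[OF filterlim_inverse_at_top_right])
        then have "filterlim (\<lambda>n. 1 + norm (proj2 x) * inverse (e n)) at_top sequentially"
          by (intro filterlim_tendsto_add_at_top[OF tendsto_const])
        then have "filterlim (\<lambda>n. s n x) at_top sequentially" by (simp add: s_def divide_inverse)
        then have "filterlim (\<lambda>n. (s n x)\<^sup>2) at_top sequentially" by (intro filterlim_pow_at_top) auto
        then show "(\<lambda>n. (g x)\<^sup>2 / (s n x)\<^sup>2) \<longlonglongrightarrow> 0"
          by (intro tendsto_divide_0[OF tendsto_const] filterlim_at_top_imp_at_infinity)
      qed
      show "AE x in ?N. norm ((g x)\<^sup>2 / (s n x)\<^sup>2) \<le> (g x)\<^sup>2" for n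
      proof (rule AE_I2)
        fix x
        have "(g x)\<^sup>2 * 1 \<le> (g x)\<^sup>2 * (s n x)\<^sup>2" using s[of n x] by (intro mult_left_mono) (auto simp: one_le_power)
        then show "norm ((g x)\<^sup>2 / (s n x)\<^sup>2) \<le> (g x)\<^sup>2" using s[of n x] by (simp add: divide_le_eq)
      qed
    qed (use borel_measurable_integrable[OF iJ] in auto)
    then show ?thesis by (simp add: J_def[abs_def])
  qed
  \<comment> \<open>A Young parameter comparable to the root of \<open>J n\<close>, with a
    correction that keeps it positive and tends to 0.\<close>
  define d where "d n = sqrt (J n) + 1 / real (Suc n)" for n
  have d: "d n > 0" for n unfolding d_def using Jnn[of n] by (intro add_nonneg_pos) auto
  have d0: "d \<longlonglongrightarrow> 0"
    using tendsto_add[OF tendsto_real_sqrt[OF J0] LIMSEQ_inverse_real_of_nat] by (simp add: d_def[abs_def] inverse_eq_divide)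
  define Cst where "Cst = 2 * M * wt_mass"
  have bound: "(LINT x|?N. norm (u x) * wt (proj2 x /\<^sub>R e n)) / (e n)\<^sup>2 \<le> pi * (d n * Cst + sqrt (J n))" for n
  proof -
    let ?W = "\<lambda>x. wt (proj2 x /\<^sub>R e n)"
    note iW = integral_wt_cyl[OF Db D3 e(1)[of n] M]
    have pt: "norm (proj2 x) * g x * ?W x \<le> (e n)\<^sup>2 * ((d n / (e n)\<^sup>2 * ?W x + ((g x)\<^sup>2 / (s n x)\<^sup>2) / d n) / 2)" for x
    proof -
      have e0: "e n > 0" by (rule e)
      have s0: "s n x > 0" using s[of n x] by linarith
      have gn: "g x \<ge> 0" by (simp add: g_def)
      have "norm (proj2 x) \<le> e n * s n x" using e0 by (simp add: s_def field_simps)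
      then have "norm (proj2 x) * (g x * ?W x) \<le> (e n * s n x) * (g x * ?W x)"
        using gn wt_pos[of "proj2 x /\<^sub>R e n"] by (intro mult_right_mono) auto
      also have "\<dots> = (e n)\<^sup>2 * ((1 / (e n * (s n x)\<^sup>2)) * (g x / s n x))"
        unfolding wts using e0 s0 by (simp add: field_simps power2_eq_square power4_eq_xxxx)
      also have "\<dots> \<le> (e n)\<^sup>2 * ((d n * (1 / (e n * (s n x)\<^sup>2))\<^sup>2 + (g x / s n x)\<^sup>2 / d n) / 2)"
        by (intro mult_left_mono young_inequality d) auto
      also have "\<dots> = (e n)\<^sup>2 * ((d n / (e n)\<^sup>2 * ?W x + ((g x)\<^sup>2 / (s n x)\<^sup>2) / d n) / 2)"
        unfolding wts by (simp add: power_divide power_mult_distrib power_mult[symmetric])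
      finally show ?thesis by (simp add: mult.assoc)
    qed
    have i1: "integrable ?N (\<lambda>x. (d n / (e n)\<^sup>2 * ?W x + ((g x)\<^sup>2 / (s n x)\<^sup>2) / d n) / 2)"
      using iW(1) iJ[of n] by (intro integrable_divide_zero Bochner_Integration.integrable_add integrable_mult_right) auto
    have "(LINT x|?N. norm (proj2 x) * g x * ?W x) \<le> (LINT x|?N. (e n)\<^sup>2 * ((d n / (e n)\<^sup>2 * ?W x + ((g x)\<^sup>2 / (s n x)\<^sup>2) / d n) / 2))"
    proof (rule integral_mono_AE')
      show "integrable ?N (\<lambda>x. (e n)\<^sup>2 * ((d n / (e n)\<^sup>2 * ?W x + ((g x)\<^sup>2 / (s n x)\<^sup>2) / d n) / 2))"
        using i1 by (rule integrable_mult_right)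
      show "AE x in ?N. norm (proj2 x) * g x * ?W x \<le> (e n)\<^sup>2 * ((d n / (e n)\<^sup>2 * ?W x + ((g x)\<^sup>2 / (s n x)\<^sup>2) / d n) / 2)"
        using pt by simp
      show "AE x in ?N. 0 \<le> (e n)\<^sup>2 * ((d n / (e n)\<^sup>2 * ?W x + ((g x)\<^sup>2 / (s n x)\<^sup>2) / d n) / 2)"
        using wt_pos d[of n] by (auto simp: less_imp_le intro!: AE_I2 mult_nonneg_nonneg add_nonneg_nonneg)
    qed
    also have "\<dots> = (e n)\<^sup>2 * ((d n / (e n)\<^sup>2 * (LINT x|?N. ?W x) + J n / d n) / 2)"
    proof -
      have "(LINT x|?N. d n / (e n)\<^sup>2 * ?W x + ((g x)\<^sup>2 / (s n x)\<^sup>2) / d n) = d n / (e n)\<^sup>2 * (LINT x|?N. ?W x) + J n / d n"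
        unfolding J_def using iW(1) iJ[of n] by (subst Bochner_Integration.integral_add) (simp_all del: divide_divide_eq_left)
      then show ?thesis by (simp only: integral_mult_right_zero integral_divide_zero)
    qed
    also have "\<dots> \<le> (e n)\<^sup>2 * ((d n * Cst + sqrt (J n)) / 2)"
    proof (intro mult_left_mono divide_right_mono add_mono)
      have "d n / (e n)\<^sup>2 * (LINT x|?N. ?W x) \<le> d n / (e n)\<^sup>2 * (2 * M * wt_mass * (e n)\<^sup>2)"
        using d[of n] by (intro mult_left_mono iW(2)) auto
      also have "\<dots> = d n * Cst" using e(1)[of n] by (simp add: Cst_def)
      finally show "d n / (e n)\<^sup>2 * (LINT x|?N. ?W x) \<le> d n * Cst" .
      have "sqrt (J n) * sqrt (J n) \<le> sqrt (J n) * d n" using Jnn[of n] by (intro mult_left_mono) (auto simp: d_def)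
      then show "J n / d n \<le> sqrt (J n)" using d[of n] Jnn[of n] by (simp add: pos_divide_le_eq)
    qed auto
    finally have le: "(LINT x|?N. norm (proj2 x) * g x * ?W x) \<le> (e n)\<^sup>2 * ((d n * Cst + sqrt (J n)) / 2)" .
    have "(LINT x|?N. norm (u x) * ?W x) \<le> 2 * pi * (LINT x|?N. norm (proj2 x) * g x * ?W x)"
      unfolding g_def by (rule rotational_poincare[OF \<Omega> D axis u G])
    also have "\<dots> \<le> 2 * pi * ((e n)\<^sup>2 * ((d n * Cst + sqrt (J n)) / 2))" using le by (intro mult_left_mono) auto
    also have "\<dots> = pi * (d n * Cst + sqrt (J n)) * (e n)\<^sup>2" by simp
    finally show ?thesis using e(1)[of n] by (simp add: pos_divide_le_eq)
  qed
  show ?thesis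
  proof (rule tendsto_sandwich[OF _ _ tendsto_const])
    show "\<forall>\<^sub>F n in sequentially. (LINT x|?N. norm (u x) * wt (proj2 x /\<^sub>R e n)) / (e n)\<^sup>2 \<le> pi * (d n * Cst + sqrt (J n))"
      using bound by simp
    have "(\<lambda>n. pi * (d n * Cst + sqrt (J n))) \<longlonglongrightarrow> pi * (0 * Cst + sqrt 0)"
      by (intro tendsto_intros d0 J0)
    then show "(\<lambda>n. pi * (d n * Cst + sqrt (J n))) \<longlonglongrightarrow> 0" by simp
    show "\<forall>\<^sub>F n in sequentially. 0 \<le> (LINT x|?N. norm (u x) * wt (proj2 x /\<^sub>R e n)) / (e n)\<^sup>2"
      using wt_pos by (auto intro!: always_eventually divide_nonneg_nonneg integral_nonneg_AE AE_I2 mult_nonneg_nonneg simp: less_imp_le)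
  qed
qed

section \<open>Herglotz functions\<close>

lemma norm_exp_i_diff_le: "norm (exp (\<i> * of_real a) - exp (\<i> * of_real b)) \<le> \<bar>a - b\<bar>" for a b :: real
proof -
  have "norm (exp (\<i> * of_real a) - exp (\<i> * of_real b)) \<le> 1 * norm (a - b)"
  proof (rule differentiable_bound[where S=UNIV and f'="\<lambda>t h. h *\<^sub>R (\<i> * exp (\<i> * of_real t))"])
    show "((\<lambda>t. exp (\<i> * of_real t)) has_derivative (\<lambda>h. h *\<^sub>R (\<i> * exp (\<i> * of_real t)))) (at t within UNIV)" for t :: real
      unfolding has_vector_derivative_def[symmetric]
      by (rule has_vector_derivative_real_field) (auto intro!: derivative_eq_intros)
    show "onorm (\<lambda>h. h *\<^sub>R (\<i> * exp (\<i> * of_real t))) \<le> 1" for t :: real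
      by (intro onorm_bound) (auto simp: norm_mult)
  qed auto
  then show ?thesis by simp
qed

lemma sgn_measurable_sphere:
  "sgn \<in> restrict_space lborel (ball 0 1 - {0}) \<rightarrow>\<^sub>M restrict_space borel (sphere 0 1 :: 'a::euclidean_space set)"
proof (rule measurable_restrict_space2)
  show "sgn \<in> space (restrict_space lborel (ball 0 1 - {0})) \<rightarrow> sphere (0::'a) 1"
    by (auto simp: space_restrict_space norm_sgn)
  have "(\<lambda>x::'a. x /\<^sub>R norm x) \<in> borel_measurable lborel" by measurable
  then have "(sgn :: 'a \<Rightarrow> 'a) \<in> borel_measurable lborel" by (simp add: sgn_div_norm[abs_def])
  then show "(sgn :: 'a \<Rightarrow> 'a) \<in> borel_measurable (restrict_space lborel (ball 0 1 - {0}))"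
    by (rule measurable_restrict_space1)
qed

lemma space_sphere_measure [simp]: "space sphere_measure = sphere (0::'a::euclidean_space) 1"
  by (simp add: sphere_measure_def space_restrict_space)

lemma sets_sphere_measure: "sets sphere_measure = sets (restrict_space borel (sphere (0::'a::euclidean_space) 1))"
  by (simp add: sphere_measure_def)

lemma finite_measure_sphere_measure: "finite_measure (sphere_measure :: 'a::euclidean_space measure)"
proof
  let ?R = "restrict_space lborel (ball (0::'a) 1 - {0})"
  have "emeasure (sphere_measure :: 'a measure) (space sphere_measure)
      \<le> emeasure (scale_measure (of_nat DIM('a)) ?R) (space (scale_measure (of_nat DIM('a)) ?R))"
  proof -
    have m: "sgn \<in> scale_measure (of_nat DIM('a)) ?R \<rightarrow>\<^sub>M restrict_space borel (sphere (0::'a) 1)"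
      using sgn_measurable_sphere by (simp add: measurable_def space_scale_measure)
    have "emeasure (sphere_measure :: 'a measure) (space sphere_measure)
        = emeasure (scale_measure (of_nat DIM('a)) ?R) (sgn -` sphere 0 1 \<inter> space (scale_measure (of_nat DIM('a)) ?R))"
      using m unfolding space_sphere_measure sphere_measure_def
      by (subst emeasure_distr) (auto simp: sets_restrict_space)
    also have "\<dots> \<le> emeasure (scale_measure (of_nat DIM('a)) ?R) (space (scale_measure (of_nat DIM('a)) ?R))"
      by (rule emeasure_space)
    finally show ?thesis .
  qed
  also have "\<dots> = of_nat DIM('a) * emeasure lborel (ball (0::'a) 1 - {0})"
    by (simp add: space_scale_measure space_restrict_space emeasure_restrict_space)
  also have "\<dots> \<le> of_nat DIM('a) * emeasure lborel (ball (0::'a) 1)"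
    by (intro mult_left_mono emeasure_mono) auto
  also have "\<dots> < \<infinity>"
    using emeasure_bounded_finite[of "ball (0::'a) 1"] by (simp add: ennreal_mult_less_top of_nat_less_top)
  finally show "emeasure (sphere_measure :: 'a measure) (space sphere_measure) \<noteq> \<infinity>" by simp
qed

text \<open>Both estimates reduce to the L1 norm of the kernel. Young's inequality with parameter B
  bounds it by c B, where c is half the sum of the area of the sphere and 1. The bound is linear in
  B, so the growth of the kernels in j carries over with the same exponent.\<close>

lemma herglotz_bounds:
  assumes g: "L2 sphere_measure g" and B: "L2_norm sphere_measure g \<le> B" "B > 0"
    and c: "c = (measure (sphere_measure :: (real^3) measure) (space sphere_measure) + 1) / 2"
  shows "norm (herglotz k g x) \<le> c * B" "norm (herglotz k g x - herglotz k g y) \<le> \<bar>k\<bar> * norm (x - y) * (c * B)"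
proof -
  let ?N = "sphere_measure :: (real^3) measure"
  interpret finite_measure ?N by (rule finite_measure_sphere_measure)
  have gi: "integrable ?N g" by (rule L2_imp_integrable[OF finite_measure_sphere_measure g])
  have g2: "integrable ?N (\<lambda>d. (norm (g d))\<^sup>2)" using g by (simp add: L2_def)
  have L1: "(LINT d|?N. norm (g d)) \<le> c * B"
  proof -
    have "(LINT d|?N. norm (g d)) \<le> (LINT d|?N. (B + (norm (g d))\<^sup>2 / B) / 2)"
      using young_inequality[where a=1, OF B(2)] gi g2 by (intro integral_mono) auto
    also have "\<dots> = (B * measure ?N (space ?N) + (L2_norm ?N g)\<^sup>2 / B) / 2"
      using g2 by (simp add: L2_norm_def integral_nonneg_AE mult.commute del: space_sphere_measure)
    also have "(L2_norm ?N g)\<^sup>2 / B \<le> B"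
    proof -
      have "0 \<le> L2_norm ?N g" unfolding L2_norm_def by (intro real_sqrt_ge_zero integral_nonneg_AE) auto
      then have "(L2_norm ?N g)\<^sup>2 \<le> B\<^sup>2" using B(1) by (intro power_mono)
      then show ?thesis using B(2) by (simp add: pos_divide_le_eq power2_eq_square)
    qed
    finally show ?thesis by (simp add: c algebra_simps del: space_sphere_measure)
  qed
  have m: "(\<lambda>d. exp (\<i> * of_real (k * (d \<bullet> x)))) \<in> borel_measurable ?N" for x
  proof -
    have "(\<lambda>d. exp (\<i> * of_real (k * (d \<bullet> x)))) \<in> borel_measurable (restrict_space borel (sphere 0 1))"
      by (rule measurable_restrict_space1) (auto intro!: borel_measurable_continuous_onI continuous_intros)
    then show ?thesis by (simp add: measurable_cong_sets[OF sets_sphere_measure refl])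
  qed
  have i: "integrable ?N (\<lambda>d. exp (\<i> * of_real (k * (d \<bullet> x))) * g d)" for x
    using integrable_mult_bounded_space[OF gi m[of x], of 1] by (simp add: mult.commute)
  have "norm (herglotz k g x) \<le> (LINT d|?N. norm (exp (\<i> * of_real (k * (d \<bullet> x))) * g d))"
    unfolding herglotz_def by (rule integral_norm_bound)
  also have "\<dots> = (LINT d|?N. norm (g d))" by (simp only: norm_mult norm_exp_i_times mult_1)
  finally show "norm (herglotz k g x) \<le> c * B" using L1 by linarith
  have "herglotz k g x - herglotz k g y
      = (LINT d|?N. exp (\<i> * of_real (k * (d \<bullet> x))) * g d - exp (\<i> * of_real (k * (d \<bullet> y))) * g d)"
    unfolding herglotz_def by (rule Bochner_Integration.integral_diff[OF i i, symmetric])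
  also have "norm \<dots> \<le> (LINT d|?N. norm (exp (\<i> * of_real (k * (d \<bullet> x))) * g d - exp (\<i> * of_real (k * (d \<bullet> y))) * g d))"
    by (rule integral_norm_bound)
  also have "\<dots> \<le> (LINT d|?N. (\<bar>k\<bar> * norm (x - y)) * norm (g d))"
  proof (rule integral_mono)
    show "integrable ?N (\<lambda>d. norm (exp (\<i> * of_real (k * (d \<bullet> x))) * g d - exp (\<i> * of_real (k * (d \<bullet> y))) * g d))"
      by (intro integrable_norm Bochner_Integration.integrable_diff i)
    show "integrable ?N (\<lambda>d. (\<bar>k\<bar> * norm (x - y)) * norm (g d))" using gi by (intro integrable_mult_right integrable_norm)
    fix d :: "real^3" assume "d \<in> space ?N"
    then have d: "norm d = 1" by simp
    have "norm (exp (\<i> * of_real (k * (d \<bullet> x))) - exp (\<i> * of_real (k * (d \<bullet> y)))) \<le> \<bar>k * (d \<bullet> x) - k * (d \<bullet> y)\<bar>"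
      by (rule norm_exp_i_diff_le)
    also have "\<dots> = \<bar>k\<bar> * \<bar>d \<bullet> (x - y)\<bar>" by (simp add: inner_diff_right right_diff_distrib[symmetric] abs_mult)
    also have "\<dots> \<le> \<bar>k\<bar> * norm (x - y)"
      using Cauchy_Schwarz_ineq2[of d "x - y"] d by (intro mult_left_mono) auto
    finally show "norm (exp (\<i> * of_real (k * (d \<bullet> x))) * g d - exp (\<i> * of_real (k * (d \<bullet> y))) * g d) \<le> (\<bar>k\<bar> * norm (x - y)) * norm (g d)"
      unfolding left_diff_distrib[symmetric] norm_mult by (intro mult_right_mono) auto
  qed
  also have "\<dots> \<le> \<bar>k\<bar> * norm (x - y) * (c * B)" using L1 by (simp add: mult_left_mono)
  finally show "norm (herglotz k g x - herglotz k g y) \<le> \<bar>k\<bar> * norm (x - y) * (c * B)" .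
qed

section \<open>The sector integral\<close>

definition vec2c :: "real^2 \<Rightarrow> complex" where "vec2c y = Complex (y $ 1) (y $ 2)"

lemma Re_vec2c [simp]: "Re (vec2c y) = y $ 1" and Im_vec2c [simp]: "Im (vec2c y) = y $ 2"
  by (simp_all add: vec2c_def)

lemma norm_vec2c [simp]: "norm (vec2c y) = norm y"
  by (simp add: vec2c_def complex_norm norm_vec2)

lemma vec2c_scaleR [simp]: "vec2c (c *\<^sub>R y) = c *\<^sub>R vec2c y"
  by (simp add: complex_eq_iff)

lemma bounded_linear_vec2c: "bounded_linear vec2c"
  by (rule bounded_linear_intro[where K=1]) (simp_all add: complex_eq_iff)

lemma continuous_on_vec2c [continuous_intros]: "continuous_on A f \<Longrightarrow> continuous_on A (\<lambda>x. vec2c (f x))"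
  by (rule bounded_linear.continuous_on[OF bounded_linear_vec2c])

locale plane_sector =
  fixes \<theta>\<^sub>m \<theta>\<^sub>M :: real
  assumes \<theta>_bounds: "- pi < \<theta>\<^sub>m" "\<theta>\<^sub>m < \<theta>\<^sub>M" "\<theta>\<^sub>M < pi"
begin

abbreviation "W \<equiv> sector \<theta>\<^sub>m \<theta>\<^sub>M"

text \<open>The point of the unit circle farthest from the sector; it lies outside the closed sector
  because the opening angle is less than \<open>2 \<pi>\<close>.\<close>

definition pole :: complex where "pole = - cis ((\<theta>\<^sub>m + \<theta>\<^sub>M) / 2)"

lemma in_sector_iff: "y \<in> W \<longleftrightarrow> y \<noteq> 0 \<and> \<theta>\<^sub>m < Arg (vec2c y) \<and> Arg (vec2c y) < \<theta>\<^sub>M"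
  by (simp add: sector_def vec2c_def)

lemma sector_scale: "e > 0 \<Longrightarrow> e *\<^sub>R y \<in> W \<longleftrightarrow> y \<in> W"
  by (simp add: in_sector_iff scaleR_conv_of_real[where 'a=complex])

text \<open>Arg is continuous off the closed negative half-axis, which the strict bounds -pi and pi
  keep outside the sector.\<close>

lemma open_sector: "open W"
proof -
  let ?U = "- {z. Re z \<le> 0 \<and> Im z = 0}"
  have "W = vec2c -` {z \<in> ?U. Arg z \<in> {\<theta>\<^sub>m<..<\<theta>\<^sub>M}}"
  proof -
    have "\<not> (y $ 1 \<le> 0 \<and> y $ 2 = 0)" if "y \<in> W" for y
    proof
      assume a: "y $ 1 \<le> 0 \<and> y $ 2 = 0"
      then have "y $ 1 < 0" using that by (auto simp: in_sector_iff vec_eq_iff forall_2 less_le)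
      with a have "Arg (vec2c y) = pi" by (simp add: Arg_eq_pi)
      with that \<theta>_bounds show False by (simp add: in_sector_iff)
    qed
    moreover have "y \<noteq> 0" if "\<not> (y $ 1 \<le> 0 \<and> y $ 2 = 0)" for y :: "real^2" using that by auto
    ultimately show ?thesis by (auto simp: in_sector_iff)
  qed
  moreover have "open {z \<in> ?U. Arg z \<in> {\<theta>\<^sub>m<..<\<theta>\<^sub>M}}"
  proof -
    have U: "open ?U" by (intro open_Compl closed_Collect_conj closed_Collect_le closed_Collect_eq continuous_intros)
    have "continuous_on ?U Arg"
      by (intro continuous_at_imp_continuous_on ballI continuous_at_Arg) (auto simp: complex_nonpos_Reals_iff)
    from continuous_open_preimage[OF this U, of "{\<theta>\<^sub>m<..<\<theta>\<^sub>M}"]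
    show ?thesis by (simp add: Int_def vimage_def)
  qed
  ultimately show ?thesis
    by (simp only: open_vimage[OF _ continuous_on_vec2c[OF continuous_on_id]])
qed

lemma sector_avoids_axis: "y \<in> W \<Longrightarrow> \<not> (y $ 2 = 0 \<and> y $ 1 \<le> 0)"
proof
  assume y: "y \<in> W" and a: "y $ 2 = 0 \<and> y $ 1 \<le> 0"
  then have "y $ 1 < 0" by (auto simp: in_sector_iff vec_eq_iff forall_2 less_le)
  with a have "Arg (vec2c y) = pi" by (simp add: Arg_eq_pi)
  with y \<theta>_bounds show False by (simp add: in_sector_iff)
qed

text \<open>By the half-angle formula this is the cosine of a quarter of the opening angle, positive
  because the opening is less than 2 pi.\<close>

definition sep :: real where "sep = sqrt ((1 + cos ((\<theta>\<^sub>M - \<theta>\<^sub>m) / 2)) / 2)"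

lemma sep_pos: "sep > 0"
proof -
  have "cos pi < cos ((\<theta>\<^sub>M - \<theta>\<^sub>m) / 2)" using \<theta>_bounds by (intro cos_monotone_0_pi) auto
  then show ?thesis by (simp add: sep_def)
qed

text \<open>After rotating the bisector to the positive axis the distance is |r exp(i t) + 1| with
  cos t \<ge> c, where c is the cosine of half the opening. The value r^2 + 2 r c + 1 exceeds (1 +
  c)/2 (1 + r)^2 by (1 - c)/2 (r - 1)^2.\<close>

lemma dist_pole_ge:
  assumes "y \<in> W"
  shows "norm (vec2c y - pole) \<ge> sep * (1 + norm y)"
proof -
  define r where "r = norm y"
  define t where "t = Arg (vec2c y) - (\<theta>\<^sub>m + \<theta>\<^sub>M) / 2"
  define c where "c = cos ((\<theta>\<^sub>M - \<theta>\<^sub>m) / 2)"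
  have r: "r \<ge> 0" by (simp add: r_def)
  have "cos ((\<theta>\<^sub>M - \<theta>\<^sub>m) / 2) \<le> cos \<bar>t\<bar>"
    using assms \<theta>_bounds by (intro cos_monotone_0_pi_le) (auto simp: t_def in_sector_iff abs_le_iff field_simps)
  then have ct: "c \<le> cos t" by (simp add: c_def)
  have c1: "c \<le> 1" by (simp add: c_def)
  have z: "vec2c y = of_real r * cis (Arg (vec2c y))"
    using rcis_cmod_Arg[of "vec2c y"] by (simp add: rcis_def r_def)
  have "vec2c y - pole = cis ((\<theta>\<^sub>m + \<theta>\<^sub>M) / 2) * (of_real r * cis t + 1)"
    by (subst z) (simp add: pole_def t_def algebra_simps cis_mult)
  then have "norm (vec2c y - pole) = norm (of_real r * cis t + 1)" by (simp add: norm_mult)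
  then have "(norm (vec2c y - pole))\<^sup>2 = (r * cos t + 1)\<^sup>2 + (r * sin t)\<^sup>2" by (simp add: cmod_power2)
  also have "\<dots> = r\<^sup>2 * ((sin t)\<^sup>2 + (cos t)\<^sup>2) + 2 * r * cos t + 1" by algebra
  also have "\<dots> = r\<^sup>2 + 2 * r * cos t + 1" by simp
  also have "\<dots> \<ge> r\<^sup>2 + 2 * r * c + 1" using r ct by (simp add: mult_left_mono)
  also have "r\<^sup>2 + 2 * r * c + 1 \<ge> (1 + c) / 2 * (1 + r)\<^sup>2"
  proof -
    have "r\<^sup>2 + 2 * r * c + 1 - (1 + c) / 2 * (1 + r)\<^sup>2 = (1 - c) / 2 * (r - 1)\<^sup>2"
      by (simp add: power2_eq_square field_simps)
    also have "\<dots> \<ge> 0" using c1 by (intro mult_nonneg_nonneg) auto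
    finally show ?thesis by simp
  qed
  finally have le: "(1 + c) / 2 * (1 + r)\<^sup>2 \<le> (norm (vec2c y - pole))\<^sup>2" .
  have e: "(1 + c) / 2 * (1 + r)\<^sup>2 = (sep * (1 + r))\<^sup>2"
    using sep_pos by (simp add: sep_def c_def power_mult_distrib real_sqrt_gt_0_iff)
  show ?thesis
    by (rule power2_le_imp_le[OF le[unfolded e, unfolded r_def] norm_ge_zero])
qed

lemma pole_notin: "y \<in> W \<Longrightarrow> vec2c y \<noteq> pole"
  using dist_pole_ge[of y] sep_pos one_plus_norm_pos[of y] by (auto simp: mult_le_0_iff)

text \<open>The exponent is one more than that of \<open>wt\<close>: by the distance estimate the
  modulus is then bounded by the weight divided by the spare factor.\<close>

definition \<eta> :: "real^2 \<Rightarrow> complex" where "\<eta> y = 1 / (vec2c y - pole) ^ 5"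

lemma norm_\<eta>_le: "y \<in> W \<Longrightarrow> norm (\<eta> y) \<le> 1 / sep ^ 5 * (wt y / (1 + norm y))"
proof -
  assume y: "y \<in> W"
  have "(sep * (1 + norm y)) ^ 5 \<le> norm (vec2c y - pole) ^ 5"
    using dist_pole_ge[OF y] sep_pos one_plus_norm_pos[of y] by (intro power_mono) auto
  then have "1 / norm (vec2c y - pole) ^ 5 \<le> 1 / (sep * (1 + norm y)) ^ 5"
    using sep_pos one_plus_norm_pos[of y] pole_notin[OF y] by (intro divide_left_mono) auto
  also have "\<dots> = 1 / sep ^ 5 * (wt y / (1 + norm y))"
    by (simp add: wt_def power_mult_distrib power_Suc2[symmetric] eval_nat_numeral mult_ac)
  finally show ?thesis by (simp add: \<eta>_def norm_divide norm_power)
qed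

lemma continuous_on_\<eta>: "continuous_on W \<eta>"
  unfolding \<eta>_def by (intro continuous_intros) (use pole_notin in auto)

lemma integrable_\<eta>: "integrable (lebesgue_on W) \<eta>"
proof -
  have Ws: "W \<in> sets borel" "W \<in> sets lebesgue" using open_sector by auto
  have iwt: "integrable lebesgue wt"
  proof -
    have "integrable lborel wt"
      using nn_integral_wt wt_pos by (intro integrableI_nonneg) (auto simp: less_imp_le)
    then show ?thesis by (subst integrable_completion) auto
  qed
  have m: "\<eta> \<in> borel_measurable (lebesgue_on W)"
    by (rule continuous_imp_measurable_on_sets_lebesgue[OF continuous_on_\<eta> Ws(2)])
  have "integrable (lebesgue_on W) (\<lambda>y. 1 / sep ^ 5 * wt y)"
    using integrable_mult_indicator[OF Ws(2) iwt] Ws by (intro integrable_mult_right) (simp add: integrable_restrict_space)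
  then show ?thesis
  proof (rule Bochner_Integration.integrable_bound[OF _ m])
    have "norm (\<eta> y) \<le> norm (1 / sep ^ 5 * wt y)" if "y \<in> W" for y
    proof -
      have "wt y / (1 + norm y) \<le> wt y" using wt_pos[of y] by (simp add: divide_le_eq mult_left_le one_plus_norm_pos)
      then have "1 / sep ^ 5 * (wt y / (1 + norm y)) \<le> 1 / sep ^ 5 * wt y" using sep_pos by (intro mult_left_mono) auto
      with norm_\<eta>_le[OF that] sep_pos wt_pos[of y] show ?thesis by simp
    qed
    then show "AE y in lebesgue_on W. norm (\<eta> y) \<le> norm (1 / sep ^ 5 * wt y)" using Ws by (intro AE_I2) auto
  qed
qed

section \<open>Polar coordinates in the sector\<close>

definition polar :: "real^2 \<Rightarrow> real^2" where "polar x = vector [x $ 1 * cos (x $ 2), x $ 1 * sin (x $ 2)]"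

definition polar_dom :: "(real^2) set" where "polar_dom = {x. 0 < x $ 1 \<and> \<theta>\<^sub>m < x $ 2 \<and> x $ 2 < \<theta>\<^sub>M}"

lemma vec2c_polar: "vec2c (polar x) = rcis (x $ 1) (x $ 2)"
  by (simp add: polar_def complex_eq_iff)

lemma Arg_polar: "x \<in> polar_dom \<Longrightarrow> Arg (vec2c (polar x)) = x $ 2"
  unfolding vec2c_polar using \<theta>_bounds by (intro Arg_rcis) (auto simp: polar_dom_def)

lemma norm_polar: "x \<in> polar_dom \<Longrightarrow> norm (polar x) = x $ 1"
  using norm_vec2c[of "polar x"] by (simp add: vec2c_polar norm_mult rcis_def polar_dom_def del: norm_vec2c)

lemma polar_image: "polar ` polar_dom = W"
proof
  show "polar ` polar_dom \<subseteq> W"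
  proof
    fix y assume "y \<in> polar ` polar_dom"
    then obtain x where x: "x \<in> polar_dom" "y = polar x" by blast
    then have "norm y > 0" using norm_polar[OF x(1)] by (simp add: polar_dom_def)
    with x Arg_polar[OF x(1)] show "y \<in> W" by (auto simp: in_sector_iff polar_dom_def)
  qed
  show "W \<subseteq> polar ` polar_dom"
  proof
    fix y assume y: "y \<in> W"
    let ?x = "vector [norm y, Arg (vec2c y)] :: real^2"
    have "polar ?x = y"
      using rcis_cmod_Arg[of "vec2c y"] vec2c_polar[of ?x] by (simp add: complex_eq_iff vec_eq_iff forall_2)
    moreover have "?x \<in> polar_dom" using y by (simp add: in_sector_iff polar_dom_def)
    ultimately show "y \<in> polar ` polar_dom" by (metis image_eqI)
  qed
qed

lemma inj_on_polar: "inj_on polar polar_dom"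
proof (rule inj_onI)
  fix x y assume xy: "x \<in> polar_dom" "y \<in> polar_dom" "polar x = polar y"
  then have "x $ 1 = y $ 1" "x $ 2 = y $ 2"
    using norm_polar[OF xy(1)] norm_polar[OF xy(2)] Arg_polar[OF xy(1)] Arg_polar[OF xy(2)] by simp_all
  then show "x = y" by (simp add: vec_eq_iff forall_2)
qed

lemma polar_has_derivative:
  "(polar has_derivative (\<lambda>h. vector [cos (x $ 2) * h $ 1 - x $ 1 * sin (x $ 2) * h $ 2, sin (x $ 2) * h $ 1 + x $ 1 * cos (x $ 2) * h $ 2])) (at x within S)"
proof -
  have n: "((\<lambda>x::real^2. x $ i) has_derivative (\<lambda>h. h $ i)) (at x within S)" for i
    by (intro bounded_linear.has_derivative[OF bounded_linear_vec_nth] has_derivative_ident)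
  have "((\<lambda>x. (x $ 1 * cos (x $ 2)) *\<^sub>R (axis 1 1 :: real^2) + (x $ 1 * sin (x $ 2)) *\<^sub>R axis 2 1) has_derivative
      (\<lambda>h. (cos (x $ 2) * h $ 1 - x $ 1 * sin (x $ 2) * h $ 2) *\<^sub>R axis 1 1 + (sin (x $ 2) * h $ 1 + x $ 1 * cos (x $ 2) * h $ 2) *\<^sub>R axis 2 1)) (at x within S)"
    by (rule derivative_eq_intros n refl)+ (auto simp: algebra_simps)
  then show ?thesis by (simp only: polar_def[abs_def] vector2_conv_axis)
qed

lemma det_polar_derivative:
  "det (matrix (\<lambda>h::real^2. vector [cos b * h $ 1 - a * sin b * h $ 2, sin b * h $ 1 + a * cos b * h $ 2] :: real^2)) = a"
proof -
  have "det (matrix (\<lambda>h::real^2. vector [cos b * h $ 1 - a * sin b * h $ 2, sin b * h $ 1 + a * cos b * h $ 2] :: real^2))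
      = a * (cos b * cos b) + a * (sin b * sin b)"
    by (simp add: det_2 matrix_def axis_def algebra_simps)
  also have "\<dots> = a * ((sin b)\<^sup>2 + (cos b)\<^sup>2)" by algebra
  finally show ?thesis by simp
qed

lemma open_polar_dom: "open polar_dom"
  unfolding polar_dom_def by (intro open_Collect_conj open_Collect_less continuous_intros)

lemma integral_sector_polar:
  fixes f :: "real^2 \<Rightarrow> complex"
  assumes f: "integrable (lebesgue_on W) f"
  shows "integrable (lebesgue_on polar_dom) (\<lambda>x. x $ 1 *\<^sub>R f (polar x))"
    and "(LINT x|lebesgue_on polar_dom. x $ 1 *\<^sub>R f (polar x)) = (LINT y|lebesgue_on W. f y)"
proof -
  have Ws: "W \<in> sets lebesgue" "polar_dom \<in> sets lebesgue" using open_sector open_polar_dom by auto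
  \<comment> \<open>The change of variables theorem concerns maps between Cartesian spaces, so
    complex values travel through \<open>real^2\<close> and return by \<open>vec2c\<close>.\<close>
  define toV where "toV z = (vector [Re z, Im z] :: real^2)" for z
  have blV: "bounded_linear toV"
    by (rule bounded_linear_intro[where K=1]) (simp_all add: toV_def vec_eq_iff forall_2 norm_vec2 cmod_def)
  have inv: "vec2c (toV z) = z" for z by (simp add: toV_def complex_eq_iff)
  have "(\<lambda>y. toV (f y)) absolutely_integrable_on W"
    unfolding set_integral_lebesgue_on(2)[OF Ws(1)] by (rule integrable_bounded_linear[OF blV f])
  then have a: "(\<lambda>y. toV (f y)) absolutely_integrable_on polar ` polar_dom \<and>
      integral (polar ` polar_dom) (\<lambda>y. toV (f y)) = integral W (\<lambda>y. toV (f y))"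
    by (simp add: polar_image)
  let ?g' = "\<lambda>x h. vector [cos (x $ 2) * h $ 1 - x $ 1 * sin (x $ 2) * h $ 2, sin (x $ 2) * h $ 1 + x $ 1 * cos (x $ 2) * h $ 2] :: real^2"
  have b: "(\<lambda>x. \<bar>det (matrix (?g' x))\<bar> *\<^sub>R toV (f (polar x))) absolutely_integrable_on polar_dom \<and>
      integral polar_dom (\<lambda>x. \<bar>det (matrix (?g' x))\<bar> *\<^sub>R toV (f (polar x))) = integral W (\<lambda>y. toV (f y))"
    using has_absolute_integral_change_of_variables[OF Ws(2) polar_has_derivative inj_on_polar,
        of "\<lambda>y. toV (f y)" "integral W (\<lambda>y. toV (f y))"] a by blast
  have e: "integrable (lebesgue_on polar_dom) (\<lambda>x. \<bar>x $ 1\<bar> *\<^sub>R toV (f (polar x)))"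
    using b unfolding det_polar_derivative set_integral_lebesgue_on(2)[OF Ws(2)] by blast
  have v: "vec2c (\<bar>x $ 1\<bar> *\<^sub>R toV (f (polar x))) = x $ 1 *\<^sub>R f (polar x)" if "x \<in> space (lebesgue_on polar_dom)" for x
    using that by (simp add: inv polar_dom_def)
  have "integrable (lebesgue_on polar_dom) (\<lambda>x. vec2c (\<bar>x $ 1\<bar> *\<^sub>R toV (f (polar x))))"
    by (rule integrable_bounded_linear[OF bounded_linear_vec2c e])
  then show "integrable (lebesgue_on polar_dom) (\<lambda>x. x $ 1 *\<^sub>R f (polar x))"
    by (subst Bochner_Integration.integrable_cong[OF refl v, symmetric])
  have "(LINT x|lebesgue_on polar_dom. x $ 1 *\<^sub>R f (polar x)) = (LINT x|lebesgue_on polar_dom. vec2c (\<bar>x $ 1\<bar> *\<^sub>R toV (f (polar x))))"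
    by (rule Bochner_Integration.integral_cong[OF refl v[symmetric]])
  also have "\<dots> = vec2c (LINT x|lebesgue_on polar_dom. \<bar>x $ 1\<bar> *\<^sub>R toV (f (polar x)))"
    by (rule integral_bounded_linear[OF bounded_linear_vec2c e])
  also have "(LINT x|lebesgue_on polar_dom. \<bar>x $ 1\<bar> *\<^sub>R toV (f (polar x))) = integral W (\<lambda>y. toV (f y))"
    using b e unfolding det_polar_derivative by (simp add: lebesgue_integral_eq_integral Ws)
  also have "\<dots> = (LINT y|lebesgue_on W. toV (f y))"
    using integrable_bounded_linear[OF blV f] by (simp add: lebesgue_integral_eq_integral Ws)
  also have "\<dots> = toV (LINT y|lebesgue_on W. f y)" by (rule integral_bounded_linear[OF blV f])
  finally show "(LINT x|lebesgue_on polar_dom. x $ 1 *\<^sub>R f (polar x)) = (LINT y|lebesgue_on W. f y)" by (simp add: inv)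
qed

text \<open>With \<open>Z = r exp (\<i> t) - p\<close> the integrand \<open>r / Z\<^sup>5\<close> is \<open>exp (- \<i> t) (1 / Z\<^sup>4 + p / Z\<^sup>5)\<close>.\<close>

lemma radial_antiderivative:
  fixes Z p :: complex
  assumes "Z \<noteq> 0"
  shows "((\<lambda>Z. - 1 / (3 * Z ^ 3) - p / (4 * Z ^ 4)) has_field_derivative (1 / Z ^ 4 + p / Z ^ 5)) (at Z)"
proof -
  have "((\<lambda>Z. - 1 / (3 * Z ^ 3)) has_field_derivative 1 / Z ^ 4) (at Z)"
    using assms by (auto intro!: derivative_eq_intros simp: field_simps eval_nat_numeral)
  moreover have "((\<lambda>Z. p / (4 * Z ^ 4)) has_field_derivative - p / Z ^ 5) (at Z)"
    using assms by (auto intro!: derivative_eq_intros simp: field_simps eval_nat_numeral)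
  ultimately show ?thesis by (rule DERIV_cong[OF DERIV_diff]) simp
qed

text \<open>With r = (Z + p) exp(-i t) the differential contributes a second factor exp(-i t). The
  antiderivative vanishes at infinity, and at r = 0, where Z = -p, its two terms combine with 1/3 -
  1/4 = 1/12.\<close>

lemma radial_integral:
  assumes t: "\<theta>\<^sub>m < t" "t < \<theta>\<^sub>M"
  shows "(LINT r|lborel. indicator {0<..} r *\<^sub>R (r *\<^sub>R (1 / (rcis r t - pole) ^ 5))) = cis (- 2 * t) / (12 * (- pole) ^ 3)"
proof -
  let ?Z = "\<lambda>r. rcis r t - pole"
  let ?f = "\<lambda>r. r *\<^sub>R (1 / ?Z r ^ 5)"
  let ?F = "\<lambda>r. cis (- 2 * t) * (- 1 / (3 * ?Z r ^ 3) - pole / (4 * ?Z r ^ 4))"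
  have Zge: "norm (?Z r) \<ge> sep * (1 + r)" if "r > 0" for r
  proof -
    have d: "vector [r, t] \<in> polar_dom" using that t by (simp add: polar_dom_def)
    then have "polar (vector [r, t]) \<in> W" using polar_image by blast
    from dist_pole_ge[OF this] show ?thesis using norm_polar[OF d] by (simp add: vec2c_polar)
  qed
  have p0: "pole \<noteq> 0" by (simp add: pole_def)
  have Z0: "?Z r \<noteq> 0" if "r \<ge> 0" for r
  proof (cases "r = 0")
    case True then show ?thesis using p0 by simp
  next
    case False
    then have "0 < sep * (1 + r)" using that sep_pos by simp
    with Zge[of r] False that have "0 < norm (?Z r)" by linarith
    then show ?thesis by simp
  qed
  have der: "(?F has_vector_derivative ?f r) (at r)" if "r > 0" for r
  proof -
    have "((\<lambda>z. cis (- 2 * t) * (- 1 / (3 * (z * cis t - pole) ^ 3) - pole / (4 * (z * cis t - pole) ^ 4)))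
        has_field_derivative (of_real r / ?Z r ^ 5)) (at (of_real r))"
    proof -
      define Z where "Z = of_real r * cis t - pole"
      have Z: "Z \<noteq> 0" using Z0[of r] that by (simp add: Z_def rcis_def)
      have "((\<lambda>z. cis (- 2 * t) * (- 1 / (3 * (z * cis t - pole) ^ 3) - pole / (4 * (z * cis t - pole) ^ 4)))
        has_field_derivative (cis (- 2 * t) * cis t * (1 / Z ^ 4 + pole / Z ^ 5))) (at (of_real r))"
      proof -
        have "((\<lambda>z. z * cis t - pole) has_field_derivative cis t) (at (of_real r))"
          by (auto intro!: derivative_eq_intros)
        from DERIV_cmult[OF DERIV_chain2[OF radial_antiderivative[OF Z[unfolded Z_def], of pole] this], of "cis (- 2 * t)"]
        show ?thesis unfolding Z_def by (simp add: mult_ac)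
      qed
      moreover have "cis (- 2 * t) * cis t * (1 / Z ^ 4 + pole / Z ^ 5) = of_real r / Z ^ 5"
      proof -
        have "1 / Z ^ 4 + pole / Z ^ 5 = (Z + pole) / Z ^ 5" using Z by (simp add: field_simps power_numeral_reduce)
        also have "Z + pole = of_real r * cis t" by (simp add: Z_def)
        finally have "cis (- 2 * t) * cis t * (1 / Z ^ 4 + pole / Z ^ 5) = (cis (- 2 * t) * cis t * cis t) * of_real r / Z ^ 5"
          by (simp add: mult_ac)
        also have "cis (- 2 * t) * cis t * cis t = 1" by (simp add: cis_mult)
        finally show ?thesis by simp
      qed
      ultimately show ?thesis by (simp add: Z_def rcis_def)
    qed
    then have "((\<lambda>r. cis (- 2 * t) * (- 1 / (3 * (of_real r * cis t - pole) ^ 3) - pole / (4 * (of_real r * cis t - pole) ^ 4)))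
        has_vector_derivative (of_real r / ?Z r ^ 5)) (at r)"
      by (rule has_vector_derivative_real_field)
    then show ?thesis by (simp add: rcis_def scaleR_conv_of_real)
  qed
  have contZ: "continuous_on {0..} ?Z" unfolding rcis_def by (intro continuous_intros)
  \<comment> \<open>By the distance to the pole the integrand is of order r / (1 + r)^5, which is at
    most 1 / (1 + r^2), the derivative of the arctangent.\<close>
  have int: "set_integrable lborel (einterval 0 \<infinity>) ?f"
  proof -
    have i: "integrable lborel (\<lambda>r::real. 1 / sep ^ 5 * (1 / (1 + r\<^sup>2)))"
      using nn_integral_inverse_1_plus_square
      by (intro integrable_mult_right integrableI_nonneg) auto
    show ?thesis
      unfolding set_integrable_def
    proof (rule Bochner_Integration.integrable_bound[OF i])
      show "(\<lambda>r. indicator (einterval 0 \<infinity>) r *\<^sub>R ?f r) \<in> borel_measurable lborel"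
        unfolding rcis_def by measurable
      have "norm (indicator (einterval 0 \<infinity>) r *\<^sub>R ?f r) \<le> norm (1 / sep ^ 5 * (1 / (1 + r\<^sup>2)))" for r
      proof (cases "r > 0")
        case True
        have "r * (1 + r\<^sup>2) \<le> (1 + r) ^ 5"
        proof -
          have "r * (1 + r\<^sup>2) \<le> (1 + r) * (1 + r)\<^sup>2"
            using True by (intro mult_mono) (auto simp: power2_eq_square algebra_simps)
          also have "\<dots> = (1 + r) ^ 3" by algebra
          also have "\<dots> \<le> (1 + r) ^ 5" using True by (intro power_increasing) auto
          finally show ?thesis .
        qed
        moreover have "(sep * (1 + r)) ^ 5 \<le> norm (?Z r) ^ 5" using Zge[OF True] sep_pos True by (intro power_mono) auto
        ultimately have "sep ^ 5 * (r * (1 + r\<^sup>2)) \<le> norm (?Z r) ^ 5"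
          using sep_pos by (simp add: power_mult_distrib) (meson mult_left_mono order_trans zero_le_power less_imp_le)
        moreover have "r / N \<le> 1 / a * (1 / q)" if "0 < a" "0 < q" "0 < N" "a * (r * q) \<le> N" for a q N :: real
          using that by (simp add: divide_le_eq le_divide_eq mult_ac)
        moreover have "norm (?Z r) ^ 5 > 0" using Z0[of r] True by simp
        moreover have "1 + r\<^sup>2 > 0" by (simp add: add_pos_nonneg)
        moreover have "sep ^ 5 > 0" using sep_pos by simp
        ultimately have "r / norm (?Z r) ^ 5 \<le> 1 / sep ^ 5 * (1 / (1 + r\<^sup>2))" by blast
        then have "norm (indicator (einterval 0 \<infinity>) r *\<^sub>R ?f r) \<le> 1 / sep ^ 5 * (1 / (1 + r\<^sup>2))"
          using True by (auto simp: norm_divide norm_power einterval_def indicator_def)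
        then show ?thesis by (rule order_trans) (simp only: real_norm_def abs_ge_self)
      qed (simp add: einterval_def zero_ereal_def indicator_def)
      then show "AE r in lborel. norm (indicator (einterval 0 \<infinity>) r *\<^sub>R ?f r) \<le> norm (1 / sep ^ 5 * (1 / (1 + r\<^sup>2)))" by simp
    qed
  qed
  have "(LBINT r=0..\<infinity>. ?f r) = 0 - ?F 0"
  proof (rule interval_integral_FTC_integrable[OF _ _ _ int, where F="?F"])
    show "(?F has_vector_derivative ?f r) (at r)" if "0 < ereal r" "ereal r < \<infinity>" for r
      using that by (intro der) simp
    show "isCont ?f r" if "0 < ereal r" "ereal r < \<infinity>" for r
      using Z0[of r] that unfolding rcis_def by (intro continuous_intros) (auto simp: rcis_def)
    have "isCont ?F 0" using Z0[of 0] unfolding rcis_def by (intro continuous_intros) (auto simp: rcis_def)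
    then have "(?F \<longlongrightarrow> ?F 0) (at_right 0)" by (simp add: isCont_def filterlim_at_split)
    then show "((?F \<circ> real_of_ereal) \<longlongrightarrow> ?F 0) (at_right 0)"
      by (simp add: zero_ereal_def ereal_tendsto_simps)
    have "(?F \<longlongrightarrow> cis (- 2 * t) * (0 - 0)) at_top"
    proof (intro tendsto_intros)
      have nt: "filterlim (\<lambda>r. norm (?Z r)) at_top at_top"
      proof (rule filterlim_at_top_mono)
        show "filterlim (\<lambda>r. sep * (1 + r)) at_top at_top"
          by (intro filterlim_tendsto_pos_mult_at_top[OF tendsto_const sep_pos] filterlim_tendsto_add_at_top[OF tendsto_const] filterlim_ident)
        show "\<forall>\<^sub>F r in at_top. sep * (1 + r) \<le> norm (?Z r)"
          using eventually_gt_at_top[of 0] by eventually_elim (rule Zge)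
      qed
      have inf: "filterlim (\<lambda>r. ?Z r ^ n) at_infinity at_top" if "n > 0" for n
        by (rule filterlim_norm_at_top_imp_at_infinity) (simp only: norm_power filterlim_pow_at_top[OF that nt])
      have pw: "filterlim (\<lambda>r. c * ?Z r ^ n) at_infinity at_top" if "n > 0" "c \<noteq> 0" for n and c :: complex
        using that by (intro tendsto_mult_filterlim_at_infinity[OF tendsto_const] inf)
      show "((\<lambda>r. - 1 / (3 * ?Z r ^ 3)) \<longlongrightarrow> 0) at_top" "((\<lambda>r. pole / (4 * ?Z r ^ 4)) \<longlongrightarrow> 0) at_top"
        by (intro tendsto_divide_0[OF tendsto_const] pw; simp)+
    qed
    then show "((?F \<circ> real_of_ereal) \<longlongrightarrow> 0) (at_left \<infinity>)"
      by (simp add: ereal_tendsto_simps)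
  qed simp
  moreover have "(LBINT r=0..\<infinity>. ?f r) = (LINT r|lborel. indicator {0<..} r *\<^sub>R ?f r)"
  proof -
    have "einterval 0 \<infinity> = {0<..}" by (auto simp: einterval_def zero_ereal_def)
    then show ?thesis by (simp add: interval_lebesgue_integral_def set_lebesgue_integral_def zero_ereal_def)
  qed
  moreover have "0 - ?F 0 = cis (- 2 * t) / (12 * (- pole) ^ 3)"
    using p0 by (simp add: rcis_def field_simps power_numeral_reduce)
  ultimately show ?thesis by simp
qed

lemma sector_integral_\<eta>:
  "(LINT y|lebesgue_on W. \<eta> y) = \<i> / 2 * (cis (- 2 * \<theta>\<^sub>M) - cis (- 2 * \<theta>\<^sub>m)) / (12 * (- pole) ^ 3)"
proof -
  let ?K = "12 * (- pole) ^ 3"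
  let ?h = "\<lambda>x. indicator polar_dom x *\<^sub>R (x $ 1 *\<^sub>R \<eta> (polar x))"
  have pd: "polar_dom \<in> sets borel" using open_polar_dom by (rule borel_open)
  have pm: "polar \<in> borel_measurable borel" unfolding polar_def by (intro borel_measurable_continuous_onI continuous_intros)
  have hm: "?h \<in> borel_measurable lborel"
  proof -
    have [measurable]: "(\<lambda>y. vec2c y) \<in> borel_measurable borel" by (intro borel_measurable_continuous_onI continuous_intros)
    note pd[measurable] pm[measurable]
    show ?thesis unfolding \<eta>_def by measurable
  qed
  have "integrable lebesgue ?h"
    using integral_sector_polar(1)[OF integrable_\<eta>] pd by (simp add: integrable_restrict_space)
  then have hi: "integrable lborel ?h" using integrable_completion[OF hm] by simp
  note v2 = integral_vector2[OF hi]
  have "(LINT y|lebesgue_on W. \<eta> y) = (LINT x|lebesgue_on polar_dom. x $ 1 *\<^sub>R \<eta> (polar x))"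
    by (rule integral_sector_polar(2)[OF integrable_\<eta>, symmetric])
  also have "\<dots> = (LINT x|lebesgue. ?h x)" using pd by (simp add: integral_restrict_space)
  also have "\<dots> = (LINT x|lborel. ?h x)" by (rule integral_completion[OF hm])
  also have "\<dots> = (LINT p|(lborel \<Otimes>\<^sub>M lborel). ?h (vector [fst p, snd p]))" by (rule v2(2))
  also have "\<dots> = (LINT t|lborel. LINT r|lborel. ?h (vector [r, t]))"
    using lborel_pair.integral_snd[of "\<lambda>r t. ?h (vector [r, t])"] v2(1) by (simp add: case_prod_beta')
  also have "\<dots> = (LINT t|lborel. indicator {\<theta>\<^sub>m<..<\<theta>\<^sub>M} t *\<^sub>R (cis (- 2 * t) / ?K))"
  proof (rule Bochner_Integration.integral_cong[OF refl])
    fix t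
    show "(LINT r|lborel. ?h (vector [r, t])) = indicator {\<theta>\<^sub>m<..<\<theta>\<^sub>M} t *\<^sub>R (cis (- 2 * t) / ?K)"
    proof (cases "t \<in> {\<theta>\<^sub>m<..<\<theta>\<^sub>M}")
      case True
      then have "(\<lambda>r. ?h (vector [r, t])) = (\<lambda>r. indicator {0<..} r *\<^sub>R (r *\<^sub>R (1 / (rcis r t - pole) ^ 5)))"
        by (auto simp: fun_eq_iff indicator_def polar_dom_def \<eta>_def vec2c_polar)
      with True radial_integral[of t] show ?thesis by simp
    qed (simp add: polar_dom_def)
  qed
  \<comment> \<open>Adding the two end points, a null set, gives the compact interval on which the
    fundamental theorem is applied.\<close>
  also have "\<dots> = (LINT t|lborel. indicator {\<theta>\<^sub>m..\<theta>\<^sub>M} t *\<^sub>R (cis (- 2 * t) / ?K))"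
  proof (rule integral_cong_AE)
    show "AE t in lborel. indicator {\<theta>\<^sub>m<..<\<theta>\<^sub>M} t *\<^sub>R (cis (- 2 * t) / ?K) = indicator {\<theta>\<^sub>m..\<theta>\<^sub>M} t *\<^sub>R (cis (- 2 * t) / ?K)"
      using AE_lborel_singleton[of \<theta>\<^sub>m] AE_lborel_singleton[of \<theta>\<^sub>M] by eventually_elim (auto simp: indicator_def)
    have [measurable]: "(\<lambda>t. cis (- 2 * t) / ?K) \<in> borel_measurable borel"
      by (intro borel_measurable_continuous_onI continuous_intros) (simp add: pole_def)
    show "(\<lambda>t. indicator {\<theta>\<^sub>m<..<\<theta>\<^sub>M} t *\<^sub>R (cis (- 2 * t) / ?K)) \<in> borel_measurable lborel"
      "(\<lambda>t. indicator {\<theta>\<^sub>m..\<theta>\<^sub>M} t *\<^sub>R (cis (- 2 * t) / ?K)) \<in> borel_measurable lborel" by measurable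
  qed
  also have "\<dots> = \<i> / 2 * cis (- 2 * \<theta>\<^sub>M) / ?K - \<i> / 2 * cis (- 2 * \<theta>\<^sub>m) / ?K"
  proof (rule integral_FTC_Icc)
    show "\<theta>\<^sub>m \<le> \<theta>\<^sub>M" using \<theta>_bounds by simp
    show "continuous_on {\<theta>\<^sub>m..\<theta>\<^sub>M} (\<lambda>t. cis (- 2 * t) / ?K)"
      by (intro continuous_intros) (simp add: pole_def)
    fix t
    have "((\<lambda>z. \<i> / 2 * exp (\<i> * (- 2 * z)) / ?K) has_field_derivative (exp (\<i> * (- 2 * of_real t)) / ?K)) (at (of_real t))"
      by (rule DERIV_cdivide) (auto intro!: derivative_eq_intros)
    then have "((\<lambda>t. \<i> / 2 * exp (\<i> * (- 2 * of_real t)) / ?K) has_vector_derivative (exp (\<i> * (- 2 * of_real t)) / ?K)) (at t within {\<theta>\<^sub>m..\<theta>\<^sub>M})"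
      by (rule has_vector_derivative_real_field)
    then show "((\<lambda>t. \<i> / 2 * cis (- 2 * t) / ?K) has_vector_derivative (cis (- 2 * t) / ?K)) (at t within {\<theta>\<^sub>m..\<theta>\<^sub>M})"
      by (simp add: cis_conv_exp)
  qed
  also have "\<dots> = \<i> / 2 * (cis (- 2 * \<theta>\<^sub>M) - cis (- 2 * \<theta>\<^sub>m)) / ?K"
    by (simp add: diff_divide_distrib right_diff_distrib)
  finally show ?thesis .
qed

text \<open>Equality of exp(-2 i t) at both ends makes the opening an integer multiple of pi;
  strictly between 0 and 2 pi the only one is pi itself.\<close>

lemma sector_integral_\<eta>_nonzero:
  assumes "\<theta>\<^sub>M - \<theta>\<^sub>m \<noteq> pi"
  shows "(LINT y|lebesgue_on W. \<eta> y) \<noteq> 0"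
proof -
  have "cis (- 2 * \<theta>\<^sub>M) \<noteq> cis (- 2 * \<theta>\<^sub>m)"
  proof
    assume "cis (- 2 * \<theta>\<^sub>M) = cis (- 2 * \<theta>\<^sub>m)"
    then obtain n :: int where "\<i> * of_real (- 2 * \<theta>\<^sub>M) = \<i> * of_real (- 2 * \<theta>\<^sub>m) + (of_int (2 * n) * pi) * \<i>"
      unfolding cis_conv_exp exp_eq by blast
    then have "Im (\<i> * of_real (- 2 * \<theta>\<^sub>M)) = Im (\<i> * of_real (- 2 * \<theta>\<^sub>m) + (of_int (2 * n) * pi) * \<i>)" by simp
    then have n: "\<theta>\<^sub>M - \<theta>\<^sub>m = - real_of_int n * pi" by simp
    then have "0 < - real_of_int n * pi" "- real_of_int n * pi < 2 * pi" using \<theta>_bounds by auto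
    then have "0 < - real_of_int n" "- real_of_int n < 2"
      using mult_less_cancel_right_pos[OF pi_gt_zero] zero_less_mult_pos2[OF _ pi_gt_zero] by blast+
    then have "n = - 1" by linarith
    with n assms show False by simp
  qed
  then show ?thesis unfolding sector_integral_\<eta> by (simp add: pole_def)
qed

end

section \<open>The corner test function\<close>

lemma smooth_pd:
  assumes "smooth f" "b \<in> Basis"
  shows "smooth (pd b f)"
  unfolding smooth_def
proof (intro allI impI)
  fix bs :: "'a list" and x assume bs: "set bs \<subseteq> Basis"
  \<comment> \<open>\<open>foldr\<close> applies the last entry of the list first, so the additional
    derivative is appended at the end.\<close>
  have "iterated_pd (bs @ [b]) f differentiable (at x)"
    using assms(1)[unfolded smooth_def, rule_format, of "bs @ [b]" x] bs assms(2) by simp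
  then show "iterated_pd bs (pd b f) differentiable (at x)" by (simp add: iterated_pd_def)
qed

lemma has_dir_deriv_add:
  assumes "has_dir_deriv f b D x" "has_dir_deriv g b E x"
  shows "has_dir_deriv (\<lambda>x. f x + g x) b (D + E) x"
  using has_vector_derivative_add[OF assms[unfolded has_dir_deriv_def]] by (simp add: has_dir_deriv_def)

lemma has_dir_deriv_const: "has_dir_deriv (\<lambda>x. c) b 0 x"
  by (simp add: has_dir_deriv_def)

lemma has_dir_deriv_coord: "has_dir_deriv (\<lambda>x. of_real (x $ i)) b (of_real (b $ i)) (x :: real^'n)"
  unfolding has_dir_deriv_def
  by (rule bounded_linear.has_vector_derivative[OF bounded_linear_of_real]) (auto intro!: derivative_eq_intros)

text \<open>The bound on n serves the point 0: there the difference quotient is at most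
  \<open>(max 0 h) ^ n\<close>, which tends to 0 only for a positive exponent.\<close>

lemma max_power_has_derivative:
  assumes "n \<ge> 1"
  shows "((\<lambda>t::real. (max 0 t) ^ Suc n) has_real_derivative (real (Suc n) * (max 0 t) ^ n)) (at t)"
proof -
  have n: "0 ^ n = (0::real)" using assms by simp
  consider "t < 0" | "t > 0" | "t = 0" by linarith
  then show ?thesis
  proof cases
    case 1
    have "((\<lambda>_. 0) has_real_derivative 0) (at t)" by simp
    then have "((\<lambda>t::real. (max 0 t) ^ Suc n) has_real_derivative 0) (at t)"
      by (rule has_field_derivative_transform_within_open[of _ _ _ "{..<0}"]) (use 1 in auto)
    moreover have "real (Suc n) * (max 0 t) ^ n = 0" using 1 n by simp
    ultimately show ?thesis by (simp only:)
  next
    case 2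
    have "((\<lambda>t. t ^ Suc n) has_real_derivative (real (Suc n) * t ^ n)) (at t)"
      using DERIV_pow[of "Suc n" t] by simp
    then have "((\<lambda>t::real. (max 0 t) ^ Suc n) has_real_derivative (real (Suc n) * t ^ n)) (at t)"
      by (rule has_field_derivative_transform_within_open[of _ _ _ "{0<..}"]) (use 2 in auto)
    then show ?thesis using 2 by simp
  next
    case 3
    have "((\<lambda>h. (max 0 h) ^ n) \<longlongrightarrow> (max 0 0) ^ n) (at (0::real))" by (intro tendsto_intros)
    then have l0: "((\<lambda>h. (max 0 h) ^ n) \<longlongrightarrow> 0) (at (0::real))" by (simp only: max.idem n)
    have "((\<lambda>h. ((max 0 (0 + h)) ^ Suc n - (max 0 0) ^ Suc n) / h) \<longlongrightarrow> 0) (at (0::real))"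
    proof (rule Lim_null_comparison[OF _ l0])
      have "norm (((max 0 (0 + h)) ^ Suc n - (max 0 0) ^ Suc n) / h) \<le> (max 0 h) ^ n" for h :: real
        by (cases "h > 0") (auto simp: max_def)
      then show "\<forall>\<^sub>F h in at 0. norm (((max 0 (0 + h)) ^ Suc n - (max 0 0) ^ Suc n) / h) \<le> (max 0 h) ^ n" for x :: real
        by simp
    qed
    then have "((\<lambda>t::real. (max 0 t) ^ Suc n) has_real_derivative 0) (at 0)" unfolding DERIV_def .
    moreover have "real (Suc n) * (max 0 t) ^ n = 0" using 3 n by simp
    ultimately show ?thesis using 3 by (simp only:)
  qed
qed

text \<open>A single scale \<open>e\<close> is fixed; the limit argument instantiates the locale
  once for each member of a sequence. That \<open>e\<close> is below \<open>h\<close> places the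
  pole, at distance \<open>e\<close> from the axis, inside the disc where \<Omega> is known to be a
  sector.\<close>

locale sector_test = plane_sector +
  fixes \<Omega> :: "(real^3) set" and h M e :: real and \<psi> :: "real \<Rightarrow> real"
  assumes h: "h > 0" and e: "0 < e" "e < h"
    and \<Omega>: "open \<Omega>" "bounded \<Omega>"
    and D: "cyl (ball 0 h) {-M<..<M} \<inter> \<Omega> = cyl (truncated_sector \<theta>\<^sub>m \<theta>\<^sub>M h) {-M<..<M}"
    and \<psi>: "test_function {-M<..<M} \<psi>"
begin

abbreviation "DD \<equiv> cyl (truncated_sector \<theta>\<^sub>m \<theta>\<^sub>M h) {-M<..<M}"

text \<open>The test function and its derivatives are polynomials in these atoms, so
  differentiation, continuity and boundedness have to be settled only for the atoms. At the pole
  \<open>Zi\<close> has the value 0 by the convention for inverses and is not continuous.\<close>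

definition Zf :: "real^3 \<Rightarrow> complex" where "Zf x = vec2c (proj2 x /\<^sub>R e) - pole"
definition Zi :: "real^3 \<Rightarrow> complex" where "Zi x = inverse (Zf x)"
definition Xf :: "real^3 \<Rightarrow> real" where "Xf x = 1 - ((x $ 1)\<^sup>2 + (x $ 2)\<^sup>2) / h\<^sup>2"
definition Q :: "nat \<Rightarrow> real^3 \<Rightarrow> complex" where "Q n x = of_real ((max 0 (Xf x)) ^ n)"
definition Y :: "3 \<Rightarrow> real^3 \<Rightarrow> complex" where "Y i x = of_real (x $ i)"
definition P :: "(real \<Rightarrow> real) \<Rightarrow> real^3 \<Rightarrow> complex" where "P f x = of_real (f (x $ 3))"

abbreviation "\<psi>1 \<equiv> pd 1 \<psi>"
abbreviation "\<psi>2 \<equiv> pd 1 \<psi>1"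
definition ca :: complex where "ca = of_real (1 / h\<^sup>2)"
definition cc :: complex where "cc = of_real (1 / e)"

definition supp :: "real set" where "supp = closure {t. \<psi> t \<noteq> 0}"

lemma supp: "compact supp" "supp \<subseteq> {-M<..<M}"
  using \<psi> by (auto simp: test_function_def supp_def)

lemma \<psi>_smooth: "smooth \<psi>" "smooth \<psi>1"
  using \<psi> smooth_pd[of \<psi> 1] by (auto simp: test_function_def)

lemma pd_support_eq_0:
  assumes "smooth f" "\<And>t. t \<notin> supp \<Longrightarrow> f t = 0" "t \<notin> supp"
  shows "pd 1 f t = (0::real)"
proof -
  have "complex_of_real (pd 1 f t) = 0"
    by (rule has_dir_deriv_0_outside[OF supp(1) _ assms(3) smooth_has_dir_deriv_of_real[OF assms(1)]])
      (subst assms(2), assumption, simp)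
  then show ?thesis by simp
qed

lemma outside_supp: "t \<notin> supp \<Longrightarrow> \<psi> t = 0" "t \<notin> supp \<Longrightarrow> \<psi>1 t = 0" "t \<notin> supp \<Longrightarrow> \<psi>2 t = 0"
proof -
  have 0: "\<psi> t = 0" if "t \<notin> supp" for t using test_function_eq_0[OF \<psi>] that unfolding supp_def .
  have 1: "\<psi>1 t = 0" if "t \<notin> supp" for t by (rule pd_support_eq_0[OF \<psi>_smooth(1) 0 that])
  have 2: "\<psi>2 t = 0" if "t \<notin> supp" for t by (rule pd_support_eq_0[OF \<psi>_smooth(2) 1 that])
  show "t \<notin> supp \<Longrightarrow> \<psi> t = 0" "t \<notin> supp \<Longrightarrow> \<psi>1 t = 0" "t \<notin> supp \<Longrightarrow> \<psi>2 t = 0" by (fact 0 1 2)+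
qed

lemma cont_\<psi>: "continuous_on UNIV \<psi>" "continuous_on UNIV \<psi>1" "continuous_on UNIV \<psi>2"
  using \<psi>_smooth smooth_imp_continuous_pd[OF \<psi>_smooth(2), of 1] by (auto intro: smooth_imp_has_derivative(2))

lemma has_dir_deriv_P:
  assumes "smooth f"
  shows "has_dir_deriv (P f) b (of_real (b $ 3) * P (pd 1 f) x) x"
proof -
  have "((\<lambda>s. f (x $ 3 + s *\<^sub>R 1)) has_vector_derivative pd 1 f (x $ 3)) (at (0 * b $ 3))"
    using smooth_has_vector_derivative_line[OF assms, of "x $ 3" 1] by simp
  moreover have "((\<lambda>t. t * b $ 3) has_vector_derivative b $ 3) (at 0)"
    by (auto intro!: derivative_eq_intros)
  ultimately have "((\<lambda>t. f (x $ 3 + (t * b $ 3) *\<^sub>R 1)) has_vector_derivative b $ 3 *\<^sub>R pd 1 f (x $ 3)) (at 0)"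
    using vector_diff_chain_at[of "\<lambda>t. t * b $ 3" "b $ 3" 0 "\<lambda>s. f (x $ 3 + s *\<^sub>R 1)"] by (simp add: o_def)
  from bounded_linear.has_vector_derivative[OF bounded_linear_of_real this]
  show ?thesis by (simp add: has_dir_deriv_def P_def)
qed

lemma has_dir_deriv_Q:
  assumes "n \<ge> 1"
  shows "has_dir_deriv (Q (Suc n)) b (of_nat (Suc n) * Q n x * (- 2 * ca * (Y 1 x * of_real (b $ 1) + Y 2 x * of_real (b $ 2)))) x"
proof -
  have "((\<lambda>t. Xf (x + t *\<^sub>R b)) has_real_derivative (- 2 * (1 / h\<^sup>2) * (x $ 1 * b $ 1 + x $ 2 * b $ 2))) (at 0)"
    unfolding Xf_def using h by (auto intro!: derivative_eq_intros simp: field_simps power2_eq_square)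
  from DERIV_chain2[OF max_power_has_derivative[OF assms] this]
  have "((\<lambda>t. (max 0 (Xf (x + t *\<^sub>R b))) ^ Suc n) has_vector_derivative
      (real (Suc n) * (max 0 (Xf x)) ^ n * (- 2 * (1 / h\<^sup>2) * (x $ 1 * b $ 1 + x $ 2 * b $ 2)))) (at 0)"
    by (simp add: has_real_derivative_iff_has_vector_derivative)
  from bounded_linear.has_vector_derivative[OF bounded_linear_of_real this]
  show ?thesis
    unfolding has_dir_deriv_def Q_def Y_def ca_def
    by (rule has_vector_derivative_eq_rhs) (simp only: of_real_mult of_real_add of_real_minus of_real_numeral of_real_of_nat_eq of_real_power)
qed

text \<open>The kernel is holomorphic in z, so its derivative in the direction b is the complex one
  times b1 + i b2. The squares of this factor for the two horizontal axes are 1 and -1, which is the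
  cancellation in the Laplacian.\<close>

lemma has_dir_deriv_Zi:
  assumes "Zf x \<noteq> 0"
  shows "has_dir_deriv (\<lambda>x. Zi x ^ n) b (- of_nat n * (cc * (of_real (b $ 1) + \<i> * of_real (b $ 2))) * Zi x ^ Suc n) x"
proof -
  define d where "d = cc * (of_real (b $ 1) + \<i> * of_real (b $ 2))"
  have Zl: "Zf (x + t *\<^sub>R b) = Zf x + of_real t * d" for t
      proof -
    have "vec2c (proj2 b /\<^sub>R e) = d"
      using e by (simp add: d_def cc_def complex_eq_iff field_simps)
    moreover have "proj2 (x + t *\<^sub>R b) = proj2 x + t *\<^sub>R proj2 b" by (simp add: vec_eq_iff forall_2)
    ultimately show ?thesis
      by (simp add: Zf_def bounded_linear.linear[OF bounded_linear_vec2c, THEN linear_add] scaleR_add_right scaleR_conv_of_real[where 'a=complex])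
  qed
  have "((\<lambda>z. inverse (Zf x + z * d) ^ n) has_field_derivative (- of_nat n * d * Zi x ^ Suc n)) (at (of_real 0))"
  proof -
    have "((\<lambda>z. inverse (Zf x + z * d)) has_field_derivative (- (d * (Zi x)\<^sup>2))) (at (of_real 0))"
      using assms by (auto intro!: derivative_eq_intros simp: Zi_def power2_eq_square)
    from DERIV_power[OF this, of n] show ?thesis
      by (rule DERIV_cong) (cases n; simp add: Zi_def power2_eq_square algebra_simps)
  qed
  from has_vector_derivative_real_field[OF this]
  show ?thesis by (simp add: has_dir_deriv_def Zl Zi_def d_def)
qed

text \<open>The exponent 3 of the cut-off is what two continuous derivatives require. In the trace of
  \<open>\<phi>''\<close> the two terms with \<open>30 * cc\<^sup>2\<close> cancel.\<close>

definition \<phi> :: "real^3 \<Rightarrow> complex" where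
  "\<phi> x = P \<psi> x * (Q 3 x * Zi x ^ 5)"

definition \<phi>' :: "real^3 \<Rightarrow> real^3 \<Rightarrow> complex" where
  "\<phi>' b x = (if b = axis 1 1 then P \<psi> x * (((- 6 * ca) * Y 1 x) * Q 2 x * Zi x ^ 5 + (- 5 * cc) * Q 3 x * Zi x ^ 6)
    else if b = axis 2 1 then P \<psi> x * (((- 6 * ca) * Y 2 x) * Q 2 x * Zi x ^ 5 + (- 5 * \<i> * cc) * Q 3 x * Zi x ^ 6)
    else P \<psi>1 x * (Q 3 x * Zi x ^ 5))"

definition \<phi>'' :: "real^3 \<Rightarrow> real^3 \<Rightarrow> complex" where
  "\<phi>'' b x = (if b = axis 1 1 then P \<psi> x * ((- 6 * ca * Q 2 x + 24 * ca\<^sup>2 * (Y 1 x)\<^sup>2 * Q 1 x) * Zi x ^ 5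
        + 60 * ca * cc * Y 1 x * Q 2 x * Zi x ^ 6 + 30 * cc\<^sup>2 * Q 3 x * Zi x ^ 7)
    else if b = axis 2 1 then P \<psi> x * ((- 6 * ca * Q 2 x + 24 * ca\<^sup>2 * (Y 2 x)\<^sup>2 * Q 1 x) * Zi x ^ 5
        + 60 * \<i> * ca * cc * Y 2 x * Q 2 x * Zi x ^ 6 - 30 * cc\<^sup>2 * Q 3 x * Zi x ^ 7)
    else P \<psi>2 x * (Q 3 x * Zi x ^ 5))"

section \<open>Differentiating the test function\<close>

lemma Basis_cases:
  assumes "b \<in> (Basis :: (real^3) set)"
  obtains "b = axis 1 1" | "b = axis 2 1" | "b = axis 3 1"
proof -
  obtain i where "b = axis i 1" using assms by (auto simp: Basis_vec_def)
  then show ?thesis using exhaust_3[of i] that by blast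
qed

lemma axis_neq [simp]:
  "axis 1 1 \<noteq> (axis 2 1 :: real^3)" "axis 2 1 \<noteq> (axis 1 1 :: real^3)" "axis 1 1 \<noteq> (axis 3 1 :: real^3)"
  "axis 3 1 \<noteq> (axis 1 1 :: real^3)" "axis 2 1 \<noteq> (axis 3 1 :: real^3)" "axis 3 1 \<noteq> (axis 2 1 :: real^3)"
  by (simp_all add: axis_eq_axis)

lemma axis_nth_3 [simp]:
  "axis 1 (1::real) $ (1::3) = 1" "axis 1 (1::real) $ (2::3) = 0" "axis 1 (1::real) $ (3::3) = 0"
  "axis 2 (1::real) $ (1::3) = 0" "axis 2 (1::real) $ (2::3) = 1" "axis 2 (1::real) $ (3::3) = 0"
  "axis 3 (1::real) $ (1::3) = 0" "axis 3 (1::real) $ (2::3) = 0" "axis 3 (1::real) $ (3::3) = 1"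
  by (simp_all add: axis_def)

lemma has_dir_deriv_eq: "has_dir_deriv f b D x \<Longrightarrow> D = E \<Longrightarrow> has_dir_deriv f b E x"
  by simp

lemma has_dir_deriv_Y: "has_dir_deriv (Y i) b (of_real (b $ i)) x"
  unfolding Y_def by (rule has_dir_deriv_coord)

lemma has_dir_deriv_\<phi>_nonsing:
  assumes "Zf x \<noteq> 0" "b \<in> Basis"
  shows "has_dir_deriv \<phi> b (\<phi>' b x) x" "has_dir_deriv (\<phi>' b) b (\<phi>'' b x) x"
proof -
  have Q3: "has_dir_deriv (Q 3) b (3 * Q 2 x * (- 2 * ca * (Y 1 x * of_real (b $ 1) + Y 2 x * of_real (b $ 2)))) x" for b
    using has_dir_deriv_Q[of 2 b x] by (simp add: numeral_3_eq_3)
  have Q2: "has_dir_deriv (Q 2) b (2 * Q 1 x * (- 2 * ca * (Y 1 x * of_real (b $ 1) + Y 2 x * of_real (b $ 2)))) x" for b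
    using has_dir_deriv_Q[of 1 b x] by (simp add: numeral_2_eq_2)
  have Z5: "has_dir_deriv (\<lambda>x. Zi x ^ 5) b (- 5 * (cc * (of_real (b $ 1) + \<i> * of_real (b $ 2))) * Zi x ^ 6) x" for b
    using has_dir_deriv_Zi[OF assms(1), of 5 b] by simp
  have Z6: "has_dir_deriv (\<lambda>x. Zi x ^ 6) b (- 6 * (cc * (of_real (b $ 1) + \<i> * of_real (b $ 2))) * Zi x ^ 7) x" for b
    using has_dir_deriv_Zi[OF assms(1), of 6 b] by simp
  note P0 = has_dir_deriv_P[OF \<psi>_smooth(1)] and P1 = has_dir_deriv_P[OF \<psi>_smooth(2)]
  have 0: "has_dir_deriv \<phi> b (P \<psi> x * (Q 3 x * (- 5 * (cc * (of_real (b $ 1) + \<i> * of_real (b $ 2))) * Zi x ^ 6)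
      + (3 * Q 2 x * (- 2 * ca * (Y 1 x * of_real (b $ 1) + Y 2 x * of_real (b $ 2)))) * Zi x ^ 5)
      + (of_real (b $ 3) * P \<psi>1 x) * (Q 3 x * Zi x ^ 5)) x" for b
    unfolding \<phi>_def by (rule has_dir_deriv_mult[OF P0 has_dir_deriv_mult[OF Q3 Z5]])
  show "has_dir_deriv \<phi> b (\<phi>' b x) x"
    by (rule Basis_cases[OF assms(2)]; rule has_dir_deriv_eq[OF 0]) (simp_all add: \<phi>'_def algebra_simps)
  have 1: "has_dir_deriv (\<lambda>x. P \<psi> x * ((k1 * Y i x) * Q 2 x * Zi x ^ 5 + k2 * Q 3 x * Zi x ^ 6)) b
      (P \<psi> x * ((((k1 * Y i x) * Q 2 x) * (- 5 * (cc * (of_real (b $ 1) + \<i> * of_real (b $ 2))) * Zi x ^ 6)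
        + ((k1 * Y i x) * (2 * Q 1 x * (- 2 * ca * (Y 1 x * of_real (b $ 1) + Y 2 x * of_real (b $ 2))))
          + (k1 * of_real (b $ i) + 0 * Y i x) * Q 2 x) * Zi x ^ 5)
       + ((k2 * Q 3 x) * (- 6 * (cc * (of_real (b $ 1) + \<i> * of_real (b $ 2))) * Zi x ^ 7)
         + (k2 * (3 * Q 2 x * (- 2 * ca * (Y 1 x * of_real (b $ 1) + Y 2 x * of_real (b $ 2)))) + 0 * Q 3 x) * Zi x ^ 6))
      + (of_real (b $ 3) * P \<psi>1 x) * ((k1 * Y i x) * Q 2 x * Zi x ^ 5 + k2 * Q 3 x * Zi x ^ 6)) x" for b i k1 k2
    by (rule has_dir_deriv_mult[OF P0 has_dir_deriv_add[OF
          has_dir_deriv_mult[OF has_dir_deriv_mult[OF has_dir_deriv_mult[OF has_dir_deriv_const has_dir_deriv_Y] Q2] Z5]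
          has_dir_deriv_mult[OF has_dir_deriv_mult[OF has_dir_deriv_const Q3] Z6]]])
  have 2: "has_dir_deriv (\<lambda>x. P \<psi>1 x * (Q 3 x * Zi x ^ 5)) b (P \<psi>1 x * (Q 3 x * (- 5 * (cc * (of_real (b $ 1) + \<i> * of_real (b $ 2))) * Zi x ^ 6)
      + (3 * Q 2 x * (- 2 * ca * (Y 1 x * of_real (b $ 1) + Y 2 x * of_real (b $ 2)))) * Zi x ^ 5)
      + (of_real (b $ 3) * P \<psi>2 x) * (Q 3 x * Zi x ^ 5)) x" for b
    by (rule has_dir_deriv_mult[OF P1 has_dir_deriv_mult[OF Q3 Z5]])
  show "has_dir_deriv (\<phi>' b) b (\<phi>'' b x) x"
  proof (rule Basis_cases[OF assms(2)])
    assume b: "b = axis 1 1"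
    have f: "\<phi>' b = (\<lambda>x. P \<psi> x * (((- 6 * ca) * Y 1 x) * Q 2 x * Zi x ^ 5 + (- 5 * cc) * Q 3 x * Zi x ^ 6))"
      by (simp add: fun_eq_iff \<phi>'_def b)
    show ?thesis unfolding f
      by (rule has_dir_deriv_eq[OF 1]) (simp add: b \<phi>''_def algebra_simps power2_eq_square)
  next
    assume b: "b = axis 2 1"
    have f: "\<phi>' b = (\<lambda>x. P \<psi> x * (((- 6 * ca) * Y 2 x) * Q 2 x * Zi x ^ 5 + (- 5 * \<i> * cc) * Q 3 x * Zi x ^ 6))"
      by (simp add: fun_eq_iff \<phi>'_def b)
    show ?thesis unfolding f
      by (rule has_dir_deriv_eq[OF 1]) (simp add: b \<phi>''_def algebra_simps power2_eq_square)
  next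
    assume b: "b = axis 3 1"
    have f: "\<phi>' b = (\<lambda>x. P \<psi>1 x * (Q 3 x * Zi x ^ 5))"
      by (simp add: fun_eq_iff \<phi>'_def b)
    show ?thesis unfolding f
      by (rule has_dir_deriv_eq[OF 2]) (simp add: b \<phi>''_def)
  qed
qed

lemma proj2_in_sector: "x \<in> DD \<Longrightarrow> proj2 x /\<^sub>R e \<in> W" "x \<in> DD \<Longrightarrow> norm (proj2 x) < h" "x \<in> DD \<Longrightarrow> x $ 3 \<in> {-M<..<M}"
  using e(1) by (auto simp: cyl_def truncated_sector_def sector_scale)

lemma norm_Zf_ge: "x \<in> DD \<Longrightarrow> norm (Zf x) \<ge> sep * (1 + norm (proj2 x) / e)"
  using dist_pole_ge[OF proj2_in_sector(1)] e by (simp add: Zf_def divide_inverse mult.commute)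

text \<open>The singularity of the test function is harmless: above its base point \<open>\<Omega>\<close> can only be met
  outside the support of \<open>\<psi>\<close>.\<close>

lemma Zf_eq_0_imp: assumes "x \<in> \<Omega>" "Zf x = 0" shows "x $ 3 \<notin> supp"
proof
  assume "x $ 3 \<in> supp"
  then have x3: "x $ 3 \<in> {-M<..<M}" using supp(2) by blast
  have "vec2c (proj2 x /\<^sub>R e) = pole" using assms(2) by (simp add: Zf_def)
  then have "norm (proj2 x /\<^sub>R e) = 1" by (metis norm_vec2c norm_cis norm_minus_cancel pole_def)
  then have "norm (proj2 x) = e" using e by (simp add: field_simps)
  then have "x \<in> DD" using x3 assms(1) D e by (auto simp: cyl_def)
  then have "Zf x \<noteq> 0" using pole_notin[OF proj2_in_sector(1)] by (simp add: Zf_def)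
  with assms(2) show False by simp
qed

section \<open>Regularity across the pole\<close>

definition off_supp :: "(real^3) set" where "off_supp = {x. x $ 3 \<notin> supp}"

lemma open_off_supp: "open off_supp"
proof -
  have "open ((\<lambda>x::real^3. x $ 3) -` (- supp))"
    by (intro open_vimage continuous_intros open_Compl compact_imp_closed supp)
  then show ?thesis by (simp add: off_supp_def vimage_def)
qed

lemma vanish_off_supp: "x \<in> off_supp \<Longrightarrow> \<phi> x = 0" "x \<in> off_supp \<Longrightarrow> \<phi>' b x = 0" "x \<in> off_supp \<Longrightarrow> \<phi>'' b x = 0"
  by (simp_all add: off_supp_def \<phi>_def \<phi>'_def \<phi>''_def P_def outside_supp)

lemma has_dir_deriv_\<phi>:
  assumes "x \<in> \<Omega>" "b \<in> Basis"
  shows "has_dir_deriv \<phi> b (\<phi>' b x) x" "has_dir_deriv (\<phi>' b) b (\<phi>'' b x) x"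
proof -
  have "has_dir_deriv \<phi> b (\<phi>' b x) x \<and> has_dir_deriv (\<phi>' b) b (\<phi>'' b x) x"
  proof (cases "Zf x = 0")
    case False
    then show ?thesis using has_dir_deriv_\<phi>_nonsing assms(2) by blast
  next
    case True
    then have x: "x \<in> off_supp" using Zf_eq_0_imp[OF assms(1)] by (simp add: off_supp_def)
    have "has_dir_deriv \<phi> b 0 x"
      by (rule has_dir_deriv_transform[OF has_dir_deriv_const open_off_supp x]) (simp add: vanish_off_supp)
    moreover have "has_dir_deriv (\<phi>' b) b 0 x"
      by (rule has_dir_deriv_transform[OF has_dir_deriv_const open_off_supp x]) (simp add: vanish_off_supp)
    ultimately show ?thesis using x by (simp add: vanish_off_supp)
  qed
  then show "has_dir_deriv \<phi> b (\<phi>' b x) x" "has_dir_deriv (\<phi>' b) b (\<phi>'' b x) x" by auto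
qed

definition off_pole :: "(real^3) set" where "off_pole = {x. Zf x \<noteq> 0}"

lemma continuous_on_Zf: "continuous_on A Zf"
  unfolding Zf_def by (intro continuous_intros continuous_on_proj2)

lemma open_off_pole: "open off_pole"
  unfolding off_pole_def by (intro open_Collect_neq continuous_on_Zf continuous_intros)

lemma atoms_continuous:
  "continuous_on off_pole Zi" "continuous_on A (Q n)" "continuous_on A (Y i)"
  "continuous_on A (P \<psi>)" "continuous_on A (P \<psi>1)" "continuous_on A (P \<psi>2)"
proof -
  show "continuous_on off_pole Zi" unfolding Zi_def
    by (intro continuous_on_inverse continuous_on_Zf) (simp add: off_pole_def)
  have "continuous_on A Xf" unfolding Xf_def by (intro continuous_intros) (use h in auto)
  then show "continuous_on A (Q n)" unfolding Q_def by (intro continuous_intros)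
  show "continuous_on A (Y i)" unfolding Y_def by (intro continuous_intros)
  have "continuous_on A (P f)" if "continuous_on UNIV f" for f
    unfolding P_def by (intro continuous_on_of_real continuous_on_compose2[OF that]) (auto intro!: continuous_intros)
  then show "continuous_on A (P \<psi>)" "continuous_on A (P \<psi>1)" "continuous_on A (P \<psi>2)" using cont_\<psi> by auto
qed

text \<open>Two open sets cover \<Omega>: the one where the kernel is regular, and the one over
  heights outside the support of \<psi>, where the function is identically 0.\<close>

lemma continuous_on_\<Omega>I:
  assumes "continuous_on off_pole f" "\<And>x. x \<in> off_supp \<Longrightarrow> f x = 0"
  shows "continuous_on \<Omega> f"
proof -
  have "continuous_on off_supp f"
    by (rule continuous_on_eq[of _ "\<lambda>_. 0"]) (use assms(2) in auto)
  from continuous_on_open_Un[OF open_off_pole open_off_supp assms(1) this]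
  show ?thesis
    by (rule continuous_on_subset) (use Zf_eq_0_imp in \<open>auto simp: off_pole_def off_supp_def\<close>)
qed

lemma continuous_on_\<phi>: "continuous_on \<Omega> \<phi>" "continuous_on \<Omega> (\<phi>' b)" "continuous_on \<Omega> (\<phi>'' b)"
proof -
  have if_c: "continuous_on A (\<lambda>x. if c then f x else g x)"
    if "continuous_on A f" "continuous_on A g" for A c and f g :: "real^3 \<Rightarrow> complex"
    using that by (cases c) simp_all
  show "continuous_on \<Omega> \<phi>"
  proof (rule continuous_on_\<Omega>I)
    show "continuous_on off_pole \<phi>" unfolding \<phi>_def by (intro continuous_intros atoms_continuous)
  qed (rule vanish_off_supp)
  show "continuous_on \<Omega> (\<phi>' b)"
  proof (rule continuous_on_\<Omega>I)
    show "continuous_on off_pole (\<phi>' b)"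
      unfolding \<phi>'_def by (intro if_c continuous_intros atoms_continuous)
  qed (rule vanish_off_supp)
  show "continuous_on \<Omega> (\<phi>'' b)"
  proof (rule continuous_on_\<Omega>I)
    show "continuous_on off_pole (\<phi>'' b)"
      unfolding \<phi>''_def by (intro if_c continuous_intros atoms_continuous)
  qed (rule vanish_off_supp)
qed

text \<open>A point of \<Omega> outside \<open>DD\<close> lies either at a height where \<psi> and
  its derivatives vanish, or at horizontal distance at least h, where every positive power of the
  cut-off is 0. The lowest power occurring, in \<phi>'', is the first.\<close>

lemma vanish_outside_DD:
  assumes "x \<in> \<Omega>" "x \<notin> DD"
  shows "\<phi> x = 0" "\<phi>' b x = 0" "\<phi>'' b x = 0"
proof -
  have "\<phi> x = 0 \<and> \<phi>' b x = 0 \<and> \<phi>'' b x = 0"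
  proof (cases "x \<in> off_supp")
    case True then show ?thesis by (simp add: vanish_off_supp)
  next
    case False
    then have "x $ 3 \<in> {-M<..<M}" using supp(2) by (auto simp: off_supp_def)
    with assms D have "proj2 x \<notin> ball 0 h" by (auto simp: cyl_def)
    then have "h \<le> norm (proj2 x)" by simp
    then have "h\<^sup>2 \<le> (norm (proj2 x))\<^sup>2" using h by (intro power_mono) auto
    then have "h\<^sup>2 \<le> (x $ 1)\<^sup>2 + (x $ 2)\<^sup>2" by (simp add: norm_vec2)
    then have "Xf x \<le> 0" using h by (simp add: Xf_def)
    then have "Q n x = 0" if "n > 0" for n using that by (simp add: Q_def)
    then show ?thesis by (simp add: \<phi>_def \<phi>'_def \<phi>''_def)
  qed
  then show "\<phi> x = 0" "\<phi>' b x = 0" "\<phi>'' b x = 0" by auto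
qed

text \<open>These bounds may depend on \<open>e\<close>; they only secure the hypotheses of
  integration by parts. The estimate that matters in the limit is the weighted one for the
  Laplacian.\<close>

definition bdd :: "(real^3 \<Rightarrow> complex) \<Rightarrow> bool" where "bdd f \<longleftrightarrow> (\<exists>B. \<forall>x\<in>DD. norm (f x) \<le> B)"

lemma bdd_const: "bdd (\<lambda>x. c)" by (auto simp: bdd_def)

lemma bdd_add: assumes "bdd f" "bdd g" shows "bdd (\<lambda>x. f x + g x)"
proof -
  obtain A B where "\<forall>x\<in>DD. norm (f x) \<le> A" "\<forall>x\<in>DD. norm (g x) \<le> B" using assms by (auto simp: bdd_def)
  then have "\<forall>x\<in>DD. norm (f x + g x) \<le> A + B" by (meson add_mono norm_triangle_ineq order_trans)
  then show ?thesis unfolding bdd_def by blast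
qed

lemma bdd_mult: assumes "bdd f" "bdd g" shows "bdd (\<lambda>x. f x * g x)"
proof -
  obtain A B where AB: "\<forall>x\<in>DD. norm (f x) \<le> A" "\<forall>x\<in>DD. norm (g x) \<le> B" using assms by (auto simp: bdd_def)
  have "norm (f x * g x) \<le> A * B" if "x \<in> DD" for x
    unfolding norm_mult using AB that by (intro mult_mono order_trans[OF norm_ge_zero AB(1)[rule_format, OF that]]) auto
  then show ?thesis unfolding bdd_def by blast
qed

lemma bdd_diff: assumes "bdd f" "bdd g" shows "bdd (\<lambda>x. f x - g x)"
  using bdd_add[OF assms(1) bdd_mult[OF bdd_const[of "-1"] assms(2)]] by simp

lemma bdd_power: "bdd f \<Longrightarrow> bdd (\<lambda>x. f x ^ n)"
  by (induction n) (auto intro: bdd_const bdd_mult)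

lemma compact_support_bounded_real:
  fixes f :: "real \<Rightarrow> real"
  assumes "continuous_on UNIV f" "\<And>t. t \<notin> supp \<Longrightarrow> f t = 0"
  obtains B where "\<And>t. \<bar>f t\<bar> \<le> B"
proof -
  have "continuous_on UNIV (\<lambda>t. complex_of_real (f t))" using assms(1) by (intro continuous_on_of_real)
  from continuous_on_compact_support_bounded[OF this supp(1)] assms(2) that show ?thesis by (metis norm_of_real of_real_0)
qed

lemma bdd_P: "bdd (P \<psi>)" "bdd (P \<psi>1)" "bdd (P \<psi>2)"
proof -
  have "bdd (P f)" if f: "continuous_on UNIV f" "\<And>t. t \<notin> supp \<Longrightarrow> f t = 0" for f
  proof -
    obtain B where "\<And>t. \<bar>f t\<bar> \<le> B" using compact_support_bounded_real[OF f] by blast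
    then show ?thesis by (auto simp: bdd_def P_def)
  qed
  then show "bdd (P \<psi>)" "bdd (P \<psi>1)" "bdd (P \<psi>2)" using cont_\<psi> outside_supp by auto
qed

lemma norm_Q_le: "norm (Q n x) \<le> 1"
proof -
  have "Xf x \<le> 1" using h by (simp add: Xf_def)
  then have "(max 0 (Xf x)) ^ n \<le> 1" by (intro power_le_one) auto
  then show ?thesis unfolding Q_def norm_of_real by simp
qed

text \<open>The second estimate saves a power of \<open>e\<close>: a factor 1/e left by
  differentiating the kernel is harmless when it comes with |x'|, because |x'|/e is absorbed by one
  more power of \<open>Zi\<close>.\<close>

lemma norm_Zi_le: assumes "x \<in> DD" shows "norm (Zi x) \<le> 1 / sep" "norm (proj2 x) / e * norm (Zi x) \<le> 1 / sep"
proof -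
  have 1: "0 < sep * (1 + norm (proj2 x) / e)" using sep_pos e by (intro mult_pos_pos add_pos_nonneg) auto
  then have n: "norm (Zi x) \<le> 1 / (sep * (1 + norm (proj2 x) / e))"
  proof -
    have "norm (Zi x) = 1 / norm (Zf x)" by (simp add: Zi_def norm_divide inverse_eq_divide)
    also have "\<dots> \<le> 1 / (sep * (1 + norm (proj2 x) / e))"
      using 1 norm_Zf_ge[OF assms] by (intro frac_le) simp_all
    finally show ?thesis .
  qed
  also have "\<dots> \<le> 1 / sep"
    using sep_pos e by (intro divide_left_mono) (auto intro!: mult_pos_pos add_pos_nonneg)
  finally show "norm (Zi x) \<le> 1 / sep" .
  have "norm (proj2 x) / e * norm (Zi x) \<le> (1 + norm (proj2 x) / e) * (1 / (sep * (1 + norm (proj2 x) / e)))"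
    using n e by (intro mult_mono) auto
  also have "\<dots> = 1 / sep"
  proof -
    have "1 + norm (proj2 x) / e > 0" using e by (intro add_pos_nonneg) auto
    then show ?thesis by simp
  qed
  finally show "norm (proj2 x) / e * norm (Zi x) \<le> 1 / sep" .
qed

lemma bdd_atoms: "bdd (Q n)" "bdd Zi" "bdd (Y 1)" "bdd (Y 2)"
proof -
  show "bdd (Q n)" unfolding bdd_def using norm_Q_le by blast
  show "bdd Zi" unfolding bdd_def using norm_Zi_le(1) by blast
  have "norm (Y 1 x) \<le> h \<and> norm (Y 2 x) \<le> h" if "x \<in> DD" for x
    using abs_nth_le_norm_proj2[of x] proj2_in_sector(2)[OF that] by (auto simp: Y_def)
  then show "bdd (Y 1)" "bdd (Y 2)" unfolding bdd_def by blast+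
qed

lemma bdd_\<phi>: "bdd \<phi>" "bdd (\<phi>' b)" "bdd (\<phi>'' b)"
proof -
  have bdd_if: "bdd (\<lambda>x. if c then f x else g x)" if "bdd f" "bdd g" for c f g
    using that by (cases c) simp_all
  note r = bdd_const bdd_add bdd_mult bdd_diff bdd_power bdd_P bdd_atoms
  show "bdd \<phi>" unfolding \<phi>_def by (intro r)
  show "bdd (\<phi>' b)" unfolding \<phi>'_def by (intro bdd_if r)
  show "bdd (\<phi>'' b)" unfolding \<phi>''_def by (intro bdd_if r)
qed

lemma bounded_on_\<Omega>:
  "\<exists>B. (\<forall>x\<in>\<Omega>. norm (\<phi> x) \<le> B) \<and> (\<forall>b\<in>Basis. \<forall>x\<in>\<Omega>. norm (\<phi>' b x) \<le> B \<and> norm (\<phi>'' b x) \<le> B)"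
proof -
  obtain B0 where B0: "\<forall>x\<in>DD. norm (\<phi> x) \<le> B0" using bdd_\<phi>(1) by (auto simp: bdd_def)
  have "\<forall>b. \<exists>B. \<forall>x\<in>DD. norm (\<phi>' b x) \<le> B" using bdd_\<phi>(2) by (auto simp: bdd_def)
  then obtain B1 where B1: "\<And>b x. x \<in> DD \<Longrightarrow> norm (\<phi>' b x) \<le> B1 b" by metis
  have "\<forall>b. \<exists>B. \<forall>x\<in>DD. norm (\<phi>'' b x) \<le> B" using bdd_\<phi>(3) by (auto simp: bdd_def)
  then obtain B2 where B2: "\<And>b x. x \<in> DD \<Longrightarrow> norm (\<phi>'' b x) \<le> B2 b" by metis
  define B where "B = \<bar>B0\<bar> + (\<Sum>b\<in>Basis. \<bar>B1 b\<bar>) + (\<Sum>b\<in>Basis. \<bar>B2 b\<bar>)"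
  have m: "\<bar>B1 b\<bar> \<le> (\<Sum>b\<in>Basis. \<bar>B1 b\<bar>)" "\<bar>B2 b\<bar> \<le> (\<Sum>b\<in>Basis. \<bar>B2 b\<bar>)" if "b \<in> Basis" for b
    using that by (auto intro!: member_le_sum)
  have s: "0 \<le> (\<Sum>b\<in>Basis. \<bar>B1 b\<bar>)" "0 \<le> (\<Sum>b\<in>Basis. \<bar>B2 b\<bar>)" by (auto intro: sum_nonneg)
  have "norm (\<phi> x) \<le> B" if "x \<in> \<Omega>" for x
    using B0[rule_format, of x] vanish_outside_DD(1)[OF that] s
    unfolding B_def by (cases "x \<in> DD") (linarith, simp)
  moreover have "norm (\<phi>' b x) \<le> B" "norm (\<phi>'' b x) \<le> B" if "b \<in> Basis" "x \<in> \<Omega>" for b x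
    using B1[of x b] B2[of x b] vanish_outside_DD(2,3)[OF that(2), of b] s m[OF that(1)]
    by (cases "x \<in> DD"; auto simp: B_def)+
  ultimately show ?thesis by blast
qed

section \<open>The Laplacian of the test function\<close>

definition lap\<phi> :: "real^3 \<Rightarrow> complex" where "lap\<phi> x = (\<Sum>b\<in>Basis. \<phi>'' b x)"

text \<open>The terms with \<open>cc\<^sup>2\<close> cancel. The one with \<open>cc\<close> is the
  mixed term of cut-off and kernel, and it carries x1 + i x2 because the gradient of a radial
  cut-off is parallel to x'.\<close>

lemma lap\<phi>_eq: "lap\<phi> x = P \<psi> x * ((- 12 * ca * Q 2 x + 24 * ca\<^sup>2 * ((Y 1 x)\<^sup>2 + (Y 2 x)\<^sup>2) * Q 1 x) * Zi x ^ 5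
    + 60 * ca * cc * (Y 1 x + \<i> * Y 2 x) * Q 2 x * Zi x ^ 6) + P \<psi>2 x * (Q 3 x * Zi x ^ 5)"
  by (simp add: lap\<phi>_def sum_Basis_cart sum_3 \<phi>''_def algebra_simps)

lemma DD_open: "open DD" and DD_subset: "DD \<subseteq> \<Omega>"
proof -
  have "open (cyl (ball 0 h) {-M<..<M} \<inter> \<Omega>)" by (intro open_Int open_cyl \<Omega>) auto
  then show "open DD" by (simp only: D)
  show "DD \<subseteq> \<Omega>" using D by blast
qed

text \<open>36 = 12 + 24 collects the two second-order terms of the cut-off, 60 belongs to the mixed
  term, where 1/sep pays for absorbing |x'|/e, and 1 to the vertical derivatives. Apart from the
  rescaling of the weight, \<open>e\<close> does not enter.\<close>

lemma lap\<phi>_bound: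
  assumes x: "x \<in> DD" and B: "\<And>t. \<bar>\<psi> t\<bar> \<le> B" "\<And>t. \<bar>\<psi>2 t\<bar> \<le> B"
  shows "norm (lap\<phi> x) \<le> B * (36 / h\<^sup>2 + 60 / (h\<^sup>2 * sep) + 1) / sep ^ 5 * wt (proj2 x /\<^sub>R e)"
proof -
  have B0: "0 \<le> B" using B(1)[of 0] by linarith
  define N where "N = norm (Zi x) ^ 5"
  have N: "N \<le> 1 / sep ^ 5 * wt (proj2 x /\<^sub>R e)"
  proof -
    have "N = norm (\<eta> (proj2 x /\<^sub>R e))"
      by (simp add: N_def \<eta>_def Zi_def Zf_def norm_divide norm_inverse norm_power inverse_eq_divide power_divide)
    also have "\<dots> \<le> 1 / sep ^ 5 * (wt (proj2 x /\<^sub>R e) / (1 + norm (proj2 x /\<^sub>R e)))"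
      by (rule norm_\<eta>_le[OF proj2_in_sector(1)[OF x]])
    also have "\<dots> \<le> 1 / sep ^ 5 * wt (proj2 x /\<^sub>R e)"
    proof (rule mult_left_mono)
      have "wt y / (1 + norm y) \<le> wt y" for y :: "real^2"
        using wt_pos[of y] one_plus_norm_pos[of y] by (simp add: divide_le_eq)
      then show "wt (proj2 x /\<^sub>R e) / (1 + norm (proj2 x /\<^sub>R e)) \<le> wt (proj2 x /\<^sub>R e)" .
    qed (use sep_pos in simp)
    finally show ?thesis .
  qed
  have N0: "N \<ge> 0" by (simp add: N_def)
  have Pn: "norm (P \<psi> x) \<le> B" "norm (P \<psi>2 x) \<le> B" using B by (simp_all add: P_def)
  have can: "norm ca = 1 / h\<^sup>2" by (simp add: ca_def norm_divide norm_power)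
  have ccn: "norm cc = 1 / e" using e by (simp add: cc_def norm_divide)
  have r: "norm (Y 1 x + \<i> * Y 2 x) = norm (proj2 x)"
    by (simp add: Y_def norm_vec2 cmod_def)
  have rh: "(norm (proj2 x))\<^sup>2 \<le> h\<^sup>2" using proj2_in_sector(2)[OF x] by (intro power_mono) auto
  have y2: "norm ((Y 1 x)\<^sup>2 + (Y 2 x)\<^sup>2) \<le> h\<^sup>2"
  proof -
    have "(Y 1 x)\<^sup>2 + (Y 2 x)\<^sup>2 = of_real ((norm (proj2 x))\<^sup>2)" by (simp add: Y_def norm_vec2)
    then show ?thesis using rh by (simp only: norm_of_real) simp
  qed
  have t1: "norm (- 12 * ca * Q 2 x) \<le> 12 / h\<^sup>2"
    using norm_Q_le[of 2 x] h by (simp add: norm_mult can divide_right_mono mult_left_le)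
  have t2: "norm (24 * ca\<^sup>2 * ((Y 1 x)\<^sup>2 + (Y 2 x)\<^sup>2) * Q 1 x) \<le> 24 / h\<^sup>2"
  proof -
    have "norm (24 * ca\<^sup>2 * ((Y 1 x)\<^sup>2 + (Y 2 x)\<^sup>2) * Q 1 x) = 24 * (1 / h\<^sup>2)\<^sup>2 * norm ((Y 1 x)\<^sup>2 + (Y 2 x)\<^sup>2) * norm (Q 1 x)"
      by (simp add: norm_mult norm_power can)
    also have "\<dots> \<le> 24 * (1 / h\<^sup>2)\<^sup>2 * h\<^sup>2 * 1"
      by (intro mult_mono y2 norm_Q_le) auto
    also have "\<dots> = 24 / h\<^sup>2" using h by (simp add: power2_eq_square)
    finally show ?thesis .
  qed
  have t3: "norm (60 * ca * cc * (Y 1 x + \<i> * Y 2 x) * Q 2 x * Zi x ^ 6) \<le> 60 / (h\<^sup>2 * sep) * N"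
  proof -
    have "norm (60 * ca * cc * (Y 1 x + \<i> * Y 2 x) * Q 2 x * Zi x ^ 6)
        = 60 / h\<^sup>2 * norm (Q 2 x) * (norm (proj2 x) / e * norm (Zi x)) * N"
      by (simp add: norm_mult can ccn r norm_power N_def power_Suc2[of _ 5, simplified])
    also have "\<dots> \<le> 60 / h\<^sup>2 * 1 * (1 / sep) * N"
      using norm_Zi_le(2)[OF x] e N0 by (intro mult_right_mono mult_mono norm_Q_le) auto
    finally show ?thesis by simp
  qed
  have "norm (lap\<phi> x) \<le> B * ((12 / h\<^sup>2 + 24 / h\<^sup>2) * N + 60 / (h\<^sup>2 * sep) * N) + B * (1 * N)"
    unfolding lap\<phi>_eq
  proof (rule order_trans[OF norm_triangle_ineq add_mono])
    show "norm (P \<psi> x * ((- 12 * ca * Q 2 x + 24 * ca\<^sup>2 * ((Y 1 x)\<^sup>2 + (Y 2 x)\<^sup>2) * Q 1 x) * Zi x ^ 5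
        + 60 * ca * cc * (Y 1 x + \<i> * Y 2 x) * Q 2 x * Zi x ^ 6)) \<le> B * ((12 / h\<^sup>2 + 24 / h\<^sup>2) * N + 60 / (h\<^sup>2 * sep) * N)"
      unfolding norm_mult[of "P \<psi> x"]
    proof (intro mult_mono Pn order_trans[OF norm_triangle_ineq add_mono] t3)
      show "norm ((- 12 * ca * Q 2 x + 24 * ca\<^sup>2 * ((Y 1 x)\<^sup>2 + (Y 2 x)\<^sup>2) * Q 1 x) * Zi x ^ 5) \<le> (12 / h\<^sup>2 + 24 / h\<^sup>2) * N"
        unfolding norm_mult[of _ "Zi x ^ 5"] norm_power N_def
        by (intro mult_right_mono order_trans[OF norm_triangle_ineq add_mono] t1 t2) auto
    qed (use B0 in auto)
    show "norm (P \<psi>2 x * (Q 3 x * Zi x ^ 5)) \<le> B * (1 * N)"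
      unfolding norm_mult norm_power N_def by (intro mult_mono Pn norm_Q_le) (use B0 in auto)
  qed
  also have "\<dots> = B * (36 / h\<^sup>2 + 60 / (h\<^sup>2 * sep) + 1) * N" by (simp add: algebra_simps)
  also have "\<dots> \<le> B * (36 / h\<^sup>2 + 60 / (h\<^sup>2 * sep) + 1) * (1 / sep ^ 5 * wt (proj2 x /\<^sub>R e))"
    using B0 sep_pos by (intro mult_left_mono N mult_nonneg_nonneg add_nonneg_nonneg) auto
  finally show ?thesis by simp
qed

lemma \<phi>_eq: "\<phi> x = of_real (\<psi> (x $ 3)) * (of_real ((max 0 (1 - (norm (proj2 x))\<^sup>2 / h\<^sup>2)) ^ 3) * \<eta> (proj2 x /\<^sub>R e))"
  by (simp add: \<phi>_def P_def Q_def Xf_def Zi_def Zf_def \<eta>_def norm_vec2 inverse_eq_divide power_divide)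

lemma sector_identity:
  assumes V: "Linf \<Omega> V" and te: "transmission_eigenfunctions \<Omega> V k v w"
  shows "(LINT x|lebesgue_on DD. (v x - w x) * lap\<phi> x)
    = (of_real k)\<^sup>2 * (LINT x|lebesgue_on DD. ((1 + V x) * w x - v x) * \<phi> x)"
proof -
  obtain B where B: "\<forall>x\<in>\<Omega>. norm (\<phi> x) \<le> B" "\<forall>b\<in>Basis. \<forall>x\<in>\<Omega>. norm (\<phi>' b x) \<le> B \<and> norm (\<phi>'' b x) \<le> B"
    using bounded_on_\<Omega> by blast
  have restr: "(LINT x|lebesgue_on \<Omega>. f x) = (LINT x|lebesgue_on DD. f x)" if "\<And>x. x \<in> \<Omega> \<Longrightarrow> x \<notin> DD \<Longrightarrow> f x = 0" for f :: "real^3 \<Rightarrow> complex"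
  proof -
    have "(\<lambda>x. indicator \<Omega> x *\<^sub>R f x) = (\<lambda>x. indicator DD x *\<^sub>R f x)"
      using that DD_subset by (auto simp: fun_eq_iff indicator_def)
    then show ?thesis using \<Omega>(1) DD_open by (simp add: integral_restrict_space)
  qed
  have "(LINT x|lebesgue_on \<Omega>. (v x - w x) * (\<Sum>b\<in>Basis. \<phi>'' b x))
    = (of_real k)\<^sup>2 * (LINT x|lebesgue_on \<Omega>. ((1 + V x) * w x - v x) * \<phi> x)"
    by (rule transmission_identity[OF \<Omega> V te, where \<phi>'=\<phi>' and B=B])
      (use B in \<open>auto intro: has_dir_deriv_\<phi> continuous_on_\<phi>\<close>)
  then show ?thesis
    unfolding lap\<phi>_def by (subst (1 2) restr[symmetric]) (simp_all add: vanish_outside_DD)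
qed

end

section \<open>The limit at the edge\<close>

text \<open>Since \<psi> vanishes off its interval, the vertical slices may be taken over all of I,
  and Fubini identifies integrals of the reduction with three-dimensional ones.\<close>

lemma dim_reduction_integral:
  assumes A: "cyl A I \<in> sets lebesgue" and f: "integrable (lebesgue_on (cyl A I)) (\<lambda>x. of_real (\<psi> (x $ 3)) * f x)"
    and \<psi>: "\<And>t. t \<notin> {c - L<..<c + L} \<Longrightarrow> \<psi> t = 0" and sub: "{c - L<..<c + L} \<subseteq> I"
  shows "(LINT y:A|lebesgue. dim_reduction \<psi> c L f y) = (LINT x|lebesgue_on (cyl A I). of_real (\<psi> (x $ 3)) * f x)"
proof -
  let ?F = "\<lambda>x. indicator (cyl A I) x *\<^sub>R (of_real (\<psi> (x $ 3)) * f x)"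
  have F: "integrable lebesgue ?F" using f A by (simp add: integrable_restrict_space)
  have "indicator A y *\<^sub>R dim_reduction \<psi> c L f y = (LINT t|lebesgue. ?F (join3 y t))" for y
  proof (cases "y \<in> A")
    case True
    have "(\<lambda>t. ?F (join3 y t)) = (\<lambda>t. indicator {c - L<..<c + L} t *\<^sub>R \<psi> t *\<^sub>R f (join3 y t))"
      using True \<psi> sub by (auto simp: fun_eq_iff indicator_def scaleR_conv_of_real)
    with True show ?thesis by (simp add: dim_reduction_def set_lebesgue_integral_def)
  qed simp
  then have "(LINT y:A|lebesgue. dim_reduction \<psi> c L f y) = (LINT y|lebesgue. LINT t|lebesgue. ?F (join3 y t))"
    by (simp add: set_lebesgue_integral_def)
  also have "\<dots> = (LINT x|lebesgue. ?F x)" by (rule lebesgue_integral_join3[OF F])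
  also have "\<dots> = (LINT x|lebesgue_on (cyl A I). of_real (\<psi> (x $ 3)) * f x)"
    using A by (simp add: integral_restrict_space)
  finally show ?thesis .
qed

lemma integral_cyl_product:
  fixes a :: "real \<Rightarrow> complex" and \<kappa> :: "real^2 \<Rightarrow> complex"
  assumes A: "cyl A I \<in> sets lebesgue" "A \<in> sets lebesgue"
    and f: "integrable (lebesgue_on (cyl A I)) (\<lambda>x. a (x $ 3) * \<kappa> (proj2 x))"
  shows "(LINT x|lebesgue_on (cyl A I). a (x $ 3) * \<kappa> (proj2 x)) = (LINT t:I|lebesgue. a t) * (LINT y|lebesgue_on A. \<kappa> y)"
proof -
  let ?F = "\<lambda>x. indicator (cyl A I) x *\<^sub>R (a (x $ 3) * \<kappa> (proj2 x))"
  have F: "integrable lebesgue ?F" using f A by (simp add: integrable_restrict_space)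
  have "(LINT t|lebesgue. ?F (join3 y t)) = (LINT t:I|lebesgue. a t) * (indicator A y *\<^sub>R \<kappa> y)" for y
  proof -
    have "(\<lambda>t. ?F (join3 y t)) = (\<lambda>t. (indicator I t *\<^sub>R a t) * (indicator A y *\<^sub>R \<kappa> y))"
      by (auto simp: fun_eq_iff indicator_def)
    then show ?thesis unfolding set_lebesgue_integral_def by (simp only: integral_mult_left_zero)
  qed
  then have "(LINT x|lebesgue. ?F x) = (LINT y|lebesgue. (LINT t:I|lebesgue. a t) * (indicator A y *\<^sub>R \<kappa> y))"
    using lebesgue_integral_join3[OF F] by simp
  also have "\<dots> = (LINT t:I|lebesgue. a t) * (LINT y|lebesgue_on A. \<kappa> y)"
    using A(2) by (simp only: integral_mult_right_zero) (simp add: integral_restrict_space)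
  finally show ?thesis using A(1) by (simp add: integral_restrict_space)
qed

text \<open>Replacing G by its edge values costs |x'|^\<alpha> = e^\<alpha> s^\<alpha> with s =
  |x'|/e. Since s^\<alpha> \<le> 1 + s, the spare factor of the kernel absorbs the growth, and a
  weight of mass of order e^2 remains. The edge part factors by Fubini.\<close>

lemma edge_concentration:
  fixes S :: "(real^2) set" and M e \<alpha> B K B0 Lc :: real and \<psi> :: "real \<Rightarrow> real"
    and \<kappa> :: "real^2 \<Rightarrow> complex" and g0 :: "real \<Rightarrow> complex" and G :: "real^3 \<Rightarrow> complex"
  defines "DD \<equiv> cyl S {-M<..<M}"
  assumes S: "open S" "bounded DD" and M: "M > 0" and e: "e > 0" and \<alpha>: "0 < \<alpha>" "\<alpha> \<le> 1"
    and \<psi>: "\<psi> \<in> borel_measurable borel" "\<And>t. \<bar>\<psi> t\<bar> \<le> B"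
    and \<kappa>: "\<kappa> \<in> borel_measurable borel" "\<And>y. y \<in> S \<Longrightarrow> norm (\<kappa> y) \<le> K * (wt (y /\<^sub>R e) / (1 + norm (y /\<^sub>R e)))"
    and K: "K \<ge> 0" and Lc: "Lc \<ge> 0"
    and g0: "g0 \<in> borel_measurable borel" "\<And>t. norm (g0 t) \<le> B0"
    and G: "G \<in> borel_measurable (lebesgue_on DD)" "\<And>x. x \<in> DD \<Longrightarrow> norm (G x - g0 (x $ 3)) \<le> Lc * norm (proj2 x) powr \<alpha>"
  shows "integrable (lebesgue_on DD) (\<lambda>x. of_real (\<psi> (x $ 3)) * G x * \<kappa> (proj2 x))"
    and "norm ((LINT x|lebesgue_on DD. of_real (\<psi> (x $ 3)) * G x * \<kappa> (proj2 x))
      - (LINT t:{-M<..<M}|lebesgue. of_real (\<psi> t) * g0 t) * (LINT y|lebesgue_on S. \<kappa> y))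
      \<le> B * Lc * K * e powr \<alpha> * (2 * M * wt_mass * e\<^sup>2)"
proof -
  let ?N = "lebesgue_on DD"
  have Do: "open DD" unfolding DD_def by (intro open_cyl S) auto
  have Ds: "DD \<in> sets lebesgue" "DD \<in> sets borel" using Do by auto
  note fin = finite_measure_lebesgue_on_open[OF Do S(2)]
  interpret finite_measure ?N by (rule fin)
  have B: "0 \<le> B" using \<psi>(2)[of 0] by linarith
  have B0: "0 \<le> B0" using g0(2)[of 0] norm_ge_zero order_trans by blast
  have DS: "proj2 x \<in> S" "x $ 3 \<in> {-M<..<M}" if "x \<in> DD" for x using that by (simp_all add: DD_def cyl_def)
  have \<kappa>K: "norm (\<kappa> y) \<le> K" if "y \<in> S" for y
  proof -
    have "wt (y /\<^sub>R e) / (1 + norm (y /\<^sub>R e)) \<le> 1 / 1"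
      using wt_le_1 wt_pos one_plus_norm_pos by (intro frac_le) auto
    then have "K * (wt (y /\<^sub>R e) / (1 + norm (y /\<^sub>R e))) \<le> K * 1" using K by (intro mult_left_mono) auto
    with \<kappa>(2)[OF that] show ?thesis by simp
  qed
  have lift3: "(\<lambda>x. a (x $ 3)) \<in> borel_measurable ?N" if [measurable]: "a \<in> borel_measurable borel" for a :: "real \<Rightarrow> complex"
    by (rule measurable_restrict_space1, rule measurable_completion) measurable
  have liftp: "(\<lambda>x. \<kappa> (proj2 x)) \<in> borel_measurable ?N"
  proof -
    have "(\<lambda>x. \<kappa> (proj2 x)) \<in> borel_measurable lborel"
      using measurable_compose[OF borel_measurable_proj2 \<kappa>(1)] by simp
    then show ?thesis by (rule measurable_restrict_space1[OF measurable_completion])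
  qed
  have \<psi>c: "(\<lambda>t. complex_of_real (\<psi> t)) \<in> borel_measurable borel" using \<psi>(1) by measurable
  have ip: "integrable ?N (\<lambda>x. (of_real (\<psi> (x $ 3)) * H x) * \<kappa> (proj2 x))"
    if H: "H \<in> borel_measurable ?N" "\<And>x. x \<in> DD \<Longrightarrow> norm (H x) \<le> C" for H C
  proof (rule integrable_const_bound[of _ "B * \<bar>C\<bar> * K"])
    show "AE x in ?N. norm (of_real (\<psi> (x $ 3)) * H x * \<kappa> (proj2 x)) \<le> B * \<bar>C\<bar> * K"
    proof (rule AE_I2)
      fix x assume "x \<in> space ?N"
      then have x: "x \<in> DD" by simp
      have "norm (H x) \<le> \<bar>C\<bar>" using H(2)[OF x] by linarith
      then show "norm (of_real (\<psi> (x $ 3)) * H x * \<kappa> (proj2 x)) \<le> B * \<bar>C\<bar> * K"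
        unfolding norm_mult using B \<psi>(2) \<kappa>K[OF DS(1)[OF x]] by (intro mult_mono) auto
    qed
    show "(\<lambda>x. of_real (\<psi> (x $ 3)) * H x * \<kappa> (proj2 x)) \<in> borel_measurable ?N"
      by (intro borel_measurable_times lift3[OF \<psi>c] H liftp)
  qed
  obtain R where R: "\<And>x. x \<in> DD \<Longrightarrow> norm x \<le> R" using S(2) by (auto simp: bounded_iff)
  have pR: "norm (proj2 x) powr \<alpha> \<le> \<bar>R\<bar> powr \<alpha>" if "x \<in> DD" for x
  proof (rule powr_mono2)
    have "norm (proj2 x) \<le> norm x" by (simp add: norm_vec2 norm_vec3)
    then show "norm (proj2 x) \<le> \<bar>R\<bar>" using R[OF that] by linarith
  qed (use \<alpha> in auto)
  have Gb: "norm (G x) \<le> B0 + Lc * \<bar>R\<bar> powr \<alpha>" if x: "x \<in> DD" for x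
  proof -
    have "norm (G x) \<le> norm (G x - g0 (x $ 3)) + norm (g0 (x $ 3))" using norm_triangle_sub[of "G x" "g0 (x $ 3)"] by simp
    also have "\<dots> \<le> Lc * \<bar>R\<bar> powr \<alpha> + B0"
      using G(2)[OF x] pR[OF x] Lc by (intro add_mono g0) (auto intro: order_trans mult_left_mono)
    finally show ?thesis by simp
  qed
  show iG: "integrable ?N (\<lambda>x. of_real (\<psi> (x $ 3)) * G x * \<kappa> (proj2 x))" by (rule ip[OF G(1) Gb])
  have i0: "integrable ?N (\<lambda>x. of_real (\<psi> (x $ 3)) * g0 (x $ 3) * \<kappa> (proj2 x))"
    by (rule ip[OF lift3[OF g0(1)]]) (rule g0(2))
  have "(LINT t:{-M<..<M}|lebesgue. of_real (\<psi> t) * g0 t) * (LINT y|lebesgue_on S. \<kappa> y)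
      = (LINT x|?N. of_real (\<psi> (x $ 3)) * g0 (x $ 3) * \<kappa> (proj2 x))"
    unfolding DD_def by (rule integral_cyl_product[symmetric]) (use i0 Ds S(1) in \<open>auto simp: DD_def\<close>)
  then have "(LINT x|?N. of_real (\<psi> (x $ 3)) * G x * \<kappa> (proj2 x))
      - (LINT t:{-M<..<M}|lebesgue. of_real (\<psi> t) * g0 t) * (LINT y|lebesgue_on S. \<kappa> y)
      = (LINT x|?N. of_real (\<psi> (x $ 3)) * G x * \<kappa> (proj2 x) - of_real (\<psi> (x $ 3)) * g0 (x $ 3) * \<kappa> (proj2 x))"
    using iG i0 by simp
  also have "norm \<dots> \<le> (LINT x|?N. norm (of_real (\<psi> (x $ 3)) * G x * \<kappa> (proj2 x) - of_real (\<psi> (x $ 3)) * g0 (x $ 3) * \<kappa> (proj2 x)))"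
    by (rule integral_norm_bound)
  also have "\<dots> \<le> (LINT x|?N. (B * Lc * K * e powr \<alpha>) * wt (proj2 x /\<^sub>R e))"
  proof (rule integral_mono)
    show "integrable ?N (\<lambda>x. norm (of_real (\<psi> (x $ 3)) * G x * \<kappa> (proj2 x) - of_real (\<psi> (x $ 3)) * g0 (x $ 3) * \<kappa> (proj2 x)))"
      using iG i0 by (intro integrable_norm Bochner_Integration.integrable_diff)
    show "integrable ?N (\<lambda>x. (B * Lc * K * e powr \<alpha>) * wt (proj2 x /\<^sub>R e))"
      by (intro integrable_mult_right integral_wt_cyl(1)[OF Ds(2) DS(2) e M])
    fix x assume "x \<in> space ?N"
    then have x: "x \<in> DD" by simp
    define s where "s = norm (proj2 x /\<^sub>R e)"
    have s0: "s \<ge> 0" by (simp add: s_def)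
    have es: "norm (proj2 x) = e * s" using e by (simp add: s_def)
    have sp: "s powr \<alpha> \<le> 1 + s"
    proof (cases "s \<le> 1")
      case True then show ?thesis using powr_mono2[of \<alpha> s 1] \<alpha> s0 by simp
    next
      case False then show ?thesis using powr_mono[of \<alpha> 1 s] \<alpha> by simp
    qed
    have "norm (of_real (\<psi> (x $ 3)) * G x * \<kappa> (proj2 x) - of_real (\<psi> (x $ 3)) * g0 (x $ 3) * \<kappa> (proj2 x))
        = \<bar>\<psi> (x $ 3)\<bar> * norm (G x - g0 (x $ 3)) * norm (\<kappa> (proj2 x))"
    proof -
      have "of_real (\<psi> (x $ 3)) * G x * \<kappa> (proj2 x) - of_real (\<psi> (x $ 3)) * g0 (x $ 3) * \<kappa> (proj2 x)
          = of_real (\<psi> (x $ 3)) * (G x - g0 (x $ 3)) * \<kappa> (proj2 x)"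
        by (simp add: algebra_simps)
      then show ?thesis by (simp only: norm_mult norm_of_real)
    qed
    also have "\<dots> \<le> B * (Lc * norm (proj2 x) powr \<alpha>) * (K * (wt (proj2 x /\<^sub>R e) / (1 + s)))"
      using B Lc \<kappa>(2)[OF DS(1)[OF x]] unfolding s_def
      by (intro mult_mono \<psi> G(2)[OF x]) auto
    also have "\<dots> = (B * Lc * K * e powr \<alpha>) * (wt (proj2 x /\<^sub>R e) * (s powr \<alpha> / (1 + s)))"
      using e s0 by (simp add: es powr_mult)
    also have "\<dots> \<le> (B * Lc * K * e powr \<alpha>) * (wt (proj2 x /\<^sub>R e) * 1)"
      using sp s0 B Lc K wt_pos[of "proj2 x /\<^sub>R e"] by (intro mult_left_mono) (auto simp: divide_le_eq)
    finally show "norm (of_real (\<psi> (x $ 3)) * G x * \<kappa> (proj2 x) - of_real (\<psi> (x $ 3)) * g0 (x $ 3) * \<kappa> (proj2 x)) \<le> (B * Lc * K * e powr \<alpha>) * wt (proj2 x /\<^sub>R e)" by simp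
  qed
  also have "\<dots> = (B * Lc * K * e powr \<alpha>) * (LINT x|?N. wt (proj2 x /\<^sub>R e))" by simp
  also have "\<dots> \<le> (B * Lc * K * e powr \<alpha>) * (2 * M * wt_mass * e\<^sup>2)"
    using B Lc K by (intro mult_left_mono integral_wt_cyl(2)[OF Ds(2) DS(2) e M]) auto
  finally show "norm ((LINT x|?N. of_real (\<psi> (x $ 3)) * G x * \<kappa> (proj2 x))
      - (LINT t:{-M<..<M}|lebesgue. of_real (\<psi> t) * g0 t) * (LINT y|lebesgue_on S. \<kappa> y))
      \<le> B * Lc * K * e powr \<alpha> * (2 * M * wt_mass * e\<^sup>2)" .
qed

section \<open>Scaling and weighted estimates\<close>

lemma lborel_integral_scale:
  fixes f :: "real^2 \<Rightarrow> complex"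
  assumes [measurable]: "f \<in> borel_measurable borel" and e: "e > 0"
  shows "(LINT y|lborel. f (y /\<^sub>R e)) = of_real (e\<^sup>2) * (LINT y|lborel. f y)"
proof -
  have "(LINT y|lborel. f (y /\<^sub>R e)) = (LINT y|density (distr lborel borel (\<lambda>x. 0 + e *\<^sub>R x)) (\<lambda>_. \<bar>e\<bar>^DIM(real^2)). f (y /\<^sub>R e))"
    using e by (subst lborel_affine[of e 0, symmetric]) auto
  also have "\<dots> = (LINT y|distr lborel borel (\<lambda>x. 0 + e *\<^sub>R x). (\<bar>e\<bar>^DIM(real^2)) *\<^sub>R f (y /\<^sub>R e))"
    by (subst integral_density) auto
  also have "\<dots> = (LINT x|lborel. (\<bar>e\<bar>^DIM(real^2)) *\<^sub>R f ((0 + e *\<^sub>R x) /\<^sub>R e))"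
    by (subst integral_distr) auto
  also have "\<dots> = (LINT x|lborel. (e\<^sup>2) *\<^sub>R f x)" using e by simp
  also have "\<dots> = of_real (e\<^sup>2) * (LINT y|lborel. f y)"
    by (simp only: scaleR_conv_of_real integral_mult_right_zero)
  finally show ?thesis .
qed

text \<open>The weight is at most 1, hence dominates its own square, and Young's inequality
  separates it from d. For an L2 norm of at most t e the result is of order t e^2.\<close>

lemma weighted_L2_bound:
  fixes d :: "real^3 \<Rightarrow> complex"
  assumes D: "open DD" "\<And>x. x \<in> DD \<Longrightarrow> x $ 3 \<in> {-M<..<M}" and M: "M > 0" and e: "e > 0" and t: "t > 0"
    and d: "L2 (lebesgue_on DD) d"
  shows "(LINT x|lebesgue_on DD. norm (d x) * wt (proj2 x /\<^sub>R e)) \<le> (t * (2 * M * wt_mass * e\<^sup>2) + (L2_norm (lebesgue_on DD) d)\<^sup>2 / t) / 2"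
proof -
  let ?N = "lebesgue_on DD"
  have Db: "DD \<in> sets borel" using D(1) by (rule borel_open)
  note iW = integral_wt_cyl[OF Db D(2) e M]
  have d2: "integrable ?N (\<lambda>x. (norm (d x))\<^sup>2)" using d by (simp add: L2_def)
  have "(LINT x|?N. norm (d x) * wt (proj2 x /\<^sub>R e)) \<le> (LINT x|?N. (t * wt (proj2 x /\<^sub>R e) + (norm (d x))\<^sup>2 / t) / 2)"
  proof (rule integral_mono_AE')
    show "integrable ?N (\<lambda>x. (t * wt (proj2 x /\<^sub>R e) + (norm (d x))\<^sup>2 / t) / 2)"
      using iW(1) d2 by (intro integrable_divide_zero Bochner_Integration.integrable_add integrable_mult_right) auto
    have "norm (d x) * wt y \<le> (t * wt y + (norm (d x))\<^sup>2 / t) / 2" for x and y :: "real^2"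
    proof -
      have "wt y * norm (d x) \<le> (t * (wt y)\<^sup>2 + (norm (d x))\<^sup>2 / t) / 2" by (rule young_inequality[OF t])
      also have "(wt y)\<^sup>2 \<le> wt y" using wt_pos[of y] wt_le_1[of y] by (simp add: power2_eq_square mult_left_le)
      finally show ?thesis using t by (simp add: mult.commute)
    qed
    then show "AE x in ?N. norm (d x) * wt (proj2 x /\<^sub>R e) \<le> (t * wt (proj2 x /\<^sub>R e) + (norm (d x))\<^sup>2 / t) / 2" by simp
    show "AE x in ?N. 0 \<le> (t * wt (proj2 x /\<^sub>R e) + (norm (d x))\<^sup>2 / t) / 2"
      using t wt_pos by (auto intro!: AE_I2 add_nonneg_nonneg simp: less_imp_le)
  qed
  also have "\<dots> = (t * (LINT x|?N. wt (proj2 x /\<^sub>R e)) + (LINT x|?N. (norm (d x))\<^sup>2) / t) / 2"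
    using iW(1) d2 by simp
  also have "(LINT x|?N. (norm (d x))\<^sup>2) = (L2_norm ?N d)\<^sup>2" by (simp add: L2_norm_def integral_nonneg_AE)
  also have "(t * (LINT x|?N. wt (proj2 x /\<^sub>R e)) + (L2_norm ?N d)\<^sup>2 / t) / 2 \<le> (t * (2 * M * wt_mass * e\<^sup>2) + (L2_norm ?N d)\<^sup>2 / t) / 2"
    using iW(2) t by (intro divide_right_mono add_mono mult_left_mono) auto
  finally show ?thesis .
qed

lemma norm_integral_le_weighted:
  fixes u \<kappa> :: "'a \<Rightarrow> complex" and m :: "'a \<Rightarrow> real"
  assumes u: "integrable N u" and m: "m \<in> borel_measurable N" "\<And>x. x \<in> space N \<Longrightarrow> \<bar>m x\<bar> \<le> 1"
    and \<kappa>: "\<And>x. x \<in> space N \<Longrightarrow> norm (\<kappa> x) \<le> K * m x"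
  shows "norm (LINT x|N. u x * \<kappa> x) \<le> K * (LINT x|N. norm (u x) * m x)"
proof (cases "integrable N (\<lambda>x. u x * \<kappa> x)")
  case True
  note i = integrable_norm_times_bounded[OF u m]
  have "norm (LINT x|N. u x * \<kappa> x) \<le> (LINT x|N. norm (u x * \<kappa> x))" by (rule integral_norm_bound)
  also have "\<dots> \<le> (LINT x|N. K * (norm (u x) * m x))"
  proof (rule integral_mono[OF integrable_norm[OF True] integrable_mult_right[OF i]])
    fix x assume x: "x \<in> space N"
    show "norm (u x * \<kappa> x) \<le> K * (norm (u x) * m x)"
      using mult_left_mono[OF \<kappa>[OF x] norm_ge_zero[of "u x"]] by (simp add: norm_mult mult_ac)
  qed
  finally show ?thesis by simp
next
  \<comment> \<open>A non-integrable product has integral 0 by convention, so only nonnegativity of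
    the right side is left; it follows from the bound on \<kappa>.\<close>
  case False
  have "0 \<le> (LINT x|N. norm (u x) * (K * m x))"
  proof (rule integral_nonneg_AE, rule AE_I2)
    fix x assume "x \<in> space N"
    then have "0 \<le> K * m x" using \<kappa> norm_ge_zero order_trans by blast
    then show "0 \<le> norm (u x) * (K * m x)" by simp
  qed
  also have "(\<lambda>x. norm (u x) * (K * m x)) = (\<lambda>x. K * (norm (u x) * m x))" by (simp add: fun_eq_iff)
  finally show ?thesis using False by (simp add: not_integrable_integral_eq)
qed

lemma holder_on_continuous_on:
  assumes "holder_on \<alpha> K f" "\<alpha> > 0"
  shows "continuous_on K f"
proof -
  obtain C where C: "\<And>x y. x \<in> K \<Longrightarrow> y \<in> K \<Longrightarrow> dist (f x) (f y) \<le> C * dist x y powr \<alpha>"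
    using assms(1) by (auto simp: holder_on_def)
  show ?thesis
    unfolding continuous_on_def
  proof
    fix y assume y: "y \<in> K"
    have "((\<lambda>x. dist x y) \<longlongrightarrow> 0) (at y within K)" by (rule tendsto_dist_iff[THEN iffD1]) (rule tendsto_ident_at)
    then have "((\<lambda>x. dist x y powr \<alpha>) \<longlongrightarrow> 0) (at y within K)"
      using assms(2) by (intro tendsto_zero_powrI[OF _ tendsto_const]) auto
    then have l: "((\<lambda>x. C * dist x y powr \<alpha>) \<longlongrightarrow> 0) (at y within K)" by (rule tendsto_mult_right_zero)
    show "(f \<longlongrightarrow> f y) (at y within K)"
    proof (rule tendsto_dist_iff[THEN iffD2], rule Lim_null_comparison[OF _ l])
      show "\<forall>\<^sub>F x in at y within K. norm (dist (f x) (f y)) \<le> C * dist x y powr \<alpha>"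
        using C y by (auto simp: eventually_at_filter)
    qed
  qed
qed

lemma L2_norm_le_H1_norm: "L2_norm (lebesgue_on U) f \<le> H1_norm U f"
  unfolding H1_norm_def by (intro real_le_rsqrt) (auto intro!: sum_nonneg)

lemma L2_norm_nonneg: "0 \<le> L2_norm N f"
  unfolding L2_norm_def by (intro real_sqrt_ge_zero integral_nonneg_AE) auto

context plane_sector
begin

section \<open>Geometry of the truncated sector and mass of the kernel\<close>

lemma sector_nonempty: "\<exists>y\<in>W. norm y = 1"
proof -
  have d: "vector [1, (\<theta>\<^sub>m + \<theta>\<^sub>M) / 2] \<in> polar_dom" using \<theta>_bounds by (simp add: polar_dom_def)
  then have "polar (vector [1, (\<theta>\<^sub>m + \<theta>\<^sub>M) / 2]) \<in> W" using polar_image by blast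
  moreover have "norm (polar (vector [1, (\<theta>\<^sub>m + \<theta>\<^sub>M) / 2])) = 1" using norm_polar[OF d] by simp
  ultimately show ?thesis by blast
qed

lemma zero_in_closure_truncated_sector:
  assumes "h > 0"
  shows "0 \<in> closure (truncated_sector \<theta>\<^sub>m \<theta>\<^sub>M h)"
  unfolding closure_approachable
proof (intro allI impI)
  fix d :: real assume d: "d > 0"
  obtain y where y: "y \<in> W" "norm y = 1" using sector_nonempty by blast
  define c where "c = min d h / 2"
  have c: "c > 0" "c < d" "c < h" using d assms by (auto simp: c_def)
  have "c *\<^sub>R y \<in> truncated_sector \<theta>\<^sub>m \<theta>\<^sub>M h" using c y by (simp add: truncated_sector_def sector_scale)
  moreover have "dist (c *\<^sub>R y) 0 < d" using c y by simp
  ultimately show "\<exists>y\<in>truncated_sector \<theta>\<^sub>m \<theta>\<^sub>M h. dist y 0 < d" by blast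
qed

lemma open_truncated_sector: "open (truncated_sector \<theta>\<^sub>m \<theta>\<^sub>M h)"
  unfolding truncated_sector_def using open_sector by (intro open_Int) auto

lemma borel_measurable_\<eta> [measurable]: "\<eta> \<in> borel_measurable borel"
proof -
  have [measurable]: "vec2c \<in> borel_measurable borel"
    using continuous_on_vec2c[OF continuous_on_id, of UNIV] by (intro borel_measurable_continuous_onI) simp
  show ?thesis unfolding \<eta>_def by measurable
qed

text \<open>The sector is a cone, so discs about its vertex of radius at most h cut out similar
  pieces.\<close>

lemma measure_truncated_sector:
  assumes "0 < e" "e \<le> h"
  shows "measure lebesgue (ball 0 e \<inter> truncated_sector \<theta>\<^sub>m \<theta>\<^sub>M h) = e\<^sup>2 * measure lebesgue (ball 0 1 \<inter> W)"
proof -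
  have b: "ball 0 1 \<inter> W \<in> sets borel" "ball 0 e \<inter> W \<in> sets borel" using open_sector by auto
  have eq: "ball 0 e \<inter> truncated_sector \<theta>\<^sub>m \<theta>\<^sub>M h = ball 0 e \<inter> W" using assms by (auto simp: truncated_sector_def)
  have ind: "indicator (ball 0 1 \<inter> W) (y /\<^sub>R e) = (indicator (ball 0 e \<inter> W) y :: complex)" for y
    using assms sector_scale[of "inverse e" y] by (auto simp: indicator_def field_simps)
  have m: "(LINT y|lborel. indicator A y :: complex) = of_real (measure lebesgue A)" if "A \<in> sets borel" "bounded A" for A :: "(real^2) set"
  proof -
    have "(LINT y|lborel. indicator A y :: complex) = (LINT y|lborel. of_real (indicator A y))"
      by (simp add: of_real_indicator)
    also have "\<dots> = of_real (LINT y|lborel. indicator A y)"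
      using that(1) emeasure_bounded_finite[OF that(2)] by (intro integral_of_real integrable_real_indicator) auto
    also have "(LINT y|lborel. indicator A y) = measure lborel A" by simp
    finally show ?thesis using that(1) by (simp add: measure_completion)
  qed
  have "of_real (measure lebesgue (ball 0 e \<inter> W)) = (LINT y|lborel. indicator (ball 0 e \<inter> W) y :: complex)"
    by (rule m[symmetric, OF b(2)]) (auto intro: bounded_subset[OF bounded_ball])
  also have "\<dots> = (LINT y|lborel. indicator (ball 0 1 \<inter> W) (y /\<^sub>R e))" by (simp only: ind)
  also have "\<dots> = of_real (e\<^sup>2) * (LINT y|lborel. indicator (ball 0 1 \<inter> W) y)"
    using b(1) assms(1) by (intro lborel_integral_scale) auto
  also have "(LINT y|lborel. indicator (ball 0 1 \<inter> W) y :: complex) = of_real (measure lebesgue (ball 0 1 \<inter> W))"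
    by (rule m[OF b(1)]) (auto intro: bounded_subset[OF bounded_ball])
  finally have "complex_of_real (measure lebesgue (ball 0 e \<inter> W)) = of_real (e\<^sup>2 * measure lebesgue (ball 0 1 \<inter> W))"
    by (simp only: of_real_mult)
  then show ?thesis unfolding eq by (simp only: of_real_eq_iff)
qed

lemma measure_unit_sector_pos: "measure lebesgue (ball 0 1 \<inter> W) > 0"
proof -
  have o: "open (ball 0 1 \<inter> W)" using open_sector by (intro open_Int) auto
  obtain y where y: "y \<in> W" "norm y = 1" using sector_nonempty by blast
  then have "(1/2) *\<^sub>R y \<in> ball 0 1 \<inter> W" by (simp add: sector_scale)
  then have "\<not> negligible (ball 0 1 \<inter> W)" using open_not_negligible[OF o] by blast
  moreover have "ball 0 1 \<inter> W \<in> lmeasurable" using o by (intro lmeasurable_open) (auto intro: bounded_subset[OF bounded_ball])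
  ultimately have "measure lebesgue (ball 0 1 \<inter> W) \<noteq> 0" by (simp add: negligible_iff_measure0)
  then show ?thesis by (simp add: less_le)
qed

text \<open>The horizontal factor of the test function, stated outside its locale so that the scale
  can vary along a sequence.\<close>

definition kern :: "real \<Rightarrow> real \<Rightarrow> real^2 \<Rightarrow> complex" where
  "kern h e y = of_real ((max 0 (1 - (norm y)\<^sup>2 / h\<^sup>2)) ^ 3) * \<eta> (y /\<^sub>R e)"

lemma norm_kern_le:
  assumes "e > 0" "y \<in> W"
  shows "norm (kern h e y) \<le> 1 / sep ^ 5 * (wt (y /\<^sub>R e) / (1 + norm (y /\<^sub>R e)))"
proof -
  have "(max 0 (1 - (norm y)\<^sup>2 / h\<^sup>2)) ^ 3 \<le> 1" by (intro power_le_one) auto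
  then have "norm (kern h e y) \<le> 1 * norm (\<eta> (y /\<^sub>R e))"
    unfolding kern_def norm_mult norm_of_real by (intro mult_right_mono) auto
  also have "\<dots> \<le> 1 / sep ^ 5 * (wt (y /\<^sub>R e) / (1 + norm (y /\<^sub>R e)))"
    using norm_\<eta>_le[of "y /\<^sub>R e"] assms sector_scale[of "inverse e" y] by simp
  finally show ?thesis .
qed

lemma borel_measurable_kern: "kern h e \<in> borel_measurable borel"
  unfolding kern_def by measurable

text \<open>In the variable z = y/e the cut-off tends to 1, the disc of radius h/e exhausts the
  plane, and |\<eta>| dominates on the sector; the divisor is the Jacobian.\<close>

lemma kern_integral_tendsto:
  fixes e :: "nat \<Rightarrow> real"
  assumes h: "h > 0" and e: "\<And>n. 0 < e n" "e \<longlonglongrightarrow> 0"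
  shows "(\<lambda>n. (LINT y|lebesgue_on (truncated_sector \<theta>\<^sub>m \<theta>\<^sub>M h). kern h (e n) y) / of_real ((e n)\<^sup>2)) \<longlonglongrightarrow> (LINT y|lebesgue_on W. \<eta> y)"
proof -
  let ?S = "truncated_sector \<theta>\<^sub>m \<theta>\<^sub>M h"
  have Wb[measurable]: "W \<in> sets borel" using open_sector by simp
  have Sb: "?S \<in> sets borel" using open_truncated_sector by simp
  let ?F = "\<lambda>n z. indicator (ball 0 (h / e n)) z *\<^sub>R indicator W z *\<^sub>R (of_real ((max 0 (1 - (norm (e n *\<^sub>R z))\<^sup>2 / h\<^sup>2)) ^ 3) * \<eta> z)"
  let ?G = "\<lambda>z. indicator W z *\<^sub>R \<eta> z"
  have Fm: "?F n \<in> borel_measurable borel" for n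
  proof -
    have [measurable]: "(\<lambda>z::real^2. complex_of_real ((max 0 (1 - (norm (e n *\<^sub>R z))\<^sup>2 / h\<^sup>2)) ^ 3)) \<in> borel_measurable borel"
      by measurable
    have [measurable]: "(indicator (ball 0 (h / e n)) :: real^2 \<Rightarrow> real) \<in> borel_measurable borel"
      by (intro borel_measurable_indicator) simp
    have [measurable]: "(indicator W :: real^2 \<Rightarrow> real) \<in> borel_measurable borel"
      by (intro borel_measurable_indicator Wb)
    show ?thesis by measurable
  qed
  have Gm: "?G \<in> borel_measurable lborel" by measurable
  have "integrable lebesgue ?G" using integrable_\<eta> Wb by (simp add: integrable_restrict_space)
  then have Gi: "integrable lborel ?G" using integrable_completion[OF Gm] by simp
  have eqn: "(LINT y|lebesgue_on ?S. kern h (e n) y) / of_real ((e n)\<^sup>2) = (LINT z|lborel. ?F n z)" for n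
  proof -
    have e0: "e n > 0" by (rule e)
    have pt: "indicator ?S y *\<^sub>R kern h (e n) y = ?F n (y /\<^sub>R e n)" for y
      using e0 sector_scale[of "inverse (e n)" y]
      by (auto simp: indicator_def truncated_sector_def kern_def field_simps)
    have km: "(\<lambda>y. indicator ?S y *\<^sub>R kern h (e n) y) \<in> borel_measurable lborel"
      using Sb borel_measurable_kern by measurable
    have "(LINT y|lebesgue_on ?S. kern h (e n) y) = (LINT y|lebesgue. indicator ?S y *\<^sub>R kern h (e n) y)"
      using Sb by (simp add: integral_restrict_space)
    also have "\<dots> = (LINT y|lborel. indicator ?S y *\<^sub>R kern h (e n) y)" by (rule integral_completion[OF km])
    also have "\<dots> = (LINT y|lborel. ?F n (y /\<^sub>R e n))" by (simp only: pt)
    also have "\<dots> = of_real ((e n)\<^sup>2) * (LINT z|lborel. ?F n z)" by (rule lborel_integral_scale[OF Fm e0])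
    finally show ?thesis using e0 by simp
  qed
  have "(\<lambda>n. LINT z|lborel. ?F n z) \<longlonglongrightarrow> (LINT z|lborel. ?G z)"
  proof (rule integral_dominated_convergence[where w="\<lambda>z. norm (?G z)"])
    show "AE z in lborel. (\<lambda>n. ?F n z) \<longlonglongrightarrow> ?G z"
    proof (rule AE_I2)
      fix z :: "real^2"
      have "(\<lambda>n. e n * (norm z + 1)) \<longlonglongrightarrow> 0 * (norm z + 1)" by (intro tendsto_intros e)
      then have "\<forall>\<^sub>F n in sequentially. e n * (norm z + 1) < h" using h by (intro order_tendstoD) auto
      then have ev: "\<forall>\<^sub>F n in sequentially. indicator (ball 0 (h / e n)) z = (1::real)"
      proof eventually_elim
        case (elim n)
        have "e n * norm z < h" using elim e(1)[of n] by (simp add: distrib_left)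
        then have "norm z < h / e n" using e(1)[of n] by (simp add: pos_less_divide_eq mult.commute)
        then show ?case by simp
      qed
      have "(\<lambda>n. of_real ((max 0 (1 - (norm (e n *\<^sub>R z))\<^sup>2 / h\<^sup>2)) ^ 3) * \<eta> z) \<longlonglongrightarrow> of_real ((max 0 (1 - (norm (0 *\<^sub>R z))\<^sup>2 / h\<^sup>2)) ^ 3) * \<eta> z"
        using h by (intro tendsto_intros e) auto
      then have "(\<lambda>n. indicator W z *\<^sub>R (of_real ((max 0 (1 - (norm (e n *\<^sub>R z))\<^sup>2 / h\<^sup>2)) ^ 3) * \<eta> z)) \<longlonglongrightarrow> ?G z"
        by (intro tendsto_scaleR tendsto_const) simp
      from tendsto_scaleR[OF tendsto_eventually[OF ev] this]
      show "(\<lambda>n. ?F n z) \<longlonglongrightarrow> ?G z" by simp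
    qed
    show "AE z in lborel. norm (?F n z) \<le> norm (?G z)" for n
    proof (rule AE_I2)
      fix z :: "real^2"
      have "(max 0 (1 - (norm (e n *\<^sub>R z))\<^sup>2 / h\<^sup>2)) ^ 3 \<le> 1" by (intro power_le_one) auto
      then have "norm (of_real ((max 0 (1 - (norm (e n *\<^sub>R z))\<^sup>2 / h\<^sup>2)) ^ 3) * \<eta> z) \<le> 1 * norm (\<eta> z)"
        unfolding norm_mult norm_of_real by (intro mult_right_mono) auto
      then show "norm (?F n z) \<le> norm (?G z)"
        by (cases "z \<in> W"; cases "z \<in> ball 0 (h / e n)") (simp_all only: indicator_simps scaleR_one scaleR_zero_left norm_zero norm_ge_zero mult_1 simp_thms not_False_eq_True)
    qed
    show "integrable lborel (\<lambda>z. norm (?G z))" by (rule integrable_norm[OF Gi])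
  qed (use Fm Gm in simp_all)
  moreover have "(LINT z|lborel. ?G z) = (LINT y|lebesgue_on W. \<eta> y)"
    using integral_completion[OF Gm] Wb by (simp add: integral_restrict_space)
  ultimately show ?thesis by (simp only: eqn)
qed

end

text \<open>In the proof, \<open>T \<kappa> G\<close> is the rescaled integral of \<open>G\<close> against \<open>\<psi> \<kappa>\<close>. Its asymptotics is the same
  for all admissible kernels \<open>\<kappa>\<close>; the test function gives that the edge values agree in the limit, and
  the indicator of a disc then gives the average.\<close>

lemma corner_average_tendsto_0:
  fixes \<Omega> :: "(real^3) set" and V v w f :: "real^3 \<Rightarrow> complex"
    and g :: "nat \<Rightarrow> real^3 \<Rightarrow> complex" and \<psi> :: "real \<Rightarrow> real" and e :: "nat \<Rightarrow> real"
    and \<theta>\<^sub>m \<theta>\<^sub>M M \<alpha> h k C \<Upsilon> \<rho>\<^sub>g :: real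
  defines "S \<equiv> truncated_sector \<theta>\<^sub>m \<theta>\<^sub>M h"
  defines "DD \<equiv> cyl S {-M<..<M}"
  assumes \<theta>: "- pi < \<theta>\<^sub>m" "\<theta>\<^sub>m < \<theta>\<^sub>M" "\<theta>\<^sub>M < pi" "\<theta>\<^sub>M - \<theta>\<^sub>m \<noteq> pi"
    and \<Omega>: "open \<Omega>" "bounded \<Omega>" and D: "cyl (ball 0 h) {-M<..<M} \<inter> \<Omega> = DD"
    and hM: "h > 0" "M > 0" and \<alpha>: "0 < \<alpha>" "\<alpha> \<le> 1"
    and \<psi>: "test_function {-M<..<M} \<psi>"
    and V: "Linf \<Omega> V" and k: "k > 0" and te: "transmission_eigenfunctions \<Omega> V k v w"
    and f: "holder_on \<alpha> (cyl (closure S) {-M..M}) f" "AE x in lebesgue_on DD. f x = (1 + V x) * w x"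
    and C: "C > 0" and \<Upsilon>: "\<Upsilon> > 0" and \<rho>: "0 < \<rho>\<^sub>g" "\<rho>\<^sub>g \<le> 1"
    and g: "\<And>j. j \<ge> 1 \<Longrightarrow> L2 sphere_measure (g j)"
      "\<And>j. j \<ge> 1 \<Longrightarrow> H1_norm DD (\<lambda>x. v x - herglotz k (g j) x) \<le> real j powr (- 2 - \<Upsilon>)"
      "\<And>j. j \<ge> 1 \<Longrightarrow> L2_norm sphere_measure (g j) \<le> C * real j powr \<rho>\<^sub>g"
    and e: "\<And>n. 0 < e n" "\<And>n. e n < h" "e \<longlonglongrightarrow> 0"
  shows "integrable (lebesgue_on DD) (\<lambda>x. V x * w x)"
    and "(\<lambda>n. (LINT x|lebesgue_on DD. (V x * w x) * (of_real (\<psi> (x $ 3)) * indicator (ball 0 (e n)) (proj2 x)))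
      / of_real (measure lebesgue (ball 0 (e n) \<inter> S))) \<longlonglongrightarrow> 0"
proof -
  let ?I = "{-M<..<M}" and ?N = "lebesgue_on DD"
  interpret plane_sector \<theta>\<^sub>m \<theta>\<^sub>M by unfold_locales (use \<theta> in auto)
  have SW: "S = W \<inter> ball 0 h" by (simp add: S_def truncated_sector_def)
  have So: "open S" unfolding S_def by (rule open_truncated_sector)
  have Do: "open DD" unfolding DD_def by (intro open_cyl So) auto
  have DS: "proj2 x \<in> S" "x $ 3 \<in> ?I" if "x \<in> DD" for x using that by (simp_all add: DD_def cyl_def)
  have Dsub: "DD \<subseteq> \<Omega>" using D by blast
  have Db: "bounded DD" using Dsub \<Omega>(2) by (rule bounded_subset[rotated])
  have Ds: "DD \<in> sets lebesgue" "\<Omega> \<in> sets lebesgue" "DD \<in> sets borel" using Do \<Omega>(1) by auto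
  note fin = finite_measure_lebesgue_on_open[OF Do Db] and fin\<Omega> = finite_measure_lebesgue_on_open[OF \<Omega>]
  note sub = lebesgue_on_subset(1)[OF Ds(1,2) Dsub]
  have st: "sector_test \<theta>\<^sub>m \<theta>\<^sub>M \<Omega> h M (e n) \<psi>" for n
    by unfold_locales (use hM e \<Omega> \<psi> D in \<open>auto simp: DD_def S_def\<close>)
  have H: "H1 \<Omega> v" "H1 \<Omega> w" and tr: "H1_0 \<Omega> (\<lambda>x. w x - v x)"
    using te by (auto simp: transmission_eigenfunctions_def same_trace_def)
  have L2\<Omega>: "L2 (lebesgue_on \<Omega>) v" "L2 (lebesgue_on \<Omega>) w" using H by simp_all
  have iv: "integrable ?N v" and iw: "integrable ?N w"
    using sub L2_imp_integrable[OF fin\<Omega>] L2\<Omega> by auto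
  show iVw: "integrable ?N (\<lambda>x. V x * w x)"
    by (rule sub[OF Linf_times_L2_integrable[OF fin\<Omega> V L2\<Omega>(2)]])
  have iqw: "integrable ?N (\<lambda>x. (1 + V x) * w x)" using iw iVw by (simp add: ring_distribs)
  have feq: "AE x in lebesgue. x \<in> DD \<longrightarrow> (1 + V x) * w x = f x"
    using f(2) unfolding AE_lebesgue_on_iff[OF Ds(1)] by eventually_elim simp
  have fm: "f \<in> borel_measurable ?N"
    by (rule borel_measurable_lebesgue_on_AE[OF Ds(1) borel_measurable_integrable[OF iqw] feq])
  have if': "integrable ?N f"
    by (rule integrable_cong_AE_imp[OF iqw fm]) (use f(2) in eventually_elim, simp)
  have L2v: "L2 ?N v"
  proof -
    have "integrable (lebesgue_on \<Omega>) (\<lambda>x. complex_of_real ((norm (v x))\<^sup>2))"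
      using L2\<Omega>(1) unfolding L2_def by (intro integrable_of_real) simp
    from sub[OF this] have "integrable ?N (\<lambda>x. (norm (v x))\<^sup>2)" by (simp only: complex_of_real_integrable_eq)
    then show ?thesis using borel_measurable_integrable[OF iv] by (simp add: L2_def)
  qed

  obtain B1 where B1: "\<And>t. \<bar>\<psi> t\<bar> \<le> B1"
    by (rule sector_test.compact_support_bounded_real[OF st[of 0] sector_test.cont_\<psi>(1)[OF st[of 0]] sector_test.outside_supp(1)[OF st[of 0]]]) auto
  obtain B2 where B2: "\<And>t. \<bar>pd 1 (pd 1 \<psi>) t\<bar> \<le> B2"
    by (rule sector_test.compact_support_bounded_real[OF st[of 0] sector_test.cont_\<psi>(3)[OF st[of 0]] sector_test.outside_supp(3)[OF st[of 0]]]) auto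
  define B where "B = max B1 B2"
  have B: "\<bar>\<psi> t\<bar> \<le> B" "\<bar>pd 1 (pd 1 \<psi>) t\<bar> \<le> B" for t
    using B1[of t] B2[of t] by (auto simp: B_def)
  have B0: "0 \<le> B" using B(1)[of 0] by linarith
  have \<psi>m: "\<psi> \<in> borel_measurable borel"
    using sector_test.cont_\<psi>(1)[OF st[of 0]] by (rule borel_measurable_continuous_onI)

  define Wn where "Wn n x = wt (proj2 x /\<^sub>R e n)" for n x
  have Wm: "Wn n \<in> borel_measurable ?N" for n
    unfolding Wn_def by (rule measurable_restrict_space1, rule measurable_completion) measurable
  have Wb: "\<bar>Wn n x\<bar> \<le> 1" "0 \<le> Wn n x" for n x
    using wt_pos[of "proj2 x /\<^sub>R e n"] wt_le_1[of "proj2 x /\<^sub>R e n"] by (auto simp: Wn_def)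
  define mu where "mu = 2 * M * wt_mass"
  have mu: "mu \<ge> 0" using hM wt_mass_nonneg by (simp add: mu_def)

  define mf where "mf \<kappa> n x = complex_of_real (\<psi> (x $ 3)) * \<kappa> n (proj2 x)" for \<kappa> :: "nat \<Rightarrow> real^2 \<Rightarrow> complex" and n x
  define T where "T \<kappa> G n = (LINT x|?N. G x * mf \<kappa> n x) / of_real ((e n)\<^sup>2)" for \<kappa> G n
  define X where "X \<kappa> n = (LINT y|lebesgue_on S. \<kappa> n y) / of_real ((e n)\<^sup>2)" for \<kappa> :: "nat \<Rightarrow> real^2 \<Rightarrow> complex" and n
  \<comment> \<open>The constant K is the same for all n, and the spare factor 1 + |y|/e is
    demanded; both the rational kernel and the indicator of a disc comply.\<close>
  define adm where "adm \<kappa> K \<longleftrightarrow> K \<ge> 0 \<and> (\<forall>n. \<kappa> n \<in> borel_measurable borel) \<and>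
      (\<forall>n. \<forall>y\<in>S. norm (\<kappa> n y) \<le> K * (wt (y /\<^sub>R e n) / (1 + norm (y /\<^sub>R e n))))" for \<kappa> :: "nat \<Rightarrow> real^2 \<Rightarrow> complex" and K

  have mfm: "mf \<kappa> n \<in> borel_measurable ?N" and mfb: "\<And>x. x \<in> DD \<Longrightarrow> norm (mf \<kappa> n x) \<le> B * K * Wn n x"
    if adm: "adm \<kappa> K" for \<kappa> K n
  proof -
    have \<kappa>m: "\<kappa> n \<in> borel_measurable borel" using adm by (simp add: adm_def)
    note [measurable] = \<kappa>m \<psi>m
    have "(\<lambda>x. complex_of_real (\<psi> (x $ 3)) * \<kappa> n (proj2 x)) \<in> borel_measurable lborel" by measurable
    then show "mf \<kappa> n \<in> borel_measurable ?N"
      unfolding mf_def by (rule measurable_restrict_space1[OF measurable_completion])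
    fix x assume x: "x \<in> DD"
    have K: "K \<ge> 0" using adm by (simp add: adm_def)
    have "norm (\<kappa> n (proj2 x)) \<le> K * (Wn n x / (1 + norm (proj2 x /\<^sub>R e n)))"
      using adm DS(1)[OF x] unfolding adm_def Wn_def by blast
    also have "\<dots> \<le> K * Wn n x"
    proof (rule mult_left_mono[OF _ K])
      have "Wn n x / (1 + norm (proj2 x /\<^sub>R e n)) \<le> Wn n x / 1"
        using one_plus_norm_pos[of "proj2 x /\<^sub>R e n"] by (intro divide_left_mono Wb(2)) (simp_all del: norm_scaleR)
      then show "Wn n x / (1 + norm (proj2 x /\<^sub>R e n)) \<le> Wn n x" by simp
    qed
    finally have "norm (\<kappa> n (proj2 x)) \<le> K * Wn n x" .
    then have "norm (mf \<kappa> n x) \<le> B * (K * Wn n x)"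
      unfolding mf_def norm_mult norm_of_real by (intro mult_mono B) (use B0 in auto)
    then show "norm (mf \<kappa> n x) \<le> B * K * Wn n x" by (simp add: mult.assoc)
  qed
  have imf: "integrable ?N (\<lambda>x. G x * mf \<kappa> n x)" if adm: "adm \<kappa> K" and G: "integrable ?N G" for \<kappa> K n G
  proof (rule integrable_mult_bounded_space[OF G mfm[OF adm]])
    fix x assume "x \<in> space ?N"
    then have "norm (mf \<kappa> n x) \<le> B * K * Wn n x" by (intro mfb[OF adm]) simp
    also have "\<dots> \<le> B * K * 1"
      using Wb(1)[of n x] B0 adm by (intro mult_left_mono) (auto simp: adm_def)
    finally show "norm (mf \<kappa> n x) \<le> B * K * 1" .
  qed
  have Tdiff: "T \<kappa> (\<lambda>x. G x - G' x) n = T \<kappa> G n - T \<kappa> G' n"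
    if "adm \<kappa> K" "integrable ?N G" "integrable ?N G'" for \<kappa> K n G G'
    unfolding T_def left_diff_distrib
    using imf[OF that(1,2)] imf[OF that(1,3)] by (simp add: diff_divide_distrib)
  have Tbound: "norm (T \<kappa> G n) \<le> B * K * ((LINT x|?N. norm (G x) * Wn n x) / (e n)\<^sup>2)"
    if adm: "adm \<kappa> K" and G: "integrable ?N G" for \<kappa> K n G
  proof -
    have "norm (LINT x|?N. G x * mf \<kappa> n x) \<le> B * K * (LINT x|?N. norm (G x) * Wn n x)"
      by (rule norm_integral_le_weighted[OF G Wm Wb(1)]) (simp add: mfb[OF adm])
    then show ?thesis unfolding T_def norm_divide norm_of_real
      using divide_right_mono[of _ _ "(e n)\<^sup>2"] by (simp add: abs_of_nonneg)
  qed
  \<comment> \<open>Everything that is small because of v - w comes from here. The sector misses the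
    half-plane x2 = 0, x1 \<le> 0, as the circle inequality requires.\<close>
  have uas: "(\<lambda>n. (LINT x|?N. norm (v x - w x) * Wn n x) / (e n)\<^sup>2) \<longlonglongrightarrow> 0"
  proof -
    have "\<not> (x $ 2 = 0 \<and> x $ 1 \<le> 0)" if "x \<in> DD" for x
      using sector_avoids_axis[of "proj2 x"] DS(1)[OF that] SW by simp
    from rotational_poincare_asymptotics[OF \<Omega> D Do this tr hM(2) e(1,3)]
    show ?thesis by (simp only: Wn_def norm_minus_commute)
  qed
  have Tu: "(\<lambda>n. T \<kappa> (\<lambda>x. v x - w x) n) \<longlonglongrightarrow> 0" if adm: "adm \<kappa> K" for \<kappa> K
    by (rule Lim_null_comparison[OF _ tendsto_mult_right_zero[OF uas, of "B * K"]])
      (use Tbound[OF adm, of "\<lambda>x. v x - w x"] iv iw in auto)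
  have conc: "norm (T \<kappa> G n - (LINT t:?I|lebesgue. of_real (\<psi> t) * g0 t) * X \<kappa> n) \<le> B * Lc * K * e n powr b * mu"
    if adm: "adm \<kappa> K" and b: "0 < b" "b \<le> 1" and Lc: "Lc \<ge> 0"
      and g0: "g0 \<in> borel_measurable borel" "\<And>t. norm (g0 t) \<le> C0"
      and G: "G \<in> borel_measurable ?N" "\<And>x. x \<in> DD \<Longrightarrow> norm (G x - g0 (x $ 3)) \<le> Lc * norm (proj2 x) powr b"
    for \<kappa> K G g0 Lc b C0 n
  proof -
    have \<kappa>: "\<kappa> n \<in> borel_measurable borel" "\<And>y. y \<in> S \<Longrightarrow> norm (\<kappa> n y) \<le> K * (wt (y /\<^sub>R e n) / (1 + norm (y /\<^sub>R e n)))" "K \<ge> 0"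
      using adm by (auto simp: adm_def)
    have r: "(\<lambda>x. of_real (\<psi> (x $ 3)) * G x * \<kappa> n (proj2 x)) = (\<lambda>x. G x * mf \<kappa> n x)"
      by (simp add: fun_eq_iff mf_def mult_ac)
    have c: "norm ((LINT x|?N. G x * mf \<kappa> n x) - (LINT t:?I|lebesgue. of_real (\<psi> t) * g0 t) * (LINT y|lebesgue_on S. \<kappa> n y))
        \<le> B * Lc * K * e n powr b * (2 * M * wt_mass * (e n)\<^sup>2)"
      using edge_concentration(2)[OF So Db[unfolded DD_def] hM(2) e(1) b \<psi>m B(1) \<kappa>(1,2,3) Lc g0 G[unfolded DD_def]]
      unfolding DD_def[symmetric] r .
    have "T \<kappa> G n - (LINT t:?I|lebesgue. of_real (\<psi> t) * g0 t) * X \<kappa> n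
      = ((LINT x|?N. G x * mf \<kappa> n x) - (LINT t:?I|lebesgue. of_real (\<psi> t) * g0 t) * (LINT y|lebesgue_on S. \<kappa> n y)) / of_real ((e n)\<^sup>2)"
      by (simp add: T_def X_def diff_divide_distrib)
    also have "norm \<dots> \<le> B * Lc * K * e n powr b * (2 * M * wt_mass * (e n)\<^sup>2) / (e n)\<^sup>2"
      unfolding norm_divide norm_of_real abs_of_nonneg[OF zero_le_power2] by (rule divide_right_mono[OF c]) simp
    also have "\<dots> = B * Lc * K * e n powr b * mu" using e(1)[of n] by (simp add: mu_def)
    finally show ?thesis .
  qed

  \<comment> \<open>The edge lies in the closure of the cylinder, so the Hoelder representative is
    controlled there. Setting it to 0 outside [-M, M] gives a bounded Borel function on the line,
    whatever f does elsewhere.\<close>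
  define f0 where "f0 t = indicator {-M..M} t *\<^sub>R f (join3 0 t)" for t
  define a where "a = (LINT t:?I|lebesgue. of_real (\<psi> t) * f0 t)"
  have c0: "0 \<in> closure S" unfolding S_def by (rule zero_in_closure_truncated_sector[OF hM(1)])
  have Tf: "(\<lambda>n. T \<kappa> f n - a * X \<kappa> n) \<longlonglongrightarrow> 0" if adm: "adm \<kappa> K" for \<kappa> K
  proof -
    obtain C0 where C0: "\<And>x y. x \<in> cyl (closure S) {-M..M} \<Longrightarrow> y \<in> cyl (closure S) {-M..M} \<Longrightarrow> dist (f x) (f y) \<le> C0 * dist x y powr \<alpha>"
      using f(1) by (auto simp: holder_on_def)
    have cont: "continuous_on {-M..M} (\<lambda>t. f (join3 0 t))"
      by (rule continuous_on_compose2[OF holder_on_continuous_on[OF f(1) \<alpha>(1)] continuous_on_join3])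
        (auto intro!: continuous_intros simp: c0)
    have f0m: "f0 \<in> borel_measurable borel"
      unfolding f0_def by (rule borel_measurable_continuous_on_indicator[OF _ cont]) simp
    obtain Cf where Cf: "\<forall>z\<in>(\<lambda>t. f (join3 0 t)) ` {-M..M}. norm z \<le> Cf"
      using compact_imp_bounded[OF compact_continuous_image[OF cont compact_Icc]] unfolding bounded_iff by blast
    have f0b: "norm (f0 t) \<le> \<bar>Cf\<bar>" for t using Cf by (force simp: f0_def indicator_def)
    have Gb: "norm (f x - f0 (x $ 3)) \<le> \<bar>C0\<bar> * norm (proj2 x) powr \<alpha>" if x: "x \<in> DD" for x
    proof -
      have x1: "x \<in> cyl (closure S) {-M..M}" "join3 0 (x $ 3) \<in> cyl (closure S) {-M..M}"
        using x c0 closure_subset[of S] by (auto simp: DD_def cyl_def)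
      have "dist x (join3 0 (x $ 3)) = norm (proj2 x)" by (simp add: dist_norm norm_vec3 norm_vec2)
      then have "norm (f x - f (join3 0 (x $ 3))) \<le> C0 * norm (proj2 x) powr \<alpha>"
        using C0[OF x1] by (simp add: dist_norm)
      also have "\<dots> \<le> \<bar>C0\<bar> * norm (proj2 x) powr \<alpha>" by (intro mult_right_mono) auto
      finally show ?thesis using DS(2)[OF x] by (simp add: f0_def)
    qed
    have le: "norm (T \<kappa> f n - a * X \<kappa> n) \<le> B * \<bar>C0\<bar> * K * e n powr \<alpha> * mu" for n
      unfolding a_def
      by (rule conc[where G = f and b = \<alpha> and Lc = "\<bar>C0\<bar>" and ?g0.0 = f0 and ?C0.0 = "\<bar>Cf\<bar>", OF adm \<alpha> _ f0m _ fm])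
        (simp, rule f0b, rule Gb)
    have "(\<lambda>n. e n powr \<alpha>) \<longlonglongrightarrow> 0"
      using e \<alpha> by (intro tendsto_zero_powrI[OF e(3) tendsto_const]) (auto simp: less_imp_le)
    from tendsto_mult_left_zero[OF tendsto_mult_right_zero[OF this]]
    have "(\<lambda>n. B * \<bar>C0\<bar> * K * e n powr \<alpha> * mu) \<longlonglongrightarrow> 0" .
    from Lim_null_comparison[OF always_eventually[OF allI[OF le]] this] show ?thesis .
  qed

  \<comment> \<open>Rounding up gives j \<ge> 1 and j^-2 \<le> e. The exponent -2 only balances the
    normalisation; the decay comes from the additional j^-\<Upsilon>. The excess of the ceiling, at
    most 1, accounts for the second summand in the bound sqrt e + e below.\<close>
  define j where "j n = nat \<lceil>1 / sqrt (e n)\<rceil>" for n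
  have se: "sqrt (e n) > 0" for n using e(1)[of n] by simp
  have j1: "real (j n) \<ge> 1 / sqrt (e n)" "real (j n) \<le> 1 / sqrt (e n) + 1" "j n \<ge> 1" for n
  proof -
    have p: "1 / sqrt (e n) > 0" using se[of n] by simp
    then have c: "\<lceil>1 / sqrt (e n)\<rceil> > 0" by simp
    then have r: "real (j n) = of_int \<lceil>1 / sqrt (e n)\<rceil>" by (simp add: j_def)
    show "real (j n) \<ge> 1 / sqrt (e n)" unfolding r by (rule le_of_int_ceiling)
    show "real (j n) \<le> 1 / sqrt (e n) + 1" unfolding r by linarith
    show "j n \<ge> 1" using c unfolding j_def by linarith
  qed
  have jinf: "filterlim (\<lambda>n. real (j n)) at_top sequentially"
  proof (rule filterlim_at_top_mono)
    have "(\<lambda>n. sqrt (e n)) \<longlonglongrightarrow> 0" using tendsto_real_sqrt[OF e(3)] by simp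
    then have "filterlim (\<lambda>n. sqrt (e n)) (at_right 0) sequentially"
      using se by (intro tendsto_imp_filterlim_at_right) auto
    from filterlim_compose[OF filterlim_inverse_at_top_right this]
    show "filterlim (\<lambda>n. 1 / sqrt (e n)) at_top sequentially" by (simp add: inverse_eq_divide)
    show "\<forall>\<^sub>F n in sequentially. 1 / sqrt (e n) \<le> real (j n)" using j1(1) by simp
  qed
  have j\<Upsilon>: "(\<lambda>n. real (j n) powr (- \<Upsilon>)) \<longlonglongrightarrow> 0"
    by (rule tendsto_neg_powr[OF _ jinf]) (use \<Upsilon> in simp)
  have je: "(\<lambda>n. real (j n) powr \<rho>\<^sub>g * e n) \<longlonglongrightarrow> 0"
  proof (rule Lim_null_comparison)
    have "real (j n) powr \<rho>\<^sub>g * e n \<le> sqrt (e n) + e n" for n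
    proof -
      have "real (j n) powr \<rho>\<^sub>g \<le> real (j n) powr 1" using j1(3)[of n] \<rho> by (intro powr_mono) auto
      also have "\<dots> \<le> 1 / sqrt (e n) + 1" using j1(2)[of n] by simp
      finally have "real (j n) powr \<rho>\<^sub>g * e n \<le> (1 / sqrt (e n) + 1) * e n" using e(1)[of n] by (intro mult_right_mono) auto
      also have "\<dots> = sqrt (e n) + e n" using e(1)[of n] by (simp add: distrib_right real_div_sqrt)
      finally show ?thesis .
    qed
    then show "\<forall>\<^sub>F n in sequentially. norm (real (j n) powr \<rho>\<^sub>g * e n) \<le> sqrt (e n) + e n"
      using e(1) by (auto simp: abs_mult less_imp_le)
    show "(\<lambda>n. sqrt (e n) + e n) \<longlonglongrightarrow> 0"
      using tendsto_add[OF tendsto_real_sqrt[OF e(3)] e(3)] by simp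
  qed

  define vh where "vh n = herglotz k (g (j n))" for n
  \<comment> \<open>The edge values of the Herglotz functions, integrated against \<psi>. They
    depend on the scale through \<open>j n\<close>; their convergence will follow only from
    comparison with the fixed number \<open>a\<close>.\<close>
  define b where "b n = (LINT t:?I|lebesgue. of_real (\<psi> t) * vh n (join3 0 t))" for n
  define cs where "cs = (measure (sphere_measure :: (real^3) measure) (space sphere_measure) + 1) / 2"
  have cs: "cs \<ge> 0" by (simp add: cs_def)
  have jpos: "C * real (j n) powr \<rho>\<^sub>g > 0" for n using C j1(3)[of n] by simp
  have vhb: "norm (vh n x) \<le> cs * (C * real (j n) powr \<rho>\<^sub>g)"
    "norm (vh n x - vh n y) \<le> \<bar>k\<bar> * norm (x - y) * (cs * (C * real (j n) powr \<rho>\<^sub>g))" for n x y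
    unfolding vh_def using herglotz_bounds[OF g(1)[OF j1(3)] g(3)[OF j1(3)] jpos cs_def] by blast+
  have vhc: "continuous_on UNIV (vh n)" for n
  proof -
    define Lq where "Lq = \<bar>k\<bar> * (cs * (C * real (j n) powr \<rho>\<^sub>g))"
    have "Lq-lipschitz_on UNIV (vh n)"
      by (rule lipschitz_onI) (use vhb(2)[of n] cs C in \<open>auto simp: dist_norm Lq_def mult_ac intro!: mult_nonneg_nonneg\<close>)
    then show ?thesis by (rule lipschitz_on_continuous_on)
  qed
  have vhm: "vh n \<in> borel_measurable ?N" for n
    by (rule continuous_imp_measurable_lebesgue_on_open[OF Do continuous_on_subset[OF vhc]]) simp
  have L2vh: "L2 ?N (vh n)" for n by (rule L2_bounded[OF fin vhm vhb(1)])
  have ivh: "integrable ?N (vh n)" for n by (rule L2_imp_integrable[OF fin L2vh])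
  have Tv: "(\<lambda>n. T \<kappa> v n - b n * X \<kappa> n) \<longlonglongrightarrow> 0" if adm: "adm \<kappa> K" for \<kappa> K
  proof -
    have K: "K \<ge> 0" using adm by (simp add: adm_def)
    let ?r1 = "\<lambda>n. B * K * (real (j n) powr (- \<Upsilon>) * (mu + 1) / 2)"
    let ?r2 = "\<lambda>n. B * (\<bar>k\<bar> * (cs * (C * real (j n) powr \<rho>\<^sub>g))) * K * e n powr 1 * mu"
    have 1: "norm (T \<kappa> (\<lambda>x. v x - vh n x) n) \<le> ?r1 n" for n
    proof -
      \<comment> \<open>The Young parameter is the surplus decay: the L2 error is at most t e, which
        makes both terms of the weighted bound of order t e^2.\<close>
      define t where "t = real (j n) powr (- \<Upsilon>)"
      have jp: "real (j n) > 0" using j1(3)[of n] by simp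
      have t: "t > 0" using jp by (simp add: t_def)
      have d2: "L2 ?N (\<lambda>x. v x - vh n x)" by (rule L2_diff[OF L2v L2vh])
      have e0: "(e n)\<^sup>2 > 0" using e(1)[of n] by simp
      have sq: "(L2_norm ?N (\<lambda>x. v x - vh n x))\<^sup>2 \<le> t\<^sup>2 * (e n)\<^sup>2"
      proof -
        have "L2_norm ?N (\<lambda>x. v x - vh n x) \<le> real (j n) powr (- 2 - \<Upsilon>)"
          using L2_norm_le_H1_norm[of DD "\<lambda>x. v x - vh n x"] g(2)[OF j1(3)[of n]] unfolding vh_def by linarith
        also have "\<dots> = t * real (j n) powr (- 2)" unfolding t_def powr_add[symmetric] by (rule arg_cong[where f = "\<lambda>s. real (j n) powr s"]) linarith
        also have "\<dots> \<le> t * e n"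
        proof (rule mult_left_mono)
          have "1 \<le> sqrt (e n) * real (j n)" using j1(1)[of n] se[of n] by (simp add: field_simps)
          then have "1 \<le> (sqrt (e n) * real (j n))\<^sup>2" by (rule one_le_power)
          then have "1 \<le> e n * (real (j n))\<^sup>2" using e(1)[of n] by (simp add: power_mult_distrib)
          then have "1 / (real (j n))\<^sup>2 \<le> e n" using jp by (simp add: divide_le_eq)
          then show "real (j n) powr (- 2) \<le> e n" using jp by (simp add: powr_minus_divide powr_numeral)
        qed (use t in simp)
        finally have "L2_norm ?N (\<lambda>x. v x - vh n x) \<le> t * e n" .
        then have "(L2_norm ?N (\<lambda>x. v x - vh n x))\<^sup>2 \<le> (t * e n)\<^sup>2" by (intro power_mono L2_norm_nonneg)
        then show ?thesis by (simp add: power_mult_distrib)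
      qed
      have "(LINT x|?N. norm (v x - vh n x) * Wn n x) \<le> (t * (2 * M * wt_mass * (e n)\<^sup>2) + (L2_norm ?N (\<lambda>x. v x - vh n x))\<^sup>2 / t) / 2"
        unfolding Wn_def by (rule weighted_L2_bound[OF Do DS(2) hM(2) e(1) t d2])
      also have "\<dots> \<le> (t * (2 * M * wt_mass * (e n)\<^sup>2) + (t\<^sup>2 * (e n)\<^sup>2) / t) / 2"
        using sq t by (intro divide_right_mono add_left_mono) auto
      also have "\<dots> = t * (mu + 1) / 2 * (e n)\<^sup>2"
        using t by (simp add: mu_def power2_eq_square algebra_simps)
      finally have "(LINT x|?N. norm (v x - vh n x) * Wn n x) / (e n)\<^sup>2 \<le> t * (mu + 1) / 2"
        using e0 by (simp add: pos_divide_le_eq)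
      then have "B * K * ((LINT x|?N. norm (v x - vh n x) * Wn n x) / (e n)\<^sup>2) \<le> B * K * (t * (mu + 1) / 2)"
        using B0 K by (intro mult_left_mono) auto
      with Tbound[OF adm Bochner_Integration.integrable_diff[OF iv ivh], of n n] show ?thesis unfolding t_def by linarith
    qed
    \<comment> \<open>The edge estimate with exponent 1. The Lipschitz constant grows like
      \<open>real (j n) powr \<rho>\<^sub>g\<close>, and the factor \<open>e n\<close> outweighs
      it.\<close>
    have 2: "norm (T \<kappa> (vh n) n - b n * X \<kappa> n) \<le> ?r2 n" for n
      unfolding b_def
    proof (rule conc[OF adm zero_less_one order_refl])
      show "0 \<le> \<bar>k\<bar> * (cs * (C * real (j n) powr \<rho>\<^sub>g))" using cs C by (intro mult_nonneg_nonneg) auto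
      show "(\<lambda>t. vh n (join3 0 t)) \<in> borel_measurable borel"
        by (intro borel_measurable_continuous_onI continuous_on_compose2[OF vhc continuous_on_join3] continuous_intros) auto
      show "norm (vh n (join3 0 t)) \<le> cs * (C * real (j n) powr \<rho>\<^sub>g)" for t by (rule vhb)
      show "vh n \<in> borel_measurable ?N" by (rule vhm)
      fix x
      have "norm (x - join3 0 (x $ 3)) = norm (proj2 x)" by (simp add: norm_vec3 norm_vec2)
      then show "norm (vh n x - vh n (join3 0 (x $ 3))) \<le> \<bar>k\<bar> * (cs * (C * real (j n) powr \<rho>\<^sub>g)) * norm (proj2 x) powr 1"
        using vhb(2)[of n x "join3 0 (x $ 3)"] by (simp add: mult_ac)
    qed
    have "?r1 n + ?r2 n = B * K * (mu + 1) / 2 * real (j n) powr (- \<Upsilon>)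
        + B * (\<bar>k\<bar> * (cs * C)) * K * mu * (real (j n) powr \<rho>\<^sub>g * e n)" for n
      using e(1)[of n] by simp
    moreover have "(\<lambda>n. B * K * (mu + 1) / 2 * real (j n) powr (- \<Upsilon>)
        + B * (\<bar>k\<bar> * (cs * C)) * K * mu * (real (j n) powr \<rho>\<^sub>g * e n)) \<longlonglongrightarrow> 0"
      by (intro tendsto_add_zero tendsto_mult_right_zero j\<Upsilon> je)
    ultimately have lim: "(\<lambda>n. ?r1 n + ?r2 n) \<longlonglongrightarrow> 0" by (simp only:)
    show ?thesis
    proof (rule Lim_null_comparison[OF always_eventually[OF allI] lim])
      fix n
      have "T \<kappa> v n - b n * X \<kappa> n = T \<kappa> (\<lambda>x. v x - vh n x) n + (T \<kappa> (vh n) n - b n * X \<kappa> n)"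
        unfolding Tdiff[OF adm iv ivh] by simp
      then show "norm (T \<kappa> v n - b n * X \<kappa> n) \<le> ?r1 n + ?r2 n"
        by (simp only:) (rule order_trans[OF norm_triangle_ineq add_mono[OF 1 2]])
    qed
  qed
  have Tfv: "(\<lambda>n. (T \<kappa> f n - T \<kappa> v n) - (a - b n) * X \<kappa> n) \<longlonglongrightarrow> 0" if adm: "adm \<kappa> K" for \<kappa> K
    using tendsto_diff[OF Tf[OF adm] Tv[OF adm]] by (simp add: algebra_simps)

  have adm1: "adm (\<lambda>n. kern h (e n)) (1 / sep ^ 5)"
    unfolding adm_def using sep_pos norm_kern_le[OF e(1)] SW by (auto simp: borel_measurable_kern)
  \<comment> \<open>Tested with the corner function, f - v turns into v - w against the Laplacian,
    divided by \<open>k\<^sup>2\<close>. The Laplacian is below a multiple of the weight with a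
    constant independent of n, so the averages of v - w control it.\<close>
  have m1: "(\<lambda>n. T (\<lambda>n. kern h (e n)) f n - T (\<lambda>n. kern h (e n)) v n) \<longlonglongrightarrow> 0"
  proof -
    define K where "K = B * (36 / h\<^sup>2 + 60 / (h\<^sup>2 * sep) + 1) / sep ^ 5"
    have "norm (T (\<lambda>n. kern h (e n)) f n - T (\<lambda>n. kern h (e n)) v n)
        \<le> K / k\<^sup>2 * ((LINT x|?N. norm (v x - w x) * Wn n x) / (e n)\<^sup>2)" for n
    proof -
      let ?\<phi> = "sector_test.\<phi> \<theta>\<^sub>m \<theta>\<^sub>M h (e n) \<psi>" and ?l = "sector_test.lap\<phi> \<theta>\<^sub>m \<theta>\<^sub>M h (e n) \<psi>"
      have \<phi>: "?\<phi> x = mf (\<lambda>n. kern h (e n)) n x" for x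
        unfolding sector_test.\<phi>_eq[OF st] mf_def kern_def ..
      have id: "(LINT x|?N. (v x - w x) * ?l x) = (of_real k)\<^sup>2 * (LINT x|?N. ((1 + V x) * w x - v x) * ?\<phi> x)"
        unfolding DD_def S_def by (rule sector_test.sector_identity[OF st V te])
      have "(LINT x|?N. ((1 + V x) * w x - v x) * ?\<phi> x) = (LINT x|?N. (f x - v x) * mf (\<lambda>n. kern h (e n)) n x)"
        unfolding \<phi>
      proof (rule integral_cong_AE)
        show "(\<lambda>x. ((1 + V x) * w x - v x) * mf (\<lambda>n. kern h (e n)) n x) \<in> borel_measurable ?N"
          by (rule borel_measurable_integrable[OF imf[OF adm1 Bochner_Integration.integrable_diff[OF iqw iv]]])
        show "(\<lambda>x. (f x - v x) * mf (\<lambda>n. kern h (e n)) n x) \<in> borel_measurable ?N"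
          by (rule borel_measurable_integrable[OF imf[OF adm1 Bochner_Integration.integrable_diff[OF if' iv]]])
        show "AE x in ?N. ((1 + V x) * w x - v x) * mf (\<lambda>n. kern h (e n)) n x = (f x - v x) * mf (\<lambda>n. kern h (e n)) n x"
          using f(2) by eventually_elim simp
      qed
      then have "T (\<lambda>n. kern h (e n)) (\<lambda>x. f x - v x) n = (LINT x|?N. (v x - w x) * ?l x) / (of_real k)\<^sup>2 / of_real ((e n)\<^sup>2)"
        unfolding T_def id using k by simp
      then have "T (\<lambda>n. kern h (e n)) f n - T (\<lambda>n. kern h (e n)) v n = (LINT x|?N. (v x - w x) * ?l x) / (of_real k)\<^sup>2 / of_real ((e n)\<^sup>2)"
        by (simp only: Tdiff[OF adm1 if' iv])
      then have eq: "norm (T (\<lambda>n. kern h (e n)) f n - T (\<lambda>n. kern h (e n)) v n) = norm (LINT x|?N. (v x - w x) * ?l x) / k\<^sup>2 / (e n)\<^sup>2"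
        by (simp only: norm_divide norm_power norm_of_real power2_abs abs_power2)
      have "norm (LINT x|?N. (v x - w x) * ?l x) \<le> K * (LINT x|?N. norm (v x - w x) * Wn n x)"
      proof (rule norm_integral_le_weighted[OF Bochner_Integration.integrable_diff[OF iv iw] Wm Wb(1)])
        fix x assume "x \<in> space ?N"
        then have "x \<in> cyl (truncated_sector \<theta>\<^sub>m \<theta>\<^sub>M h) ?I" by (simp add: DD_def S_def)
        then show "norm (?l x) \<le> K * Wn n x"
          unfolding K_def Wn_def by (rule sector_test.lap\<phi>_bound[OF st _ B])
      qed
      then have "norm (LINT x|?N. (v x - w x) * ?l x) / k\<^sup>2 / (e n)\<^sup>2 \<le> K * (LINT x|?N. norm (v x - w x) * Wn n x) / k\<^sup>2 / (e n)\<^sup>2"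
        by (intro divide_right_mono) auto
      then show ?thesis unfolding eq by simp
    qed
    then show ?thesis
      by (intro Lim_null_comparison[OF _ tendsto_mult_right_zero[OF uas, of "K / k\<^sup>2"]] always_eventually allI)
  qed
  have X1: "X (\<lambda>n. kern h (e n)) \<longlonglongrightarrow> (LINT y|lebesgue_on W. \<eta> y)"
    unfolding X_def[abs_def] S_def by (rule kern_integral_tendsto[OF hM(1) e(1,3)])
  \<comment> \<open>Here the opening angle pi is excluded: the nonzero limit of the normalised
    kernel mass permits the division that frees a - b n from the kernel.\<close>
  have ab: "(\<lambda>n. a - b n) \<longlonglongrightarrow> 0"
  proof -
    have nz: "(LINT y|lebesgue_on W. \<eta> y) \<noteq> 0" by (rule sector_integral_\<eta>_nonzero[OF \<theta>(4)])
    have "(\<lambda>n. (a - b n) * X (\<lambda>n. kern h (e n)) n) \<longlonglongrightarrow> 0"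
      using tendsto_diff[OF m1 Tfv[OF adm1]] by simp
    from tendsto_divide[OF this X1 nz]
    have l: "(\<lambda>n. (a - b n) * X (\<lambda>n. kern h (e n)) n / X (\<lambda>n. kern h (e n)) n) \<longlonglongrightarrow> 0" by simp
    have "\<forall>\<^sub>F n in sequentially. X (\<lambda>n. kern h (e n)) n \<noteq> 0"
      by (rule tendsto_imp_eventually_ne[OF X1 nz])
    then have "\<forall>\<^sub>F n in sequentially. (a - b n) * X (\<lambda>n. kern h (e n)) n / X (\<lambda>n. kern h (e n)) n = a - b n"
      by eventually_elim simp
    from Lim_transform_eventually[OF l this] show ?thesis .
  qed

  define \<kappa>2 where "\<kappa>2 n = (indicator (ball 0 (e n)) :: real^2 \<Rightarrow> complex)" for n
  \<comment> \<open>On the disc 1 + |y|/e is at most 2, and the bound contains its fifth inverse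
    power; hence 32 = 2^5.\<close>
  have adm2: "adm \<kappa>2 32"
    unfolding adm_def
  proof (intro conjI allI ballI)
    show "\<kappa>2 n \<in> borel_measurable borel" for n
      unfolding \<kappa>2_def by (intro borel_measurable_indicator) simp
    fix n y
    have nn: "0 \<le> 32 * (wt (y /\<^sub>R e n) / (1 + norm (y /\<^sub>R e n)))"
      using wt_pos[of "y /\<^sub>R e n"] one_plus_norm_pos[of "y /\<^sub>R e n"] by simp
    show "norm (\<kappa>2 n y) \<le> 32 * (wt (y /\<^sub>R e n) / (1 + norm (y /\<^sub>R e n)))"
    proof (cases "y \<in> ball 0 (e n)")
      case True
      then have s: "norm (y /\<^sub>R e n) \<le> 1" using e(1)[of n] by (simp add: field_simps)
      have "(1 + norm (y /\<^sub>R e n)) ^ 5 \<le> 2 ^ 5" using s by (intro power_mono) auto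
      then have "1 \<le> 32 * (1 / (1 + norm (y /\<^sub>R e n)) ^ 5)"
        using one_plus_norm_pos[of "y /\<^sub>R e n"] by (simp add: le_divide_eq del: norm_scaleR)
      also have "1 / (1 + norm (y /\<^sub>R e n)) ^ 5 = wt (y /\<^sub>R e n) / (1 + norm (y /\<^sub>R e n))"
        by (simp add: wt_def power_Suc2[of _ 4, simplified] mult.commute del: norm_scaleR)
      finally show ?thesis using True by (simp add: \<kappa>2_def del: norm_scaleR)
    qed (use nn in \<open>simp add: \<kappa>2_def\<close>)
  qed simp
  define mu1 where "mu1 = measure lebesgue (ball 0 1 \<inter> W)"
  have mu1: "mu1 > 0" unfolding mu1_def by (rule measure_unit_sector_pos)
  have meas: "measure lebesgue (ball 0 (e n) \<inter> S) = (e n)\<^sup>2 * mu1" for n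
    unfolding S_def mu1_def by (rule measure_truncated_sector[OF e(1) less_imp_le[OF e(2)]])
  \<comment> \<open>By homogeneity the normalised mass of the disc is the same positive number at
    every scale, so dividing by the area instead of \<open>(e n)\<^sup>2\<close> changes only a
    constant.\<close>
  have X2: "X \<kappa>2 n = of_real mu1" for n
  proof -
    have bs: "ball 0 (e n) \<inter> S \<in> sets borel" using So by auto
    have "(LINT y|lebesgue_on S. \<kappa>2 n y) = (LINT y|lebesgue. indicator S y *\<^sub>R \<kappa>2 n y)"
      using So by (simp add: integral_restrict_space)
    also have "\<dots> = (LINT y|lebesgue. of_real (indicator (ball 0 (e n) \<inter> S) y))"
      by (rule Bochner_Integration.integral_cong[OF refl]) (auto simp: \<kappa>2_def indicator_def)
    also have "\<dots> = of_real (LINT y|lebesgue. indicator (ball 0 (e n) \<inter> S) y)"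
    proof (intro integral_of_real integrable_real_indicator)
      have "ball 0 (e n) \<inter> S \<in> lmeasurable"
        using So by (intro lmeasurable_open) (auto intro: bounded_subset[OF bounded_ball])
      then show "ball 0 (e n) \<inter> S \<in> sets lebesgue" "emeasure lebesgue (ball 0 (e n) \<inter> S) < \<infinity>"
        by (auto simp: fmeasurable_def)
    qed
    also have "(LINT y|lebesgue. indicator (ball 0 (e n) \<inter> S) y) = measure lebesgue (ball 0 (e n) \<inter> S)" using bs by simp
    finally show ?thesis using e(1)[of n] by (simp add: X_def meas)
  qed
  \<comment> \<open>Almost everywhere V w = f - w = (f - v) + (v - w). The first part is governed by
    a - b n, the second is small near the edge.\<close>
  have TVw: "T \<kappa>2 (\<lambda>x. V x * w x) n = (T \<kappa>2 f n - T \<kappa>2 v n) + T \<kappa>2 (\<lambda>x. v x - w x) n" for n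
  proof -
    have "(LINT x|?N. (V x * w x) * mf \<kappa>2 n x) = (LINT x|?N. (f x - w x) * mf \<kappa>2 n x)"
    proof (rule integral_cong_AE)
      show "(\<lambda>x. (V x * w x) * mf \<kappa>2 n x) \<in> borel_measurable ?N"
        by (rule borel_measurable_integrable[OF imf[OF adm2 iVw]])
      show "(\<lambda>x. (f x - w x) * mf \<kappa>2 n x) \<in> borel_measurable ?N"
        by (rule borel_measurable_integrable[OF imf[OF adm2 Bochner_Integration.integrable_diff[OF if' iw]]])
      show "AE x in ?N. (V x * w x) * mf \<kappa>2 n x = (f x - w x) * mf \<kappa>2 n x"
        using f(2) by eventually_elim (simp add: algebra_simps)
    qed
    then have "T \<kappa>2 (\<lambda>x. V x * w x) n = T \<kappa>2 (\<lambda>x. f x - w x) n" by (simp add: T_def)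
    then show ?thesis by (simp only: Tdiff[OF adm2 if' iw] Tdiff[OF adm2 iv iw]) simp
  qed
  have "(\<lambda>n. ((T \<kappa>2 f n - T \<kappa>2 v n) - (a - b n) * X \<kappa>2 n) + (a - b n) * of_real mu1 + T \<kappa>2 (\<lambda>x. v x - w x) n)
      \<longlonglongrightarrow> 0 + 0 * of_real mu1 + 0"
    by (intro tendsto_add tendsto_mult[OF ab tendsto_const] Tfv[OF adm2] Tu[OF adm2])
  then have "(\<lambda>n. T \<kappa>2 (\<lambda>x. V x * w x) n) \<longlonglongrightarrow> 0" by (simp add: X2 TVw)
  from tendsto_divide[OF this tendsto_const[of "complex_of_real mu1"]] mu1
  have "(\<lambda>n. T \<kappa>2 (\<lambda>x. V x * w x) n / of_real mu1) \<longlonglongrightarrow> 0" by simp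
  then show "(\<lambda>n. (LINT x|?N. (V x * w x) * (of_real (\<psi> (x $ 3)) * indicator (ball 0 (e n)) (proj2 x)))
      / of_real (measure lebesgue (ball 0 (e n) \<inter> S))) \<longlonglongrightarrow> 0"
    by (simp add: T_def mf_def \<kappa>2_def meas)
qed

theorem corollary3p1:
  fixes \<Omega> :: "(real^3) set" and V v w :: "real^3 \<Rightarrow> complex"
    and g :: "nat \<Rightarrow> real^3 \<Rightarrow> complex" and \<psi> :: "real \<Rightarrow> real"
    and \<theta>\<^sub>m \<theta>\<^sub>M M \<alpha> h c L k C \<Upsilon> \<rho>\<^sub>g :: real
  defines "S \<equiv> truncated_sector \<theta>\<^sub>m \<theta>\<^sub>M h"
    and "P \<equiv> proj2 ` (cyl (ball 0 h) {-M<..<M} \<inter> \<Omega>)"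
  assumes "bounded_lipschitz_domain \<Omega>" and "0 \<in> frontier \<Omega>"
    and "M > 0" and "0 < \<alpha>" and "\<alpha> < 1" and "h > 0"
    and "cyl (ball 0 h) {-M<..<M} \<inter> \<Omega> = cyl S {-M<..<M}"
    and "c \<in> {-M<..<M}" and "L > 0" and "{c - L<..<c + L} \<subseteq> {-M<..<M}"
    and "test_function {c - L<..<c + L} \<psi>" and "\<And>t. \<psi> t \<ge> 0" and "\<exists>t. \<psi> t \<noteq> 0"
    and "Linf \<Omega> V" and "k > 0"
    and "transmission_eigenfunctions \<Omega> V k v w"
    and "\<exists>f. holder_on \<alpha> (cyl (closure S) {-M..M}) f \<and>
           (AE x in lebesgue_on (cyl S {-M<..<M}). f x = (1 + V x) * w x)"
    and "H2 (cyl S {-M<..<M}) (\<lambda>x. v x - w x)"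
    and "C > 0" and "\<Upsilon> > 0" and "0 < \<rho>\<^sub>g" and "\<rho>\<^sub>g < \<alpha>"
    and "\<And>j. j \<ge> 1 \<Longrightarrow> L2 sphere_measure (g j)"
    and "\<And>j. j \<ge> 1 \<Longrightarrow>
           H1_norm (cyl S {-M<..<M}) (\<lambda>x. v x - herglotz k (g j) x) \<le> real j powr (- 2 - \<Upsilon>)"
    and "\<And>j. j \<ge> 1 \<Longrightarrow> L2_norm sphere_measure (g j) \<le> C * real j powr \<rho>\<^sub>g"
    and "- pi < \<theta>\<^sub>m" and "\<theta>\<^sub>m < \<theta>\<^sub>M" and "\<theta>\<^sub>M < pi" and "\<theta>\<^sub>M - \<theta>\<^sub>m \<noteq> pi"
  shows "((\<lambda>\<rho>. (LINT x':ball 0 \<rho> \<inter> P|lebesgue. dim_reduction \<psi> c L (\<lambda>x. V x * w x) x')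
             / of_real (measure lebesgue (ball 0 \<rho> \<inter> P))) \<longlongrightarrow> 0) (at_right 0)"
proof -
  let ?I = "{-M<..<M}"
  have bd: "bounded_lipschitz_domain \<Omega>" by fact
  have D: "cyl (ball 0 h) ?I \<inter> \<Omega> = cyl S ?I" by fact
  have hM: "h > 0" "M > 0" by fact+
  have tf: "test_function {c - L<..<c + L} \<psi>" by fact
  have sub: "{c - L<..<c + L} \<subseteq> ?I" by fact
  have c: "c \<in> ?I" by fact
  have \<Omega>: "open \<Omega>" "bounded \<Omega>" using bd by (auto simp: bounded_lipschitz_domain_def)
  have \<psi>: "test_function ?I \<psi>" using tf sub unfolding test_function_def by blast
  have \<psi>0: "\<psi> t = 0" if "t \<notin> {c - L<..<c + L}" for t
    using test_function_eq_0[OF tf, of t] tf that unfolding test_function_def by blast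
  obtain f where f: "holder_on \<alpha> (cyl (closure S) {-M..M}) f" "AE x in lebesgue_on (cyl S ?I). f x = (1 + V x) * w x"
    using \<open>\<exists>f. holder_on \<alpha> (cyl (closure S) {-M..M}) f \<and> (AE x in lebesgue_on (cyl S {-M<..<M}). f x = (1 + V x) * w x)\<close> by blast
  \<comment> \<open>The height c lies in the interval, so every fibre over S is nonempty and the
    projection reaches all of S.\<close>
  have PS: "P = S"
  proof
    show "P \<subseteq> S" unfolding P_def D by (auto simp: cyl_def)
    show "S \<subseteq> P"
    proof
      fix y assume "y \<in> S"
      then have "join3 y c \<in> cyl S ?I" using c by simp
      then show "y \<in> P" unfolding P_def D by (metis image_eqI proj2_join3)
    qed
  qed
  have So: "open S"
  proof -
    interpret plane_sector \<theta>\<^sub>m \<theta>\<^sub>M by unfold_locales fact+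
    show ?thesis unfolding S_def by (rule open_truncated_sector)
  qed
  have Do: "open (cyl S ?I)" by (intro open_cyl So) auto
  have \<alpha>1: "\<alpha> \<le> 1" and \<rho>1: "\<rho>\<^sub>g \<le> 1" using \<open>\<alpha> < 1\<close> \<open>\<rho>\<^sub>g < \<alpha>\<close> by auto
  \<comment> \<open>Sequences in (0, h) suffice for the one-sided limit; a disc of radius below h
    meets S in a piece of the full sector, which scales exactly.\<close>
  show ?thesis
  proof (rule tendsto_at_right_sequentially[OF hM(1)])
    fix e :: "nat \<Rightarrow> real" assume e: "\<And>n. 0 < e n" "\<And>n. e n < h" "e \<longlonglongrightarrow> 0"
    note cor = corner_average_tendsto_0[where V=V and v=v and w=w and f=f and g=g and \<psi>=\<psi> and e=e and k=k and C=C and \<Upsilon>=\<Upsilon> and \<rho>\<^sub>g=\<rho>\<^sub>g,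
        OF \<open>- pi < \<theta>\<^sub>m\<close> \<open>\<theta>\<^sub>m < \<theta>\<^sub>M\<close> \<open>\<theta>\<^sub>M < pi\<close> \<open>\<theta>\<^sub>M - \<theta>\<^sub>m \<noteq> pi\<close> \<Omega> D[unfolded S_def] hM \<open>0 < \<alpha>\<close> \<alpha>1 \<psi> \<open>Linf \<Omega> V\<close> \<open>k > 0\<close>
          \<open>transmission_eigenfunctions \<Omega> V k v w\<close> f[unfolded S_def] \<open>C > 0\<close> \<open>\<Upsilon> > 0\<close> \<open>0 < \<rho>\<^sub>g\<close> \<rho>1]
    have g: "\<And>j. j \<ge> 1 \<Longrightarrow> L2 sphere_measure (g j)"
      "\<And>j. j \<ge> 1 \<Longrightarrow> H1_norm (cyl (truncated_sector \<theta>\<^sub>m \<theta>\<^sub>M h) {-M<..<M}) (\<lambda>x. v x - herglotz k (g j) x) \<le> real j powr (- 2 - \<Upsilon>)"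
      "\<And>j. j \<ge> 1 \<Longrightarrow> L2_norm sphere_measure (g j) \<le> C * real j powr \<rho>\<^sub>g"
      unfolding S_def[symmetric] by fact+
    note cor1 = cor[OF g e, folded S_def]
    \<comment> \<open>Fubini turns the planar integral of the reduction into one over a cylinder
      above the disc; the disc then moves into the integrand as an indicator, the kernel for which
      the limit is known.\<close>
    have eq: "(LINT x':ball 0 (e n) \<inter> P|lebesgue. dim_reduction \<psi> c L (\<lambda>x. V x * w x) x')
        = (LINT x|lebesgue_on (cyl S ?I). (V x * w x) * (of_real (\<psi> (x $ 3)) * indicator (ball 0 (e n)) (proj2 x)))" for n
    proof -
      let ?A = "ball 0 (e n) \<inter> S"
      have Ao: "open (cyl ?A ?I)" by (intro open_cyl open_Int So) auto
      have As: "cyl ?A ?I \<in> sets lebesgue" "cyl S ?I \<in> sets lebesgue" using Ao Do by auto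
      have As': "cyl ?A ?I \<subseteq> cyl S ?I" by (auto simp: cyl_def)
      have iA: "integrable (lebesgue_on (cyl ?A ?I)) (\<lambda>x. V x * w x)"
        by (rule lebesgue_on_subset(1)[OF As As' cor1(1)])
      obtain B where B: "\<And>t. norm (complex_of_real (\<psi> t)) \<le> B"
        and \<psi>c: "continuous_on UNIV (\<lambda>t. complex_of_real (\<psi> t))"
      proof -
        have s: "smooth \<psi>" and cp: "compact (closure {t. \<psi> t \<noteq> 0})" using tf by (auto simp: test_function_def)
        have c1: "continuous_on UNIV (\<lambda>t. complex_of_real (\<psi> t))"
          by (intro continuous_on_of_real smooth_imp_has_derivative(2)[OF s])
        have "complex_of_real (\<psi> t) = 0" if "t \<notin> closure {t. \<psi> t \<noteq> 0}" for t
          by (simp only: test_function_eq_0[OF tf that] of_real_0)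
        from continuous_on_compact_support_bounded[OF c1 cp this]
        obtain B where "\<And>t. norm (complex_of_real (\<psi> t)) \<le> B" by blast
        then show thesis using that c1 by blast
      qed
      have m3: "(\<lambda>x::real^3. complex_of_real (\<psi> (x $ 3))) \<in> borel_measurable (lebesgue_on (cyl ?A ?I))"
        by (rule continuous_imp_measurable_lebesgue_on_open[OF Ao]) (intro continuous_on_compose2[OF \<psi>c] continuous_intros, auto)
      have i: "integrable (lebesgue_on (cyl ?A ?I)) (\<lambda>x. of_real (\<psi> (x $ 3)) * (V x * w x))"
        using integrable_mult_bounded_space[OF iA m3 B] by (simp add: mult.commute)
      have "(LINT x':ball 0 (e n) \<inter> P|lebesgue. dim_reduction \<psi> c L (\<lambda>x. V x * w x) x')
          = (LINT x|lebesgue_on (cyl ?A ?I). of_real (\<psi> (x $ 3)) * (V x * w x))"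
        unfolding PS by (rule dim_reduction_integral[OF As(1) i \<psi>0 sub])
      also have "\<dots> = (LINT x|lebesgue. indicator (cyl ?A ?I) x *\<^sub>R (of_real (\<psi> (x $ 3)) * (V x * w x)))"
        using As by (simp add: integral_restrict_space)
      also have "\<dots> = (LINT x|lebesgue. indicator (cyl S ?I) x *\<^sub>R ((V x * w x) * (of_real (\<psi> (x $ 3)) * indicator (ball 0 (e n)) (proj2 x))))"
        by (rule Bochner_Integration.integral_cong[OF refl]) (auto simp: cyl_def indicator_def)
      also have "\<dots> = (LINT x|lebesgue_on (cyl S ?I). (V x * w x) * (of_real (\<psi> (x $ 3)) * indicator (ball 0 (e n)) (proj2 x)))"
        using As by (simp add: integral_restrict_space)
      finally show ?thesis .
    qed
    show "(\<lambda>n. (LINT x':ball 0 (e n) \<inter> P|lebesgue. dim_reduction \<psi> c L (\<lambda>x. V x * w x) x')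
        / of_real (measure lebesgue (ball 0 (e n) \<inter> P))) \<longlonglongrightarrow> 0"
      unfolding eq unfolding PS by (rule cor1(2))
  qed
qed

end
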